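(* Assume the setting of the context and suppose $v_1<0$, $v_2>0$ (in particular $\gamma$ reaches $\{\theta=0\}$) and $v_3<0$. Then for every integer $k\ge0$ there exists a periodic orbit, of some period $T$, such that $\theta(0)=-\pi/2$, $v(0)=0$, during $(0,T/4)$ the function $\theta$ crosses the partial-collision line $\{\theta=-\pi/2\}$ $k$ times, and at $s=T/4$ the orbit hits an Eulerian line orthogonally: $v(T/4)=0$, with $\theta(T/4)=0$ if $k$ is even and $\theta(T/4)=-\pi$ if $k$ is odd.
   Context: Let $c:\mathbb R\to(0,\infty)$ be either $c(\theta)=\frac14(1+\sin^2\theta)^2$ or $c(\theta)=1+\cos^2\theta$. Let $V:\mathbb R\setminus(\frac\pi2+\pi\mathbb Z)\to(0,\infty)$ be smooth, even and $\pi$-periodic, such that $\mathcal W(\theta):=\cos^2\theta\,V(\theta)$ extends to a smooth positive function on $\mathbb R$, and such that on $(-\pi/2,\pi/2)$ the function $V$ has exactly three critical points $-\theta^*<0<\theta^*$, all non-degenerate. (This is the shape potential of a Lagrangian system $\frac12\dot r^2+\frac12r^2\dot\theta^2\cos^2\theta/c(\theta)+V(\theta)/r$; the lines $\theta\in\frac\pi2+\pi\mathbb Z$ are regularized partial-collision configurations, the lines $\theta\in\pi\mathbb Z$ the "Eulerian" configurations.) With energy fixed at $-1$, $v=r^{1/2}\dot r$, $w=\dot\theta\,r^{3/2}\cos^2\theta/c(\theta)$ and time change $dt/ds=r^{3/2}\cos^2\theta$, the regularized equations are ($'=d/ds$): $r'=rv\cos^2\theta$, $v'=\frac12v^2\cos^2\theta+w^2c(\theta)-\mathcal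 W(\theta)$, $\theta'=w\,c(\theta)$, $w'=\mathcal W'(\theta)-\frac12vw\cos^2\theta+\cos\theta\sin\theta(2r+v^2)-\frac12w^2c'(\theta)$, on the energy manifold $\mathcal P_1=\{r\ge0,\ \frac12v^2\cos^2\theta+\frac12w^2c(\theta)-\mathcal W(\theta)=-r\cos^2\theta\}$; the collision manifold $\mathcal P_1\cap\{r=0\}$ is invariant. Let $v^*=\sqrt{2V(\theta^* )}$ and consider the equilibria $L_-=(r,v,\theta,w)=(0,-v^*,\theta^*-\pi,0)$ and $L'_-=(0,-v^*,-\theta^*,0)$. Within the collision manifold each has a one-dimensional unstable manifold; let $\gamma$ (resp. $\gamma'$) be the branch of the unstable manifold of $L_-$ (resp. $L'_-$) in the collision manifold along which initially $w\ge0$. Let $v_1$ be the $v$-coordinate of the first intersection of $\gamma$ with $\{\theta=-\pi/2\}$, $v_2$ the $v$-coordinate of the first intersection of $\gamma$ with $\{\theta=0\}$, and $v_3$ the $v$-coordinate of the first intersection of $\gamma'$ with $\{\theta=0\}$. A periodic orbit means a periodic solution $s\mapsto(r,v,\theta,w)(s)$ of the regularized system on $\mathcal P_1$ with $r>0$; "crossing" a line $\{\theta=a\}$ means $\theta(s)$ passes through $a$.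
   Formalization: Periodic orbit is read with θ as an angle modulo 2π: r, v, w are T-periodic and θ(s+T)=θ(s)+2πm for a fixed integer m; literal periodicity of a real-valued θ is impossible, since the two orthogonal hits force θ to advance by ±2π over one period. *)

theory Defs
  imports "HOL-Analysis.Analysis"
begin

type_synonym state = "real \<times> real \<times> real \<times> real"

definition rr :: "state \<Rightarrow> real" where "rr x = fst x"
definition vv :: "state \<Rightarrow> real" where "vv x = fst (snd x)"
definition th :: "state \<Rightarrow> real" where "th x = fst (snd (snd x))"
definition ww :: "state \<Rightarrow> real" where "ww x = snd (snd (snd x))"

definition smooth_on :: "real set \<Rightarrow> (real \<Rightarrow> real) \<Rightarrow> bool" where
  "smooth_on S f \<longleftrightarrow> (\<forall>n. \<forall>x\<in>S. ((deriv ^^ n) f) differentiable (at x))"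

definition c_one :: "real \<Rightarrow> real" where
  "c_one \<theta> = (1/4) * (1 + (sin \<theta>)^2)^2"
definition c_two :: "real \<Rightarrow> real" where
  "c_two \<theta> = 1 + (cos \<theta>)^2"

definition reg_field :: "(real \<Rightarrow> real) \<Rightarrow> (real \<Rightarrow> real) \<Rightarrow> state \<Rightarrow> state" where
  "reg_field c W x = (let r = rr x; v = vv x; \<theta> = th x; w = ww x in
     ( r * v * (cos \<theta>)^2,
       (1/2) * v^2 * (cos \<theta>)^2 + w^2 * c \<theta> - W \<theta>,
       w * c \<theta>,
       deriv W \<theta> - (1/2) * v * w * (cos \<theta>)^2 + cos \<theta> * sin \<theta> * (2 * r + v^2)
         - (1/2) * w^2 * deriv c \<theta>))"

text \<open>Energy manifold P_1 (energy -1) and collision manifold.\<close>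
definition energy_manifold :: "(real \<Rightarrow> real) \<Rightarrow> (real \<Rightarrow> real) \<Rightarrow> state set" where
  "energy_manifold c W = {x. rr x \<ge> 0 \<and>
     (1/2) * (vv x)^2 * (cos (th x))^2 + (1/2) * (ww x)^2 * c (th x) - W (th x)
       = - rr x * (cos (th x))^2}"

definition collision_manifold :: "(real \<Rightarrow> real) \<Rightarrow> (real \<Rightarrow> real) \<Rightarrow> state set" where
  "collision_manifold c W = energy_manifold c W \<inter> {x. rr x = 0}"

definition is_solution_on :: "(real \<Rightarrow> real) \<Rightarrow> (real \<Rightarrow> real) \<Rightarrow> (real \<Rightarrow> state) \<Rightarrow> real set \<Rightarrow> bool" where
  "is_solution_on c W x I \<longleftrightarrow> (\<forall>s\<in>I. (x has_vector_derivative reg_field c W (x s)) (at s))"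

text \<open>gamma, defined for s < b, is (a time parametrization of) the branch of the unstable
  manifold of the equilibrium L inside the collision manifold along which initially w \<ge> 0:
  a non-constant solution in the collision manifold tending to L as s \<rightarrow> -\<infinity>,
  with w \<ge> 0 for all sufficiently negative s.\<close>
definition unstable_branch :: "(real \<Rightarrow> real) \<Rightarrow> (real \<Rightarrow> real) \<Rightarrow> state \<Rightarrow> (real \<Rightarrow> state) \<Rightarrow> real \<Rightarrow> bool" where
  "unstable_branch c W L \<gamma> b \<longleftrightarrow>
     is_solution_on c W \<gamma> {..<b} \<and>
     (\<forall>s<b. \<gamma> s \<in> collision_manifold c W) \<and>
     (\<gamma> \<longlongrightarrow> L) at_bot \<and>
     (\<exists>s<b. \<gamma> s \<noteq> L) \<and>
     (\<forall>\<^sub>F s in at_bot. ww (\<gamma> s) \<ge> 0)"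

definition first_hit :: "(real \<Rightarrow> state) \<Rightarrow> real \<Rightarrow> real \<Rightarrow> bool" where
  "first_hit \<gamma> a s \<longleftrightarrow> th (\<gamma> s) = a \<and> (\<forall>t<s. th (\<gamma> t) \<noteq> a)"

definition crosses_at :: "(real \<Rightarrow> real) \<Rightarrow> real \<Rightarrow> real \<Rightarrow> bool" where
  "crosses_at f a s \<longleftrightarrow> f s = a \<and> (\<exists>\<epsilon>>0.
      ((\<forall>t. s - \<epsilon> < t \<and> t < s \<longrightarrow> f t < a) \<and> (\<forall>t. s < t \<and> t < s + \<epsilon> \<longrightarrow> f t > a)) \<or>
      ((\<forall>t. s - \<epsilon> < t \<and> t < s \<longrightarrow> f t > a) \<and> (\<forall>t. s < t \<and> t < s + \<epsilon> \<longrightarrow> f t < a)))"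

definition crossing_times :: "(real \<Rightarrow> real) \<Rightarrow> real \<Rightarrow> real set \<Rightarrow> real set" where
  "crossing_times f a I = {s \<in> I. crosses_at f a s}"

text \<open>Periodic orbit of period T (theta is an angle, taken modulo 2 pi), with r > 0.\<close>
definition periodic_orbit :: "(real \<Rightarrow> real) \<Rightarrow> (real \<Rightarrow> real) \<Rightarrow> (real \<Rightarrow> state) \<Rightarrow> real \<Rightarrow> bool" where
  "periodic_orbit c W x T \<longleftrightarrow>
     T > 0 \<and> is_solution_on c W x UNIV \<and>
     (\<forall>s. x s \<in> energy_manifold c W \<and> rr (x s) > 0) \<and>
     (\<exists>m::int. \<forall>s. rr (x (s + T)) = rr (x s) \<and> vv (x (s + T)) = vv (x s) \<and>
                     ww (x (s + T)) = ww (x s) \<and> th (x (s + T)) = th (x s) + 2 * pi * m)"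

end

theory Submission
  imports Defs
begin

text \<open>The flow on the energy manifold is global, \<open>v\<close> increases on the collision manifold, and an orbit crossing
  \<open>\<theta> = - \<pi>/2\<close> or \<open>\<theta> = 0\<close> with \<open>w > 0\<close> passes the next critical point of \<open>V\<close>, turns back before it, or converges 
  to the collision equilibrium over it. The first two alternatives are open, and orbits close to one of the third kind
  leave along the unstable branch of the equilibrium, so that \<open>v1 < 0 < v2\<close> and \<open>v3 < 0\<close> determine the
  sign of \<open>v\<close> at their next section. A continuous curve of orbits along which this sign or the alternative changes thus
  contains an orbit with \<open>v = 0\<close> at the section. For \<open>k > 0\<close> the curve consists of the \<open>k\<close>-th returns to 
  \<open>\<theta> = - \<pi>/2\<close> of the points with \<open>v = 0\<close> there. For \<open>k = 0\<close> one starts at \<open>\<theta> = 0\<close> with \<open>v = 0\<close>; if no such orbit 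
  reaches \<open>\<pi>/2\<close> with \<open>v = 0\<close> directly, then \<open>v2 > - v3\<close>, by a convexity comparison on the 
  collision manifold, and some such orbit crosses \<open>\<pi>/2\<close>, returns, passes \<open>\<theta> = 0\<close> and hits \<open>- \<pi>/2\<close> with \<open>v = 0\<close>.
  Orbits with two perpendicular hits are periodic by reversibility.\<close>

subsection \<open>Ordinary differential equations with a Lipschitz right-hand side\<close>

text \<open>The equilibria are handled without linearization or an inclination lemma. Orbits close
  to one that converges to an equilibrium stay near it for longer and longer times, so a limit of
  their exit points has a complete past in a small window around the equilibrium, with v negative.
  Boundedness of that past forces r = 0, and a comparison of graphs over \<theta> shows that for a
  given sign of w only one orbit in the collision manifold has such a past; this identifies the
  limit. The obstacle for k = 0 is the end r = 0 of the curve of points with v = 0 on \<theta> = -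
  \<pi>/2: there the orbit is not known to reach \<theta> = 0, because convergence to the Eulerian
  equilibrium is excluded only for r > 0 (\<open>exit_left\<close>). Hence the start on the Eulerian
  line. If all direct orbits from there arrive with v > 0, those close to the homothetic orbit at r
  = \<open>V 0\<close> reach the critical angle with v not much above - vE cos b1, where vE > vs is
  the value of v at the Eulerian equilibrium and b1 an angle depending on c only through an
  integral. The convexity comparison turns this into v2 > - v3.\<close>

lemma norm_growth:
 fixes f f' :: "real => 'a::real_inner"
 assumes "a <= b"
  and d: "!!t. a <= t ==> t <= b ==> (f has_vector_derivative f' t) (at t)"
  and n: "!!t. a <= t ==> t <= b ==> norm (f' t) <= N * norm (f t)"
 shows "norm (f b) <= exp (N * (b - a)) * norm (f a)"
  and "norm (f a) <= exp (N * (b - a)) * norm (f b)"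
proof -
 have ip: "\<bar>f t \<bullet> f' t\<bar> <= N * (f t \<bullet> f t)" if "a <= t" "t <= b" for t
 proof -
  have "\<bar>f t \<bullet> f' t\<bar> <= norm (f t) * norm (f' t)" by (rule Cauchy_Schwarz_ineq2)
  also have "\<dots> <= norm (f t) * (N * norm (f t))" using n[OF that] by (intro mult_left_mono) auto
  also have "\<dots> = N * (f t \<bullet> f t)" by (simp add: dot_square_norm power2_eq_square)
  finally show ?thesis .
 qed
 \<comment> \<open>For e = - 1 the weighted square decreases, which is the forward bound; for e = 1
   it increases, which is the backward bound.\<close>
 have der: "((%t. exp (e * 2 * N * t) * (f t \<bullet> f t)) has_real_derivative
   exp (e * 2 * N * t) * (2 * (e * N * (f t \<bullet> f t) + f t \<bullet> f' t))) (at t)"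
  if "a <= t" "t <= b" for t e
 proof -
  have 1: "((%t. f t \<bullet> f t) has_real_derivative 2 * (f t \<bullet> f' t)) (at t)"
   using bounded_bilinear.has_vector_derivative[OF bounded_bilinear_inner d[OF that] d[OF that]]
   by (simp add: has_real_derivative_iff_has_vector_derivative inner_commute)
  show ?thesis
   by (rule derivative_eq_intros 1 refl | simp add: algebra_simps)+
 qed
 have 1: "exp (- 1 * 2 * N * b) * (f b \<bullet> f b) <= exp (- 1 * 2 * N * a) * (f a \<bullet> f a)"
 proof (rule DERIV_nonpos_imp_nonincreasing[OF \<open>a <= b\<close>])
  fix t assume t: "a <= t" "t <= b"
  have "exp (- 1 * 2 * N * t) * (2 * (- 1 * N * (f t \<bullet> f t) + f t \<bullet> f' t)) <= 0"
   using ip[OF t] by (intro mult_nonneg_nonpos) auto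
  then show "EX y. ((%t. exp (- 1 * 2 * N * t) * (f t \<bullet> f t)) has_real_derivative y) (at t) & y <= 0"
   using der[OF t, of "-1"] by blast
 qed
 have 2: "exp (1 * 2 * N * a) * (f a \<bullet> f a) <= exp (1 * 2 * N * b) * (f b \<bullet> f b)"
 proof (rule DERIV_nonneg_imp_nondecreasing[OF \<open>a <= b\<close>])
  fix t assume t: "a <= t" "t <= b"
  have "0 <= exp (1 * 2 * N * t) * (2 * (1 * N * (f t \<bullet> f t) + f t \<bullet> f' t))"
   using ip[OF t] by (intro mult_nonneg_nonneg) auto
  then show "EX y. ((%t. exp (1 * 2 * N * t) * (f t \<bullet> f t)) has_real_derivative y) (at t) & 0 <= y"
   using der[OF t, of "1"] by blast
 qed
 have fin: "norm x <= exp (N * (b - a)) * norm y"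
  if "exp (- 2 * N * b) * (x \<bullet> x) <= exp (- 2 * N * a) * (y \<bullet> y)" for x y :: 'a
 proof (rule power2_le_imp_le)
  have "x \<bullet> x = exp (2 * N * b) * (exp (- 2 * N * b) * (x \<bullet> x))"
   by (simp add: mult_exp_exp flip: mult.assoc)
  also have "\<dots> <= exp (2 * N * b) * (exp (- 2 * N * a) * (y \<bullet> y))"
   using that by (intro mult_left_mono) auto
  also have "\<dots> = (exp (N * (b - a)) * norm y)^2"
   by (simp add: power_mult_distrib dot_square_norm mult_exp_exp algebra_simps flip: mult.assoc exp_double)
  finally show "(norm x)^2 <= (exp (N * (b - a)) * norm y)^2" by (simp add: dot_square_norm)
 qed auto
 show "norm (f b) <= exp (N * (b - a)) * norm (f a)" by (rule fin) (use 1 in simp)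
 show "norm (f a) <= exp (N * (b - a)) * norm (f b)"
 proof (rule fin)
  have e: "exp (- (2 * N * (a + b))) * exp (2 * N * a) = exp (- 2 * N * b)"
   "exp (- (2 * N * (a + b))) * exp (2 * N * b) = exp (- 2 * N * a)"
   by (simp_all add: mult_exp_exp algebra_simps)
  have "exp (- (2 * N * (a + b))) * (exp (2 * N * a) * (f a \<bullet> f a)) <= exp (- (2 * N * (a + b))) * (exp (2 * N * b) * (f b \<bullet> f b))"
   using 2 by (intro mult_left_mono) auto
  then show "exp (- 2 * N * b) * (f a \<bullet> f a) <= exp (- 2 * N * a) * (f b \<bullet> f b)"
   by (simp add: e flip: mult.assoc)
 qed
qed

text \<open>The difference is the signed integral from 0 to t: an integral over an empty or
  degenerate interval is 0, so one of the two terms always vanishes.\<close>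

lemma continuous_antiderivative:
 fixes g :: "real => 'a::banach"
 assumes g: "continuous_on UNIV g"
 shows "((%t. integral {0..t} g - integral {t..0} g) has_vector_derivative g t) (at t)"
proof -
 define a b where "a = min t 0 - 1" and "b = max t 0 + 1"
 have ab: "a < t" "t < b" "a < 0" "0 < b" unfolding a_def b_def by auto
 have int: "g integrable_on {x..y}" for x y
  by (rule integrable_continuous_real) (use g continuous_on_subset in blast)
 have "((%u. integral {a..u} g) has_vector_derivative g t) (at t within {a..b})"
  by (rule integral_has_vector_derivative) (use continuous_on_subset[OF g] ab in auto)
 then have "((%u. integral {a..u} g) has_vector_derivative g t) (at t)"
  using ab by (simp add: at_within_Icc_at)
 then have "((%u. integral {a..u} g - integral {a..0} g) has_vector_derivative g t) (at t)"
  by (auto intro!: derivative_eq_intros)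
 moreover have "integral {a..u} g - integral {a..0} g = integral {0..u} g - integral {u..0} g"
  if u: "u \<in> {a<..<b}" for u
 proof (cases "0 <= u")
  case True
  have "integral {a..0} g + integral {0..u} g = integral {a..u} g"
   by (rule Henstock_Kurzweil_Integration.integral_combine) (use True ab int in auto)
  moreover have "integral {u..0} g = 0" using True by (cases "u = 0") auto
  ultimately show ?thesis by (simp add: algebra_simps)
 next
  case False
  have "integral {a..u} g + integral {u..0} g = integral {a..0} g"
   by (rule Henstock_Kurzweil_Integration.integral_combine) (use False u int in auto)
  moreover have "integral {0..u} g = 0" using False by auto
  ultimately show ?thesis by (simp add: algebra_simps)
 qed
 ultimately show ?thesis
  using has_vector_derivative_transform_within_open[of _ "g t" t "{a<..<b}" "%t. integral {0..t} g - integral {t..0} g"] ab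
  by auto
qed

text \<open>Banach's fixed point theorem in a weighted sup norm: with weight \<open>exp (- K \<bar>t\<bar>)\<close> and
 \<open>K > L\<close> the Picard operator contracts globally in time.\<close>
lemma picard_global:
 fixes F :: "'a::banach => 'a"
 assumes lip: "!!x y. norm (F x - F y) <= L * norm (x - y)"
  and bnd: "!!x. norm (F x) <= B" and L: "0 <= L"
 shows "EX X. X 0 = x0 & (\<forall>t::real. (X has_vector_derivative F (X t)) (at t))"
proof -
 \<comment> \<open>The contraction factor L / K is then at most 1/2, and K stays positive when L =
   0.\<close>
 define K where "K = 2 * L + 1"
 have K: "K > 0" "L / K <= 1/2" using L by (auto simp: K_def field_simps)
 have B: "B \<ge> 0" using bnd[of 0] norm_ge_zero order_trans by blast
 have Fc: "continuous_on UNIV F"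
 proof -
  have "L-lipschitz_on UNIV F" by (rule lipschitz_onI) (use lip L in \<open>auto simp: dist_norm\<close>)
  then show ?thesis by (rule lipschitz_on_continuous_on)
 qed
 define I where "I g t = integral {0..t} g - integral {t..0} g" for g :: "real => 'a" and t
 have Id: "(I g has_vector_derivative g t) (at t)" if "continuous_on UNIV g" for g t
  using continuous_antiderivative[OF that, of t] unfolding I_def[abs_def] .
 have I0: "I g 0 = 0" for g by (simp add: I_def)
 have Ic: "continuous_on UNIV (I g)" if "continuous_on UNIV g" for g
  by (rule continuous_at_imp_continuous_on) (use Id[OF that] has_vector_derivative_continuous in blast)
 \<comment> \<open>A mean value inequality for both time directions at once: \<phi>' at the absolute
   time dominates the norm of h'.\<close>
 have bound: "norm (h t) <= \<phi> \<bar>t\<bar> - \<phi> 0"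
  if h: "!!t. (h has_vector_derivative h' t) (at t)" and h0: "h 0 = 0"
   and \<phi>: "!!t. (\<phi> has_vector_derivative \<phi>' t) (at t)" and n: "!!t. norm (h' t) <= \<phi>' \<bar>t\<bar>"
  for h h' :: "real => 'a" and \<phi> \<phi>' t
 proof (cases t "0::real" rule: linorder_cases)
  case equal then show ?thesis using h0 by simp
 next
  case greater
  have "norm (h t - h 0) <= \<phi> t - \<phi> 0"
  proof (rule differentiable_bound_general[OF greater, of _ _ h' \<phi>'])
   show "continuous_on {0..t} h" "continuous_on {0..t} \<phi>"
    using h \<phi> has_vector_derivative_continuous by (blast intro: continuous_at_imp_continuous_on)+
   show "norm (h' s) <= \<phi>' s" if "0 < s" for s using n[of s] that by simp
  qed (use h \<phi> in auto)
  then show ?thesis using greater h0 by simp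
 next
  case less
  then have lt: "0 < - t" by simp
  have hm: "((%s. h (- s)) has_vector_derivative - h' (- s)) (at s)" for s
   using vector_diff_chain_at[of uminus "-1" s h "h' (- s)"] h[of "-s"] DERIV_minus[OF DERIV_ident, of s UNIV]
   by (simp add: o_def has_real_derivative_iff_has_vector_derivative)
  have "norm (h (- (- t)) - h (- 0)) <= \<phi> (- t) - \<phi> 0"
  proof (rule differentiable_bound_general[OF lt, of "%s. h (- s)" _ "%s. - h' (- s)" \<phi>'])
   show "continuous_on {0..- t} (%s. h (- s))" "continuous_on {0..- t} \<phi>"
    using hm \<phi> has_vector_derivative_continuous by (blast intro: continuous_at_imp_continuous_on)+
   show "norm (- h' (- s)) <= \<phi>' s" if "0 < s" for s using n[of "- s"] that by simp
  qed (use hm \<phi> in auto)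
  then show ?thesis using less h0 by simp
 qed
 \<comment> \<open>The unknown y is the solution times the decaying weight, which keeps it bounded;
   G removes the weight before F is applied.\<close>
 define G where "G y s = F (exp (K * \<bar>s\<bar>) *\<^sub>R apply_bcontfun y s)" for y :: "real \<Rightarrow>\<^sub>C 'a" and s
 have Gc: "continuous_on UNIV (G y)" for y
  unfolding G_def by (intro continuous_on_compose2[OF Fc] continuous_intros) auto
 define Op where "Op y t = exp (- (K * \<bar>t\<bar>)) *\<^sub>R (x0 + I (G y) t)" for y t
 have Op_mem: "Op y \<in> bcontfun" for y
 proof (rule bcontfun_normI)
  show "continuous_on UNIV (Op y)" unfolding Op_def[abs_def]
   by (intro continuous_intros continuous_on_compose2[OF Ic[OF Gc]]) auto
  fix t
  have "norm (I (G y) t) <= B * \<bar>t\<bar> - B * 0"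
  proof (rule bound[of _ "G y" "%t. B * t" "%_. B"])
   show "(I (G y) has_vector_derivative G y s) (at s)" for s by (rule Id[OF Gc])
   show "norm (G y s) <= B" for s by (simp add: G_def bnd)
  qed (use I0 in \<open>auto simp: has_real_derivative_iff_has_vector_derivative[symmetric] intro!: derivative_eq_intros\<close>)
  also have "\<dots> <= (B / K) * exp (K * \<bar>t\<bar>)"
  proof -
   have "B * \<bar>t\<bar> = (B / K) * (K * \<bar>t\<bar>)" using K by simp
   also have "\<dots> <= (B / K) * exp (K * \<bar>t\<bar>)"
   proof (rule mult_left_mono)
    show "K * \<bar>t\<bar> <= exp (K * \<bar>t\<bar>)"
     by (rule order_trans[OF _ exp_ge_add_one_self]) simp
   qed (use K B in simp)
   finally show ?thesis by simp
  qed
  finally have i: "norm (I (G y) t) <= (B / K) * exp (K * \<bar>t\<bar>)" .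
  have "norm (Op y t) <= exp (- (K * \<bar>t\<bar>)) * (norm x0 + norm (I (G y) t))"
   unfolding Op_def by (simp add: norm_triangle_ineq mult_left_mono)
  also have "\<dots> <= exp (- (K * \<bar>t\<bar>)) * (norm x0 + (B / K) * exp (K * \<bar>t\<bar>))"
   using i by (intro mult_left_mono) auto
  also have "\<dots> = exp (- (K * \<bar>t\<bar>)) * norm x0 + B / K"
   by (simp add: algebra_simps mult_exp_exp)
  also have "\<dots> <= norm x0 + B / K" using K by (auto intro!: mult_left_le_one_le)
  finally show "norm (Op y t) <= norm x0 + B / K" .
 qed
 define \<Phi> where "\<Phi> y = Bcontfun (Op y)" for y
 have \<Phi>_app: "apply_bcontfun (\<Phi> y) t = Op y t" for y t
  unfolding \<Phi>_def using Op_mem by (simp add: Bcontfun_inverse)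
 have contr: "dist (\<Phi> y) (\<Phi> z) <= (1/2) * dist y z" for y z
 proof (rule dist_bound)
  fix t
  have "norm (I (G y) t - I (G z) t) <= (L / K * dist y z) * exp (K * \<bar>t\<bar>) - (L / K * dist y z) * exp (K * 0)"
  proof (rule bound[of "%t. I (G y) t - I (G z) t" "%t. G y t - G z t" "%t. (L / K * dist y z) * exp (K * t)" "%t. L * dist y z * exp (K * t)"])
   fix s
   show "((%t. I (G y) t - I (G z) t) has_vector_derivative G y s - G z s) (at s)"
    by (intro derivative_intros Id Gc)
   show "((%t. (L / K * dist y z) * exp (K * t)) has_vector_derivative L * dist y z * exp (K * s)) (at s)"
    using K by (auto simp: has_real_derivative_iff_has_vector_derivative[symmetric] intro!: derivative_eq_intros)
   have "norm (G y s - G z s) <= L * norm (exp (K * \<bar>s\<bar>) *\<^sub>R (apply_bcontfun y s - apply_bcontfun z s))"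
    unfolding G_def by (rule order_trans[OF lip]) (simp add: scaleR_diff_right)
   also have "\<dots> = L * (exp (K * \<bar>s\<bar>) * dist (apply_bcontfun y s) (apply_bcontfun z s))" by (simp add: dist_norm)
   also have "\<dots> <= L * (exp (K * \<bar>s\<bar>) * dist y z)"
    using L by (intro mult_left_mono dist_bounded) auto
   finally show "norm (G y s - G z s) <= L * dist y z * exp (K * \<bar>s\<bar>)" by (simp add: mult_ac)
  qed (simp add: I0)
  also have "\<dots> <= (1/2 * dist y z) * exp (K * \<bar>t\<bar>)"
  proof -
   have "(L / K * dist y z) * exp (K * \<bar>t\<bar>) <= (1/2 * dist y z) * exp (K * \<bar>t\<bar>)"
    using K by (intro mult_right_mono) auto
   moreover have "0 <= (L / K * dist y z) * exp (K * 0)" using K L by auto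
   ultimately show ?thesis by linarith
  qed
  finally have i: "norm (I (G y) t - I (G z) t) <= (1/2 * dist y z) * exp (K * \<bar>t\<bar>)" .
  have "dist (\<Phi> y t) (\<Phi> z t) = exp (- (K * \<bar>t\<bar>)) * norm (I (G y) t - I (G z) t)"
   unfolding \<Phi>_app Op_def dist_norm by (simp flip: scaleR_diff_right)
  also have "\<dots> <= exp (- (K * \<bar>t\<bar>)) * ((1/2 * dist y z) * exp (K * \<bar>t\<bar>))"
   using i by (intro mult_left_mono) auto
  also have "\<dots> = (1/2) * dist y z" by (simp add: mult_exp_exp)
  finally show "dist (\<Phi> y t) (\<Phi> z t) <= (1/2) * dist y z" .
 qed
 obtain y where y: "\<Phi> y = y"
  using banach_fix_type[of "1/2" \<Phi>] contr by auto
 define X where "X t = x0 + I (G y) t" for t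
 have GX: "G y t = F (X t)" for t
 proof -
  have "apply_bcontfun y t = Op y t" using \<Phi>_app[of y t] y by simp
  then have "exp (K * \<bar>t\<bar>) *\<^sub>R apply_bcontfun y t = X t" by (simp add: Op_def X_def mult_exp_exp)
  then show ?thesis by (simp add: G_def)
 qed
 have "(X has_vector_derivative F (X t)) (at t)" for t
 proof -
  have "((%t. x0 + I (G y) t) has_vector_derivative G y t) (at t)"
   using Id[OF Gc, of y t] by (auto intro!: derivative_eq_intros)
  moreover have "X = (%t. x0 + I (G y) t)" by (rule ext) (rule X_def)
  ultimately show ?thesis using GX[of t] by metis
 qed
 moreover have "X 0 = x0" by (simp add: X_def I0)
 ultimately show ?thesis by blast
qed

lemma cos_sin_unit: "cos x = 0 ==> sin x ~= (0::real)"
 using sin_cos_squared_add[of x] by auto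

text \<open>The zeros of cos are isolated, so equality extends by continuity. This carries the
  symmetries of \<open>V\<close> over to \<open>W\<close> on the collision lines.\<close>

lemma continuous_eq_off_cos_zeros:
 fixes f g :: "real => real"
 assumes f: "continuous_on UNIV f" and g: "continuous_on UNIV g"
  and eq: "!!x. cos x ~= 0 ==> f x = g x"
 shows "f x = g x"
proof (rule ccontr)
 assume ne: "f x ~= g x"
 have "open {x. f x ~= g x}" using f g by (rule open_Collect_neq)
 with ne obtain e where e: "e > 0" "ball x e \<subseteq> {x. f x ~= g x}"
  unfolding open_contains_ball by blast
 define d where "d = min (e / 2) 1"
 have d: "0 < d" "d < e" "d < pi" using e pi_gt3 by (auto simp: d_def)
 have "cos x = 0" using ne eq by blast
 moreover have "cos (x + d) ~= 0"
  using cos_sin_unit[OF \<open>cos x = 0\<close>] sin_gt_zero[OF d(1,3)] by (simp add: cos_add \<open>cos x = 0\<close>)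
 moreover have "x + d \<in> ball x e" using d by (simp add: dist_real_def)
 ultimately show False using e eq[of "x + d"] by auto
qed

lemma periodic_int:
 fixes f :: "real => real"
 assumes "!!x. f (x + pi) = f x"
 shows "f (x + of_int k * pi) = f x"
proof (induction k)
 case (nonneg n) then show ?case
 proof (induction n)
  case (Suc n)
  have "f (x + of_int (int (Suc n)) * pi) = f ((x + of_int (int n) * pi) + pi)" by (simp add: algebra_simps)
  then show ?case using Suc assms by simp
 qed simp
next
 case (neg n)
 have "f (x - real m * pi) = f x" for m
 proof (induction m)
  case (Suc m)
  have "f (x - real (Suc m) * pi) = f ((x - real (Suc m) * pi) + pi)" using assms by simp
  also have "(x - real (Suc m) * pi) + pi = x - real m * pi" by (simp add: algebra_simps)
  finally show ?case using Suc by simp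
 qed simp
 from this[of "Suc n"] show ?case by (simp add: algebra_simps)
qed

lemma periodic_bounded:
 fixes f :: "real => real"
 assumes p: "!!x. f (x + pi) = f x" and c: "continuous_on UNIV f"
 obtains B where "B > 0" "!!x. \<bar>f x\<bar> <= B"
proof -
 have "bounded (f ` {0..pi})"
  by (intro compact_imp_bounded compact_continuous_image) (use c continuous_on_subset in auto)
 then obtain B where B: "B > 0" "!!x. x \<in> {0..pi} ==> \<bar>f x\<bar> <= B"
  unfolding bounded_pos by auto
 have "\<bar>f x\<bar> <= B" for x
 proof -
  define k where "k = \<lfloor>x / pi\<rfloor>"
  have "of_int k <= x / pi" "x / pi < of_int k + 1" unfolding k_def by linarith+
  then have "x - of_int k * pi \<in> {0..pi}" using pi_gt_zero by (auto simp: field_simps)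
  then have "\<bar>f (x - of_int k * pi)\<bar> <= B" using B by blast
  then show ?thesis using periodic_int[of f "x - of_int k * pi" k] p by simp
 qed
 with B that show thesis by blast
qed

section \<open>Bounded Lipschitz functions\<close>

definition C1_fun :: "(real => real) => bool" where
 "C1_fun f \<longleftrightarrow> (EX f'. (ALL x. (f has_real_derivative f' x) (at x)) & continuous_on UNIV f')"

text \<open>Boundedness is carried along because products of Lipschitz functions need it; the vector
  field on a bounded set is then Lipschitz by structural rules alone.\<close>

definition bdd_lip :: "'a::real_normed_vector set => ('a => real) => bool" where
 "bdd_lip S f \<longleftrightarrow> (EX B L. 0 <= L & (\<forall>x\<in>S. \<bar>f x\<bar> <= B) & (\<forall>x\<in>S. \<forall>y\<in>S. \<bar>f x - f y\<bar> <= L * norm (x - y)))"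

lemma bdd_lip_const [intro]: "bdd_lip S (%_. k)"
 unfolding bdd_lip_def by (rule exI[of _ "\<bar>k\<bar>"], rule exI[of _ 0]) auto

lemma bdd_lip_add [intro]:
 assumes "bdd_lip S f" "bdd_lip S g" shows "bdd_lip S (%x. f x + g x)"
proof -
 obtain B L B' L' where h: "0 <= L" "!!x. x\<in>S ==> \<bar>f x\<bar> <= B" "!!x y. x\<in>S ==> y\<in>S ==> \<bar>f x - f y\<bar> <= L * norm (x - y)"
  "0 <= L'" "!!x. x\<in>S ==> \<bar>g x\<bar> <= B'" "!!x y. x\<in>S ==> y\<in>S ==> \<bar>g x - g y\<bar> <= L' * norm (x - y)"
  using assms unfolding bdd_lip_def by metis
 show ?thesis unfolding bdd_lip_def
 proof (intro exI conjI ballI)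
  show "0 <= L + L'" using h by simp
  show "\<bar>f x + g x\<bar> <= B + B'" if "x \<in> S" for x using h(2)[OF that] h(5)[OF that] by linarith
  show "\<bar>f x + g x - (f y + g y)\<bar> <= (L + L') * norm (x - y)" if "x \<in> S" "y \<in> S" for x y
   using h(3)[OF that] h(6)[OF that] unfolding distrib_right by linarith
 qed
qed

lemma bdd_lip_mult [intro]:
 assumes "bdd_lip S f" "bdd_lip S g" shows "bdd_lip S (%x. f x * g x)"
proof -
 obtain B L B' L' where h: "0 <= L" "!!x. x\<in>S ==> \<bar>f x\<bar> <= B" "!!x y. x\<in>S ==> y\<in>S ==> \<bar>f x - f y\<bar> <= L * norm (x - y)"
  "0 <= L'" "!!x. x\<in>S ==> \<bar>g x\<bar> <= B'" "!!x y. x\<in>S ==> y\<in>S ==> \<bar>g x - g y\<bar> <= L' * norm (x - y)"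
  using assms unfolding bdd_lip_def by metis
 show ?thesis unfolding bdd_lip_def
 proof (intro exI conjI ballI)
  show "0 <= \<bar>B\<bar> * L' + \<bar>B'\<bar> * L" using h by simp
  show "\<bar>f x * g x\<bar> <= \<bar>B\<bar> * \<bar>B'\<bar>" if "x \<in> S" for x
   unfolding abs_mult using h(2)[OF that] h(5)[OF that] by (intro mult_mono) auto
  show "\<bar>f x * g x - f y * g y\<bar> <= (\<bar>B\<bar> * L' + \<bar>B'\<bar> * L) * norm (x - y)" if xy: "x \<in> S" "y \<in> S" for x y
  proof -
   have "f x * g x - f y * g y = f x * (g x - g y) + g y * (f x - f y)" by (simp add: algebra_simps)
   then have "\<bar>f x * g x - f y * g y\<bar> <= \<bar>f x\<bar> * \<bar>g x - g y\<bar> + \<bar>g y\<bar> * \<bar>f x - f y\<bar>"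
    by (metis abs_mult abs_triangle_ineq)
   also have "\<dots> <= \<bar>B\<bar> * (L' * norm (x - y)) + \<bar>B'\<bar> * (L * norm (x - y))"
    using h(2)[OF xy(1)] h(5)[OF xy(2)] h(3)[OF xy] h(6)[OF xy] by (intro add_mono mult_mono) auto
   finally show ?thesis by (simp add: algebra_simps)
  qed
 qed
qed

lemma bdd_lip_minus [intro]: "bdd_lip S f ==> bdd_lip S (%x. - f x)"
 using bdd_lip_mult[OF bdd_lip_const[of S "-1"], of f] by simp

lemma bdd_lip_diff [intro]: "bdd_lip S f ==> bdd_lip S g ==> bdd_lip S (%x. f x - g x)"
 using bdd_lip_add[of S f "%x. - g x"] by (simp add: bdd_lip_minus)

lemma bdd_lip_power [intro]: "bdd_lip S f ==> bdd_lip S (%x. f x ^ n)"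
 by (induction n) auto

lemma bdd_lip_C1:
 assumes f: "bdd_lip S f" and g: "C1_fun g" shows "bdd_lip S (%x. g (f x))"
proof -
 obtain B L where h: "0 <= L" "!!x. x\<in>S ==> \<bar>f x\<bar> <= B" "!!x y. x\<in>S ==> y\<in>S ==> \<bar>f x - f y\<bar> <= L * norm (x - y)"
  using f unfolding bdd_lip_def by metis
 obtain g' where g': "!!x. (g has_real_derivative g' x) (at x)" "continuous_on UNIV g'"
  using g unfolding C1_fun_def by blast
 have gc: "continuous_on UNIV g"
  using g'(1) DERIV_isCont by (blast intro: continuous_at_imp_continuous_on)
 have bd: "EX M. \<forall>x\<in>{-B..B}. \<bar>k x\<bar> <= M" if "continuous_on UNIV k" for k :: "real => real"
 proof -
  have "bounded (k ` {-B..B})"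
   by (intro compact_imp_bounded compact_continuous_image continuous_on_subset[OF that]) auto
  then show ?thesis unfolding bounded_iff by auto
 qed
 obtain M M' where M: "!!x. x \<in> {-B..B} ==> \<bar>g x\<bar> <= M" "!!x. x \<in> {-B..B} ==> \<bar>g' x\<bar> <= M'"
  using bd[OF gc] bd[OF g'(2)] by blast
 have lip: "\<bar>g x - g y\<bar> <= \<bar>M'\<bar> * \<bar>x - y\<bar>" if "x \<in> {-B..B}" "y \<in> {-B..B}" for x y
 proof -
  have "norm (g x - g y) <= \<bar>M'\<bar> * norm (x - y)"
  proof (rule field_differentiable_bound[of "{-B..B}" g g'])
   show "(g has_real_derivative g' z) (at z within {-B..B})" for z
    using g'(1) by (rule has_field_derivative_at_within)
   show "norm (g' z) <= \<bar>M'\<bar>" if "z \<in> {-B..B}" for z using M(2)[OF that] by simp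
  qed (use that in auto)
  then show ?thesis by simp
 qed
 show ?thesis unfolding bdd_lip_def
 proof (intro exI conjI ballI)
  show "0 <= \<bar>M'\<bar> * L" using h by simp
  have in': "f x \<in> {-B..B}" if "x \<in> S" for x using h(2)[OF that] by auto
  show "\<bar>g (f x)\<bar> <= M" if "x \<in> S" for x using M(1)[OF in'[OF that]] .
  show "\<bar>g (f x) - g (f y)\<bar> <= (\<bar>M'\<bar> * L) * norm (x - y)" if xy: "x \<in> S" "y \<in> S" for x y
   using lip[OF in'[OF xy(1)] in'[OF xy(2)]] mult_left_mono[OF h(3)[OF xy], of "\<bar>M'\<bar>"] by (simp add: mult.assoc)
 qed
qed

lemma bdd_lip_linear:
 assumes "bounded S" "bounded_linear f" shows "bdd_lip S f"
proof -
 obtain K where K: "!!x. norm (f x) <= norm x * K" "K \<ge> 0"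
  using bounded_linear.nonneg_bounded[OF assms(2)] by blast
 obtain B where B: "!!x. x \<in> S ==> norm x <= B" using assms(1) unfolding bounded_iff by blast
 show ?thesis unfolding bdd_lip_def
 proof (intro exI conjI ballI)
  show "0 <= K" by fact
  show "\<bar>f x\<bar> <= B * K" if "x \<in> S" for x
   using K(1)[of x] mult_right_mono[OF B[OF that] K(2)] by simp
  show "\<bar>f x - f y\<bar> <= K * norm (x - y)" for x y
   using K(1)[of "x - y"] by (simp add: linear_diff bounded_linear.linear[OF assms(2)] mult.commute)
 qed
qed

section \<open>Coordinates of a state and the symmetries of the system: reversal, reflection,
  translation\<close>

definition Rv :: "state => state" where "Rv x = (rr x, - vv x, th x, - ww x)"
definition Mi :: "state => state" where "Mi x = (rr x, vv x, - th x, - ww x)"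
definition Sh :: "real => state => state" where "Sh a x = (rr x, vv x, th x + a, ww x)"

lemma comp_simps [simp]:
 "rr (a, b, d, e) = a" "vv (a, b, d, e) = b" "th (a, b, d, e) = d" "ww (a, b, d, e) = e"
 "rr (Rv x) = rr x" "vv (Rv x) = - vv x" "th (Rv x) = th x" "ww (Rv x) = - ww x"
 "rr (Mi x) = rr x" "vv (Mi x) = vv x" "th (Mi x) = - th x" "ww (Mi x) = - ww x"
 "rr (Sh y x) = rr x" "vv (Sh y x) = vv x" "th (Sh y x) = th x + y" "ww (Sh y x) = ww x"
 by (auto simp: rr_def vv_def th_def ww_def Rv_def Mi_def Sh_def)

lemma state_eqI: "rr x = rr y ==> vv x = vv y ==> th x = th y ==> ww x = ww y ==> x = y"
 by (auto simp: rr_def vv_def th_def ww_def prod_eq_iff)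

lemma Rv_Rv [simp]: "Rv (Rv x) = x" by (rule state_eqI) auto
lemma Mi_Mi [simp]: "Mi (Mi x) = x" by (rule state_eqI) auto

lemma bounded_linear_comp: "bounded_linear rr" "bounded_linear vv" "bounded_linear th" "bounded_linear ww"
 unfolding rr_def[abs_def] vv_def[abs_def] th_def[abs_def] ww_def[abs_def]
 by (rule bounded_linear_fst bounded_linear_fst_comp[OF bounded_linear_snd]
   bounded_linear_fst_comp[OF bounded_linear_snd_comp[OF bounded_linear_snd]]
   bounded_linear_snd_comp[OF bounded_linear_snd_comp[OF bounded_linear_snd]])+

lemma norm_state_le: "norm x <= \<bar>rr x\<bar> + \<bar>vv x\<bar> + \<bar>th x\<bar> + \<bar>ww x\<bar>"
proof -
 obtain a b d e where x: "x = (a, b, d, e)" by (cases x)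
 have "norm (a, b, d, e) <= norm a + norm (b, d, e)" by (rule norm_Pair_le)
 also have "norm (b, d, e) <= norm b + norm (d, e)" by (rule norm_Pair_le)
 also have "norm (d, e) <= norm d + norm e" by (rule norm_Pair_le)
 finally show ?thesis by (simp add: x)
qed

lemma comp_le_norm: "\<bar>rr x\<bar> <= norm x" "\<bar>vv x\<bar> <= norm x" "\<bar>th x\<bar> <= norm x" "\<bar>ww x\<bar> <= norm x"
proof -
 obtain a b d e where x: "x = (a, b, d, e)" by (cases x)
 have 1: "norm b <= norm (b, d, e)" "norm (d, e) <= norm (b, d, e)" "norm a <= norm (a, b, d, e)"
  "norm (b, d, e) <= norm (a, b, d, e)" "norm d <= norm (d, e)" "norm e <= norm (d, e)"
  using norm_fst_le[of b "(d, e)"] norm_snd_le[of "(d, e)" b] norm_fst_le[of a "(b, d, e)"]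
   norm_snd_le[of "(b, d, e)" a] norm_fst_le[of d e] norm_snd_le[of e d] by simp_all
 then show "\<bar>rr x\<bar> <= norm x" "\<bar>vv x\<bar> <= norm x" "\<bar>th x\<bar> <= norm x" "\<bar>ww x\<bar> <= norm x" by (auto simp: x)
qed

lemma comp_diff [simp]: "rr (x - y) = rr x - rr y" "vv (x - y) = vv x - vv y"
 "th (x - y) = th x - th y" "ww (x - y) = ww x - ww y"
 by (auto simp: rr_def vv_def th_def ww_def)

lemmas comp_tendsto [tendsto_intros] = bounded_linear.tendsto[OF bounded_linear_comp(1)]
 bounded_linear.tendsto[OF bounded_linear_comp(2)] bounded_linear.tendsto[OF bounded_linear_comp(3)]
 bounded_linear.tendsto[OF bounded_linear_comp(4)]

lemmas comp_continuous [continuous_intros] = bounded_linear.continuous_on[OF bounded_linear_comp(1)]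
 bounded_linear.continuous_on[OF bounded_linear_comp(2)] bounded_linear.continuous_on[OF bounded_linear_comp(3)]
 bounded_linear.continuous_on[OF bounded_linear_comp(4)]

lemma state_tendstoI:
 assumes "((%x. rr (f x)) \<longlongrightarrow> rr l) F" "((%x. vv (f x)) \<longlongrightarrow> vv l) F"
  "((%x. th (f x)) \<longlongrightarrow> th l) F" "((%x. ww (f x)) \<longlongrightarrow> ww l) F"
 shows "(f \<longlongrightarrow> l) F"
proof -
 have "((%x. (rr (f x), vv (f x), th (f x), ww (f x))) \<longlongrightarrow> (rr l, vv l, th l, ww l)) F"
  by (intro tendsto_Pair assms)
 then show ?thesis by (simp add: rr_def vv_def th_def ww_def)
qed

lemma state_vderiv_iff:
 "(X has_vector_derivative (a, b, d, e)) (at t) \<longleftrightarrow>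
  ((%t. rr (X t)) has_real_derivative a) (at t) & ((%t. vv (X t)) has_real_derivative b) (at t) &
  ((%t. th (X t)) has_real_derivative d) (at t) & ((%t. ww (X t)) has_real_derivative e) (at t)" (is "?L \<longleftrightarrow> ?R")
proof
 assume ?L
 from bounded_linear.has_vector_derivative[OF bounded_linear_comp(1) this]
  bounded_linear.has_vector_derivative[OF bounded_linear_comp(2) this]
  bounded_linear.has_vector_derivative[OF bounded_linear_comp(3) this]
  bounded_linear.has_vector_derivative[OF bounded_linear_comp(4) this]
 show ?R by (simp add: has_real_derivative_iff_has_vector_derivative)
next
 assume ?R
 then have "((%t. (rr (X t), vv (X t), th (X t), ww (X t))) has_vector_derivative (a, b, d, e)) (at t)"
  by (auto simp: has_real_derivative_iff_has_vector_derivative intro!: has_vector_derivative_Pair)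
 then show ?L by (simp add: rr_def vv_def th_def ww_def)
qed

subsection \<open>The shape potential\<close>

locale shape =
 fixes c V W :: "real => real" and ts :: real
 assumes c_choice: "c = c_one | c = c_two"
  and V_smooth: "smooth_on {\<theta>. cos \<theta> ~= 0} V"
  and V_pos: "\<forall>\<theta>. cos \<theta> ~= 0 --> V \<theta> > 0"
  and V_even: "\<forall>\<theta>. cos \<theta> ~= 0 --> V (- \<theta>) = V \<theta>"
  and V_periodic: "\<forall>\<theta>. cos \<theta> ~= 0 --> V (\<theta> + pi) = V \<theta>"
  and W_smooth: "smooth_on UNIV W"
  and W_pos: "\<forall>\<theta>. W \<theta> > 0"
  and W_ext: "\<forall>\<theta>. cos \<theta> ~= 0 --> W \<theta> = (cos \<theta>)^2 * V \<theta>"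
  and ts_range: "0 < ts" "ts < pi / 2"
  and V_crit: "{\<theta> \<in> {- (pi / 2)<..<pi / 2}. deriv V \<theta> = 0} = {- ts, 0, ts}"
  and V_nondeg: "\<forall>\<theta>\<in>{- ts, 0, ts}. deriv (deriv V) \<theta> ~= 0"
begin

lemma c_derivs:
 shows c_deriv: "(c has_real_derivative deriv c x) (at x)"
  and C1_c: "C1_fun c" and C1_dc: "C1_fun (deriv c)"
  and dc_bound: "\<bar>deriv c x\<bar> <= 1"
proof -
 have "EX c1 c2. (ALL x. (c has_real_derivative c1 x) (at x)) & (ALL x. (c1 has_real_derivative c2 x) (at x)) &
   continuous_on UNIV c2 & (ALL x. \<bar>c1 x\<bar> <= 1)"
  using c_choice
 proof
  assume c: "c = c_one"
  have b: "\<bar>(1 + (sin x)^2) * (sin x * cos x)\<bar> <= 1" for x :: real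
  proof -
   have "\<bar>sin x * cos x\<bar> <= 1/2"
    using sin_double[of x] abs_sin_le_one[of "2 * x"] by simp
   moreover have "\<bar>1 + (sin x)^2\<bar> <= 2" using abs_square_le_1[of "sin x"] by auto
   ultimately have "\<bar>1 + (sin x)^2\<bar> * \<bar>sin x * cos x\<bar> <= 2 * (1/2)" by (intro mult_mono) auto
   then show ?thesis by (simp add: abs_mult)
  qed
  show ?thesis unfolding c
   apply (rule exI[of _ "%x. (1 + (sin x)^2) * (sin x * cos x)"])
   apply (rule exI[of _ "%x. (2 * sin x * cos x) * (sin x * cos x) + (1 + (sin x)^2) * (cos x * cos x - sin x * sin x)"])
   using b unfolding c_one_def[abs_def]
   by (intro conjI allI) (auto intro!: derivative_eq_intros continuous_intros simp: field_simps)
 next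
  assume c: "c = c_two"
  have b: "\<bar>- (2 * cos x * sin x)\<bar> <= 1" for x :: real
   using sin_double[of x] abs_sin_le_one[of "2 * x"] by (simp add: mult_ac)
  show ?thesis unfolding c
   apply (rule exI[of _ "%x. - (2 * cos x * sin x)"])
   apply (rule exI[of _ "%x. 2 * sin x * sin x - 2 * cos x * cos x"])
   using b unfolding c_two_def[abs_def]
   by (intro conjI allI) (auto intro!: derivative_eq_intros continuous_intros simp: field_simps)
 qed
 then obtain c1 c2 where h: "!!x. (c has_real_derivative c1 x) (at x)" "!!x. (c1 has_real_derivative c2 x) (at x)"
  "continuous_on UNIV c2" "!!x. \<bar>c1 x\<bar> <= 1" by blast
 have c1: "deriv c = c1" using h(1) by (intro ext DERIV_imp_deriv)
 show "(c has_real_derivative deriv c x) (at x)" "\<bar>deriv c x\<bar> <= 1" using h(1,4) c1 by auto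
 have "continuous_on UNIV c1" using h(2) DERIV_isCont continuous_at_imp_continuous_on by metis
 then show "C1_fun c" "C1_fun (deriv c)" unfolding C1_fun_def c1 using h by blast+
qed

lemma c_bounds: "1/4 <= c x" "c x <= 2"
proof -
 have s: "0 <= (sin x)^2" "(sin x)^2 <= 1" "0 <= (cos x)^2" "(cos x)^2 <= 1" for x :: real
  by (auto simp: abs_square_le_1)
 have "1 <= (1 + (sin x)^2)^2" "(1 + (sin x)^2)^2 <= 2^2"
  using s[of x] by (intro one_le_power power_mono; linarith)+
 then show "1/4 <= c x" "c x <= 2" using c_choice s[of x] by (auto simp: c_one_def c_two_def)
qed

lemma c_pos: "c x > 0" using c_bounds(1)[of x] by linarith

lemma c_sym: "c (- x) = c x" "c (x + pi) = c x"
 using c_choice by (auto simp: c_one_def c_two_def)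

lemma deriv_sym:
 assumes d: "!!x. (f has_real_derivative deriv f x) (at x)"
 shows "(!!x. f (- x) = f x) ==> deriv f (- x) = - deriv f x"
  and "(!!x. f (x + pi) = f x) ==> deriv f (x + pi) = deriv f x"
proof -
 assume e: "!!x. f (- x) = f x"
 have "((%x. f (- x)) has_real_derivative deriv f (- x) * (- 1)) (at x)"
  by (rule DERIV_chain2[OF d]) (auto intro!: derivative_eq_intros)
 then have "(f has_real_derivative - deriv f (- x)) (at x)" using e by simp
 then show "deriv f (- x) = - deriv f x" using DERIV_unique[OF d] by force
next
 assume e: "!!x. f (x + pi) = f x"
 have "((%x. f (x + pi)) has_real_derivative deriv f (x + pi) * 1) (at x)"
  by (rule DERIV_chain2[OF d]) (auto intro!: derivative_eq_intros)
 then have "(f has_real_derivative deriv f (x + pi)) (at x)" using e by simp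
 then show "deriv f (x + pi) = deriv f x" using DERIV_unique[OF d] by force
qed

lemma dc_sym: "deriv c (- x) = - deriv c x" "deriv c (x + pi) = deriv c x"
 using deriv_sym[OF c_deriv] c_sym by auto

lemma W_deriv: "(W has_real_derivative deriv W x) (at x)"
 and dW_deriv: "(deriv W has_real_derivative deriv (deriv W) x) (at x)"
 and C1_W: "C1_fun W" and C1_dW: "C1_fun (deriv W)"
proof -
 have d: "((deriv ^^ n) W has_real_derivative (deriv ^^ Suc n) W x) (at x)" for n x
  using W_smooth unfolding smooth_on_def
  by (auto simp: DERIV_deriv_iff_real_differentiable)
 have c: "continuous_on UNIV ((deriv ^^ n) W)" for n
  by (rule continuous_at_imp_continuous_on) (use d[of n] DERIV_isCont in blast)
 show 1: "(W has_real_derivative deriv W x) (at x)" for x using d[of 0 x] by simp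
 show 2: "(deriv W has_real_derivative deriv (deriv W) x) (at x)" for x using d[of 1 x] by simp
 show "C1_fun W" unfolding C1_fun_def using 1 c[of 1] by auto
 show "C1_fun (deriv W)" unfolding C1_fun_def using 2 c[of 2] by (auto simp: numeral_2_eq_2)
qed

lemma cont_W: "continuous_on UNIV W" and cont_dW: "continuous_on UNIV (deriv W)"
 and cont_c: "continuous_on UNIV c" and cont_dc: "continuous_on UNIV (deriv c)"
 using C1_W C1_dW C1_c C1_dc unfolding C1_fun_def
 by (metis DERIV_isCont continuous_at_imp_continuous_on)+

lemma W_sym: "W (- x) = W x" "W (x + pi) = W x"
proof -
 show "W (- x) = W x"
  by (rule continuous_eq_off_cos_zeros[of "%x. W (- x)" W])
    (auto intro!: continuous_intros continuous_on_compose2[OF cont_W] cont_W simp: W_ext V_even)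
 show "W (x + pi) = W x"
  by (rule continuous_eq_off_cos_zeros[of "%x. W (x + pi)" W])
    (auto intro!: continuous_intros continuous_on_compose2[OF cont_W] cont_W simp: W_ext V_periodic)
qed

lemma dW_sym: "deriv W (- x) = - deriv W x" "deriv W (x + pi) = deriv W x"
 using deriv_sym[OF W_deriv] W_sym by auto

definition WM :: real where "WM = (SOME B. B > 0 & (ALL x. W x <= B))"

lemma WM: "WM > 0" "W x <= WM"
proof -
 obtain B where "B > 0" "!!x. \<bar>W x\<bar> <= B" using periodic_bounded[of W] W_sym(2) cont_W by blast
 then have "EX B. B > 0 & (ALL x. W x <= B)" by (metis abs_le_D1)
 then have "WM > 0 & (ALL x. W x <= WM)" unfolding WM_def by (rule someI_ex)
 then show "WM > 0" "W x <= WM" by auto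
qed

text \<open>Away from the collision lines this is cos^3 times V' (\<open>G_V\<close>); written with
  \<open>W\<close> it stays continuous across them. Its sign decides the direction of w' at rest
  points of \<theta>.\<close>

definition G :: "real => real" where "G x = deriv W x * cos x + 2 * W x * sin x"

lemma cont_G: "continuous_on UNIV G"
 unfolding G_def[abs_def] by (intro continuous_intros cont_W cont_dW)

lemma G_sym: "G (- x) = - G x" "G (x + pi) = - G x"
 unfolding G_def by (auto simp: dW_sym W_sym)

lemma V_deriv: "cos x ~= 0 ==> (V has_real_derivative deriv V x) (at x)"
 and dV_deriv: "cos x ~= 0 ==> (deriv V has_real_derivative deriv (deriv V) x) (at x)"
proof -
 assume x: "cos x ~= 0"
 have d: "((deriv ^^ n) V has_real_derivative (deriv ^^ Suc n) V x) (at x)" for n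
  using V_smooth x unfolding smooth_on_def
  by (auto simp: DERIV_deriv_iff_real_differentiable)
 show "(V has_real_derivative deriv V x) (at x)" using d[of 0] by simp
 show "(deriv V has_real_derivative deriv (deriv V) x) (at x)" using d[of 1] by simp
qed

lemma open_cos: "open {x::real. cos x ~= 0}"
 by (intro open_Collect_neq continuous_intros)

lemma G_V: assumes x: "cos x ~= 0" shows "G x = (cos x)^3 * deriv V x"
proof -
 have "((%x. (cos x)^2 * V x) has_real_derivative - (2 * cos x * sin x) * V x + (cos x)^2 * deriv V x) (at x)"
  by (rule derivative_eq_intros V_deriv[OF x] refl | simp)+
 moreover have "((%x. (cos x)^2 * V x) has_real_derivative deriv W x) (at x)"
  by (rule has_field_derivative_transform_within_open[OF W_deriv open_cos]) (use x W_ext in auto)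
 ultimately have e: "deriv W x = - (2 * cos x * sin x) * V x + (cos x)^2 * deriv V x"
  using DERIV_unique by blast
 have w: "W x = (cos x)^2 * V x" using W_ext x by blast
 show ?thesis unfolding G_def e w by (simp add: power2_eq_square power3_eq_cube algebra_simps)
qed

lemma cos_pos: "- (pi/2) < x ==> x < pi/2 ==> cos x > 0" by (rule cos_gt_zero_pi) auto

lemma G_nonzero: "- (pi/2) < x ==> x < pi/2 ==> G x = 0 \<longleftrightarrow> x = -ts | x = 0 | x = ts"
proof -
 assume x: "- (pi/2) < x" "x < pi/2"
 have "x \<in> {\<theta> \<in> {- (pi / 2)<..<pi / 2}. deriv V \<theta> = 0} \<longleftrightarrow> x \<in> {- ts, 0, ts}" unfolding V_crit ..
 then show "G x = 0 \<longleftrightarrow> x = -ts | x = 0 | x = ts"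
  using x cos_pos[OF x] by (auto simp: G_V)
qed

text \<open>At \<pi>/2 only 2 W > 0 survives, and there is no critical point between ts and \<pi>/2,
  so the sign cannot change.\<close>

lemma G_outer: assumes "ts < x" "x <= pi/2" shows "G x > 0"
proof (rule ccontr)
 assume n: "~ G x > 0"
 have p: "G (pi/2) > 0" unfolding G_def using W_pos by simp
 then have "x < pi/2" using n assms by (cases "x = pi/2") auto
 obtain y where y: "x <= y" "y <= pi/2" "G y = 0"
  using IVT'[of G x 0 "pi/2"] n p assms continuous_on_subset[OF cont_G] by force
 then have "y < pi/2" using p by (cases "y = pi/2") auto
 then show False using G_nonzero[of y] y assms ts_range by auto
qed

text \<open>Nondegeneracy of ts enters here. A nonnegative value would make G positive all the way
  up to ts; but V'' at ts being nonzero makes V' negative either just left of ts or just right of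
  it, the latter against \<open>G_outer\<close>.\<close>

lemma G_inner: assumes "0 < x" "x < ts" shows "G x < 0"
proof (rule ccontr)
 assume n: "~ G x < 0"
 have cs: "cos ts > 0" using cos_pos ts_range by auto
 have c0: "ts \<in> {- ts, 0, ts}" by simp
 then have z: "deriv V ts = 0" using V_crit by blast
 have d: "(deriv V has_real_derivative deriv (deriv V) ts) (at ts)" using dV_deriv cs by auto
 have pos: "G y > 0" if y: "x <= y" "y < ts" for y
 proof (rule ccontr)
  assume m: "~ G y > 0"
  obtain u where "x <= u" "u <= y" "G u = 0"
   using IVT2'[of G y 0 x] n m y continuous_on_subset[OF cont_G] by force
  then show False using G_nonzero[of u] y assms ts_range by auto
 qed
 show False
 proof (cases "deriv (deriv V) ts > 0")
  case True
  from DERIV_pos_inc_left[OF d True] obtain e where e: "e > 0" "!!h. h > 0 ==> h < e ==> deriv V (ts - h) < deriv V ts"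
   by blast
  define h where "h = min (e/2) (ts - x)"
  have h: "h > 0" "h < e" "h <= ts - x" using e assms by (auto simp: h_def)
  have cp: "cos (ts - h) > 0" by (rule cos_pos) (use h assms ts_range in auto)
  have "G (ts - h) < 0" using e(2)[OF h(1,2)] z cp by (simp add: G_V mult_pos_neg)
  then show False using pos[of "ts - h"] h by auto
 next
  case False
  then have "deriv (deriv V) ts < 0" using V_nondeg by auto
  from DERIV_neg_dec_right[OF d this] obtain e where e: "e > 0" "!!h. h > 0 ==> h < e ==> deriv V (ts + h) < deriv V ts"
   by blast
  define h where "h = min (e/2) ((pi/2 - ts) / 2)"
  have h: "h > 0" "h < e" "h < pi/2 - ts" using e ts_range by (auto simp: h_def min_less_iff_disj)
  have cp: "cos (ts + h) > 0" by (rule cos_pos) (use h assms ts_range in auto)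
  have "G (ts + h) < 0" using e(2)[OF h(1,2)] z cp by (simp add: G_V mult_pos_neg)
  then show False using G_outer[of "ts + h"] h by auto
 qed
qed

lemma G_crit [simp]: "G ts = 0" "G (- ts) = 0" "G 0 = 0"
 using G_nonzero[of ts] G_nonzero[of "-ts"] G_nonzero[of 0] ts_range by auto

lemma G_neg_outer: "- (pi/2) <= x ==> x < -ts ==> G x < 0"
 using G_outer[of "-x"] G_sym(1)[of x] by auto

lemma G_neg_inner: "- ts < x ==> x < 0 ==> G x > 0"
 using G_inner[of "-x"] G_sym(1)[of x] by auto

lemma dV_sign: "- (pi/2) < x ==> x < pi/2 ==> sgn (deriv V x) = sgn (G x)"
 using G_V[of x] cos_pos[of x] by (simp add: sgn_mult)

lemma V_even': "- (pi/2) < x ==> x < pi/2 ==> V (- x) = V x"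
 using V_even cos_pos[of x] by auto

lemma V_dec_inner: assumes "0 <= x" "x < y" "y <= ts" shows "V y < V x"
proof (rule DERIV_neg_imp_decreasing_open[OF assms(2)])
 have c: "cos z > 0" if "x <= z" "z <= y" for z by (rule cos_pos) (use that assms ts_range in auto)
 show "EX d. (V has_real_derivative d) (at z) & d < 0" if z: "x < z" "z < y" for z
 proof -
  have "sgn (deriv V z) = sgn (G z)" by (rule dV_sign) (use z assms ts_range in auto)
  moreover have "G z < 0" by (rule G_inner) (use z assms in auto)
  ultimately have "deriv V z < 0" by (metis sgn_less)
  then show ?thesis using V_deriv[of z] c[of z] z by auto
 qed
 show "continuous_on {x..y} V"
  by (rule continuous_at_imp_continuous_on) (use c V_deriv DERIV_isCont in force)
qed

lemma V_inc_outer: assumes "ts <= x" "x < y" "y < pi/2" shows "V x < V y"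
proof (rule DERIV_pos_imp_increasing_open[OF assms(2)])
 have c: "cos z > 0" if "x <= z" "z <= y" for z by (rule cos_pos) (use that assms ts_range in auto)
 show "EX d. (V has_real_derivative d) (at z) & 0 < d" if z: "x < z" "z < y" for z
 proof -
  have "sgn (deriv V z) = sgn (G z)" by (rule dV_sign) (use z assms ts_range in auto)
  moreover have "G z > 0" by (rule G_outer) (use z assms in auto)
  ultimately have "deriv V z > 0" by (metis sgn_greater)
  then show ?thesis using V_deriv[of z] c[of z] z by auto
 qed
 show "continuous_on {x..y} V"
  by (rule continuous_at_imp_continuous_on) (use c V_deriv DERIV_isCont in force)
qed

text \<open>\<open>Vs\<close> is the minimum of V (\<open>V_min\<close>), and - \<open>vs\<close> is
  the v-coordinate of the equilibria in the hypotheses.\<close>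

definition "Vs = V ts"
definition "vs = sqrt (2 * Vs)"

lemma Vs_pos: "Vs > 0" and vs_pos: "vs > 0" and vs_sq: "vs^2 = 2 * Vs"
proof -
 show 1: "Vs > 0" unfolding Vs_def using V_pos cos_pos[of ts] ts_range by auto
 then show "vs > 0" "vs^2 = 2 * Vs" unfolding vs_def by auto
qed

lemma V_min: assumes "- (pi/2) < x" "x < pi/2" "x ~= ts" "x ~= - ts" shows "Vs < V x"
proof -
 have a: "Vs < V y" if "0 <= y" "y < pi/2" "y ~= ts" for y
  unfolding Vs_def using V_dec_inner[of y ts] V_inc_outer[of ts y] that by (cases "y < ts") auto
 show ?thesis using a[of x] a[of "-x"] assms V_even'[of x] by (cases "0 <= x") auto
qed

lemma V_at_crit: "V (- ts) = Vs" using V_even'[of ts] ts_range by (simp add: Vs_def)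

lemma V_min': "- (pi/2) < x ==> x < pi/2 ==> Vs <= V x"
 using V_min[of x] V_at_crit by (cases "x = ts"; cases "x = -ts") (auto simp: Vs_def)

lemma W_V: "- (pi/2) < x ==> x < pi/2 ==> W x = (cos x)^2 * V x"
 using W_ext cos_pos[of x] by auto

end

subsection \<open>The flow on the energy manifold\<close>

lemma vderiv_continuous_on:
 assumes "!!t. a <= t ==> t <= b ==> (X has_vector_derivative X' t) (at t)"
 shows "continuous_on {a..b::real} X"
proof (rule continuous_at_imp_continuous_on, rule ballI)
 fix t assume "t \<in> {a..b}"
 then have "(X has_vector_derivative X' t) (at t)" using assms by simp
 then show "isCont X t" by (rule has_vector_derivative_continuous)
qed

context shape
begin

abbreviation Fld :: "state => state" where "Fld \<equiv> reg_field c W"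
abbreviation P1 :: "state set" where "P1 \<equiv> energy_manifold c W"

definition En :: "state => real" where
 "En x = (1/2) * (vv x)^2 * (cos (th x))^2 + (1/2) * (ww x)^2 * c (th x) - W (th x) + rr x * (cos (th x))^2"

lemma P1_iff: "x \<in> P1 \<longleftrightarrow> 0 <= rr x & En x = 0"
 unfolding energy_manifold_def En_def by auto

definition dw :: "state => real" where
 "dw x = deriv W (th x) - (1/2) * vv x * ww x * (cos (th x))^2 + cos (th x) * sin (th x) * (2 * rr x + (vv x)^2)
     - (1/2) * (ww x)^2 * deriv c (th x)"

lemma Fld_eq: "Fld x = (rr x * vv x * (cos (th x))^2,
  (1/2) * (vv x)^2 * (cos (th x))^2 + (ww x)^2 * c (th x) - W (th x), ww x * c (th x), dw x)"
 by (simp add: reg_field_def Let_def dw_def)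

definition wM :: real where "wM = sqrt (8 * WM)"

lemma P1_bounds:
 assumes "x \<in> P1"
 shows "0 <= rr x" "0 <= rr x * (cos (th x))^2" "rr x * (cos (th x))^2 <= WM" "0 <= (1/2) * (ww x)^2 * c (th x)"
  "(1/2) * (ww x)^2 * c (th x) <= WM" "\<bar>ww x\<bar> <= wM" "(vv x)^2 * (cos (th x))^2 <= 2 * WM"
proof -
 have e: "(1/2) * (vv x)^2 * (cos (th x))^2 + (1/2) * (ww x)^2 * c (th x) + rr x * (cos (th x))^2 = W (th x)"
  and r: "0 <= rr x"
  using assms unfolding P1_iff En_def by auto
 have a: "0 <= (1/2) * (vv x)^2 * (cos (th x))^2" "0 <= (1/2) * (ww x)^2 * c (th x)" "0 <= rr x * (cos (th x))^2"
  using r c_pos[of "th x"] by auto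
 show "0 <= rr x" "0 <= rr x * (cos (th x))^2" "0 <= (1/2) * (ww x)^2 * c (th x)" using r a by auto
 show "rr x * (cos (th x))^2 <= WM" "(1/2) * (ww x)^2 * c (th x) <= WM" "(vv x)^2 * (cos (th x))^2 <= 2 * WM"
  using e a WM(2)[of "th x"] by linarith+
 have "(1/4) * (ww x)^2 <= c (th x) * (ww x)^2" using c_bounds(1) by (intro mult_right_mono) auto
 moreover have "c (th x) * (ww x)^2 = 2 * ((1/2) * (ww x)^2 * c (th x))" by simp
 ultimately have "(ww x)^2 <= 8 * WM" using e a WM(2)[of "th x"] by linarith
 then show "\<bar>ww x\<bar> <= wM" unfolding wM_def by (simp add: real_le_rsqrt)
qed

lemma wM_nonneg: "0 <= wM" unfolding wM_def using WM(1) by simp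

text \<open>The energy relation replaces cos^2 (2 r + v^2). Afterwards r has disappeared and every
  term except G carries a factor w.\<close>

lemma dw_cos:
 assumes "x \<in> P1"
 shows "cos (th x) * dw x = G (th x) - (ww x)^2 * c (th x) * sin (th x) - (1/2) * vv x * ww x * (cos (th x))^3
   - (1/2) * (ww x)^2 * deriv c (th x) * cos (th x)"
proof -
 have e: "(cos (th x))^2 * (2 * rr x + (vv x)^2) = 2 * W (th x) - (ww x)^2 * c (th x)"
  using assms unfolding P1_iff En_def by (simp add: algebra_simps)
 have "cos (th x) * dw x = deriv W (th x) * cos (th x) - (1/2) * vv x * ww x * (cos (th x))^3
   + sin (th x) * ((cos (th x))^2 * (2 * rr x + (vv x)^2)) - (1/2) * (ww x)^2 * deriv c (th x) * cos (th x)"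
  unfolding dw_def by (simp add: power2_eq_square power3_eq_cube algebra_simps)
 then show ?thesis unfolding e G_def by (simp add: algebra_simps)
qed

lemma Fld_lip:
 assumes "bounded S"
 shows "EX B L. 0 <= L & (\<forall>x\<in>S. norm (Fld x) <= B) & (\<forall>x\<in>S. \<forall>y\<in>S. norm (Fld x - Fld y) <= L * norm (x - y))"
proof -
 have lin: "bdd_lip S rr" "bdd_lip S vv" "bdd_lip S th" "bdd_lip S ww"
  by (rule bdd_lip_linear[OF assms bounded_linear_comp(1)] bdd_lip_linear[OF assms bounded_linear_comp(2)]
   bdd_lip_linear[OF assms bounded_linear_comp(3)] bdd_lip_linear[OF assms bounded_linear_comp(4)])+
 have "C1_fun cos" unfolding C1_fun_def
  by (intro exI[of _ "%x. - sin x"] conjI allI) (auto intro!: derivative_eq_intros continuous_intros)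
 moreover have "C1_fun sin" unfolding C1_fun_def
  by (intro exI[of _ cos] conjI allI) (auto intro!: derivative_eq_intros continuous_intros)
 ultimately have th: "bdd_lip S (%x. cos (th x))" "bdd_lip S (%x. sin (th x))"
   "bdd_lip S (%x. W (th x))" "bdd_lip S (%x. deriv W (th x))" "bdd_lip S (%x. c (th x))" "bdd_lip S (%x. deriv c (th x))"
  using C1_W C1_dW C1_c C1_dc lin(3) by (simp_all add: bdd_lip_C1)
 have bl: "bdd_lip S (%x. rr (Fld x))" "bdd_lip S (%x. vv (Fld x))" "bdd_lip S (%x. th (Fld x))" "bdd_lip S (%x. ww (Fld x))"
  unfolding Fld_eq comp_simps dw_def
  by (intro bdd_lip_add bdd_lip_mult bdd_lip_diff bdd_lip_power bdd_lip_const lin th)+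
 obtain B1 L1 where h1: "0 <= L1" "\<forall>x\<in>S. \<bar>rr (Fld x)\<bar> <= B1"
  "\<forall>x\<in>S. \<forall>y\<in>S. \<bar>rr (Fld x) - rr (Fld y)\<bar> <= L1 * norm (x - y)"
  using bl(1) unfolding bdd_lip_def by blast
 obtain B2 L2 where h2: "0 <= L2" "\<forall>x\<in>S. \<bar>vv (Fld x)\<bar> <= B2"
  "\<forall>x\<in>S. \<forall>y\<in>S. \<bar>vv (Fld x) - vv (Fld y)\<bar> <= L2 * norm (x - y)"
  using bl(2) unfolding bdd_lip_def by blast
 obtain B3 L3 where h3: "0 <= L3" "\<forall>x\<in>S. \<bar>th (Fld x)\<bar> <= B3"
  "\<forall>x\<in>S. \<forall>y\<in>S. \<bar>th (Fld x) - th (Fld y)\<bar> <= L3 * norm (x - y)"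
  using bl(3) unfolding bdd_lip_def by blast
 obtain B4 L4 where h4: "0 <= L4" "\<forall>x\<in>S. \<bar>ww (Fld x)\<bar> <= B4"
  "\<forall>x\<in>S. \<forall>y\<in>S. \<bar>ww (Fld x) - ww (Fld y)\<bar> <= L4 * norm (x - y)"
  using bl(4) unfolding bdd_lip_def by blast
 show ?thesis
 proof (intro exI conjI ballI)
  show "0 <= L1 + L2 + L3 + L4" using h1 h2 h3 h4 by simp
  show "norm (Fld x) <= B1 + B2 + B3 + B4" if "x \<in> S" for x
   using norm_state_le[of "Fld x"] h1(2)[rule_format, OF that] h2(2)[rule_format, OF that]
    h3(2)[rule_format, OF that] h4(2)[rule_format, OF that] by linarith
  show "norm (Fld x - Fld y) <= (L1 + L2 + L3 + L4) * norm (x - y)" if "x \<in> S" "y \<in> S" for x y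
   using norm_state_le[of "Fld x - Fld y"] h1(3)[rule_format, OF that] h2(3)[rule_format, OF that]
    h3(3)[rule_format, OF that] h4(3)[rule_format, OF that]
   unfolding comp_diff distrib_right by linarith
 qed
qed

text \<open>The summands bound r, v, \<theta> and w separately: v and \<theta> grow at most
  linearly, w is bounded by energy, and r grows at most like the exponential of the bound on
  v.\<close>

definition bnd :: "real => real => real" where
 "bnd R T = R * exp ((R + WM * T) * T) + (R + WM * T) + (R + 2 * wM * T) + wM"

lemma bnd_mono: assumes "0 <= R" "R <= R'" "0 <= T" "T <= T'" shows "bnd R T <= bnd R' T'"
proof -
 have "(R + WM * T) * T <= (R' + WM * T') * T'"
  using assms WM(1) by (intro mult_mono add_mono mult_left_mono) auto
 then have "R * exp ((R + WM * T) * T) <= R' * exp ((R' + WM * T') * T')"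
  using assms by (intro mult_mono) auto
 moreover have "WM * T <= WM * T'" "2 * wM * T <= 2 * wM * T'"
  using assms WM(1) wM_nonneg by (intro mult_left_mono; simp)+
 ultimately show ?thesis unfolding bnd_def using assms by linarith
qed

text \<open>\<open>e = 1\<close> is forward and \<open>e = - 1\<close> is backward time; \<open>En\<close> solves the linear equation
 \<open>En' = e v cos^2(\<theta>) En\<close> along solutions.\<close>
lemma apriori:
 assumes T: "0 <= T" and e: "e = 1 | e = (- 1::real)" and X0: "X 0 \<in> P1"
  and d: "!!t. 0 <= t ==> t <= T ==> (X has_vector_derivative e *\<^sub>R Fld (X t)) (at t)"
 shows "X T \<in> P1" and "norm (X T) <= bnd (norm (X 0)) T"
proof -
 have D: "((%t. rr (X t)) has_real_derivative e * (rr (X t) * vv (X t) * (cos (th (X t)))^2)) (at t)"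
   "((%t. vv (X t)) has_real_derivative e * ((1/2) * (vv (X t))^2 * (cos (th (X t)))^2 + (ww (X t))^2 * c (th (X t)) - W (th (X t)))) (at t)"
   "((%t. th (X t)) has_real_derivative e * (ww (X t) * c (th (X t)))) (at t)"
   "((%t. ww (X t)) has_real_derivative e * dw (X t)) (at t)"
  if "0 <= t" "t <= T" for t
  using d[OF that] unfolding Fld_eq scaleR_Pair state_vderiv_iff by auto
 have cX: "continuous_on {0..T} X"
  by (rule vderiv_continuous_on[OF d])
 have "bounded ((%t. vv (X t)) ` {0..T})"
  by (intro compact_imp_bounded compact_continuous_image continuous_intros cX) auto
 then have "EX Nv. \<forall>t\<in>{0..T}. \<bar>vv (X t)\<bar> <= Nv" unfolding bounded_iff by auto
 then obtain Nv where Nv0: "\<forall>t\<in>{0..T}. \<bar>vv (X t)\<bar> <= Nv" by blast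
 have Nv: "\<bar>vv (X t)\<bar> <= Nv" if "0 <= t" "t <= T" for t using Nv0 that by simp
 have cos2: "0 <= (cos x)^2" "(cos x)^2 <= 1" for x :: real by (auto simp: abs_square_le_1)
 have vc: "\<bar>e * (vv (X t) * (cos (th (X t)))^2 * y)\<bar> <= N * \<bar>y\<bar>" if "\<bar>vv (X t)\<bar> <= N" for t y N
 proof -
  have "\<bar>e * (vv (X t) * (cos (th (X t)))^2 * y)\<bar> = \<bar>vv (X t)\<bar> * (cos (th (X t)))^2 * \<bar>y\<bar>"
   using e by (auto simp: abs_mult)
  also have "\<dots> <= N * 1 * \<bar>y\<bar>" using cos2 that by (intro mult_mono) auto
  finally show ?thesis by simp
 qed
 have En: "En (X t) = 0" if t: "0 <= t" "t <= T" for t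
 proof -
  have "((%t. En (X t)) has_real_derivative e * (vv (X s) * (cos (th (X s)))^2 * En (X s))) (at s)" if s: "0 <= s" "s <= T" for s
   unfolding En_def
   by (rule derivative_eq_intros DERIV_chain2[OF W_deriv] DERIV_chain2[OF c_deriv] D[OF s] refl)+
     (simp add: dw_def power2_eq_square algebra_simps)
  then have "norm (En (X t)) <= exp (Nv * (t - 0)) * norm (En (X 0))"
   using t vc[OF Nv]
   by (intro norm_growth(1)[of 0 t "%t. En (X t)" "%s. e * (vv (X s) * (cos (th (X s)))^2 * En (X s))"])
     (auto simp: has_real_derivative_iff_has_vector_derivative)
  then show ?thesis using X0 P1_iff by auto
 qed
 have Dr: "((%t. rr (X t)) has_vector_derivative e * (vv (X t) * (cos (th (X t)))^2 * rr (X t))) (at t)" if "0 <= t" "t <= T" for t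
  using D(1)[OF that] by (simp add: has_real_derivative_iff_has_vector_derivative mult_ac)
 \<comment> \<open>r' is a multiple of r, so r stays 0 from any zero on and cannot become
   negative.\<close>
 have rr: "0 <= rr (X t)" if t: "0 <= t" "t <= T" for t
 proof (rule ccontr)
  assume n: "~ 0 <= rr (X t)"
  have r0: "0 <= rr (X 0)" using X0 P1_iff by auto
  have "continuous_on {0..t} (%t. rr (X t))"
   by (intro continuous_intros continuous_on_subset[OF cX]) (use t in auto)
  then obtain s where s: "0 <= s" "s <= t" "rr (X s) = 0"
   using IVT2'[of "%t. rr (X t)" t 0 0] n r0 t by auto
  have "norm (rr (X t)) <= exp (Nv * (t - s)) * norm (rr (X s))"
   using t s Dr vc[OF Nv]
   by (intro norm_growth(1)[of s t "%t. rr (X t)" "%s. e * (vv (X s) * (cos (th (X s)))^2 * rr (X s))"]) auto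
  then show False using n s by auto
 qed
 have inP: "X t \<in> P1" if "0 <= t" "t <= T" for t using En[OF that] rr[OF that] P1_iff by auto
 show "X T \<in> P1" using inP T by auto
 \<comment> \<open>On \<open>P1\<close> the derivative of v is the kinetic term minus r cos^2, two
   numbers between 0 and \<open>WM\<close>.\<close>
 have v: "\<bar>vv (X t) - vv (X 0)\<bar> <= WM * T" if t: "0 <= t" "t <= T" for t
 proof -
  have "norm (vv (X t) - vv (X 0)) <= WM * norm (t - 0)"
  proof (rule field_differentiable_bound[of "{0..t}"])
   fix z assume z: "z \<in> {0..t}"
   then have z': "0 <= z" "z <= T" using t by auto
   show "((%t. vv (X t)) has_real_derivative e * ((1/2) * (vv (X z))^2 * (cos (th (X z)))^2 + (ww (X z))^2 * c (th (X z)) - W (th (X z)))) (at z within {0..t})"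
    by (rule has_field_derivative_at_within[OF D(2)[OF z']])
   have "(1/2) * (vv (X z))^2 * (cos (th (X z)))^2 + (ww (X z))^2 * c (th (X z)) - W (th (X z))
     = (1/2) * (ww (X z))^2 * c (th (X z)) - rr (X z) * (cos (th (X z)))^2"
    using En[OF z'] unfolding En_def by (simp add: algebra_simps)
   moreover have "\<bar>(1/2) * (ww (X z))^2 * c (th (X z)) - rr (X z) * (cos (th (X z)))^2\<bar> <= WM"
    using P1_bounds(2-5)[OF inP[OF z']] by linarith
   ultimately show "norm (e * ((1/2) * (vv (X z))^2 * (cos (th (X z)))^2 + (ww (X z))^2 * c (th (X z)) - W (th (X z)))) <= WM"
    using e by auto
  qed (use t in auto)
  also have "\<dots> <= WM * T" using t WM(1) by (intro mult_left_mono) auto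
  finally show ?thesis by simp
 qed
 have "norm (th (X T) - th (X 0)) <= (2 * wM) * norm (T - 0)"
 proof (rule field_differentiable_bound[of "{0..T}"])
  fix z assume z: "z \<in> {0..T}"
  then show "((%t. th (X t)) has_real_derivative e * (ww (X z) * c (th (X z)))) (at z within {0..T})"
   using has_field_derivative_at_within[OF D(3)[of z]] by auto
  have "\<bar>ww (X z)\<bar> * \<bar>c (th (X z))\<bar> <= wM * 2"
   using P1_bounds(6)[OF inP[of z]] z c_bounds[of "th (X z)"] wM_nonneg by (intro mult_mono) auto
  then show "norm (e * (ww (X z) * c (th (X z)))) <= 2 * wM" using e by (auto simp: abs_mult)
 qed (use T in auto)
 then have th: "\<bar>th (X T) - th (X 0)\<bar> <= 2 * wM * T" using T by simp
 have r: "\<bar>rr (X T)\<bar> <= exp ((norm (X 0) + WM * T) * T) * norm (X 0)"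
 proof -
  have "norm (rr (X T)) <= exp ((norm (X 0) + WM * T) * (T - 0)) * norm (rr (X 0))"
  proof (rule norm_growth(1)[of 0 T "%t. rr (X t)" "%s. e * (vv (X s) * (cos (th (X s)))^2 * rr (X s))"])
   fix t assume t: "0 <= t" "t <= T"
   have "\<bar>vv (X t)\<bar> <= norm (X 0) + WM * T" using v[OF t] comp_le_norm(2)[of "X 0"] by linarith
   from vc[OF this, of "rr (X t)"]
   show "norm (e * (vv (X t) * (cos (th (X t)))^2 * rr (X t))) <= (norm (X 0) + WM * T) * norm (rr (X t))" by simp
  qed (use T Dr in auto)
  also have "\<dots> <= exp ((norm (X 0) + WM * T) * (T - 0)) * norm (X 0)"
   using comp_le_norm(1)[of "X 0"] by (intro mult_left_mono) auto
  finally show ?thesis by simp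
 qed
 show "norm (X T) <= bnd (norm (X 0)) T"
  unfolding bnd_def using norm_state_le[of "X T"] r th v[OF T order_refl] comp_le_norm(2,3)[of "X 0"]
   P1_bounds(6)[OF inP[OF T order_refl]] mult.commute[of "exp ((norm (X 0) + WM * T) * T)" "norm (X 0)"]
  by linarith
qed

text \<open>The field composed with the projection onto a large ball is bounded and globally
  Lipschitz. The radius exceeds the a priori bound by 1, so a first time on the sphere contradicts
  that bound and the truncation is never felt.\<close>

lemma solution_exists:
 assumes p: "p \<in> P1" and T: "0 <= T"
 shows "EX X. X 0 = p & (ALL t. \<bar>t\<bar> <= T --> (X has_vector_derivative Fld (X t)) (at t))"
proof -
 define N where "N = bnd (norm p) T + 1"
 have "0 <= norm p * exp ((norm p + WM * T) * T)" "0 <= WM * T" "0 <= 2 * wM * T"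
  using T WM(1) wM_nonneg by simp_all
 then have N: "N > norm p"
  unfolding N_def bnd_def using wM_nonneg norm_ge_zero[of p] by linarith
 have N0: "cball (0::state) N ~= {}" using N norm_ge_zero[of p] by (auto simp del: norm_ge_zero)
 obtain B L where BL: "L \<ge> 0" "!!x. x \<in> cball 0 N ==> norm (Fld x) <= B"
  "!!x y. x \<in> cball 0 N ==> y \<in> cball 0 N ==> norm (Fld x - Fld y) <= L * norm (x - y)"
  using Fld_lip[OF bounded_cball[of 0 N]] by meson
 define k where "k = closest_point (cball (0::state) N)"
 have k: "k x \<in> cball 0 N" for x unfolding k_def by (rule closest_point_in_set[OF closed_cball N0])
 have "EX X. X 0 = p & (\<forall>t::real. (X has_vector_derivative Fld (k (X t))) (at t))"
 proof (rule picard_global)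
  show "norm (Fld (k x) - Fld (k y)) <= L * norm (x - y)" for x y
  proof -
   have "norm (Fld (k x) - Fld (k y)) <= L * norm (k x - k y)" by (rule BL(3)[OF k k])
   also have "\<dots> <= L * norm (x - y)"
    using closest_point_lipschitz[OF convex_cball closed_cball N0, of x y] BL(1)
    unfolding k_def dist_norm by (intro mult_left_mono) auto
   finally show ?thesis .
  qed
  show "norm (Fld (k x)) <= B" for x by (rule BL(2)[OF k])
 qed (rule BL(1))
 then obtain X where X: "X 0 = p" "!!t. (X has_vector_derivative Fld (k (X t))) (at t)" by blast
 have in_ball: "norm (X (e * t)) < N" if e: "e = 1 | e = -1" and t: "0 <= t" "t <= T" for e t
 proof (rule ccontr)
  assume n: "~ norm (X (e * t)) < N"
  define Y where "Y s = X (e * s)" for s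
  have Y: "(Y has_vector_derivative e *\<^sub>R Fld (k (Y s))) (at s)" for s
  proof -
   have "((%s. e * s) has_vector_derivative e) (at s)"
    unfolding has_real_derivative_iff_has_vector_derivative[symmetric]
    by (rule derivative_eq_intros refl | simp)+
   from vector_diff_chain_at[OF this X(2)[of "e * s"]] show ?thesis by (simp add: Y_def[abs_def] o_def)
  qed
  have cY: "continuous_on A Y" for A
   using has_vector_derivative_continuous[OF Y] by (simp add: continuous_at_imp_continuous_on)
  define A where "A = {s \<in> {0..T}. N <= norm (Y s)}"
  have "A = {0..T} \<inter> {s. N <= norm (Y s)}" by (auto simp: A_def)
  moreover have "closed ({0..T} \<inter> {s. N <= norm (Y s)})"
   by (intro closed_Int closed_atLeastAtMost closed_Collect_le continuous_intros cY)
  ultimately have "closed A" by simp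
  moreover have "t \<in> A" using n t by (simp add: A_def Y_def)
  moreover have bb: "bdd_below A" by (rule bdd_belowI[of _ 0]) (simp add: A_def)
  ultimately have IA: "Inf A \<in> A" by (intro closed_contains_Inf) auto
  define t0 where "t0 = Inf A"
  have t0: "0 <= t0" "t0 <= T" "N <= norm (Y t0)" using IA by (auto simp: A_def t0_def)
  have lt: "norm (Y s) < N" if "0 <= s" "s < t0" for s
   using cInf_lower[OF _ bb, of s] that t0 by (force simp: A_def t0_def)
  have "t0 ~= 0" using t0(3) N X(1) by (auto simp: Y_def)
  have le: "norm (Y s) <= N" if "0 <= s" "s <= t0" for s
  proof (cases "s = t0")
   case True
   have "isCont Y t0" by (rule has_vector_derivative_continuous[OF Y])
   then have "((%s. norm (Y s)) \<longlongrightarrow> norm (Y t0)) (at t0)" unfolding isCont_def by (rule tendsto_norm)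
   then have "((%s. norm (Y s)) \<longlongrightarrow> norm (Y t0)) (at_left t0)" by (rule tendsto_within_subset) simp
   moreover have "eventually (%s. norm (Y s) <= N) (at_left t0)"
    by (rule eventually_mono[OF eventually_at_left_real[of 0 t0]])
      (use lt \<open>t0 ~= 0\<close> t0 in \<open>auto simp: less_imp_le\<close>)
   ultimately have "norm (Y t0) <= N" by (rule tendsto_upperbound) auto
   then show ?thesis using True by simp
  qed (use lt[of s] that in auto)
  have "norm (Y t0) <= bnd (norm (Y 0)) t0"
  proof (rule apriori(2)[OF t0(1) e])
   show "Y 0 \<in> P1" using p X(1) by (simp add: Y_def)
   show "(Y has_vector_derivative e *\<^sub>R Fld (Y s)) (at s)" if "0 <= s" "s <= t0" for s
    using Y[of s] le[OF that] by (simp add: k_def closest_point_self)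
  qed
  also have "\<dots> <= bnd (norm p) T" using t0 X(1) by (intro bnd_mono) (auto simp: Y_def)
  finally show False using t0(3) by (simp add: N_def)
 qed
 have "(X has_vector_derivative Fld (X t)) (at t)" if "\<bar>t\<bar> <= T" for t
 proof -
  have "norm (X t) < N" using in_ball[of 1 t] in_ball[of "-1" "-t"] that by (cases "t \<ge> 0") auto
  then show ?thesis using X(2)[of t] by (simp add: k_def closest_point_self)
 qed
 then show ?thesis using X(1) by blast
qed

lemma solution_unique:
 assumes X: "!!t. a <= t ==> t <= b ==> (X has_vector_derivative Fld (X t)) (at t)"
  and Y: "!!t. a <= t ==> t <= b ==> (Y has_vector_derivative Fld (Y t)) (at t)"
  and s: "a <= s" "s <= b" "X s = Y s" and t: "a <= t" "t <= b"
 shows "X t = Y t"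
proof -
 have cX: "continuous_on {a..b} X"
  by (rule vderiv_continuous_on[OF X])
 have cY: "continuous_on {a..b} Y"
  by (rule vderiv_continuous_on[OF Y])
 have "bounded (X ` {a..b} \<union> Y ` {a..b})"
  unfolding bounded_Un by (intro conjI compact_imp_bounded compact_continuous_image cX cY) auto
 then obtain B L where BL: "L \<ge> 0"
  "!!x y. x \<in> X ` {a..b} \<union> Y ` {a..b} ==> y \<in> X ` {a..b} \<union> Y ` {a..b} ==> norm (Fld x - Fld y) <= L * norm (x - y)"
  using Fld_lip by meson
 have d: "((%t. X t - Y t) has_vector_derivative Fld (X t) - Fld (Y t)) (at t)"
  and n: "norm (Fld (X t) - Fld (Y t)) <= L * norm (X t - Y t)" if "a <= t" "t <= b" for t
  using X[OF that] Y[OF that] BL(2) that by (auto intro!: derivative_intros)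
 show ?thesis
 proof (cases "s <= t")
  case True
  have "norm (X t - Y t) <= exp (L * (t - s)) * norm (X s - Y s)"
   by (rule norm_growth(1)[OF True d n]) (use s t in auto)
  then show ?thesis using s by simp
 next
  case False
  then have "t <= s" by simp
  have "norm (X t - Y t) <= exp (L * (s - t)) * norm (X s - Y s)"
   by (rule norm_growth(2)[OF \<open>t <= s\<close> d n]) (use s t in auto)
  then show ?thesis using s by simp
 qed
qed

end

section \<open>The global flow\<close>

context shape
begin

definition sol :: "real => state => (real => state) => bool" where
 "sol T p X \<longleftrightarrow> X 0 = p & (ALL t. \<bar>t\<bar> <= T --> (X has_vector_derivative Fld (X t)) (at t))"

text \<open>The choice depends on t, but uniqueness makes all chosen solutions agree
  (\<open>flow_eq_sol\<close>).\<close>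

definition flow :: "state => real => state" where
 "flow p t = (SOME X. sol (\<bar>t\<bar> + 1) p X) t"

lemma sol_agree: "sol T p X ==> sol T' p Y ==> \<bar>t\<bar> <= T ==> \<bar>t\<bar> <= T' ==> X t = Y t"
 by (rule solution_unique[of "-\<bar>t\<bar>" "\<bar>t\<bar>" X Y 0]) (auto simp: sol_def)

lemma flow_eq_sol:
 assumes p: "p \<in> P1" and X: "sol T p X" and t: "\<bar>t\<bar> <= T"
 shows "flow p t = X t"
proof -
 have "EX Z. sol (\<bar>t\<bar> + 1) p Z" using solution_exists[OF p, of "\<bar>t\<bar> + 1"] unfolding sol_def by simp
 then have "sol (\<bar>t\<bar> + 1) p (SOME Z. sol (\<bar>t\<bar> + 1) p Z)" by (rule someI_ex)
 from sol_agree[OF this X _ t] show ?thesis unfolding flow_def by simp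
qed

lemma flow_sol: assumes p: "p \<in> P1" shows "(flow p has_vector_derivative Fld (flow p t)) (at t)"
proof -
 obtain X where X: "sol (\<bar>t\<bar> + 1) p X" using solution_exists[OF p, of "\<bar>t\<bar> + 1"] unfolding sol_def by auto
 have "(X has_vector_derivative Fld (X t)) (at t)" using X unfolding sol_def by simp
 moreover have "X s = flow p s" if "s \<in> {- (\<bar>t\<bar> + 1)<..<\<bar>t\<bar> + 1}" for s
  using flow_eq_sol[OF p X, of s] that by auto
 moreover have "t \<in> {- (\<bar>t\<bar> + 1)<..<\<bar>t\<bar> + 1}" by auto
 ultimately show ?thesis
  using has_vector_derivative_transform_within_open[of X "Fld (X t)" t "{- (\<bar>t\<bar> + 1)<..<\<bar>t\<bar> + 1}" "flow p"] by simp
qed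

lemma flow_0 [simp]: assumes p: "p \<in> P1" shows "flow p 0 = p"
proof -
 obtain X where X: "sol 1 p X" using solution_exists[OF p, of 1] unfolding sol_def by auto
 show ?thesis using flow_eq_sol[OF p X, of 0] X unfolding sol_def by simp
qed

lemma assumes p: "p \<in> P1" shows flow_in [simp]: "flow p t \<in> P1"
 and flow_norm: "norm (flow p t) <= bnd (norm p) \<bar>t\<bar>"
proof -
 define e :: real where "e = (if 0 <= t then 1 else - 1)"
 define Y where "Y s = flow p (e * s)" for s
 have e: "e = 1 | e = -1" "e * \<bar>t\<bar> = t" by (auto simp: e_def)
 have d: "(Y has_vector_derivative e *\<^sub>R Fld (Y s)) (at s)" for s
 proof -
  have "((%s. e * s) has_vector_derivative e) (at s)"
   unfolding has_real_derivative_iff_has_vector_derivative[symmetric]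
   by (rule derivative_eq_intros refl | simp)+
  from vector_diff_chain_at[OF this flow_sol[OF p]] show ?thesis by (simp add: Y_def[abs_def] o_def)
 qed
 have "Y \<bar>t\<bar> \<in> P1" "norm (Y \<bar>t\<bar>) <= bnd (norm (Y 0)) \<bar>t\<bar>"
  by (rule apriori[of "\<bar>t\<bar>" e Y]; use e d p in \<open>simp add: Y_def\<close>)+
 then show "flow p t \<in> P1" "norm (flow p t) <= bnd (norm p) \<bar>t\<bar>" using e p by (auto simp: Y_def)
qed

lemma flow_unique:
 assumes X: "!!t. a <= t ==> t <= b ==> (X has_vector_derivative Fld (X t)) (at t)"
  and s: "a <= s" "s <= b" "X s \<in> P1" and t: "a <= t" "t <= b"
 shows "X t = flow (X s) (t - s)"
proof (rule solution_unique[OF X _ s(1,2) _ t])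
 fix t assume "a <= t" "t <= b"
 have "((%t. t - s) has_vector_derivative 1) (at t)"
  unfolding has_real_derivative_iff_has_vector_derivative[symmetric]
  by (rule derivative_eq_intros refl | simp)+
 from vector_diff_chain_at[OF this flow_sol[OF s(3)]]
 show "((%t. flow (X s) (t - s)) has_vector_derivative Fld (flow (X s) (t - s))) (at t)" by (simp add: o_def)
qed (use s in auto)

lemma flow_flow: assumes p: "p \<in> P1" shows "flow (flow p s) t = flow p (s + t)"
proof -
 have "flow p (s + t) = flow (flow p s) (s + t - s)"
  by (rule flow_unique[of "min s (s + t)" "max s (s + t)"]) (use p flow_sol in auto)
 then show ?thesis by simp
qed

lemma flow_inverse: "p \<in> P1 ==> flow p s = q ==> flow q (- s) = p"
 using flow_flow[of p s "-s"] by auto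

abbreviation "fr p t \<equiv> rr (flow p t)"
abbreviation "fv p t \<equiv> vv (flow p t)"
abbreviation "ft p t \<equiv> th (flow p t)"
abbreviation "fw p t \<equiv> ww (flow p t)"

lemma vv_Fld: "x \<in> P1 ==> vv (Fld x) = (1/2) * (ww x)^2 * c (th x) - rr x * (cos (th x))^2"
 unfolding P1_iff En_def Fld_eq by (simp add: algebra_simps)

lemma fr_deriv: "p \<in> P1 ==> ((%t. fr p t) has_real_derivative fr p t * fv p t * (cos (ft p t))^2) (at t)"
 and fv_deriv: "p \<in> P1 ==> ((%t. fv p t) has_real_derivative (1/2) * (fw p t)^2 * c (ft p t) - fr p t * (cos (ft p t))^2) (at t)"
 and ft_deriv: "p \<in> P1 ==> ((%t. ft p t) has_real_derivative fw p t * c (ft p t)) (at t)"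
 and fw_deriv: "p \<in> P1 ==> ((%t. fw p t) has_real_derivative dw (flow p t)) (at t)"
proof -
 assume p: "p \<in> P1"
 note d = flow_sol[OF p, of t, unfolded Fld_eq[of "flow p t"] state_vderiv_iff]
 show "((%t. fr p t) has_real_derivative fr p t * fv p t * (cos (ft p t))^2) (at t)"
  "((%t. ft p t) has_real_derivative fw p t * c (ft p t)) (at t)"
  "((%t. fw p t) has_real_derivative dw (flow p t)) (at t)"
  using d by auto
 show "((%t. fv p t) has_real_derivative (1/2) * (fw p t)^2 * c (ft p t) - fr p t * (cos (ft p t))^2) (at t)"
  using d vv_Fld[OF flow_in[OF p, of t]] unfolding Fld_eq comp_simps by auto
qed

lemma cont_flow: "p \<in> P1 ==> continuous_on A (flow p)"
 using has_vector_derivative_continuous[OF flow_sol] by (simp add: continuous_at_imp_continuous_on)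

lemma cont_f: assumes "p \<in> P1"
 shows "continuous_on A (%t. fr p t)" "continuous_on A (%t. fv p t)" "continuous_on A (%t. ft p t)" "continuous_on A (%t. fw p t)"
 by (intro continuous_intros cont_flow assms)+

lemma energy: "p \<in> P1 ==> (fw p t)^2 * c (ft p t) = 2 * W (ft p t) - (fv p t)^2 * (cos (ft p t))^2 - 2 * fr p t * (cos (ft p t))^2"
 using flow_in[of p t] unfolding P1_iff En_def by (simp add: algebra_simps)

subsection \<open>Symmetries\<close>

lemma sym_P1 [simp]: "x \<in> P1 ==> Rv x \<in> P1" "x \<in> P1 ==> Mi x \<in> P1" "x \<in> P1 ==> Sh pi x \<in> P1" "x \<in> P1 ==> Sh (- pi) x \<in> P1"
proof -
 have 1: "W (x - pi) = W x" "c (x - pi) = c x" for x using W_sym(2)[of "x - pi"] c_sym(2)[of "x - pi"] by auto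
 show "x \<in> P1 ==> Rv x \<in> P1" "x \<in> P1 ==> Mi x \<in> P1" "x \<in> P1 ==> Sh pi x \<in> P1" "x \<in> P1 ==> Sh (- pi) x \<in> P1"
  unfolding P1_iff En_def by (auto simp: c_sym W_sym 1)
qed

text \<open>One argument for all symmetries: S is affine with linear part S0, and e = - 1 allows a
  reversal of time.\<close>

lemma flow_sym_aux:
 assumes p: "p \<in> P1" and S: "bounded_linear S0" "!!x. S x = S0 x + k" "S p \<in> P1"
  and F: "!!x. Fld (S x) = e *\<^sub>R S0 (Fld x)"
 shows "flow (S p) t = S (flow p (e * t))"
proof -
 define Y where "Y s = S (flow p (e * s))" for s
 have "(Y has_vector_derivative Fld (Y s)) (at s)" for s
 proof -
  have "((%s. e * s) has_vector_derivative e) (at s)"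
   unfolding has_real_derivative_iff_has_vector_derivative[symmetric]
   by (rule derivative_eq_intros refl | simp)+
  from vector_diff_chain_at[OF this flow_sol[OF p]]
  have "((%s. flow p (e * s)) has_vector_derivative e *\<^sub>R Fld (flow p (e * s))) (at s)" by (simp add: o_def)
  from bounded_linear.has_vector_derivative[OF S(1) this]
  have "((%s. S0 (flow p (e * s)) + k) has_vector_derivative S0 (e *\<^sub>R Fld (flow p (e * s)))) (at s)"
   by (rule has_vector_derivative_add_const[THEN iffD2])
  then show ?thesis unfolding Y_def F by (simp add: S(2) linear_scale bounded_linear.linear[OF S(1)])
 qed
 moreover have "Y 0 \<in> P1" using S(3) p by (simp add: Y_def)
 ultimately have "Y t = flow (Y 0) (t - 0)"
  by (intro flow_unique[of "min 0 t" "max 0 t"]) auto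
 then show ?thesis using p by (simp add: Y_def)
qed

lemma flow_Rv: assumes "p \<in> P1" shows "flow (Rv p) t = Rv (flow p (- t))"
proof -
 have bl: "bounded_linear Rv" unfolding Rv_def[abs_def]
  by (intro bounded_linear_Pair bounded_linear_comp bounded_linear_minus)
 have "flow (Rv p) t = Rv (flow p (- 1 * t))"
  by (rule flow_sym_aux[where S = Rv and k = 0, OF assms bl _ sym_P1(1)[OF assms]]) (auto simp: Fld_eq Rv_def dw_def)
 then show ?thesis by simp
qed

lemma flow_Mi: assumes "p \<in> P1" shows "flow (Mi p) t = Mi (flow p t)"
proof -
 have bl: "bounded_linear Mi" unfolding Mi_def[abs_def]
  by (intro bounded_linear_Pair bounded_linear_comp bounded_linear_minus)
 have "flow (Mi p) t = Mi (flow p (1 * t))"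
  by (rule flow_sym_aux[where S = Mi and k = 0, OF assms bl _ sym_P1(2)[OF assms]])
    (auto simp: Fld_eq Mi_def dw_def W_sym c_sym dW_sym dc_sym)
 then show ?thesis by simp
qed

lemma flow_Sh: assumes "p \<in> P1" shows "flow (Sh pi p) t = Sh pi (flow p t)" "flow (Sh (- pi) p) t = Sh (- pi) (flow p t)"
proof -
 have 1: "W (x - pi) = W x" "c (x - pi) = c x" "deriv W (x - pi) = deriv W x" "deriv c (x - pi) = deriv c x" for x
  using W_sym(2)[of "x - pi"] c_sym(2)[of "x - pi"] dW_sym(2)[of "x - pi"] dc_sym(2)[of "x - pi"] by auto
 have "flow (Sh pi p) t = Sh pi (flow p (1 * t))"
  by (rule flow_sym_aux[where S = "Sh pi" and k = "(0,0,pi,0)", OF assms bounded_linear_ident _ sym_P1(3)[OF assms]])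
    (auto simp: Fld_eq Sh_def dw_def W_sym c_sym dW_sym dc_sym rr_def vv_def th_def ww_def)
 moreover have "flow (Sh (- pi) p) t = Sh (- pi) (flow p (1 * t))"
  by (rule flow_sym_aux[where S = "Sh (- pi)" and k = "(0,0,- pi,0)", OF assms bounded_linear_ident _ sym_P1(4)[OF assms]])
    (auto simp: Fld_eq Sh_def dw_def 1 rr_def vv_def th_def ww_def)
 ultimately show "flow (Sh pi p) t = Sh pi (flow p t)" "flow (Sh (- pi) p) t = Sh (- pi) (flow p t)" by auto
qed

subsection \<open>Continuous dependence on the initial point\<close>

lemma flow_lipschitz:
 "EX K. \<forall>p\<in>P1. \<forall>q\<in>P1. ALL t. norm p <= R --> norm q <= R --> \<bar>t\<bar> <= T --> norm (flow p t - flow q t) <= K * norm (p - q)"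
proof -
 obtain L where L: "0 <= L" "\<forall>x\<in>cball 0 (bnd R T). \<forall>y\<in>cball 0 (bnd R T). norm (Fld x - Fld y) <= L * norm (x - y)"
  using Fld_lip[OF bounded_cball[of 0 "bnd R T"]] by meson
 show ?thesis
 proof (intro exI ballI allI impI)
  fix p q t assume h: "p \<in> P1" "q \<in> P1" "norm p <= R" "norm q <= R" "\<bar>t\<bar> <= T"
  have R: "0 <= R" using h(3) norm_ge_zero order_trans by blast
  have inb: "flow x s \<in> cball 0 (bnd R T)" if "x \<in> P1" "norm x <= R" "\<bar>s\<bar> <= T" for x s
   using order_trans[OF flow_norm[OF that(1), of s] bnd_mono[of "norm x" R "\<bar>s\<bar>" T]] that by simp
  have d: "((%t. flow p t - flow q t) has_vector_derivative Fld (flow p s) - Fld (flow q s)) (at s)" for s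
   by (intro derivative_intros flow_sol h)
  have n: "norm (Fld (flow p s) - Fld (flow q s)) <= L * norm (flow p s - flow q s)" if "\<bar>s\<bar> <= T" for s
   using L(2) inb[OF h(1,3) that] inb[OF h(2,4) that] by blast
  have "norm (flow p t - flow q t) <= exp (L * \<bar>t\<bar>) * norm (p - q)"
  proof (cases "0 <= t")
   case True
   have "norm (flow p t - flow q t) <= exp (L * (t - 0)) * norm (flow p 0 - flow q 0)"
    by (rule norm_growth(1)[OF True d n]) (use h in auto)
   then show ?thesis using True h by simp
  next
   case False
   then have t: "t <= 0" by simp
   have "norm (flow p t - flow q t) <= exp (L * (0 - t)) * norm (flow p 0 - flow q 0)"
    by (rule norm_growth(2)[OF t d n]) (use h in auto)
   then show ?thesis using t h by simp
  qed
  also have "\<dots> <= exp (L * T) * norm (p - q)" using L h by (intro mult_right_mono) (auto intro: mult_left_mono)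
  finally show "norm (flow p t - flow q t) <= exp (L * T) * norm (p - q)" .
 qed
qed

text \<open>Every condition that holds with a margin on a compact time interval is thereby open in
  the initial point; all stability lemmas below rest on this.\<close>

lemma flow_uniform:
 assumes q: "(q \<longlongrightarrow> p) F" "\<forall>\<^sub>F x in F. q x \<in> P1" and p: "p \<in> P1" and e: "0 < e"
 shows "\<forall>\<^sub>F x in F. ALL t. \<bar>t\<bar> <= T --> norm (flow (q x) t - flow p t) < e"
proof -
 obtain K where K: "\<forall>x\<in>P1. \<forall>y\<in>P1. ALL t. norm x <= norm p + 1 --> norm y <= norm p + 1 --> \<bar>t\<bar> <= T --> norm (flow x t - flow y t) <= K * norm (x - y)"
  using flow_lipschitz by meson
 have "\<forall>\<^sub>F x in F. dist (q x) p < min 1 (e / (\<bar>K\<bar> + 1))"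
  by (rule tendstoD[OF q(1)]) (use e in auto)
 with q(2) show ?thesis
 proof eventually_elim
  case (elim x)
  show ?case
  proof (intro allI impI)
   fix t assume t: "\<bar>t\<bar> <= T"
   have n: "norm (q x) <= norm p + 1" using elim(2) norm_triangle_ineq2[of "q x" p] by (simp add: dist_norm)
   have "norm (flow (q x) t - flow p t) <= K * norm (q x - p)"
    using K[rule_format, OF elim(1) p n _ t] by simp
   also have "\<dots> <= (\<bar>K\<bar> + 1) * norm (q x - p)" by (intro mult_right_mono) auto
   also have "\<dots> < (\<bar>K\<bar> + 1) * (e / (\<bar>K\<bar> + 1))" using elim(2) by (intro mult_strict_left_mono) (auto simp: dist_norm)
   also have "\<dots> = e" by simp
   finally show "norm (flow (q x) t - flow p t) < e" .
  qed
 qed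
qed

lemma flow_tendsto:
 assumes q: "(q \<longlongrightarrow> p) F" "\<forall>\<^sub>F x in F. q x \<in> P1" and p: "p \<in> P1" and t: "(t \<longlongrightarrow> s) F"
 shows "((%x. flow (q x) (t x)) \<longlongrightarrow> flow p s) F"
proof (rule tendstoI)
 fix e :: real assume e: "0 < e"
 have "isCont (flow p) s" using flow_sol[OF p] by (rule has_vector_derivative_continuous)
 then have "((%x. flow p (t x)) \<longlongrightarrow> flow p s) F" using t by (rule isCont_tendsto_compose)
 from tendstoD[OF this, of "e/2"] have 1: "\<forall>\<^sub>F x in F. dist (flow p (t x)) (flow p s) < e / 2" using e by simp
 have 2: "\<forall>\<^sub>F x in F. dist (t x) s < 1" by (rule tendstoD[OF t]) simp
 have 3: "\<forall>\<^sub>F x in F. ALL t. \<bar>t\<bar> <= \<bar>s\<bar> + 1 --> norm (flow (q x) t - flow p t) < e / 2"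
  by (rule flow_uniform[OF q p]) (use e in simp)
 from 1 2 3 show "\<forall>\<^sub>F x in F. dist (flow (q x) (t x)) (flow p s) < e"
 proof eventually_elim
  case (elim x)
  have "\<bar>t x\<bar> <= \<bar>s\<bar> + 1" using elim(2) by (simp add: dist_real_def)
  then have "dist (flow (q x) (t x)) (flow p (t x)) < e / 2" using elim(3) by (simp add: dist_norm)
  then show ?case using elim(1) dist_triangle_half_l[of "flow p (t x)" _ e] by (metis dist_commute dist_triangle_half_l)
 qed
qed

lemma closed_P1: "closed P1"
proof -
 have "closed {x. 0 <= rr x}" by (intro closed_Collect_le continuous_intros)
 moreover have "closed {x. En x = 0}" unfolding En_def
  by (intro closed_Collect_eq continuous_intros continuous_on_compose2[OF cont_c] continuous_on_compose2[OF cont_W]) auto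
 ultimately have "closed ({x. 0 <= rr x} \<inter> {x. En x = 0})" by (rule closed_Int)
 also have "{x. 0 <= rr x} \<inter> {x. En x = 0} = P1" using P1_iff by auto
 finally show ?thesis .
qed

text \<open>Since r' is a multiple of r, Gronwall's bound in both time directions makes r = 0
  invariant.\<close>

lemma fr_pos_iff: assumes p: "p \<in> P1" shows "fr p t = 0 \<longleftrightarrow> rr p = 0"
proof -
 have z: "fr q s = 0" if q: "q \<in> P1" "rr q = 0" for q s
 proof -
  define X where "X t = Rv (Rv (flow q t))" for t
  have "bounded ((%t. fv q t) ` {- \<bar>s\<bar>..\<bar>s\<bar>})"
   by (intro compact_imp_bounded compact_continuous_image cont_f q) auto
  then have "EX N. \<forall>t\<in>{- \<bar>s\<bar>..\<bar>s\<bar>}. \<bar>fv q t\<bar> <= N" unfolding bounded_iff by auto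
  then obtain N where N: "\<forall>t\<in>{- \<bar>s\<bar>..\<bar>s\<bar>}. \<bar>fv q t\<bar> <= N" by blast
  have d: "((%t. fr q t) has_vector_derivative fr q t * fv q t * (cos (ft q t))^2) (at t)" for t
   using fr_deriv[OF q(1), of t] by (simp add: has_real_derivative_iff_has_vector_derivative)
  have n: "norm (fr q t * fv q t * (cos (ft q t))^2) <= N * norm (fr q t)" if "\<bar>t\<bar> <= \<bar>s\<bar>" for t
  proof -
   have "t \<in> {- \<bar>s\<bar>..\<bar>s\<bar>}" using that by (simp add: abs_le_iff minus_le_iff)
   then have "\<bar>fv q t\<bar> <= N" using N by blast
   then have "(\<bar>fv q t\<bar> * \<bar>fr q t\<bar>) * (cos (ft q t))^2 <= (N * \<bar>fr q t\<bar>) * 1"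
    by (intro mult_mono mult_right_mono) (auto simp: abs_square_le_1)
   then show ?thesis by (simp add: abs_mult mult_ac)
  qed
  show ?thesis
  proof (cases "0 <= s")
   case True
   have "norm (fr q s) <= exp (N * (s - 0)) * norm (fr q 0)"
    by (rule norm_growth(1)[OF True d n]) auto
   then show ?thesis using q by simp
  next
   case False
   then have "s <= 0" by simp
   have "norm (fr q s) <= exp (N * (0 - s)) * norm (fr q 0)"
    by (rule norm_growth(2)[OF \<open>s <= 0\<close> d n]) (use \<open>s <= 0\<close> in auto)
   then show ?thesis using q by simp
  qed
 qed
 show ?thesis using z[OF p] z[OF flow_in[OF p, of t], of "-t"] flow_flow[OF p, of t "-t"] p by auto
qed

lemma fr_nonneg: "p \<in> P1 ==> 0 <= fr p t" using P1_bounds(1)[OF flow_in] .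

end

subsection \<open>Real-variable lemmas\<close>

lemma stays_below:
 fixes h h' :: "real => real"
 assumes h0: "h a <= k"
  and D: "!!s. a <= s ==> s <= b ==> (h has_real_derivative h' s) (at s)"
  and key: "!!s. a <= s ==> s <= b ==> h s = k ==> (!!x. a < x ==> x < s ==> h x < k) ==> h' s < 0"
  and s: "a < s" "s <= b"
 shows "h s < k"
proof (rule ccontr)
 assume n: "~ h s < k"
 have cont: "isCont h x" if "a <= x" "x <= b" for x using D[OF that] by (rule DERIV_isCont)
 have "\<exists>d>0. ALL x. a < x & x < a + d --> h x < k"
 proof (cases "h a = k")
  case True
  have "h' a < 0" by (rule key) (use True s in auto)
  from DERIV_neg_dec_right[OF D[of a] this] s obtain d where d: "d > 0" "\<forall>x>0. x < d --> h (a + x) < h a" by auto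
  have "h x < k" if "a < x" "x < a + d" for x using d(2)[rule_format, of "x - a"] that True by simp
  then show ?thesis using d(1) by blast
 next
  case False
  then have "h a < k" using h0 by simp
  moreover have "(h \<longlongrightarrow> h a) (at a)" using cont[of a] s by (simp add: isCont_def)
  ultimately have "eventually (%x. h x < k) (at a)" by (rule order_tendstoD(2)[rotated])
  then obtain d where d: "d > 0" "ALL x. x ~= a & dist x a < d --> h x < k" unfolding eventually_at by auto
  have "h x < k" if "a < x" "x < a + d" for x using d(2)[rule_format, of x] that by (simp add: dist_real_def)
  then show ?thesis using d(1) by blast
 qed
 then obtain d where d: "d > 0" "!!x. a < x ==> x < a + d ==> h x < k" by blast
 define A where "A = {x \<in> {min (a + d) s..s}. k <= h x}"
 have "continuous_on {min (a + d) s..s} h"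
  by (rule continuous_at_imp_continuous_on) (use cont s d in auto)
 then have "closed A" unfolding A_def by (rule continuous_on_closed_Collect_le[OF continuous_on_const]) simp
 moreover have "s \<in> A" using n by (simp add: A_def)
 moreover have bb: "bdd_below A" by (rule bdd_belowI[of _ "min (a + d) s"]) (simp add: A_def)
 ultimately have IA: "Inf A \<in> A" by (intro closed_contains_Inf) auto
 define z where "z = Inf A"
 have z: "min (a + d) s <= z" "z <= s" "k <= h z" using IA by (auto simp: A_def z_def)
 then have az: "a < z" using d(1) s by auto
 have lt: "h x < k" if "a < x" "x < z" for x
 proof (cases "x < a + d")
  case False
  show ?thesis using cInf_lower[OF _ bb, of x] that False z by (force simp: A_def z_def)
 qed (use d that in auto)
 have "isCont h z" using cont az z s by auto
 then have "(h \<longlongrightarrow> h z) (at_left z)" unfolding isCont_def by (rule tendsto_within_subset) simp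
 moreover have "eventually (%x. h x <= k) (at_left z)"
  by (rule eventually_mono[OF eventually_at_left_real[OF az]]) (use lt in \<open>auto simp: less_imp_le\<close>)
 ultimately have "h z <= k" by (rule tendsto_upperbound) auto
 then have hz: "h z = k" using z by simp
 have "h' z < 0" by (rule key) (use az z s hz lt in auto)
 from DERIV_neg_dec_left[OF D[of z] this] az z s
 obtain e where e: "e > 0" "\<forall>x>0. x < e --> h z < h (z - x)" by auto
 define x where "x = min (e / 2) ((z - a) / 2)"
 have "x > 0" "x < e" "x < z - a" using e az by (auto simp: x_def min_less_iff_disj)
 then show False using e(2)[rule_format, of x] lt[of "z - x"] hz by auto
qed

lemma stays_above:
 fixes h h' :: "real => real"
 assumes h0: "k <= h a"
  and D: "!!s. a <= s ==> s <= b ==> (h has_real_derivative h' s) (at s)"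
  and key: "!!s. a <= s ==> s <= b ==> h s = k ==> (!!x. a < x ==> x < s ==> k < h x) ==> 0 < h' s"
  and s: "a < s" "s <= b"
 shows "k < h s"
proof -
 have "- h s < - k"
 proof (rule stays_below[of "%x. - h x" a "-k" b "%x. - h' x"])
  show "((%x. - h x) has_real_derivative - h' s) (at s)" if "a <= s" "s <= b" for s
   using D[OF that] by (rule DERIV_minus)
  show "- h' s < 0" if "a <= s" "s <= b" "- h s = - k" "!!x. a < x ==> x < s ==> - h x < - k" for s
   using key[of s] that by force
 qed (use h0 s in auto)
 then show ?thesis by simp
qed

lemma deriv_upper:
 fixes h :: "real => real"
 assumes "a <= b" and D: "!!s. a <= s ==> s <= b ==> (h has_real_derivative h' s) (at s)"
  and le: "!!s. a <= s ==> s <= b ==> h' s <= K"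
 shows "h b <= h a + K * (b - a)"
proof -
 have "h b - K * b <= h a - K * a"
 proof (rule DERIV_nonpos_imp_nonincreasing[OF assms(1)])
  fix s assume s: "a <= s" "s <= b"
  have "((%s. h s - K * s) has_real_derivative h' s - K) (at s)"
   by (rule derivative_eq_intros D[OF s] refl | simp)+
  then show "EX y. ((%s. h s - K * s) has_real_derivative y) (at s) & y <= 0" using le[OF s] by auto
 qed
 then show ?thesis by (simp add: algebra_simps)
qed

lemma deriv_lower:
 fixes h :: "real => real"
 assumes "a <= b" and D: "!!s. a <= s ==> s <= b ==> (h has_real_derivative h' s) (at s)"
  and le: "!!s. a <= s ==> s <= b ==> K <= h' s"
 shows "h a + K * (b - a) <= h b"
proof -
 have "- h b <= - h a + (- K) * (b - a)"
 proof (rule deriv_upper[OF assms(1), of "%s. - h s" "%s. - h' s"])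
  show "((%x. - h x) has_real_derivative - h' s) (at s)" if "a <= s" "s <= b" for s
   using D[OF that] by (rule DERIV_minus)
 qed (use le in auto)
 then show ?thesis by simp
qed

text \<open>Over a short window of fixed length the increment of f becomes small, so f' is small at
  some point of the window, and the Lipschitz bound spreads this to its left end.\<close>

lemma barbalat:
 fixes f f' :: "real => real"
 assumes D: "!!t. 0 <= t ==> (f has_real_derivative f' t) (at t)" and l: "(f \<longlongrightarrow> l) at_top"
  and L: "!!s t. 0 <= s ==> s <= t ==> \<bar>f' s - f' t\<bar> <= L * (t - s)"
 shows "(f' \<longlongrightarrow> 0) at_top"
proof (rule tendstoI)
 fix e :: real assume e: "0 < e"
 define h where "h = e / (2 * (\<bar>L\<bar> + 1))"
 have h: "h > 0" "\<bar>L\<bar> * h < e / 2" using e by (auto simp: h_def field_simps)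
 have 1: "eventually (%t. dist (f t) l < h * e / 4) at_top" by (rule tendstoD[OF l]) (use h e in simp)
 then obtain T where T: "!!t. T <= t ==> dist (f t) l < h * e / 4" unfolding eventually_at_top_linorder by blast
 show "eventually (%t. dist (f' t) 0 < e) at_top"
  unfolding eventually_at_top_linorder
 proof (intro exI[of _ "max T 0"] allI impI)
  fix t assume t: "max T 0 <= t"
  obtain x where x: "t < x" "x < t + h" "f (t + h) - f t = (t + h - t) * f' x"
   using MVT2[of t "t + h" f f'] D t h by auto
  have "\<bar>f (t + h) - f t\<bar> < h * e / 2"
   using T[of t] T[of "t + h"] t h unfolding dist_real_def by linarith
  then have "h * \<bar>f' x\<bar> < h * (e / 2)" using x h by (simp add: abs_mult)
  then have a: "\<bar>f' x\<bar> < e / 2" using h by simp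
  have "\<bar>f' t - f' x\<bar> <= L * (x - t)" by (rule L) (use t x in auto)
  also have "\<dots> <= \<bar>L\<bar> * h" using x by (intro mult_mono) auto
  finally show "dist (f' t) 0 < e" using a h by (simp add: dist_real_def)
 qed
qed

lemma mono_bounded_limit:
 fixes f :: "real => real"
 assumes mono: "!!s t. T <= s ==> s <= t ==> f s <= f t" and b: "!!t. T <= t ==> f t <= B"
 obtains l where "(f \<longlongrightarrow> l) at_top" "!!t. T <= t ==> f t <= l" "l <= B"
proof -
 have bdd: "bdd_above (f ` {T..})" by (rule bdd_aboveI[of _ B]) (use b in auto)
 define l where "l = Sup (f ` {T..})"
 have le: "f t <= l" if "T <= t" for t unfolding l_def by (rule cSup_upper[OF _ bdd]) (use that in auto)
 have lB: "l <= B" unfolding l_def by (rule cSup_least) (use b in auto)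
 have "(f \<longlongrightarrow> l) at_top"
 proof (rule order_tendstoI)
  fix a assume "a < l"
  then obtain t where t: "T <= t" "a < f t" unfolding l_def using less_cSup_iff[OF _ bdd, of a] by auto
  show "eventually (%x. a < f x) at_top" unfolding eventually_at_top_linorder
   by (rule exI[of _ t]) (use t mono in force)
 next
  fix a assume "l < a"
  show "eventually (%x. f x < a) at_top" unfolding eventually_at_top_linorder
   by (rule exI[of _ T]) (use le \<open>l < a\<close> in force)
 qed
 from that[OF this le lB] show thesis by simp
qed

lemma first_time:
 fixes h :: "real => real"
 assumes "a <= b" and c: "continuous_on {a..b} h" and b: "h b <= k" and a: "k < h a"
 obtains u where "a < u" "u <= b" "h u = k" "!!s. a <= s ==> s < u ==> k < h s"
proof -
 define A where "A = {x \<in> {a..b}. h x <= k}"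
 have "closed A" unfolding A_def by (rule continuous_on_closed_Collect_le[OF c continuous_on_const]) simp
 moreover have "b \<in> A" using assms by (simp add: A_def)
 moreover have bb: "bdd_below A" by (rule bdd_belowI[of _ a]) (simp add: A_def)
 ultimately have IA: "Inf A \<in> A" by (intro closed_contains_Inf) auto
 define u where "u = Inf A"
 have u: "a <= u" "u <= b" "h u <= k" using IA by (auto simp: A_def u_def)
 have lt: "k < h s" if "a <= s" "s < u" for s
  using cInf_lower[OF _ bb, of s] that u by (force simp: A_def u_def)
 have "h u = k"
 proof (rule ccontr)
  assume n: "h u ~= k"
  obtain x where "a <= x" "x <= u" "h x = k"
   using IVT2'[of h u k a] u a continuous_on_subset[OF c, of "{a..u}"] by auto
  then show False using lt[of x] n by (cases "x = u") auto
 qed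
 moreover have "a < u" using u a by (cases "a = u") auto
 ultimately show thesis using that u lt by blast
qed

context shape
begin

subsection \<open>Limits of bounded orbits\<close>

lemma cos_lower:
 assumes "- (pi/2) < x1" "x2 < pi/2"
 obtains c0 where "0 < c0" "!!x. x1 <= x ==> x <= x2 ==> c0 <= cos x"
proof -
 have "min (cos x1) (cos x2) <= cos x" if "x1 <= x" "x <= x2" for x
 proof (cases "0 <= x")
  case True
  have "cos x2 <= cos x" by (rule cos_monotone_0_pi_le) (use that assms True in auto)
  then show ?thesis by simp
 next
  case False
  have "cos (- x1) <= cos (- x)" by (rule cos_monotone_0_pi_le) (use that assms False in auto)
  then show ?thesis by simp
 qed
 moreover have "0 < min (cos x1) (cos x2)" if "x1 <= x2" using cos_pos assms that by auto
 ultimately show thesis using that[of 1] that[of "min (cos x1) (cos x2)"] by (cases "x1 <= x2") auto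
qed

text \<open>Energy controls only v cos and r cos^2, hence v and r only at a distance from the
  collision lines.\<close>

lemma P1_v_bound:
 assumes "x \<in> P1" "0 < c0" "c0 <= cos (th x)"
 shows "\<bar>vv x\<bar> <= sqrt (2 * WM) / c0" "rr x <= WM / c0^2"
proof -
 have c: "c0^2 <= (cos (th x))^2" using assms by (intro power_mono) auto
 have "(vv x * c0)^2 <= (vv x)^2 * (cos (th x))^2" unfolding power_mult_distrib using c by (intro mult_left_mono) auto
 then have "(vv x * c0)^2 <= 2 * WM" using P1_bounds(7)[OF assms(1)] by linarith
 then have "\<bar>vv x * c0\<bar> <= sqrt (2 * WM)" by (simp add: real_le_rsqrt)
 then show "\<bar>vv x\<bar> <= sqrt (2 * WM) / c0" using assms by (simp add: abs_mult pos_le_divide_eq)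
 have "rr x * c0^2 <= rr x * (cos (th x))^2" using c P1_bounds(1)[OF assms(1)] by (intro mult_left_mono) auto
 then show "rr x <= WM / c0^2" using P1_bounds(3)[OF assms(1)] assms by (simp add: pos_le_divide_eq)
qed

lemma P1_norm_bound:
 assumes "x \<in> P1" "- (pi/2) < x1" "x2 < pi/2"  "0 < c0" "c0 <= cos (th x)" "x1 <= th x" "th x <= x2"
 shows "norm x <= WM / c0^2 + sqrt (2 * WM) / c0 + pi/2 + wM"
proof -
 have "\<bar>th x\<bar> <= pi/2" using assms by (simp add: abs_le_iff)
 then show ?thesis
  using norm_state_le[of x] P1_v_bound[OF assms(1,4,5)] P1_bounds(1,6)[OF assms(1)] by linarith
qed

lemma flow_Fld_lipschitz:
 assumes p: "p \<in> P1" and N: "!!t. 0 <= t ==> norm (flow p t) <= N"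
 shows "EX L. ALL s t. 0 <= s --> s <= t --> norm (Fld (flow p s) - Fld (flow p t)) <= L * (t - s)"
proof -
 obtain B L where L: "0 <= L" "\<forall>x\<in>cball 0 N. norm (Fld x) <= B"
  "\<forall>x\<in>cball 0 N. \<forall>y\<in>cball 0 N. norm (Fld x - Fld y) <= L * norm (x - y)"
  using Fld_lip[OF bounded_cball[of 0 N]] by meson
 have inb: "flow p t \<in> cball 0 N" if "0 <= t" for t using N[OF that] by simp
 have a: "norm (flow p t - flow p s) <= B * (t - s)" if "0 <= s" "s <= t" for s t
 proof (cases "s = t")
  case False
  then have st: "s < t" using that by simp
  have "norm (flow p t - flow p s) <= B * t - B * s"
  proof (rule differentiable_bound_general[OF st cont_flow[OF p], of "%t. B * t" "%x. Fld (flow p x)" "%_. B"])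
   show "((%t. B * t) has_vector_derivative B) (at x)" for x
    unfolding has_real_derivative_iff_has_vector_derivative[symmetric]
    by (rule derivative_eq_intros refl | simp)+
   show "norm (Fld (flow p x)) <= B" if "s < x" for x using L(2) inb[of x] that \<open>0 <= s\<close> by auto
  qed (auto intro!: flow_sol p continuous_intros)
  then show ?thesis by (simp add: algebra_simps)
 qed simp
 show ?thesis
 proof (intro exI allI impI)
  fix s t :: real assume st: "0 <= s" "s <= t"
  have "norm (Fld (flow p s) - Fld (flow p t)) <= L * norm (flow p s - flow p t)"
   using L(3) inb[of s] inb[of t] st by auto
  also have "\<dots> <= L * (B * (t - s))" using a[OF st] L(1) by (intro mult_left_mono) (auto simp: norm_minus_commute)
  finally show "norm (Fld (flow p s) - Fld (flow p t)) <= (L * B) * (t - s)" by (simp add: mult_ac)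
 qed
qed

text \<open>Along a bounded orbit the field is Lipschitz in time. Convergence of \<theta>, or of v
  when r = 0, therefore forces w to 0; then w' tends to 0, and \<open>dw_cos\<close> leaves only G.
  So limits of \<theta> are critical.\<close>

lemma barbalat_flow:
 assumes p: "p \<in> P1" and N: "!!t. 0 <= t ==> norm (flow p t) <= N"
 shows "((%t. ft p t) \<longlongrightarrow> l) at_top ==> ((%t. fw p t) \<longlongrightarrow> 0) at_top"
  and "((%t. fv p t) \<longlongrightarrow> l) at_top ==> rr p = 0 ==> ((%t. fw p t) \<longlongrightarrow> 0) at_top"
  and "((%t. fw p t) \<longlongrightarrow> 0) at_top ==> ((%t. G (ft p t)) \<longlongrightarrow> 0) at_top"
proof -
 obtain L where L: "ALL s t. 0 <= s --> s <= t --> norm (Fld (flow p s) - Fld (flow p t)) <= L * (t - s)"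
  using flow_Fld_lipschitz[OF p N] by blast
 have Lc: "\<bar>th (Fld (flow p s)) - th (Fld (flow p t))\<bar> <= L * (t - s)"
    "\<bar>vv (Fld (flow p s)) - vv (Fld (flow p t))\<bar> <= L * (t - s)"
    "\<bar>ww (Fld (flow p s)) - ww (Fld (flow p t))\<bar> <= L * (t - s)" if "0 <= s" "s <= t" for s t
  using L[rule_format, OF that] comp_le_norm[of "Fld (flow p s) - Fld (flow p t)"] by auto
 { assume l: "((%t. ft p t) \<longlongrightarrow> l) at_top"
  have "((%t. th (Fld (flow p t))) \<longlongrightarrow> 0) at_top"
   by (rule barbalat[OF _ l Lc(1)]) (use ft_deriv[OF p] in \<open>simp_all add: Fld_eq\<close>)
  from tendsto_mult[OF tendsto_const[of 4] tendsto_rabs[OF this]]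
  have "((%t. 4 * \<bar>th (Fld (flow p t))\<bar>) \<longlongrightarrow> 0) at_top" by simp
  moreover have "\<bar>fw p t\<bar> <= 4 * \<bar>th (Fld (flow p t))\<bar>" for t
  proof -
   have "\<bar>fw p t\<bar> * (1/4) <= \<bar>fw p t\<bar> * c (ft p t)" using c_bounds(1) by (intro mult_left_mono) auto
   then show ?thesis using c_pos[of "ft p t"] by (simp add: Fld_eq abs_mult)
  qed
  ultimately show "((%t. fw p t) \<longlongrightarrow> 0) at_top"
   using Lim_null_comparison[of "%t. fw p t" "%t. 4 * \<bar>th (Fld (flow p t))\<bar>" at_top] by simp }
 { assume l: "((%t. fv p t) \<longlongrightarrow> l) at_top" and r: "rr p = 0"
  have r0: "fr p t = 0" for t using fr_pos_iff[OF p] r by simp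
  have vF: "vv (Fld (flow p t)) = (1/2) * (fw p t)^2 * c (ft p t)" for t using vv_Fld[OF flow_in[OF p]] r0 by simp
  have "((%t. vv (Fld (flow p t))) \<longlongrightarrow> 0) at_top"
   by (rule barbalat[OF _ l Lc(2)]) (use fv_deriv[OF p] in \<open>simp_all add: vF r0\<close>)
  from tendsto_mult[OF tendsto_const[of 8] this]
  have "((%t. 8 * vv (Fld (flow p t))) \<longlongrightarrow> 0) at_top" by simp
  moreover have "norm ((fw p t)^2) <= 8 * vv (Fld (flow p t))" for t
   using mult_left_mono[OF c_bounds(1)[of "ft p t"], of "(fw p t)^2"] unfolding vF by (simp add: mult_ac)
  ultimately have "((%t. (fw p t)^2) \<longlongrightarrow> 0) at_top"
   using Lim_null_comparison[of "%t. (fw p t)^2" "%t. 8 * vv (Fld (flow p t))" at_top] by simp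
  then have "((%t. sqrt ((fw p t)^2)) \<longlongrightarrow> sqrt 0) at_top" by (rule tendsto_real_sqrt)
  then show "((%t. fw p t) \<longlongrightarrow> 0) at_top" by (simp add: tendsto_rabs_zero_iff) }
 { assume l: "((%t. fw p t) \<longlongrightarrow> 0) at_top"
  have 1: "((%t. ww (Fld (flow p t))) \<longlongrightarrow> 0) at_top"
   by (rule barbalat[OF _ l Lc(3)]) (use fw_deriv[OF p] in \<open>simp_all add: Fld_eq\<close>)
  have z: "((%t. f (flow p t) * g t) \<longlongrightarrow> 0) at_top"
   if f: "!!x. norm x <= N ==> \<bar>f x\<bar> <= B" and g: "(g \<longlongrightarrow> 0) at_top" for f :: "state => real" and B g
  proof (rule Lim_null_comparison)
   show "\<forall>\<^sub>F t in at_top. norm (f (flow p t) * g t) <= B * \<bar>g t\<bar>"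
    unfolding eventually_at_top_linorder
   proof (intro exI[of _ 0] allI impI)
    fix t :: real assume "0 <= t"
    then show "norm (f (flow p t) * g t) <= B * \<bar>g t\<bar>"
     using f[OF N[of t]] by (simp add: abs_mult mult_right_mono)
   qed
   show "((%t. B * \<bar>g t\<bar>) \<longlongrightarrow> 0) at_top"
    using tendsto_mult[OF tendsto_const[of B] tendsto_rabs[OF g]] by simp
  qed
  have a1: "((%t. cos (ft p t) * ww (Fld (flow p t))) \<longlongrightarrow> 0) at_top"
   by (rule z[of "%x. cos (th x)" 1, OF _ 1]) auto
  have a2: "((%t. (c (ft p t) * sin (ft p t)) * (fw p t)^2) \<longlongrightarrow> 0) at_top"
  proof (rule z[of "%x. c (th x) * sin (th x)" "2 * 1"])
   show "\<bar>c (th x) * sin (th x)\<bar> <= 2 * 1" for x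
    unfolding abs_mult using c_bounds[of "th x"] by (intro mult_mono) auto
   show "((%t. (fw p t)^2) \<longlongrightarrow> 0) at_top" using tendsto_power[OF l, of 2] by simp
  qed
  have a3: "((%t. (vv (flow p t) * (cos (ft p t))^3) * fw p t) \<longlongrightarrow> 0) at_top"
  proof (rule z[of "%x. vv x * (cos (th x))^3" "N * 1", OF _ l])
   show "\<bar>vv x * (cos (th x))^3\<bar> <= N * 1" if "norm x <= N" for x
    unfolding abs_mult using that comp_le_norm(2)[of x] norm_ge_zero[of x]
    by (intro mult_mono) (auto simp: power_abs intro: power_le_one)
  qed
  have a4: "((%t. (deriv c (ft p t) * cos (ft p t)) * (fw p t)^2) \<longlongrightarrow> 0) at_top"
  proof (rule z[of "%x. deriv c (th x) * cos (th x)" "1 * 1"])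
   show "\<bar>deriv c (th x) * cos (th x)\<bar> <= 1 * 1" for x
    unfolding abs_mult using dc_bound[of "th x"] by (intro mult_mono) auto
   show "((%t. (fw p t)^2) \<longlongrightarrow> 0) at_top" using tendsto_power[OF l, of 2] by simp
  qed
  have "((%t. cos (ft p t) * ww (Fld (flow p t)) + (c (ft p t) * sin (ft p t)) * (fw p t)^2
    + (1/2) * ((vv (flow p t) * (cos (ft p t))^3) * fw p t)
    + (1/2) * ((deriv c (ft p t) * cos (ft p t)) * (fw p t)^2)) \<longlongrightarrow> 0 + 0 + (1/2) * 0 + (1/2) * 0) at_top"
   by (intro tendsto_intros a1 a2 a3 a4)
  moreover have "cos (ft p t) * ww (Fld (flow p t)) + (c (ft p t) * sin (ft p t)) * (fw p t)^2
    + (1/2) * ((vv (flow p t) * (cos (ft p t))^3) * fw p t)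
    + (1/2) * ((deriv c (ft p t) * cos (ft p t)) * (fw p t)^2) = G (ft p t)" for t
   using dw_cos[OF flow_in[OF p, of t]] by (simp add: Fld_eq algebra_simps)
  ultimately show "((%t. G (ft p t)) \<longlongrightarrow> 0) at_top" by simp }
qed

end

lemma tendsto_at_top_shift:
 fixes f :: "real => 'a::topological_space"
 shows "((%t. f (a + t)) \<longlongrightarrow> k) at_top \<longleftrightarrow> (f \<longlongrightarrow> k) at_top"
proof
 have s: "filterlim (%t::real. b + t) at_top at_top" for b
  by (rule filterlim_tendsto_add_at_top[OF tendsto_const filterlim_ident])
 show "((%t. f (a + t)) \<longlongrightarrow> k) at_top" if "(f \<longlongrightarrow> k) at_top"
  using filterlim_compose[OF that s[of a]] by simp
 show "(f \<longlongrightarrow> k) at_top" if "((%t. f (a + t)) \<longlongrightarrow> k) at_top"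
  using filterlim_compose[OF that s[of "-a"]] by simp
qed

context shape
begin

lemma G_lip: "\<exists>A>0. \<forall>x\<in>{-10..10}. \<forall>y\<in>{-10..10}. \<bar>G x - G y\<bar> <= A * \<bar>x - y\<bar>"
proof -
 have id: "bdd_lip {-10..10::real} (%x. x)"
  by (rule bdd_lip_linear) (auto intro: bounded_linear_ident)
 have cs: "C1_fun cos" "C1_fun sin" unfolding C1_fun_def
  by (intro exI[of _ "%x. - sin x"] conjI allI; auto intro!: derivative_eq_intros continuous_intros)
    (intro exI[of _ cos] conjI allI; auto intro!: derivative_eq_intros continuous_intros)
 have "bdd_lip {-10..10} G" unfolding G_def[abs_def]
  by (intro bdd_lip_add bdd_lip_mult bdd_lip_const bdd_lip_C1[OF id] cs C1_W C1_dW)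
 then obtain L where L: "0 <= L" "\<forall>x\<in>{-10..10}. \<forall>y\<in>{-10..10}. \<bar>G x - G y\<bar> <= L * norm (x - y)"
  unfolding bdd_lip_def by blast
 have "\<bar>G x - G y\<bar> <= (L + 1) * \<bar>x - y\<bar>" if "x\<in>{-10..10}" "y\<in>{-10..10}" for x y
  using L(2)[rule_format, OF that] mult_right_mono[of L "L + 1" "\<bar>x - y\<bar>"] by simp
 then show ?thesis using L(1) by (intro exI[of _ "L + 1"]) auto
qed

lemma dw_bound:
 assumes x: "x \<in> P1" "0 < c0" "c0 <= cos (th x)" "\<bar>vv x\<bar> <= B"
 shows "\<bar>dw x\<bar> <= (\<bar>G (th x)\<bar> + (3 * wM + B) * \<bar>ww x\<bar>) / c0"
proof -
 have w: "\<bar>ww x\<bar> <= wM" by (rule P1_bounds(6)[OF x(1)])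
 have cos1: "\<bar>cos (th x)\<bar> <= 1" "\<bar>(cos (th x))^3\<bar> <= 1" by (auto simp: power_abs power_le_one)
 have 1: "\<bar>(ww x)^2 * c (th x) * sin (th x)\<bar> <= 2 * wM * \<bar>ww x\<bar>"
 proof -
  have "\<bar>(ww x)^2 * c (th x) * sin (th x)\<bar> = \<bar>ww x\<bar> * (\<bar>ww x\<bar> * (\<bar>c (th x)\<bar> * \<bar>sin (th x)\<bar>))"
   by (simp add: power2_eq_square abs_mult mult_ac)
  also have "\<dots> <= \<bar>ww x\<bar> * (wM * (2 * 1))"
   using w wM_nonneg c_bounds[of "th x"] by (intro mult_mono) auto
  finally show ?thesis by (simp add: mult_ac)
 qed
 have 2: "\<bar>(1/2) * vv x * ww x * (cos (th x))^3\<bar> <= B * \<bar>ww x\<bar>"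
 proof -
  have "\<bar>(1/2) * vv x * ww x * (cos (th x))^3\<bar> = (1/2) * (\<bar>vv x\<bar> * \<bar>ww x\<bar>) * \<bar>(cos (th x))^3\<bar>"
   by (simp add: abs_mult mult_ac)
  also have "\<dots> <= 1 * (B * \<bar>ww x\<bar>) * 1"
   using cos1 x(4) by (intro mult_mono) auto
  finally show ?thesis by simp
 qed
 have 3: "\<bar>(1/2) * (ww x)^2 * deriv c (th x) * cos (th x)\<bar> <= wM * \<bar>ww x\<bar>"
 proof -
  have "\<bar>(1/2) * (ww x)^2 * deriv c (th x) * cos (th x)\<bar> = (1/2) * (\<bar>ww x\<bar> * (\<bar>ww x\<bar> * (\<bar>deriv c (th x)\<bar> * \<bar>cos (th x)\<bar>)))"
   by (simp add: power2_eq_square abs_mult mult_ac)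
  also have "\<dots> <= 1 * (\<bar>ww x\<bar> * (wM * (1 * 1)))"
   using w wM_nonneg dc_bound[of "th x"] cos1 by (intro mult_mono) auto
  finally show ?thesis by (simp add: mult_ac)
 qed
 have "\<bar>cos (th x) * dw x\<bar> <= \<bar>G (th x)\<bar> + (3 * wM + B) * \<bar>ww x\<bar>"
  unfolding dw_cos[OF x(1)] distrib_right using 1 2 3 by linarith
 moreover have "c0 * \<bar>dw x\<bar> <= \<bar>cos (th x) * dw x\<bar>"
  unfolding abs_mult using x by (intro mult_right_mono) auto
 ultimately show ?thesis using x(2) by (simp add: pos_le_divide_eq mult.commute)
qed

lemma dw_at_rest: "x \<in> P1 ==> ww x = 0 ==> - (pi/2) < th x ==> th x < pi/2 ==> sgn (dw x) = sgn (G (th x))"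
 using dw_cos[of x] cos_pos[of "th x"] by (simp add: sgn_mult flip: dw_cos) (metis mult_1 sgn_mult sgn_pos)

text \<open>The homothetic plane \<open>\<theta> = tL\<close>, \<open>w = 0\<close> over a critical point of \<open>V\<close> is invariant.\<close>
lemma homothetic:
 assumes p: "p \<in> P1" and u: "fw p u = 0" "ft p u = tL" "G tL = 0" "- (pi/2) < tL" "tL < pi/2"
 obtains d where "0 < d" "!!s. \<bar>s - u\<bar> <= d ==> fw p s = 0"
proof -
 define q where "q = flow p u"
 have q: "q \<in> P1" "th q = tL" "ww q = 0" using p u by (auto simp: q_def)
 define x1 where "x1 = (tL - pi/2) / 2"
 define x2 where "x2 = (tL + pi/2) / 2"
 have x12: "- (pi/2) < x1" "x1 < tL" "tL < x2" "x2 < pi/2" using u by (auto simp: x1_def x2_def field_simps)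
 obtain c0 where c0: "0 < c0" "!!x. x1 <= x ==> x <= x2 ==> c0 <= cos x" using cos_lower[OF x12(1,4)] by blast
 obtain A where A: "0 < A" "\<forall>x\<in>{-10..10}. \<forall>y\<in>{-10..10}. \<bar>G x - G y\<bar> <= A * \<bar>x - y\<bar>" using G_lip by blast
 have "(%s. ft q s) \<midarrow>0\<rightarrow> ft q 0" using DERIV_isCont[OF ft_deriv[OF q(1)]] by (simp add: isCont_def)
 then have "(%s. ft q s) \<midarrow>0\<rightarrow> tL" using q by simp
 from tendstoD[OF this, of "min (tL - x1) (x2 - tL)"] x12
 have "eventually (%s. dist (ft q s) tL < min (tL - x1) (x2 - tL)) (at 0)" by simp
 then obtain d where d: "0 < d" "!!s. s ~= 0 ==> \<bar>s\<bar> < d ==> dist (ft q s) tL < min (tL - x1) (x2 - tL)"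
  unfolding eventually_at by (auto simp: dist_real_def)
 have near: "x1 <= ft q s" "ft q s <= x2" if "\<bar>s\<bar> < d" for s
 proof -
  have "dist (ft q s) tL < min (tL - x1) (x2 - tL)"
   using d(2)[of s] that q x12 by (cases "s = 0") auto
  then show "x1 <= ft q s" "ft q s <= x2" by (auto simp: dist_real_def abs_less_iff)
 qed
 define B where "B = sqrt (2 * WM) / c0"
 define N where "N = 2 + (A + 3 * wM + B) / c0"
 \<comment> \<open>G is Lipschitz and vanishes at tL, so \<open>dw_bound\<close> makes the
   derivative of this pair at most N times its norm; it starts at 0 and stays there.\<close>
 define f where "f s = (ft q s - tL, fw q s)" for s
 define f' where "f' s = (fw q s * c (ft q s), dw (flow q s))" for s
 have B: "B \<ge> 0" unfolding B_def using WM(1) c0 by simp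
 have der: "(f has_vector_derivative f' s) (at s)" for s
  unfolding f_def f'_def
  by (rule has_vector_derivative_Pair; unfold has_real_derivative_iff_has_vector_derivative[symmetric])
    (rule derivative_eq_intros ft_deriv[OF q(1)] fw_deriv[OF q(1)] refl | simp)+
 have bound: "norm (f' s) <= N * norm (f s)" if s: "\<bar>s\<bar> < d" for s
 proof -
  have th: "ft q s \<in> {-10..10}" "tL \<in> {-10..10}" using near[OF s] x12 pi_less_4 by auto
  have cc: "c0 <= cos (ft q s)" by (rule c0(2)[OF near[OF s]])
  have v: "\<bar>fv q s\<bar> <= B" unfolding B_def by (rule P1_v_bound(1)[OF flow_in[OF q(1)] c0(1) cc])
  have f1: "\<bar>ft q s - tL\<bar> <= norm (f s)" "\<bar>fw q s\<bar> <= norm (f s)"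
   using norm_fst_le[of "ft q s - tL" "fw q s"] norm_snd_le[of "fw q s" "ft q s - tL"] by (auto simp: f_def)
  have "\<bar>G (ft q s)\<bar> <= A * \<bar>ft q s - tL\<bar>" using A(2)[rule_format, OF th] u(3) by simp
  also have "\<dots> <= A * norm (f s)" using A(1) f1 by (intro mult_left_mono) auto
  finally have g: "\<bar>G (ft q s)\<bar> <= A * norm (f s)" .
  have "\<bar>dw (flow q s)\<bar> <= (\<bar>G (ft q s)\<bar> + (3 * wM + B) * \<bar>fw q s\<bar>) / c0"
   by (rule dw_bound[OF flow_in[OF q(1)] c0(1) cc v])
  also have "\<dots> <= (A * norm (f s) + (3 * wM + B) * norm (f s)) / c0"
   using g f1 wM_nonneg B c0 by (intro divide_right_mono add_mono mult_left_mono) auto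
  also have "\<dots> = (A + 3 * wM + B) / c0 * norm (f s)" by (simp add: algebra_simps)
  finally have d1: "\<bar>dw (flow q s)\<bar> <= (A + 3 * wM + B) / c0 * norm (f s)" .
  have "\<bar>fw q s * c (ft q s)\<bar> <= norm (f s) * 2"
   unfolding abs_mult using f1 c_bounds[of "ft q s"] by (intro mult_mono) auto
  then show ?thesis
   using norm_Pair_le[of "fw q s * c (ft q s)" "dw (flow q s)"] d1 unfolding f'_def N_def by (simp add: distrib_right)
 qed
 have f0: "f 0 = 0" using q by (simp add: f_def zero_prod_def)
 have z: "fw q s = 0" if s: "\<bar>s\<bar> <= d / 2" for s
 proof -
  have "norm (f s) <= exp (N * \<bar>s\<bar>) * norm (f 0)"
  proof (cases "0 <= s")
   case True
   have "norm (f s) <= exp (N * (s - 0)) * norm (f 0)"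
    by (rule norm_growth(1)[OF True der bound]) (use d s in auto)
   then show ?thesis using True by simp
  next
   case False
   then have s0: "s <= 0" by simp
   have "norm (f s) <= exp (N * (0 - s)) * norm (f 0)"
    by (rule norm_growth(2)[OF s0 der bound]) (use d s s0 in auto)
   then show ?thesis using s0 by simp
  qed
  then have "f s = 0" using f0 by simp
  then show ?thesis by (simp add: f_def zero_prod_def)
 qed
 show thesis
 proof (rule that[of "d / 2"])
  show "fw p s = 0" if "\<bar>s - u\<bar> <= d / 2" for s
   using z[OF that] flow_flow[OF p, of u "s - u"] by (simp add: q_def)
 qed (use d in simp)
qed

lemma ft_strict_mono:
 assumes p: "p \<in> P1" and w: "!!x. s < x ==> x < t ==> 0 < fw p x" and st: "s < t"
 shows "ft p s < ft p t"
proof (rule DERIV_pos_imp_increasing_open[OF st])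
 show "EX y. ((%t. ft p t) has_real_derivative y) (at x) & 0 < y" if "s < x" "x < t" for x
  using ft_deriv[OF p, of x] w[OF that] c_pos[of "ft p x"] by (intro exI[of _ "fw p x * c (ft p x)"]) simp
qed (rule cont_f[OF p])

lemma ft_strict_antimono:
 assumes p: "p \<in> P1" and w: "!!x. s < x ==> x < t ==> fw p x < 0" and st: "s < t"
 shows "ft p t < ft p s"
proof (rule DERIV_neg_imp_decreasing_open[OF st])
 show "EX y. ((%t. ft p t) has_real_derivative y) (at x) & y < 0" if "s < x" "x < t" for x
  using ft_deriv[OF p, of x] w[OF that] c_pos[of "ft p x"]
  by (intro exI[of _ "fw p x * c (ft p x)"]) (simp add: mult_neg_pos)
qed (rule cont_f[OF p])

text \<open>\<theta> is monotone and bounded, hence convergent, and by \<open>barbalat_flow\<close>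
  its limit is a zero of G.\<close>

lemma ft_increasing_limit:
 assumes p: "p \<in> P1" and w: "!!s. 0 <= s ==> 0 < fw p s" and b: "!!s. 0 <= s ==> ft p s <= b"
  and ab: "- (pi/2) <= th p" "b < pi/2"
 obtains l where "((%t. ft p t) \<longlongrightarrow> l) at_top" "((%t. fw p t) \<longlongrightarrow> 0) at_top" "G l = 0" "th p < l" "l <= b"
  "!!s. 0 <= s ==> ft p s < l"
proof -
 have mono: "ft p s < ft p t" if "0 <= s" "s < t" for s t
  by (rule ft_strict_mono[OF p _ that(2)]) (use w that in auto)
 obtain l where l: "((%t. ft p t) \<longlongrightarrow> l) at_top" "!!t. 0 <= t ==> ft p t <= l" "l <= b"
 proof (rule mono_bounded_limit[of 0 "%t. ft p t" b])
  show "ft p s <= ft p t" if "0 <= s" "s <= t" for s t using mono[of s t] that by (cases "s = t") auto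
 qed (use b in auto)
 have lt: "ft p s < l" if "0 <= s" for s using mono[of s "s + 1"] l(2)[of "s + 1"] that by auto
 \<comment> \<open>The start may lie on \<theta> = - \<pi>/2, where r and v are not controlled by
   energy. From time 1 on \<theta> stays in a compact part of the open interval.\<close>
 define q where "q = flow p 1"
 have q: "q \<in> P1" "th q = ft p 1" using p by (auto simp: q_def)
 have qs: "flow q t = flow p (1 + t)" for t using flow_flow[OF p] by (simp add: q_def)
 have q1: "- (pi/2) < th q" using mono[of 0 1] ab p q by simp
 obtain c0 where c0: "0 < c0" "!!x. th q <= x ==> x <= b ==> c0 <= cos x" using cos_lower[OF q1 ab(2)] by blast
 have in': "th q <= ft q t" "ft q t <= b" if "0 <= t" for t
  using mono[of 1 "1 + t"] b[of "1 + t"] that q qs by (cases "t = 0"; auto)+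
 have N: "norm (flow q t) <= WM / c0^2 + sqrt (2 * WM) / c0 + pi/2 + wM" if "0 <= t" for t
  by (rule P1_norm_bound[OF flow_in[OF q(1)] q1 ab(2) c0(1) c0(2) in'[OF that]]) (use in'[OF that] in auto)
 have sh: "((%t. f (flow q t)) \<longlongrightarrow> k) at_top \<longleftrightarrow> ((%t. f (flow p t)) \<longlongrightarrow> k) at_top" for f :: "state => real" and k
  unfolding qs by (rule tendsto_at_top_shift[of "%t. f (flow p t)"])
 have fl: "((%t. ft q t) \<longlongrightarrow> l) at_top" using l(1) sh[of th l] by simp
 have fw: "((%t. fw q t) \<longlongrightarrow> 0) at_top" by (rule barbalat_flow(1)[OF q(1) N fl])
 have "((%t. G (ft q t)) \<longlongrightarrow> 0) at_top" by (rule barbalat_flow(3)[OF q(1) N fw])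
 moreover have "((%t. G (ft q t)) \<longlongrightarrow> G l) at_top"
  by (rule continuous_on_tendsto_compose[OF cont_G fl]) auto
 ultimately have "G l = 0" using tendsto_unique trivial_limit_at_top_linorder by blast
 with that l(1,3) fw sh[of ww 0] lt[of 0] lt p show thesis by simp
qed

end

section \<open>Possible fates of an orbit that moves towards a critical point\<close>

context shape
begin

text \<open>If w stays positive, \<theta> either reaches tL or increases to a zero of G, which can
  only be tL. Otherwise the first zero of w lies before tL, which is a turn, or past it.\<close>

lemma trichotomy:
 assumes p: "p \<in> P1" and a: "- (pi/2) <= a" "a <= th p" "th p < tL" "tL < pi/2" and w: "0 < ww p"
  and Gneg: "!!x. a < x ==> x < tL ==> G x < 0" and GL: "G tL = 0"
 shows "(\<exists>t>0. ft p t = tL & (\<forall>s\<in>{0..t}. 0 < fw p s)) |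
  (\<exists>u>0. fw p u = 0 & th p < ft p u & ft p u < tL & (\<forall>s\<in>{0..<u}. 0 < fw p s)) |
  ((\<forall>s\<ge>0. 0 < fw p s & ft p s < tL) & ((%t. ft p t) \<longlongrightarrow> tL) at_top & ((%t. fw p t) \<longlongrightarrow> 0) at_top)"
proof (cases "\<forall>s\<ge>0. 0 < fw p s")
 case True
 show ?thesis
 proof (cases "\<exists>s\<ge>0. tL <= ft p s")
  case T: True
  then obtain s where s: "0 <= s" "tL <= ft p s" by blast
  obtain t where t: "0 <= t" "t <= s" "ft p t = tL"
   using IVT'[of "%t. ft p t" 0 tL s] s cont_f(3)[OF p] p a by auto
  have "t ~= 0" using t p a by auto
  then show ?thesis using t True by (intro disjI1 exI[of _ t]) auto
 next
  case F: False
  then have lt: "ft p s < tL" if "0 <= s" for s using that by (meson not_less)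
  obtain l where l: "((%t. ft p t) \<longlongrightarrow> l) at_top" "((%t. fw p t) \<longlongrightarrow> 0) at_top" "G l = 0" "th p < l" "l <= tL"
  proof (rule ft_increasing_limit[OF p, of tL])
   show "0 < fw p s" if "0 <= s" for s using True that by simp
   show "ft p s <= tL" if "0 <= s" for s using lt[OF that] by simp
  qed (use a in auto)
  have "l = tL" using Gneg[of l] l(3-5) a by (cases "l = tL") auto
  then show ?thesis using l lt True by auto
 qed
next
 case False
 then obtain s0 where s0: "0 <= s0" "fw p s0 <= 0" by (meson not_less)
 obtain u where u: "0 < u" "u <= s0" "fw p u = 0" "!!s. 0 <= s ==> s < u ==> 0 < fw p s"
  using first_time[OF s0(1) cont_f(4)[OF p], of 0] s0 w p by auto
 have mono: "ft p 0 < ft p u" by (rule ft_strict_mono[OF p]) (use u in auto)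
 consider "ft p u < tL" | "ft p u = tL" | "tL < ft p u" by linarith
 then show ?thesis
 proof cases
  case 1 then show ?thesis using u mono p by (intro disjI2 disjI1 exI[of _ u]) auto
 next
  case 2
  \<comment> \<open>At tL itself w would vanish on a whole interval, also before its first
    zero.\<close>
  obtain d where d: "0 < d" "!!s. \<bar>s - u\<bar> <= d ==> fw p s = 0"
   using homothetic[OF p u(3) 2 GL] a by auto
  define s where "s = max 0 (u - d)"
  have "0 <= s" "s < u" "\<bar>s - u\<bar> <= d" using d u by (auto simp: s_def)
  then show ?thesis using d(2)[of s] u(4)[of s] by auto
 next
  case 3
  obtain t where t: "0 <= t" "t <= u" "ft p t = tL"
   using IVT'[of "%t. ft p t" 0 tL u] u 3 cont_f(3)[OF p] p a by auto
  have "t ~= 0" "t ~= u" using t p a 3 by auto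
  then show ?thesis using t u by (intro disjI1 exI[of _ t]) auto
 qed
qed

lemma w_at_collision: "x \<in> P1 ==> cos (th x) = 0 ==> ww x ~= 0"
 using W_pos[rule_format, of "th x"] unfolding P1_iff En_def by auto

text \<open>The bound is uniform up to the collision line although v is unbounded there, since in
  \<open>dw_cos\<close> v occurs only through v cos, which energy bounds.\<close>

lemma turn_rate:
 assumes "\<theta>1 < - ts"
 shows "\<exists>\<epsilon>>0. \<exists>\<eta>>0. \<forall>x\<in>P1. - (pi/2) <= th x --> th x <= \<theta>1 --> \<bar>ww x\<bar> <= \<epsilon> --> dw x <= - \<eta>"
proof (cases "- (pi/2) <= \<theta>1")
 case False
 then show ?thesis by (intro exI[of _ "1::real"] conjI) auto
next
 case le: True
 have "\<exists>x\<in>{- (pi/2)..\<theta>1}. \<forall>y\<in>{- (pi/2)..\<theta>1}. G y <= G x"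
  by (rule continuous_attains_sup) (use le continuous_on_subset[OF cont_G] in auto)
 then obtain x0 where x0: "x0 \<in> {- (pi/2)..\<theta>1}" "!!y. y \<in> {- (pi/2)..\<theta>1} ==> G y <= G x0" by blast
 define m where "m = - G x0"
 have m: "0 < m" "!!y. - (pi/2) <= y ==> y <= \<theta>1 ==> G y <= - m"
  using x0 G_neg_outer[of x0] assms by (auto simp: m_def)
 define vM where "vM = sqrt (2 * WM)"
 have vM: "0 <= vM" using WM(1) by (simp add: vM_def)
 \<comment> \<open>K dominates the coefficients of the three terms of \<open>dw_cos\<close> that
   carry w; \<epsilon> makes their sum at most half of m.\<close>
 define K where "K = 3 * wM + vM + 1"
 have K: "0 < K" using vM wM_nonneg by (simp add: K_def)
 define \<epsilon> where "\<epsilon> = m / (2 * K)"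
 have \<epsilon>: "0 < \<epsilon>" "K * \<epsilon> = m / 2" using m K by (auto simp: \<epsilon>_def)
 have "\<forall>x\<in>P1. - (pi/2) <= th x --> th x <= \<theta>1 --> \<bar>ww x\<bar> <= \<epsilon> --> dw x <= - (m/2)"
 proof (intro ballI impI)
  fix x assume x: "x \<in> P1" and th: "- (pi/2) <= th x" "th x <= \<theta>1" and w: "\<bar>ww x\<bar> <= \<epsilon>"
  have w': "\<bar>ww x\<bar> <= wM" by (rule P1_bounds(6)[OF x])
  have cos0: "0 <= cos (th x)" using th assms ts_range by (intro cos_ge_zero) auto
  have "(vv x * cos (th x))^2 <= 2 * WM" using P1_bounds(7)[OF x] by (simp add: power_mult_distrib)
  then have vc: "\<bar>vv x * cos (th x)\<bar> <= vM" unfolding vM_def by (simp add: real_le_rsqrt)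
  have 1: "\<bar>(ww x)^2 * c (th x) * sin (th x)\<bar> <= 2 * wM * \<epsilon>"
  proof -
   have "\<bar>(ww x)^2 * c (th x) * sin (th x)\<bar> = \<bar>ww x\<bar> * (\<bar>ww x\<bar> * (\<bar>c (th x)\<bar> * \<bar>sin (th x)\<bar>))"
    by (simp add: power2_eq_square abs_mult mult_ac)
   also have "\<dots> <= \<epsilon> * (wM * (2 * 1))"
    using w w' wM_nonneg c_bounds[of "th x"] \<epsilon> by (intro mult_mono) auto
   finally show ?thesis by (simp add: mult_ac)
  qed
  have 2: "\<bar>(1/2) * vv x * ww x * (cos (th x))^3\<bar> <= vM * \<epsilon>"
  proof -
   have "\<bar>(1/2) * vv x * ww x * (cos (th x))^3\<bar> = (1/2) * (\<bar>vv x * cos (th x)\<bar> * (\<bar>ww x\<bar> * \<bar>(cos (th x))^2\<bar>))"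
    by (simp add: abs_mult mult_ac power2_eq_square power3_eq_cube)
   also have "\<dots> <= 1 * (vM * (\<epsilon> * 1))"
    using vc w \<epsilon> vM by (intro mult_mono) (auto simp: abs_square_le_1)
   finally show ?thesis by simp
  qed
  have 3: "\<bar>(1/2) * (ww x)^2 * deriv c (th x) * cos (th x)\<bar> <= wM * \<epsilon>"
  proof -
   have "\<bar>(1/2) * (ww x)^2 * deriv c (th x) * cos (th x)\<bar> = (1/2) * (\<bar>ww x\<bar> * (\<bar>ww x\<bar> * (\<bar>deriv c (th x)\<bar> * \<bar>cos (th x)\<bar>)))"
    by (simp add: power2_eq_square abs_mult mult_ac)
   also have "\<dots> <= 1 * (wM * (\<epsilon> * (1 * 1)))"
    using w w' wM_nonneg dc_bound[of "th x"] \<epsilon> by (intro mult_mono) auto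
   finally show ?thesis by (simp add: mult_ac)
  qed
  have "cos (th x) * dw x <= - m + (3 * wM + vM) * \<epsilon>"
   unfolding dw_cos[OF x] distrib_right using 1 2 3 m(2)[OF th] by linarith
  also have "\<dots> <= - m + K * \<epsilon>" unfolding K_def using \<epsilon>(1) by (simp add: distrib_right)
  finally have le: "cos (th x) * dw x <= - (m / 2)" using \<epsilon>(2) by simp
  then have "cos (th x) * dw x < 0" using m(1) by linarith
  then have "dw x < 0" using cos0 by (simp add: mult_less_0_iff)
  \<comment> \<open>\<open>dw x\<close> is negative, so replacing the factor cos <= 1 by 1 only
    lowers the product.\<close>
  then have "1 * dw x <= cos (th x) * dw x" using cos_le_one by (intro mult_right_mono_neg) auto
  then show "dw x <= - (m / 2)" using le by simp
 qed
 moreover have "0 < m/2" using m by simp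
 ultimately show ?thesis using \<epsilon>(1) by blast
qed

text \<open>The time bound does not depend on p: within T1 the velocity w falls to - \<epsilon>, and
  from then on \<theta> decreases at a definite rate. Uniformity is what \<open>far_return\<close>
  needs, where r has to stay large during the whole excursion.\<close>

lemma return_time:
 assumes "\<theta>1 < - ts"
 shows "\<exists>T>0. \<forall>p\<in>P1. - (pi/2) < th p --> th p <= \<theta>1 --> ww p <= 0 -->
  (\<exists>t>0. t <= T & ft p t = - (pi/2) & fw p t < 0 & (ALL s. 0 < s --> s <= t --> fw p s < 0) &
   (ALL s. 0 <= s --> s < t --> - (pi/2) < ft p s & ft p s <= th p))"
proof -
 obtain \<epsilon> \<eta> where e: "0 < \<epsilon>" "0 < \<eta>"
  "\<forall>x\<in>P1. - (pi/2) <= th x --> th x <= \<theta>1 --> \<bar>ww x\<bar> <= \<epsilon> --> dw x <= - \<eta>"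
  using turn_rate[OF assms] by blast
 define T1 where "T1 = \<epsilon> / \<eta>"
 \<comment> \<open>Since c >= 1/4, after T1 the angle falls at least at rate \<epsilon> / 4, hence
   by more than |\<theta>1| + \<pi> before T, past - \<pi>/2.\<close>
 define T where "T = T1 + 4 * (\<bar>\<theta>1\<bar> + pi) / \<epsilon> + 1"
 have T1: "0 < T1" using e by (simp add: T1_def)
 have T: "T1 < T" "4 * (\<bar>\<theta>1\<bar> + pi) / \<epsilon> < T - T1" using e by (auto simp: T_def intro!: add_nonneg_pos)
 show ?thesis
 proof (rule exI[of _ T], intro conjI ballI impI)
  show "0 < T" using T T1 by simp
  fix p assume p: "p \<in> P1" and th: "- (pi/2) < th p" "th p <= \<theta>1" and w: "ww p <= 0"
  have neg: "fw p s < 0" if ab: "!!x. 0 <= x ==> x <= b ==> - (pi/2) <= ft p x" and s: "0 < s" "s <= b" for b s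
  proof (rule stays_below[of "%s. fw p s" 0 0 b "%s. dw (flow p s)"])
   fix s assume s: "0 <= s" "s <= b" "fw p s = 0" and lt: "!!x. 0 < x ==> x < s ==> fw p x < 0"
   have "ft p s <= th p"
    using ft_strict_antimono[OF p, of 0 s] lt s p by (cases "s = 0") auto
   then have "dw (flow p s) <= - \<eta>"
    using e(3)[rule_format, OF flow_in[OF p], of s] ab[of s] s e(1) th by auto
   then show "dw (flow p s) < 0" using e(2) by simp
  qed (use w p s fw_deriv[OF p] in auto)
  have anti: "ft p s <= th p" if ab: "!!x. 0 <= x ==> x <= s ==> - (pi/2) <= ft p x" and s: "0 <= s" for s
   using ft_strict_antimono[OF p, of 0 s] neg[of s] ab s p by (cases "s = 0") auto
  have "EX s. 0 <= s & s <= T & ft p s <= - (pi/2)"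
  proof (rule ccontr)
   assume n: "~ ?thesis"
   then have ab: "- (pi/2) < ft p s" if "0 <= s" "s <= T" for s using that by (meson not_less)
   have ab': "- (pi/2) <= ft p s" if "0 <= s" "s <= T" for s using ab[OF that] by simp
   have le: "ft p s <= \<theta>1" if "0 <= s" "s <= T" for s using anti[of s] ab' that th by fastforce
   have rate: "dw (flow p s) <= - \<eta>" if "0 <= s" "s <= T" "\<bar>fw p s\<bar> <= \<epsilon>" for s
    using e(3)[rule_format, OF flow_in[OF p] ab'[OF that(1,2)] le[OF that(1,2)] that(3)] .
   have wle: "fw p s <= 0" if "0 <= s" "s <= T" for s
    using neg[of T s] ab' that w p by (cases "s = 0") auto
   have "EX s. 0 <= s & s <= T1 & fw p s <= - \<epsilon>"
   proof (rule ccontr)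
    assume "~ ?thesis"
    then have g: "- \<epsilon> < fw p s" if "0 <= s" "s <= T1" for s using that by (meson not_less)
    have "fw p T1 <= fw p 0 + (- \<eta>) * (T1 - 0)"
    proof (rule deriv_upper[of 0 T1 "%s. fw p s" "%s. dw (flow p s)"])
     show "dw (flow p s) <= - \<eta>" if "0 <= s" "s <= T1" for s
      using rate[of s] g[OF that] wle[of s] that T by auto
    qed (use T1 fw_deriv[OF p] in auto)
    also have "\<dots> <= - \<epsilon>" using w p e by (simp add: T1_def)
    finally show False using g[of T1] T1 by simp
   qed
   then obtain s1 where s1: "0 <= s1" "s1 <= T1" "fw p s1 <= - \<epsilon>" by blast
   have b: "fw p s < - \<epsilon>" if "s1 < s" "s <= T" for s
   proof (rule stays_below[OF s1(3) fw_deriv[OF p] _ that])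
    show "dw (flow p s) < 0" if "s1 <= s" "s <= T" "fw p s = - \<epsilon>" for s
     using rate[of s] that s1 e by auto
   qed
   have "ft p T <= ft p s1 + (- (\<epsilon> / 4)) * (T - s1)"
   proof (rule deriv_upper[of s1 T "%s. ft p s" "%s. fw p s * c (ft p s)"])
    show "fw p s * c (ft p s) <= - (\<epsilon> / 4)" if s: "s1 <= s" "s <= T" for s
    proof -
     have "fw p s <= - \<epsilon>" using b[of s] s s1 by (cases "s = s1") auto
     then have "\<epsilon> * (1/4) <= (- fw p s) * c (ft p s)" using c_bounds[of "ft p s"] e by (intro mult_mono) auto
     then show ?thesis by simp
    qed
   qed (use s1 T ft_deriv[OF p] in auto)
   also have "\<dots> <= \<theta>1 - (\<epsilon> / 4) * (T - T1)"
   proof -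
    have "(\<epsilon> / 4) * (T - T1) <= (\<epsilon> / 4) * (T - s1)" using s1 e by (intro mult_left_mono) auto
    then show ?thesis using le[of s1] s1 T by linarith
   qed
   finally have "ft p T <= \<theta>1 - (\<epsilon> / 4) * (T - T1)" .
   moreover have "(\<epsilon> / 4) * (4 * (\<bar>\<theta>1\<bar> + pi) / \<epsilon>) < (\<epsilon> / 4) * (T - T1)" using T e by (intro mult_strict_left_mono) auto
   moreover have "(\<epsilon> / 4) * (4 * (\<bar>\<theta>1\<bar> + pi) / \<epsilon>) = \<bar>\<theta>1\<bar> + pi" using e by simp
   ultimately have "ft p T < \<theta>1 - (\<bar>\<theta>1\<bar> + pi)" by linarith
   then have "ft p T < - (pi/2)" using pi_gt_zero by linarith
   then show False using ab[of T] T T1 by simp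
  qed
  then obtain s where s: "0 <= s" "s <= T" "ft p s <= - (pi/2)" by blast
  obtain t where t: "0 < t" "t <= s" "ft p t = - (pi/2)" "!!x. 0 <= x ==> x < t ==> - (pi/2) < ft p x"
   using first_time[OF s(1) cont_f(3)[OF p], of "- (pi/2)"] s th p by auto
  have wn: "fw p x < 0" if "0 < x" "x <= t" for x
   by (rule neg[of t]) (use t that in \<open>metis less_eq_real_def\<close>, use that in auto)
  show "\<exists>t>0. t <= T & ft p t = - (pi/2) & fw p t < 0 & (ALL s. 0 < s --> s <= t --> fw p s < 0) &
   (ALL s. 0 <= s --> s < t --> - (pi/2) < ft p s & ft p s <= th p)"
  proof (intro exI[of _ t] conjI allI impI)
   show "ft p x <= th p" if "0 <= x" "x < t" for x
    by (rule anti) (use t(4) that in \<open>auto simp: less_imp_le\<close>)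
  qed (use t s wn in auto)
 qed
qed

text \<open>G > 0 beyond ts, so w cannot vanish. It cannot approach 0 either: the mirror image of
  \<open>turn_rate\<close> keeps it above a positive constant, and \<theta> has to reach \<pi>/2.
  This also holds for r = 0.\<close>

lemma pass_right:
 assumes p: "p \<in> P1" and th: "ts <= th p" "th p < pi/2" and w: "0 < ww p"
 shows "\<exists>t>0. ft p t = pi/2 & (\<forall>s\<in>{0..t}. 0 < fw p s)"
proof -
 have pos: "0 < fw p s" if ab: "!!x. 0 <= x ==> x <= b ==> ft p x <= pi/2" and s: "0 < s" "s <= b" for b s
 proof (rule stays_above[of 0 "%s. fw p s" 0 b "%s. dw (flow p s)"])
  fix s assume s: "0 <= s" "s <= b" "fw p s = 0" and lt: "!!x. 0 < x ==> x < s ==> 0 < fw p x"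
  have s0: "s ~= 0" using s w p by auto
  then have "th p < ft p s" using ft_strict_mono[OF p, of 0 s] lt s p by auto
  moreover have "cos (ft p s) ~= 0" using w_at_collision[OF flow_in[OF p], of s] s by auto
  then have "ft p s ~= pi/2" using cos_pi_half by metis
  then have "ft p s < pi/2" using ab[of s] s by auto
  ultimately have "sgn (dw (flow p s)) = sgn (G (ft p s))" "G (ft p s) > 0"
   using dw_at_rest[OF flow_in[OF p] s(3)] th ts_range G_outer[of "ft p s"] by auto
  then show "0 < dw (flow p s)" by (metis sgn_greater)
 qed (use w p s fw_deriv[OF p] in auto)
 have "EX s. 0 <= s & pi/2 <= ft p s"
 proof (rule ccontr)
  assume n: "~ ?thesis"
  then have ab: "ft p s < pi/2" if "0 <= s" for s using that by (meson not_less)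
  have pos': "0 < fw p s" if "0 <= s" for s
   using pos[of s s] ab that w p by (cases "s = 0") (auto simp: less_imp_le)
  define \<theta>1 where "\<theta>1 = ft p 1"
  have \<theta>1: "ts < \<theta>1" using ft_strict_mono[OF p, of 0 1] pos' th p by (auto simp: \<theta>1_def)
  have ge: "\<theta>1 <= ft p s" if "1 <= s" for s
   using ft_strict_mono[OF p, of 1 s] pos' that by (cases "s = 1") (auto simp: \<theta>1_def)
  obtain \<epsilon> \<eta> where e: "0 < \<epsilon>" "0 < \<eta>"
   "\<forall>x\<in>P1. - (pi/2) <= th x --> th x <= - \<theta>1 --> \<bar>ww x\<bar> <= \<epsilon> --> dw x <= - \<eta>"
   using turn_rate[of "- \<theta>1"] \<theta>1 by auto
  have rate: "\<eta> <= dw (flow p s)" if "1 <= s" "\<bar>fw p s\<bar> <= \<epsilon>" for s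
  proof -
   have "dw (Mi (flow p s)) <= - \<eta>" using e(3)[rule_format, OF sym_P1(2)[OF flow_in[OF p]], of s] ge[of s] ab[of s] that by auto
   moreover have "dw (Mi (flow p s)) = - dw (flow p s)" by (simp add: dw_def dW_sym dc_sym)
   ultimately show ?thesis by simp
  qed
  define k where "k = min (fw p 1) \<epsilon>"
  have k: "0 < k" "k <= \<epsilon>" using pos'[of 1] e by (auto simp: k_def)
  have ka: "k <= fw p s" if "1 <= s" for s
  proof (cases "s = 1")
   case False
   have "k < fw p s"
   proof (rule stays_above[of k "%s. fw p s" 1 s "%s. dw (flow p s)"])
    show "0 < dw (flow p x)" if "1 <= x" "fw p x = k" for x using rate[of x] that k e by auto
   qed (use False that fw_deriv[OF p] in \<open>auto simp: k_def\<close>)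
   then show ?thesis by simp
  qed (simp add: k_def)
  define T where "T = 1 + 4 * pi / k"
  have T: "1 <= T" using k by (simp add: T_def)
  have "ft p 1 + (k / 4) * (T - 1) <= ft p T"
  proof (rule deriv_lower[of 1 T "%s. ft p s" "%s. fw p s * c (ft p s)"])
   show "k / 4 <= fw p s * c (ft p s)" if "1 <= s" for s
   proof -
    have "k * (1/4) <= fw p s * c (ft p s)" using ka[OF that] k c_bounds[of "ft p s"] by (intro mult_mono) auto
    then show ?thesis by simp
   qed
  qed (use T ft_deriv[OF p] in auto)
  then have "ft p 1 + pi <= ft p T" using k by (simp add: T_def)
  then show False using ab[of T] \<theta>1 T ts_range by (auto simp: \<theta>1_def)
 qed
 then obtain s where s: "0 <= s" "pi/2 <= ft p s" by blast
 obtain t where t: "0 < t" "t <= s" "- ft p t = - (pi/2)" "!!x. 0 <= x ==> x < t ==> - (pi/2) < - ft p x"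
  using first_time[OF s(1) continuous_on_minus[OF cont_f(3)[OF p]], of "- (pi/2)"] s th p by auto
 have "0 < fw p x" if "0 <= x" "x <= t" for x
 proof (cases "x = 0")
  case False
  show ?thesis
  proof (rule pos[of t])
   show "ft p y <= pi/2" if "0 <= y" "y <= t" for y using t(3) t(4)[of y] that by (cases "y = t") auto
  qed (use False that in auto)
 qed (use w p in auto)
 then show ?thesis using t by (intro exI[of _ t]) auto
qed

end

lemma eventually_at_top_obtain:
 assumes "eventually P (at_top :: real filter)"
 obtains T where "!!t. T <= t ==> P t"
 using assms unfolding eventually_at_top_linorder by blast

context shape
begin

lemma isCont_c: "isCont c x" and isCont_W: "isCont W x" and isCont_G: "isCont G x"
 using cont_c cont_W cont_G by (auto simp: continuous_on_eq_continuous_at)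

lemma sum_limit:
 assumes p: "p \<in> P1" and l: "((%t. ft p t) \<longlongrightarrow> \<theta>l) F" "((%t. fw p t) \<longlongrightarrow> 0) F" "- (pi/2) < \<theta>l" "\<theta>l < pi/2"
 shows "((%t. (fv p t)^2 + 2 * fr p t) \<longlongrightarrow> 2 * V \<theta>l) F"
proof -
 have c0: "0 < cos \<theta>l" using cos_pos l by simp
 have "((%t. (2 * W (ft p t) - (fw p t)^2 * c (ft p t)) / (cos (ft p t))^2) \<longlongrightarrow> (2 * W \<theta>l - 0^2 * c \<theta>l) / (cos \<theta>l)^2) F"
  by (intro tendsto_intros isCont_tendsto_compose[OF isCont_W] isCont_tendsto_compose[OF isCont_c] l) (use c0 in auto)
 moreover have "(2 * W \<theta>l - 0^2 * c \<theta>l) / (cos \<theta>l)^2 = 2 * V \<theta>l" using W_V[OF l(3,4)] c0 by simp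
 moreover have "eventually (%t. (2 * W (ft p t) - (fw p t)^2 * c (ft p t)) / (cos (ft p t))^2 = (fv p t)^2 + 2 * fr p t) F"
 proof -
  have "((%t. cos (ft p t)) \<longlongrightarrow> cos \<theta>l) F" by (intro tendsto_intros l)
  then have "eventually (%t. 0 < cos (ft p t)) F" using c0 by (rule order_tendstoD(1))
  then show ?thesis
  proof eventually_elim
   case (elim t)
   have "2 * W (ft p t) - (fw p t)^2 * c (ft p t) = ((fv p t)^2 + 2 * fr p t) * (cos (ft p t))^2"
    using energy[OF p, of t] by (simp add: algebra_simps)
   then show ?case using elim by simp
  qed
 qed
 ultimately show ?thesis by (simp add: Lim_transform_eventually)
qed

text \<open>In the limit v^2 + 2 r tends to 2 V(\<theta>l), and v' is close to - r cos^2. If v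
  stayed nonnegative, r would not decrease and v would fall without bound. Once negative, v remains
  so, r decreases, and a positive limit of r would again drive v to - infinity.\<close>

lemma collapse:
 assumes p: "p \<in> P1" "0 < rr p"
  and l: "((%t. ft p t) \<longlongrightarrow> \<theta>l) at_top" "((%t. fw p t) \<longlongrightarrow> 0) at_top" "- (pi/2) < \<theta>l" "\<theta>l < pi/2"
 shows "((%t. fr p t) \<longlongrightarrow> 0) at_top" "((%t. fv p t) \<longlongrightarrow> - sqrt (2 * V \<theta>l)) at_top"
proof -
 have c0: "0 < cos \<theta>l" using cos_pos l by simp
 define k where "k = (cos \<theta>l)^2"
 define E where "E = V \<theta>l"
 have k: "0 < k" using c0 by (simp add: k_def)
 have E: "0 < E" using V_pos c0 by (simp add: E_def)
 have r: "0 < fr p t" for t using fr_nonneg[OF p(1), of t] fr_pos_iff[OF p(1), of t] p(2) by simp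
 have S: "((%t. (fv p t)^2 + 2 * fr p t) \<longlongrightarrow> 2 * E) at_top" using sum_limit[OF p(1) l] by (simp add: E_def)
 have "((%t. (cos (ft p t))^2) \<longlongrightarrow> k) at_top" unfolding k_def by (intro tendsto_intros l)
 from order_tendstoD(1)[OF this, of "k/2"] have ev1: "eventually (%t. k/2 < (cos (ft p t))^2) at_top" using k by simp
 have ev2: "eventually (%t. E < (fv p t)^2 + 2 * fr p t) at_top" by (rule order_tendstoD(1)[OF S]) (use E in simp)
 have ev2': "eventually (%t. (fv p t)^2 + 2 * fr p t < 3 * E) at_top" by (rule order_tendstoD(2)[OF S]) (use E in simp)
 have "((%t. (1/2) * (fw p t)^2 * c (ft p t)) \<longlongrightarrow> (1/2) * 0^2 * c \<theta>l) at_top"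
  by (intro tendsto_intros isCont_tendsto_compose[OF isCont_c] l)
 then have K0: "((%t. (1/2) * (fw p t)^2 * c (ft p t)) \<longlongrightarrow> 0) at_top" by simp
 have ev3: "eventually (%t. (1/2) * (fw p t)^2 * c (ft p t) < d) at_top" if "0 < d" for d
  using order_tendstoD(2)[OF K0 that] .
 have drop: "\<exists>t\<ge>T. fv p t < - M" if T: "!!t. T <= t ==> (1/2) * (fw p t)^2 * c (ft p t) - fr p t * (cos (ft p t))^2 <= - d" "0 < d" for T d M
 proof -
  define t where "t = T + (\<bar>fv p T\<bar> + \<bar>M\<bar> + 1) / d"
  have t: "T <= t" using that by (auto simp: t_def)
  have "fv p t <= fv p T + (- d) * (t - T)"
   by (rule deriv_upper[OF t fv_deriv[OF p(1)]]) (use T in auto)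
  also have "(- d) * (t - T) = - (\<bar>fv p T\<bar> + \<bar>M\<bar> + 1)" using that by (simp add: t_def)
  finally have "fv p t < - M" by linarith
  then show ?thesis using t by blast
 qed
 have Dv: "(1/2) * (fw p t)^2 * c (ft p t) - fr p t * (cos (ft p t))^2 <= - (\<rho> * k / 4)"
  if "k/2 < (cos (ft p t))^2" "(1/2) * (fw p t)^2 * c (ft p t) < \<rho> * k / 4" "\<rho> <= fr p t" "0 < \<rho>" for t \<rho>
 proof -
  have "\<rho> * (k/2) <= fr p t * (cos (ft p t))^2" using that k by (intro mult_mono) auto
  then show ?thesis using that(2) by linarith
 qed
 have exneg: "\<exists>t\<ge>T. fv p t < 0" for T
 proof (rule ccontr)
  assume "~ ?thesis"
  then have vp: "0 <= fv p t" if "T <= t" for t using that by (meson not_less)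
  have rm: "fr p T <= fr p t" if "T <= t" for t
  proof (rule DERIV_nonneg_imp_nondecreasing[OF that])
   show "EX y. ((%t. fr p t) has_real_derivative y) (at x) & 0 <= y" if "T <= x" for x
    using fr_deriv[OF p(1), of x] vp[OF that] r[of x]
    by (intro exI[of _ "fr p x * fv p x * (cos (ft p x))^2"]) auto
  qed
  have d0: "0 < fr p T * k / 4" using r k by simp
  from eventually_conj[OF ev1 eventually_conj[OF ev3[OF d0] eventually_ge_at_top[of T]]]
  obtain T' where T': "!!t. T' <= t ==> k/2 < (cos (ft p t))^2 & (1/2) * (fw p t)^2 * c (ft p t) < fr p T * k / 4 & T <= t"
   by (rule eventually_at_top_obtain) (rule that)
  have D: "(1/2) * (fw p t)^2 * c (ft p t) - fr p t * (cos (ft p t))^2 <= - (fr p T * k / 4)" if "T' <= t" for t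
   by (rule Dv) (use T'[OF that] rm[of t] r[of T] in auto)
  have "\<exists>t\<ge>T'. fv p t < - 0" by (rule drop[OF D d0])
  then obtain t where "T' <= t" "fv p t < 0" by auto
  then show False using vp[of t] T'[of t] by auto
 qed
 have "0 < E/2 * k / 4" using E k by simp
 from eventually_conj[OF ev1 eventually_conj[OF ev3[OF this] eventually_conj[OF ev2 ev2']]]
 obtain T0 where T0: "!!t. T0 <= t ==> k/2 < (cos (ft p t))^2 & (1/2) * (fw p t)^2 * c (ft p t) < E/2 * k / 4 &
   E < (fv p t)^2 + 2 * fr p t & (fv p t)^2 + 2 * fr p t < 3 * E"
  by (rule eventually_at_top_obtain) (rule that)
 obtain T where T: "T0 <= T" "fv p T < 0" using exneg by blast
 \<comment> \<open>At a zero of v the sum v^2 + 2 r > E gives r > E / 2, so v' < 0 there.\<close>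
 have vneg: "fv p t < 0" if "T <= t" for t
 proof (cases "t = T")
  case False
  show ?thesis
  proof (rule stays_below[of "%t. fv p t" T 0 t])
   show "((%t. fv p t) has_real_derivative (1/2) * (fw p s)^2 * c (ft p s) - fr p s * (cos (ft p s))^2) (at s)" for s
    by (rule fv_deriv[OF p(1)])
   show "(1/2) * (fw p s)^2 * c (ft p s) - fr p s * (cos (ft p s))^2 < 0" if s: "T <= s" "fv p s = 0" for s
   proof -
    have "(1/2) * (fw p s)^2 * c (ft p s) - fr p s * (cos (ft p s))^2 <= - (E/2 * k / 4)"
     by (rule Dv) (use T0[of s] s T E in auto)
    then show ?thesis using \<open>0 < E/2 * k / 4\<close> by linarith
   qed
  qed (use T that False in auto)
 qed (use T in simp)
 have rdec: "fr p t <= fr p s" if "T <= s" "s <= t" for s t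
 proof (rule DERIV_nonpos_imp_nonincreasing[OF that(2)])
  show "EX y. ((%t. fr p t) has_real_derivative y) (at x) & y <= 0" if "s <= x" for x
   using fr_deriv[OF p(1), of x] vneg[of x] r[of x] that \<open>T <= s\<close>
   by (intro exI[of _ "fr p x * fv p x * (cos (ft p x))^2"]) (auto simp: mult_nonneg_nonpos mult_nonneg_nonpos2 less_imp_le)
 qed
 show r0: "((%t. fr p t) \<longlongrightarrow> 0) at_top"
 proof (rule order_tendstoI)
  fix a :: real assume "a < 0"
  then show "eventually (%t. a < fr p t) at_top" using r by (auto intro!: always_eventually less_trans[OF _ r])
 next
  fix a :: real assume a: "0 < a"
  have "\<exists>s\<ge>T. fr p s < a"
  proof (rule ccontr)
   assume "~ ?thesis"
   then have ge: "a <= fr p s" if "T <= s" for s using that by (meson not_less)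
   have "0 < a * k / 4" using a k by simp
   from eventually_conj[OF ev3[OF this] eventually_ge_at_top[of T]]
   obtain T' where T': "!!t. T' <= t ==> (1/2) * (fw p t)^2 * c (ft p t) < a * k / 4 & T <= t"
    by (rule eventually_at_top_obtain) (rule that)
   have D: "(1/2) * (fw p t)^2 * c (ft p t) - fr p t * (cos (ft p t))^2 <= - (a * k / 4)" if "T' <= t" for t
    by (rule Dv) (use T'[OF that] T0[of t] T ge[of t] a in auto)
   have "\<exists>t\<ge>T'. fv p t < - (3 * E + 1)" by (rule drop[OF D \<open>0 < a * k / 4\<close>])
   then obtain t where t: "T' <= t" "fv p t < - (3 * E + 1)" by auto
   then have "(3 * E + 1)^2 < (- fv p t)^2" using E by (intro power_strict_mono) auto
   moreover have "(fv p t)^2 + 2 * fr p t < 3 * E" using T0[of t] T'[OF t(1)] T by auto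
   moreover have "3 * E + 1 <= (3 * E + 1)^2" using E by (simp add: power2_eq_square)
   ultimately show False using r[of t] by (simp only: power2_minus)
  qed
  then obtain s where s: "T <= s" "fr p s < a" by blast
  show "eventually (%t. fr p t < a) at_top" unfolding eventually_at_top_linorder
   using rdec[OF s(1)] s(2) by (intro exI[of _ s]) (meson le_less_trans)
 qed
 have "((%t. (fv p t)^2 + 2 * fr p t - 2 * fr p t) \<longlongrightarrow> 2 * E - 2 * 0) at_top"
  by (intro tendsto_intros S r0)
 then have "((%t. (fv p t)^2) \<longlongrightarrow> 2 * E) at_top" by simp
 then have "((%t. - sqrt ((fv p t)^2)) \<longlongrightarrow> - sqrt (2 * E)) at_top" by (intro tendsto_intros)
 moreover have "eventually (%t. - sqrt ((fv p t)^2) = fv p t) at_top"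
  unfolding eventually_at_top_linorder using vneg by (intro exI[of _ T]) (auto simp: abs_of_neg)
 ultimately show "((%t. fv p t) \<longlongrightarrow> - sqrt (2 * V \<theta>l)) at_top" unfolding E_def by (rule Lim_transform_eventually)
qed

text \<open>On (- ts, 0) G > 0, so w cannot vanish, and only convergence to \<theta> = 0 could
  prevent the exit. Then v tends to - vE by \<open>collapse\<close>, which needs r > 0, and such a v
  acts as negative friction: w no longer decreases, against w tending to 0.\<close>

lemma exit_left:
 assumes p: "p \<in> P1" "0 < rr p" and th: "- ts <= th p" "th p < 0" and w: "0 < ww p"
 shows "\<exists>t>0. ft p t = 0 & (\<forall>s\<in>{0..t}. 0 < fw p s)"
proof -
 have pos: "0 < fw p s" if ab: "!!x. 0 <= x ==> x <= b ==> ft p x <= 0" and s: "0 < s" "s <= b" for b s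
 proof (rule stays_above[of 0 "%s. fw p s" 0 b "%s. dw (flow p s)"])
  fix s assume s: "0 <= s" "s <= b" "fw p s = 0" and lt: "!!x. 0 < x ==> x < s ==> 0 < fw p x"
  have s0: "0 < s" using s w p by (cases "s = 0") auto
  then have gt: "th p < ft p s" using ft_strict_mono[OF p(1), of 0 s] lt s p by auto
  have "ft p s ~= 0"
  proof
   assume z: "ft p s = 0"
   obtain d where d: "0 < d" "!!x. \<bar>x - s\<bar> <= d ==> fw p x = 0"
    using homothetic[OF p(1) s(3) z] by auto
   define x where "x = max (s / 2) (s - d)"
   have "0 < x" "x < s" "\<bar>x - s\<bar> <= d" using d s0 by (auto simp: x_def)
   then show False using d(2)[of x] lt[of x] by auto
  qed
  then have "ft p s < 0" using ab[of s] s by auto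
  then have "sgn (dw (flow p s)) = sgn (G (ft p s))" "G (ft p s) > 0"
   using dw_at_rest[OF flow_in[OF p(1)] s(3)] th gt ts_range G_neg_inner[of "ft p s"] by auto
  then show "0 < dw (flow p s)" by (metis sgn_greater)
 qed (use w p s fw_deriv[OF p(1)] in auto)
 have "EX s. 0 <= s & 0 <= ft p s"
 proof (rule ccontr)
  assume n: "~ ?thesis"
  then have ab: "ft p s < 0" if "0 <= s" for s using that by (meson not_less)
  have pos': "0 < fw p s" if "0 <= s" for s
  proof (cases "s = 0")
   case False
   show ?thesis
   proof (rule pos[of s])
    show "ft p x <= 0" if "0 <= x" for x using ab[OF that] by simp
   qed (use that False in auto)
  qed (use w p in simp)
  obtain l where l: "((%t. ft p t) \<longlongrightarrow> l) at_top" "((%t. fw p t) \<longlongrightarrow> 0) at_top" "G l = 0" "th p < l" "l <= 0"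
  proof (rule ft_increasing_limit[OF p(1) pos', of 0])
   show "ft p s <= 0" if "0 <= s" for s using ab[OF that] by simp
  qed (use th ts_range in auto)
  have "l = 0" using G_nonzero[of l] l(3-5) th ts_range by auto
  have c0: "cos 0 = (1::real)" by simp
  define vE where "vE = sqrt (2 * V 0)"
  have vE: "0 < vE" using V_pos by (simp add: vE_def)
  have "((%t. fv p t) \<longlongrightarrow> - vE) at_top"
   using collapse(2)[OF p l(1,2)] \<open>l = 0\<close> by (simp add: vE_def)
  from order_tendstoD(2)[OF this, of "- vE / 2"] have e1: "eventually (%t. fv p t < - vE / 2) at_top" using vE by simp
  have e2: "eventually (%t. fw p t < vE / 8) at_top" by (rule order_tendstoD(2)[OF l(2)]) (use vE in simp)
  have "((%t. cos (ft p t)) \<longlongrightarrow> cos 0) at_top" using l(1) \<open>l = 0\<close> by (intro tendsto_intros) auto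
  from order_tendstoD(1)[OF this, of "1/2"] have e3: "eventually (%t. 1/2 < cos (ft p t)) at_top" by simp
  have "EX T. \<forall>t\<ge>T. fv p t < - vE / 2 & fw p t < vE / 8 & 1/2 < cos (ft p t)"
   using eventually_conj[OF e1 eventually_conj[OF e2 e3]] unfolding eventually_at_top_linorder .
  then obtain T where T0: "\<forall>t\<ge>T. fv p t < - vE / 2 & fw p t < vE / 8 & 1/2 < cos (ft p t)" ..
  have T: "fv p t < - vE / 2 & fw p t < vE / 8 & 1/2 < cos (ft p t)" if "T <= t" for t using T0 that by simp
  have dpos: "0 <= dw (flow p t)" if t: "T <= t" "0 <= t" for t
  proof -
   have gt: "- ts <= ft p t"
   proof (cases "t = 0")
    case False
    have "ft p 0 < ft p t" by (rule ft_strict_mono[OF p(1)]) (use pos' t False in auto)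
    then show ?thesis using th p by simp
   qed (use th p in simp)
   have G: "0 <= G (ft p t)" using G_neg_inner[of "ft p t"] ab[OF t(2)] gt by (cases "ft p t = -ts") auto
   have sn: "sin (ft p t) <= 0" using sin_ge_zero[of "- ft p t"] ab[OF t(2)] gt ts_range by auto
   have w0: "0 < fw p t" by (rule pos'[OF t(2)])
   have "(1/2)^2 <= (cos (ft p t))^2" using T[OF t(1)] by (intro power_mono) auto
   \<comment> \<open>With cos > 1/2 the friction coefficient is at least vE / 8. This is why w < vE
     / 8 was required: it absorbs the term with c', as |c'| <= 1.\<close>
   then have "(vE/2) * (1/4) <= (- fv p t) * (cos (ft p t))^2" using T[OF t(1)] vE by (intro mult_mono) (auto simp: power2_eq_square)
   moreover have "fw p t * deriv c (ft p t) <= fw p t * 1" using dc_bound[of "ft p t"] w0 by (intro mult_left_mono) auto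
   ultimately have "0 <= (- fv p t) * (cos (ft p t))^2 - fw p t * deriv c (ft p t)" using T[OF t(1)] by linarith
   then have "0 <= (1/2) * fw p t * cos (ft p t) * ((- fv p t) * (cos (ft p t))^2 - fw p t * deriv c (ft p t))"
    using w0 T[OF t(1)] by simp
   moreover have "0 <= - ((fw p t)^2 * c (ft p t) * sin (ft p t))" using sn c_pos[of "ft p t"] by (simp add: mult_nonneg_nonpos)
   ultimately have "0 <= cos (ft p t) * dw (flow p t)"
    unfolding dw_cos[OF flow_in[OF p(1)]] using G by (simp add: power2_eq_square power3_eq_cube algebra_simps)
   then show ?thesis using T[OF t(1)] by (simp add: zero_le_mult_iff)
  qed
  define T1 where "T1 = max T 0"
  have ge: "fw p T1 <= fw p t" if "T1 <= t" for t
  proof (rule DERIV_nonneg_imp_nondecreasing[OF that])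
   fix x assume x: "T1 <= x"
   then have "0 <= dw (flow p x)" by (intro dpos) (auto simp: T1_def)
   then show "EX y. ((%t. fw p t) has_real_derivative y) (at x) & 0 <= y" using fw_deriv[OF p(1), of x] by blast
  qed
  have "0 < fw p T1" by (rule pos') (simp add: T1_def)
  then have "eventually (%t. fw p t < fw p T1) at_top" by (rule order_tendstoD(2)[OF l(2)])
  then have "EX T2. \<forall>t\<ge>T2. fw p t < fw p T1" unfolding eventually_at_top_linorder .
  then obtain T2 where T2: "\<forall>t\<ge>T2. fw p t < fw p T1" ..
  have "fw p (max T1 T2) < fw p T1" using T2 by simp
  moreover have "fw p T1 <= fw p (max T1 T2)" by (rule ge) simp
  ultimately show False by linarith
 qed
 then obtain s where s: "0 <= s" "0 <= ft p s" by blast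
 obtain t where t: "0 < t" "t <= s" "- ft p t = 0" "!!x. 0 <= x ==> x < t ==> 0 < - ft p x"
  using first_time[OF s(1) continuous_on_minus[OF cont_f(3)[OF p(1)]], of 0] s th p by auto
 have "0 < fw p x" if "0 <= x" "x <= t" for x
 proof (cases "x = 0")
  case False
  show ?thesis
  proof (rule pos[of t])
   show "ft p y <= 0" if "0 <= y" "y <= t" for y using t(3) t(4)[of y] that by (cases "y = t") auto
  qed (use False that in auto)
 qed (use w p in auto)
 then show ?thesis using t by (intro exI[of _ t]) auto
qed

text \<open>While w > \<epsilon>, the angle moves at rate at least \<epsilon> / 4 and would leave
  the allowed range within T1; once w <= \<epsilon>, \<open>turn_rate\<close> brings it to 0 in time
  \<epsilon> / \<eta>.\<close>

lemma far_turn: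
 assumes "\<theta>1 < - ts"
 shows "\<exists>T>0. \<forall>p\<in>P1. th p = - (pi/2) --> 0 < ww p --> (ALL s. 0 <= s --> s <= T --> ft p s <= \<theta>1) -->
  (\<exists>u>0. u <= T & fw p u = 0 & (ALL s. 0 <= s --> s < u --> 0 < fw p s))"
proof -
 obtain \<epsilon> \<eta> where e: "0 < \<epsilon>" "0 < \<eta>"
  "\<forall>x\<in>P1. - (pi/2) <= th x --> th x <= \<theta>1 --> \<bar>ww x\<bar> <= \<epsilon> --> dw x <= - \<eta>"
  using turn_rate[OF assms] by blast
 define T1 where "T1 = 4 * pi / \<epsilon>"
 define T where "T = T1 + \<epsilon> / \<eta>"
 have T: "0 < T1" "T1 < T" using e by (auto simp: T_def T1_def)
 show ?thesis
 proof (rule exI[of _ T], intro conjI ballI impI)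
  show "0 < T" using T by simp
  fix p assume p: "p \<in> P1" "th p = - (pi/2)" "0 < ww p" and le: "ALL s. 0 <= s --> s <= T --> ft p s <= \<theta>1"
  have "EX s. 0 <= s & s <= T & fw p s <= 0"
  proof (rule ccontr)
   assume "~ ?thesis"
   then have pos: "0 < fw p s" if "0 <= s" "s <= T" for s using that by (meson not_less)
   have ge: "- (pi/2) <= ft p s" if "0 <= s" "s <= T" for s
    using ft_strict_mono[OF p(1), of 0 s] pos p that by (cases "s = 0") auto
   have rate: "dw (flow p s) <= - \<eta>" if "0 <= s" "s <= T" "\<bar>fw p s\<bar> <= \<epsilon>" for s
    using e(3)[rule_format, OF flow_in[OF p(1)] ge[OF that(1,2)] _ that(3)] le that by auto
   have "EX s. 0 <= s & s <= T1 & fw p s <= \<epsilon>"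
   proof (rule ccontr)
    assume "~ ?thesis"
    then have g: "\<epsilon> < fw p s" if "0 <= s" "s <= T1" for s using that by (meson not_less)
    have "ft p 0 + (\<epsilon> / 4) * (T1 - 0) <= ft p T1"
    proof (rule deriv_lower[of 0 T1 "%s. ft p s" "%s. fw p s * c (ft p s)"])
     show "\<epsilon> / 4 <= fw p s * c (ft p s)" if s: "0 <= s" "s <= T1" for s
     proof -
      have "\<epsilon> * (1/4) <= fw p s * c (ft p s)" using g[OF s] e c_bounds[of "ft p s"] by (intro mult_mono) auto
      then show ?thesis by simp
     qed
    qed (use T ft_deriv[OF p(1)] in auto)
    then have "pi/2 <= ft p T1" using p e by (simp add: T1_def)
    moreover have "ft p T1 <= \<theta>1" using le T by auto
    ultimately show False using assms ts_range pi_gt_zero by linarith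
   qed
   then obtain s1 where s1: "0 <= s1" "s1 <= T1" "fw p s1 <= \<epsilon>" by blast
   have b: "fw p s <= \<epsilon>" if "s1 <= s" "s <= T" for s
   proof (cases "s = s1")
    case False
    have "fw p s < \<epsilon>"
    proof (rule stays_below[OF s1(3) fw_deriv[OF p(1)]])
     show "dw (flow p s) < 0" if "s1 <= s" "s <= T" "fw p s = \<epsilon>" for s
      using rate[of s] that s1 e by auto
    qed (use that False in auto)
    then show ?thesis by simp
   qed (use s1 in simp)
   have "fw p T <= fw p s1 + (- \<eta>) * (T - s1)"
   proof (rule deriv_upper[of s1 T "%s. fw p s" "%s. dw (flow p s)"])
    show "dw (flow p s) <= - \<eta>" if "s1 <= s" "s <= T" for s
     using rate[of s] b[OF that] pos[of s] that s1 by auto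
   qed (use s1 T fw_deriv[OF p(1)] in auto)
   moreover have "\<eta> * (T - s1) \<ge> \<eta> * (\<epsilon> / \<eta>)" using s1 e by (intro mult_left_mono) (auto simp: T_def)
   ultimately have "fw p T <= 0" using s1 e by simp
   then show False using pos[of T] T by auto
  qed
  then obtain s where s: "0 <= s" "s <= T" "fw p s <= 0" by blast
  obtain u where u: "0 < u" "u <= s" "fw p u = 0" "!!x. 0 <= x ==> x < u ==> 0 < fw p x"
   using first_time[OF s(1) cont_f(4)[OF p(1)], of 0] s p by auto
  then show "\<exists>u>0. u <= T & fw p u = 0 & (ALL s. 0 <= s --> s < u --> 0 < fw p s)"
   using s by (intro exI[of _ u]) auto
 qed
qed

end

subsection \<open>Passing, turning and converging orbits\<close>

context shape
begin

definition Up :: "real => state => real => bool" where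
 "Up b p t \<longleftrightarrow> 0 < t & ft p t = b & (ALL s. 0 <= s & s <= t --> 0 < fw p s)"

text \<open>The turn is recorded by a strictly negative w, not by a zero of w, so that the condition
  is open.\<close>

definition Turn :: "real => state => bool" where
 "Turn tL p \<longleftrightarrow> (\<exists>u>0. fw p u < 0 & (ALL s. 0 <= s & s <= u --> ft p s < tL))"

definition Conv :: "real => state => bool" where
 "Conv tL p \<longleftrightarrow> (\<forall>s\<ge>0. 0 < fw p s & ft p s < tL) & ((%t. ft p t) \<longlongrightarrow> tL) at_top & ((%t. fw p t) \<longlongrightarrow> 0) at_top"

definition Ret :: "state => real => bool" where
 "Ret p t \<longleftrightarrow> 0 < t & ft p t = - (pi/2) & fw p t < 0 & (ALL s. 0 < s & s < t --> - (pi/2) < ft p s & ft p s < - ts)"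

definition Sec :: "real => state set" where
 "Sec a = {p \<in> P1. th p = a & 0 < ww p}"

lemma SecD: "p \<in> Sec a ==> p \<in> P1" "p \<in> Sec a ==> th p = a" "p \<in> Sec a ==> 0 < ww p"
 by (auto simp: Sec_def)

definition upT :: "real => state => real" where "upT b p = (THE t. Up b p t)"
definition up :: "real => state => state" where "up b p = flow p (upT b p)"
definition retT :: "state => real" where "retT p = (THE t. Ret p t)"
text \<open>The reflection in the line \<theta> = - \<pi>/2.\<close>

definition Sr :: "state => state" where "Sr x = Sh (- pi) (Mi x)"
text \<open>The return map to \<theta> = - \<pi>/2 followed by the reflection in that line: the
  image again has w > 0, so the map can be iterated on one section.\<close>

definition Qm :: "state => state" where "Qm p = Sr (flow p (retT p))"

lemma Up_mono: assumes "p \<in> P1" "Up b p t" "0 <= s" "s < s'" "s' <= t" shows "ft p s < ft p s'"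
 by (rule ft_strict_mono[OF assms(1) _ assms(4)]) (use assms in \<open>auto simp: Up_def\<close>)

lemma Up_unique: assumes p: "p \<in> P1" and "Up b p t" "Up b p t'" shows "t = t'"
proof (rule ccontr)
 assume "t ~= t'"
 then consider "t < t'" | "t' < t" by linarith
 then show False using Up_mono[OF p assms(3), of t t'] Up_mono[OF p assms(2), of t' t] assms by cases (auto simp: Up_def)
qed

lemma upT_eq: "p \<in> P1 ==> Up b p t ==> upT b p = t"
 unfolding upT_def using Up_unique by blast

lemma up_eq: "p \<in> P1 ==> Up b p t ==> up b p = flow p t"
 unfolding up_def using upT_eq by simp

lemma Ret_unique: assumes "Ret p t" "Ret p t'" shows "t = t'"
proof (rule ccontr)
 assume "t ~= t'"
 then consider "t < t'" | "t' < t" by linarith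
 then show False
 proof cases
  case 1
  then have "- (pi/2) < ft p t" using assms unfolding Ret_def by blast
  then show False using assms unfolding Ret_def by auto
 next
  case 2
  then have "- (pi/2) < ft p t'" using assms unfolding Ret_def by blast
  then show False using assms unfolding Ret_def by auto
 qed
qed

lemma retT_eq: "Ret p t ==> retT p = t"
 unfolding retT_def using Ret_unique by blast

lemma Up_Sec: "p \<in> P1 ==> Up b p t ==> flow p t \<in> Sec b"
 unfolding Up_def Sec_def by auto

lemma Up_trans: assumes p: "p \<in> P1" and 1: "Up b p t" and 2: "Up d (flow p t) t'" shows "Up d p (t + t')"
proof -
 have "0 < fw p s" if "0 <= s" "s <= t + t'" for s
 proof (cases "s <= t")
  case False
  then have "0 < fw (flow p t) (s - t)" using 2 that unfolding Up_def by auto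
  then show ?thesis using flow_flow[OF p, of t "s - t"] by simp
 qed (use 1 that in \<open>auto simp: Up_def\<close>)
 then show ?thesis using 1 2 flow_flow[OF p, of t t'] unfolding Up_def by auto
qed

lemma Up_between:
 assumes p: "p \<in> P1" and 1: "Up d p t" and b: "th p < b" "b < d"
 obtains t' where "Up b p t'" "0 < t'" "t' < t" "Up d (flow p t') (t - t')"
proof -
 obtain t' where t': "0 <= t'" "t' <= t" "ft p t' = b"
  using IVT'[of "%t. ft p t" 0 b t] 1 b p cont_f(3)[OF p] unfolding Up_def by auto
 have n: "t' ~= 0" "t' ~= t" using t' b p 1 by (auto simp: Up_def)
 have "0 < fw (flow p t') s" if "0 <= s" "s <= t - t'" for s
  using 1 t' that flow_flow[OF p, of t' s] unfolding Up_def by auto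
 then have "Up d (flow p t') (t - t')" using 1 t' n flow_flow[OF p, of t' "t - t'"] unfolding Up_def by auto
 moreover have "Up b p t'" using 1 t' n unfolding Up_def by auto
 ultimately show thesis using that[of t'] t' n by auto
qed

lemma Up_not_Turn: assumes "Up tL p t" shows "~ Turn tL p"
proof
 assume "Turn tL p"
 then obtain u where u: "0 < u" "fw p u < 0" "!!s. 0 <= s ==> s <= u ==> ft p s < tL" unfolding Turn_def by blast
 show False
 proof (cases "t <= u")
  case True then show False using u(3)[of t] assms unfolding Up_def by auto
 next
  case False
  then have "0 < fw p u" using assms u(1) unfolding Up_def by auto
  then show False using u(2) by simp
 qed
qed

lemma Conv_not_Up: "Conv tL p ==> ~ Up tL p t"
 unfolding Conv_def Up_def by (metis less_eq_real_def less_irrefl)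

text \<open>A section line together with the first critical point of \<open>V\<close> ahead of it
  that is not on the line.\<close>

definition good :: "real => real => bool" where
 "good a tL \<longleftrightarrow> a = - (pi/2) & tL = - ts | a = 0 & tL = ts"

lemma goodD: assumes "good a tL"
 shows "- (pi/2) <= a" "a < tL" "tL < pi/2" "- (pi/2) < tL" "!!x. a < x ==> x < tL ==> G x < 0" "G tL = 0" "V tL = Vs"
 using assms ts_range G_neg_outer G_inner V_at_crit unfolding good_def Vs_def by auto

text \<open>At a zero of w before tL the derivative of w is negative because G is; moving on a
  little gives the strict inequality that \<open>Turn\<close> asks for.\<close>

lemma section_trichotomy:
 assumes g: "good a tL" and p: "p \<in> P1" "a <= th p" "th p < tL" "0 < ww p"
 shows "(EX t. Up tL p t) | Turn tL p | Conv tL p"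
proof -
 note gd = goodD[OF g]
 consider (1) t where "0 < t" "ft p t = tL" "\<forall>s\<in>{0..t}. 0 < fw p s"
  | (2) u where "0 < u" "fw p u = 0" "th p < ft p u" "ft p u < tL" "\<forall>s\<in>{0..<u}. 0 < fw p s"
  | (3) "Conv tL p"
  using trichotomy[OF p(1) gd(1) p(2,3) gd(3) p(4) gd(5,6)] unfolding Conv_def by blast
 then show ?thesis
 proof cases
  case 1 then show ?thesis unfolding Up_def by auto
 next
  case 2
  have "sgn (dw (flow p u)) = sgn (G (ft p u))"
   by (rule dw_at_rest[OF flow_in[OF p(1)] 2(2)]) (use 2 gd p in auto)
  moreover have "G (ft p u) < 0" by (rule gd(5)) (use 2 p in auto)
  ultimately have "dw (flow p u) < 0" by (metis sgn_less)
  from DERIV_neg_dec_right[OF fw_deriv[OF p(1)] this] obtain d where d: "0 < d" "\<forall>h>0. h < d --> fw p (u + h) < fw p u" by auto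
  have "isCont (%t. ft p t) u" by (rule DERIV_isCont[OF ft_deriv[OF p(1)]])
  then have "eventually (%t. ft p t < tL) (at u)" unfolding isCont_def by (rule order_tendstoD(2)) (rule 2(4))
  then obtain d' where d': "0 < d'" "ALL t. t ~= u & dist t u < d' --> ft p t < tL" unfolding eventually_at by auto
  define h where "h = min d d' / 2"
  have h: "0 < h" "h < d" "h < d'" using d d' by (auto simp: h_def)
  have "ft p s < tL" if s: "0 <= s" "s <= u + h" for s
  proof -
   consider "s < u" | "s = u" | "u < s" by linarith
   then show ?thesis
   proof cases
    case 1
    have "ft p s < ft p u" by (rule ft_strict_mono[OF p(1) _ 1]) (use 2 s in auto)
    then show ?thesis using 2 by simp
   next
    case 3
    then show ?thesis using d'(2)[rule_format, of s] s h by (auto simp: dist_real_def)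
   qed (use 2 in simp)
  qed
  moreover have "fw p (u + h) < 0" using d(2) h 2 by auto
  ultimately have "Turn tL p" unfolding Turn_def using 2(1) h(1) by (intro exI[of _ "u + h"]) auto
  then show ?thesis by simp
 qed simp
qed

subsection \<open>Stability of passing and turning\<close>

lemma comp_close: assumes "norm (x - y) < e" shows "\<bar>rr x - rr y\<bar> < e" "\<bar>vv x - vv y\<bar> < e" "\<bar>th x - th y\<bar> < e" "\<bar>ww x - ww y\<bar> < e"
 using comp_le_norm[of "x - y"] assms by auto

lemma Turn_stable:
 assumes q: "(q \<longlongrightarrow> p) F" "\<forall>\<^sub>F x in F. q x \<in> P1" and p: "p \<in> P1" and T: "Turn tL p"
 shows "\<forall>\<^sub>F x in F. Turn tL (q x)"
proof -
 obtain u where u: "0 < u" "fw p u < 0" "!!s. 0 <= s ==> s <= u ==> ft p s < tL" using T unfolding Turn_def by blast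
 have "\<exists>x\<in>{0..u}. \<forall>y\<in>{0..u}. ft p y <= ft p x"
  by (rule continuous_attains_sup) (use u cont_f(3)[OF p] in auto)
 then obtain s0 where s0: "s0 \<in> {0..u}" "\<forall>y\<in>{0..u}. ft p y <= ft p s0" by blast
 define e where "e = min (tL - ft p s0) (- fw p u)"
 have e: "0 < e" using u(2) u(3)[of s0] s0 by (simp add: e_def)
 from flow_uniform[OF q p e, of u] show ?thesis
 proof eventually_elim
  case (elim x)
  have "fw (q x) u < 0" using comp_close(4)[of "flow (q x) u" "flow p u" e] elim[rule_format, of u] u(1) by (auto simp: e_def)
  moreover have "ft (q x) s < tL" if "0 <= s" "s <= u" for s
  proof -
   have "\<bar>ft (q x) s - ft p s\<bar> < e" by (rule comp_close(3)) (use elim that in auto)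
   moreover have "ft p s <= ft p s0" using s0 that by simp
   ultimately show ?thesis by (auto simp: e_def)
  qed
  ultimately show ?case unfolding Turn_def using u(1) by blast
 qed
qed

text \<open>w remains positive slightly beyond t, and \<theta> brackets b at the times t - h and t +
  h; both survive small perturbations.\<close>

lemma Up_stable_aux:
 assumes q: "(q \<longlongrightarrow> p) F" "\<forall>\<^sub>F x in F. q x \<in> P1" and p: "p \<in> P1" and U: "Up b p t" and e: "0 < e"
 shows "\<forall>\<^sub>F x in F. EX t'. Up b (q x) t' & \<bar>t' - t\<bar> < e"
proof -
 have t: "0 < t" "ft p t = b" "!!s. 0 <= s ==> s <= t ==> 0 < fw p s" using U unfolding Up_def by auto
 have "isCont (%t. fw p t) t" by (rule DERIV_isCont[OF fw_deriv[OF p]])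
 then have "eventually (%s. 0 < fw p s) (at t)" unfolding isCont_def by (rule order_tendstoD(1)) (use t in auto)
 then obtain d where d: "0 < d" "ALL s. s ~= t & dist s t < d --> 0 < fw p s" unfolding eventually_at by auto
 define h where "h = min (min d e) t / 2"
 have h: "0 < h" "h < d" "h < e" "h < t" using d e t by (auto simp: h_def)
 have pos: "0 < fw p s" if "0 <= s" "s <= t + h" for s
  using t(3)[of s] d(2)[rule_format, of s] that h by (cases "s <= t") (auto simp: dist_real_def)
 have m1: "ft p (t - h) < b" using ft_strict_mono[OF p, of "t - h" t] pos h t by auto
 have m2: "b < ft p (t + h)" using ft_strict_mono[OF p, of t "t + h"] pos h t by auto
 have "\<exists>x\<in>{0..t + h}. \<forall>y\<in>{0..t + h}. fw p x <= fw p y"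
  by (rule continuous_attains_inf) (use t h cont_f(4)[OF p] in auto)
 then obtain s0 where s0: "s0 \<in> {0..t + h}" "\<forall>y\<in>{0..t + h}. fw p s0 <= fw p y" by blast
 define m where "m = min (fw p s0) (min (b - ft p (t - h)) (ft p (t + h) - b))"
 have m: "0 < m" using pos[of s0] s0 m1 m2 by (simp add: m_def)
 from flow_uniform[OF q p m, of "t + h"] q(2) show ?thesis
 proof eventually_elim
  case (elim x)
  have w: "0 < fw (q x) s" if "0 <= s" "s <= t + h" for s
  proof -
   have "\<bar>fw (q x) s - fw p s\<bar> < m" by (rule comp_close(4)) (use elim that in auto)
   moreover have "fw p s0 <= fw p s" using s0 that by simp
   ultimately show ?thesis by (auto simp: m_def)
  qed
  have "\<bar>ft (q x) (t - h) - ft p (t - h)\<bar> < m" "\<bar>ft (q x) (t + h) - ft p (t + h)\<bar> < m"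
   by (rule comp_close(3); use elim h t in auto)+
  then have "ft (q x) (t - h) < b" "b < ft (q x) (t + h)" by (auto simp: m_def)
  then obtain t' where t': "t - h <= t'" "t' <= t + h" "ft (q x) t' = b"
   using IVT'[of "%s. ft (q x) s" "t - h" b "t + h"] cont_f(3)[OF elim(2)] h by auto
  have "Up b (q x) t'" unfolding Up_def using t' h w by auto
  moreover have "\<bar>t' - t\<bar> < e" using t' h by auto
  ultimately show ?case by blast
 qed
qed

lemma Up_stable:
 assumes q: "(q \<longlongrightarrow> p) F" "\<forall>\<^sub>F x in F. q x \<in> P1" and p: "p \<in> P1" and U: "Up b p t"
 shows "\<forall>\<^sub>F x in F. Up b (q x) (upT b (q x))" "((%x. up b (q x)) \<longlongrightarrow> up b p) F"
proof -
 have ev: "\<forall>\<^sub>F x in F. Up b (q x) (upT b (q x)) & \<bar>upT b (q x) - t\<bar> < e" if "0 < e" for e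
  using Up_stable_aux[OF q p U that] q(2)
 proof eventually_elim
  case (elim x)
  then obtain t' where "Up b (q x) t'" "\<bar>t' - t\<bar> < e" by blast
  then show ?case using upT_eq[OF elim(2)] by auto
 qed
 show "\<forall>\<^sub>F x in F. Up b (q x) (upT b (q x))" using ev[OF zero_less_one] by (rule eventually_mono) simp
 have "((%x. upT b (q x)) \<longlongrightarrow> t) F"
 proof (rule tendstoI)
  fix e :: real assume "0 < e"
  from ev[OF this] show "\<forall>\<^sub>F x in F. dist (upT b (q x)) t < e" by (rule eventually_mono) (simp add: dist_real_def)
 qed
 then show "((%x. up b (q x)) \<longlongrightarrow> up b p) F"
  unfolding up_def[of b p] upT_eq[OF p U] unfolding up_def by (rule flow_tendsto[OF q p])
qed

text \<open>Closeness alone cannot keep \<theta> above - \<pi>/2 near the two ends, where equality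
  holds. There the sign of w is used instead, positive on [0, h] and negative on [t - h, t + h];
  between them a compactness margin suffices.\<close>

lemma Ret_stable_aux:
 assumes q: "(q \<longlongrightarrow> p) F" "\<forall>\<^sub>F x in F. q x \<in> Sec (- (pi/2))" and p: "p \<in> Sec (- (pi/2))" and U: "Ret p t" and e: "0 < e"
 shows "\<forall>\<^sub>F x in F. EX t'. Ret (q x) t' & \<bar>t' - t\<bar> < e"
proof -
 have pP: "p \<in> P1" and p0: "th p = - (pi/2)" "0 < ww p" using p by (auto simp: Sec_def)
 have qP: "\<forall>\<^sub>F x in F. q x \<in> P1" using q(2) by (rule eventually_mono) (simp add: Sec_def)
 have t: "0 < t" "ft p t = - (pi/2)" "fw p t < 0"
  "!!s. 0 < s ==> s < t ==> - (pi/2) < ft p s" "!!s. 0 < s ==> s < t ==> ft p s < - ts" using U unfolding Ret_def by auto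
 have "isCont (%t. fw p t) t" by (rule DERIV_isCont[OF fw_deriv[OF pP]])
 then have "eventually (%s. fw p s < 0) (at t)" unfolding isCont_def by (rule order_tendstoD(2)) (simp add: t)
 then obtain d where d: "0 < d" "ALL s. s ~= t & dist s t < d --> fw p s < 0" unfolding eventually_at by auto
 have "isCont (%t. fw p t) 0" by (rule DERIV_isCont[OF fw_deriv[OF pP]])
 then have "eventually (%s. 0 < fw p s) (at 0)" unfolding isCont_def by (rule order_tendstoD(1)) (use pP p0 in simp)
 then obtain d0 where d0: "0 < d0" "ALL s. s ~= 0 & dist s 0 < d0 --> 0 < fw p s" unfolding eventually_at by auto
 have "isCont (%t. ft p t) t" by (rule DERIV_isCont[OF ft_deriv[OF pP]])
 then have "eventually (%s. ft p s < - ts) (at t)" unfolding isCont_def by (rule order_tendstoD(2)) (use t ts_range in simp)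
 then obtain d1 where d1: "0 < d1" "ALL s. s ~= t & dist s t < d1 --> ft p s < - ts" unfolding eventually_at by auto
 define h where "h = min (min (min d d1) e) (min d0 t) / 2"
 have h: "0 < h" "h < d" "h < e" "h < d0" "h < d1" "2 * h <= t" using d e t d0 d1 by (auto simp: h_def min_def)
 have ht: "h < t" using h t by linarith
 have pos: "0 < fw p s" if "0 <= s" "s <= h" for s
  using d0(2)[rule_format, of s] that h pP p0 by (cases "s = 0") (auto simp: dist_real_def)
 have neg: "fw p s < 0" if "t - h <= s" "s <= t + h" for s
  using d(2)[rule_format, of s] that h t by (cases "s = t") (auto simp: dist_real_def)
 have lt: "ft p s < - ts" if s: "0 <= s" "s <= t + h" for s
 proof -
  consider "s = 0" | "0 < s" "s < t" | "s = t" | "t < s"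
   using s by (cases "s = 0"; cases "s < t"; cases "s = t") auto
  then show ?thesis
  proof cases
   case 4 then show ?thesis using d1(2)[rule_format, of s] s h by (auto simp: dist_real_def)
  qed (use t p0 pP ts_range in auto)
 qed
 have m1: "- (pi/2) < ft p (t - h)" using t(4)[of "t - h"] h t by auto
 have m2: "ft p (t + h) < - (pi/2)" using ft_strict_antimono[OF pP, of t "t + h"] neg h t by auto
 have gt: "- (pi/2) < ft p s" if "h <= s" "s <= t - h" for s using t(4)[of s] that h by auto
 have 1: "\<exists>x\<in>{0..h}. \<forall>y\<in>{0..h}. fw p x <= fw p y"
  by (rule continuous_attains_inf) (use h cont_f(4)[OF pP] in auto)
 then obtain s1 where s1: "s1 \<in> {0..h}" "\<forall>y\<in>{0..h}. fw p s1 <= fw p y" by blast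
 have 2: "\<exists>x\<in>{t - h..t + h}. \<forall>y\<in>{t - h..t + h}. fw p y <= fw p x"
  by (rule continuous_attains_sup) (use h cont_f(4)[OF pP] in auto)
 then obtain s2 where s2: "s2 \<in> {t - h..t + h}" "\<forall>y\<in>{t - h..t + h}. fw p y <= fw p s2" by blast
 have 3: "\<exists>x\<in>{0..t + h}. \<forall>y\<in>{0..t + h}. ft p y <= ft p x"
  by (rule continuous_attains_sup) (use h t cont_f(3)[OF pP] in auto)
 then obtain s3 where s3: "s3 \<in> {0..t + h}" "\<forall>y\<in>{0..t + h}. ft p y <= ft p s3" by blast
 have 4: "\<exists>x\<in>{h..t - h}. \<forall>y\<in>{h..t - h}. ft p x <= ft p y"
  by (rule continuous_attains_inf) (use h t cont_f(3)[OF pP] in auto)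
 then obtain s4 where s4: "s4 \<in> {h..t - h}" "\<forall>y\<in>{h..t - h}. ft p s4 <= ft p y" by blast
 define m where "m = min (min (fw p s1) (- fw p s2)) (min (min (- ts - ft p s3) (ft p s4 + pi/2)) (min (ft p (t - h) + pi/2) (- (pi/2) - ft p (t + h))))"
 have m: "0 < m" using pos[of s1] s1 neg[of s2] s2 lt[of s3] s3 gt[of s4] s4 m1 m2 by (auto simp: m_def)
 have mm: "m <= fw p s1" "m <= - fw p s2" "m <= - ts - ft p s3" "m <= ft p s4 + pi/2" "m <= ft p (t - h) + pi/2" "m <= - (pi/2) - ft p (t + h)"
  unfolding m_def by linarith+
 from flow_uniform[OF q(1) qP pP m, of "t + h"] q(2) show ?thesis
 proof eventually_elim
  case (elim x)
  have xP: "q x \<in> P1" and x0: "th (q x) = - (pi/2)" using elim by (auto simp: Sec_def)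
  have cl: "\<bar>ft (q x) s - ft p s\<bar> < m" "\<bar>fw (q x) s - fw p s\<bar> < m" if "0 <= s" "s <= t + h" for s
   by (rule comp_close(3) comp_close(4); use elim that in auto)+
  have w1: "0 < fw (q x) s" if "0 <= s" "s <= h" for s
   using cl(2)[of s] s1(2)[rule_format, of s] that mm(1) h t by auto
  have w2: "fw (q x) s < 0" if "t - h <= s" "s <= t + h" for s
   using cl(2)[of s] s2(2)[rule_format, of s] that mm(2) h t by auto
  have th1: "ft (q x) s < - ts" if "0 <= s" "s <= t + h" for s
   using cl(1)[of s] s3(2)[rule_format, of s] that mm(3) by auto
  have th2: "- (pi/2) < ft (q x) s" if "h <= s" "s <= t - h" for s
   using cl(1)[of s] s4(2)[rule_format, of s] that mm(4) h by auto
  have "- (pi/2) < ft (q x) (t - h)" "ft (q x) (t + h) < - (pi/2)"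
   using cl(1)[of "t - h"] cl(1)[of "t + h"] mm(5,6) h ht by auto
  then obtain t' where t': "t - h <= t'" "t' <= t + h" "ft (q x) t' = - (pi/2)"
   using IVT2'[of "%s. ft (q x) s" "t + h" "- (pi/2)" "t - h"] cont_f(3)[OF xP] h by auto
  have th3: "- (pi/2) < ft (q x) s" if s: "0 < s" "s < t'" for s
  proof -
   consider "s <= h" | "h <= s" "s <= t - h" | "t - h <= s"
    by (cases "s <= h"; cases "s <= t - h") auto
   then show ?thesis
   proof cases
    case 1
    have "ft (q x) 0 < ft (q x) s" by (rule ft_strict_mono[OF xP]) (use w1 s 1 in auto)
    then show ?thesis using x0 xP by simp
   next
    case 3
    have "ft (q x) t' < ft (q x) s" by (rule ft_strict_antimono[OF xP]) (use w2 s 3 t' in auto)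
    then show ?thesis using t' by simp
   qed (use th2 in auto)
  qed
  have "Ret (q x) t'" unfolding Ret_def
  proof (intro conjI allI impI)
   show "0 < t'" using t' h ht by linarith
   show "fw (q x) t' < 0" using w2 t' by simp
   show "- (pi/2) < ft (q x) s" if "0 < s & s < t'" for s using th3 that by blast
   show "ft (q x) s < - ts" if "0 < s & s < t'" for s using th1[of s] that t' by auto
  qed (rule t')
  moreover have "\<bar>t' - t\<bar> < e" using t' h by auto
  ultimately show ?case by blast
 qed
qed

lemma Sr_simps [simp]: "rr (Sr x) = rr x" "vv (Sr x) = vv x" "th (Sr x) = - th x - pi" "ww (Sr x) = - ww x"
 by (auto simp: Sr_def)

lemma Sr_P1 [simp]: "x \<in> P1 ==> Sr x \<in> P1" by (simp add: Sr_def)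

lemma flow_Sr: "p \<in> P1 ==> flow (Sr p) t = Sr (flow p t)"
 unfolding Sr_def by (simp add: flow_Sh flow_Mi)

lemma Sr_Sr [simp]: "Sr (Sr x) = x" by (rule state_eqI) auto

lemma Sr_tendsto [tendsto_intros]: "(f \<longlongrightarrow> l) F ==> ((%x. Sr (f x)) \<longlongrightarrow> Sr l) F"
 by (rule state_tendstoI) (auto intro!: tendsto_intros)

lemma Qm_eq: "Ret p t ==> Qm p = Sr (flow p t)"
 unfolding Qm_def using retT_eq by simp

lemma Qm_Sec: "p \<in> P1 ==> Ret p t ==> Qm p \<in> Sec (- (pi/2))"
 using Qm_eq[of p t] unfolding Sec_def Ret_def by simp

lemma Ret_stable:
 assumes q: "(q \<longlongrightarrow> p) F" "\<forall>\<^sub>F x in F. q x \<in> Sec (- (pi/2))" and p: "p \<in> Sec (- (pi/2))" and U: "Ret p t"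
 shows "\<forall>\<^sub>F x in F. Ret (q x) (retT (q x))" "((%x. Qm (q x)) \<longlongrightarrow> Qm p) F"
proof -
 have pP: "p \<in> P1" using p by (auto simp: Sec_def)
 have qP: "\<forall>\<^sub>F x in F. q x \<in> P1" using q(2) by (rule eventually_mono) (simp add: Sec_def)
 have ev: "\<forall>\<^sub>F x in F. Ret (q x) (retT (q x)) & \<bar>retT (q x) - t\<bar> < e" if "0 < e" for e
  using Ret_stable_aux[OF q p U that]
 proof eventually_elim
  case (elim x)
  then obtain t' where "Ret (q x) t'" "\<bar>t' - t\<bar> < e" by blast
  then show ?case using retT_eq by auto
 qed
 show "\<forall>\<^sub>F x in F. Ret (q x) (retT (q x))" using ev[OF zero_less_one] by (rule eventually_mono) simp
 have "((%x. retT (q x)) \<longlongrightarrow> t) F"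
 proof (rule tendstoI)
  fix e :: real assume "0 < e"
  from ev[OF this] show "\<forall>\<^sub>F x in F. dist (retT (q x)) t < e" by (rule eventually_mono) (simp add: dist_real_def)
 qed
 then have "((%x. flow (q x) (retT (q x))) \<longlongrightarrow> flow p t) F" by (rule flow_tendsto[OF q(1) qP pP])
 then show "((%x. Qm (q x)) \<longlongrightarrow> Qm p) F" unfolding Qm_eq[OF U] unfolding Qm_def by (rule Sr_tendsto)
qed

text \<open>After the first zero of w, \<open>return_time\<close> leads back to - \<pi>/2 with w <
  0. Both that time and t are first hits, so they agree.\<close>

lemma Ret_structure:
 assumes p: "p \<in> Sec (- (pi/2))" and R: "Ret p t"
 obtains u where "0 < u" "u < t" "fw p u = 0" "!!s. 0 <= s ==> s < u ==> 0 < fw p s" "!!s. u < s ==> s <= t ==> fw p s < 0"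
  "- (pi/2) < ft p u" "ft p u < - ts"
proof -
 have pP: "p \<in> P1" and p0: "th p = - (pi/2)" "0 < ww p" using p by (auto simp: Sec_def)
 have t: "0 < t" "ft p t = - (pi/2)" "fw p t < 0"
  "!!s. 0 < s ==> s < t ==> - (pi/2) < ft p s" "!!s. 0 < s ==> s < t ==> ft p s < - ts" using R unfolding Ret_def by auto
 obtain u where u: "0 < u" "u <= t" "fw p u = 0" "!!s. 0 <= s ==> s < u ==> 0 < fw p s"
  using first_time[OF _ cont_f(4)[OF pP], of 0 t 0] t p0 pP by auto
 have ut: "u < t" using u t by (cases "u = t") auto
 have th: "- (pi/2) < ft p u" "ft p u < - ts" using t(4,5)[of u] u ut by auto
 have wu: "ww (flow p u) <= 0" using u by simp
 obtain T where T: "!!p'. p' \<in> P1 ==> - (pi/2) < th p' ==> th p' <= ft p u ==> ww p' <= 0 ==>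
  (\<exists>t>0. t <= T & ft p' t = - (pi/2) & fw p' t < 0 & (ALL s. 0 < s --> s <= t --> fw p' s < 0) &
   (ALL s. 0 <= s --> s < t --> - (pi/2) < ft p' s & ft p' s <= th p'))"
  using return_time[OF th(2)] by blast
 obtain t' where t': "0 < t'" "ft (flow p u) t' = - (pi/2)" "fw (flow p u) t' < 0"
  "!!s. 0 < s ==> s <= t' ==> fw (flow p u) s < 0"
  "!!s. 0 <= s ==> s < t' ==> - (pi/2) < ft (flow p u) s & ft (flow p u) s <= ft p u"
  using T[OF flow_in[OF pP] th(1) order_refl wu] by blast
 note ff = flow_flow[OF pP, of u]
 have "u + t' = t"
 proof (rule ccontr)
  assume n: "u + t' ~= t"
  then consider "u + t' < t" | "t < u + t'" by linarith
  then show False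
  proof cases
   case 1 then show False using t(4)[of "u + t'"] t'(1,2) u(1) ff by auto
  next
   case 2
   then have "- (pi/2) < ft (flow p u) (t - u)" using t'(5)[of "t - u"] ut by auto
   then show False using t(2) ff by auto
  qed
 qed
 then have "fw p s < 0" if "u < s" "s <= t" for s using t'(4)[of "s - u"] that ff by auto
 then show thesis using that[of u] u ut th by auto
qed

lemma Ret_imp_Turn: "p \<in> P1 ==> th p = - (pi/2) ==> Ret p t ==> Turn (- ts) p"
proof -
 assume a: "p \<in> P1" "th p = - (pi/2)" "Ret p t"
 have "ft p s < - ts" if "0 <= s" "s <= t" for s
  using a ts_range that unfolding Ret_def by (cases "s = 0"; cases "s = t") auto
 then show ?thesis using a unfolding Ret_def Turn_def by blast
qed

text \<open>Left of - ts nothing can stop an orbit that has come to rest: it goes straight back to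
  the collision line.\<close>

lemma Turn_imp_Ret: assumes p: "p \<in> Sec (- (pi/2))" and T: "Turn (- ts) p" shows "EX t. Ret p t"
proof -
 have pP: "p \<in> P1" and p0: "th p = - (pi/2)" "0 < ww p" using p by (auto simp: Sec_def)
 obtain u1 where u1: "0 < u1" "fw p u1 < 0" "!!s. 0 <= s ==> s <= u1 ==> ft p s < - ts" using T unfolding Turn_def by blast
 obtain u where u: "0 < u" "u <= u1" "fw p u = 0" "!!s. 0 <= s ==> s < u ==> 0 < fw p s"
  using first_time[OF _ cont_f(4)[OF pP], of 0 u1 0] u1 p0 pP by auto
 have mono: "ft p s < ft p s'" if "0 <= s" "s < s'" "s' <= u" for s s'
  by (rule ft_strict_mono[OF pP _ that(2)]) (use u that in auto)
 have th: "- (pi/2) < ft p u" "ft p u < - ts" using mono[of 0 u] u u1(3)[of u] p0 pP by auto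
 have wu: "ww (flow p u) <= 0" using u by simp
 obtain T where T: "!!p'. p' \<in> P1 ==> - (pi/2) < th p' ==> th p' <= ft p u ==> ww p' <= 0 ==>
  (\<exists>t>0. t <= T & ft p' t = - (pi/2) & fw p' t < 0 & (ALL s. 0 < s --> s <= t --> fw p' s < 0) &
   (ALL s. 0 <= s --> s < t --> - (pi/2) < ft p' s & ft p' s <= th p'))"
  using return_time[OF th(2)] by blast
 obtain t' where t': "0 < t'" "ft (flow p u) t' = - (pi/2)" "fw (flow p u) t' < 0"
  "!!s. 0 <= s ==> s < t' ==> - (pi/2) < ft (flow p u) s & ft (flow p u) s <= ft p u"
  using T[OF flow_in[OF pP] th(1) order_refl wu] by blast
 note ff = flow_flow[OF pP, of u]
 have "- (pi/2) < ft p s & ft p s < - ts" if s: "0 < s" "s < u + t'" for s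
 proof (cases "s < u")
  case True
  then show ?thesis using mono[of 0 s] mono[of s u] s th p0 pP by auto
 next
  case False
  then show ?thesis using t'(4)[of "s - u"] s th ff by auto
 qed
 then have "Ret p (u + t')" unfolding Ret_def using u t' ff by auto
 then show ?thesis by blast
qed

end

subsection \<open>Orbits in the collision manifold as graphs over \<open>\<theta>\<close>\<close>

context shape
begin

text \<open>The value of w >= 0 that energy assigns to the angle x and the given v when r =
  0.\<close>

definition qf :: "real => real => real" where
 "qf x v = sqrt ((2 * W x - v^2 * (cos x)^2) / c x)"

lemma fr_zero: "p \<in> P1 ==> rr p = 0 ==> fr p t = 0"
 using fr_pos_iff by simp

lemma qf_eq: assumes "p \<in> P1" "rr p = 0" "0 <= fw p s" shows "qf (ft p s) (fv p s) = fw p s"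
proof -
 have "(2 * W (ft p s) - (fv p s)^2 * (cos (ft p s))^2) / c (ft p s) = (fw p s)^2"
  using energy[OF assms(1), of s] fr_zero[OF assms(1,2), of s] c_pos[of "ft p s"] by (simp add: field_simps)
 then show ?thesis unfolding qf_def using assms(3) by simp
qed

lemma fv_deriv0: "p \<in> P1 ==> rr p = 0 ==> ((%t. fv p t) has_real_derivative (1/2) * (fw p t)^2 * c (ft p t)) (at t)"
 using fv_deriv[of p t] fr_zero[of p t] by simp

lemma fv_mono0: assumes "p \<in> P1" "rr p = 0" "s <= t" shows "fv p s <= fv p t"
proof (rule DERIV_nonneg_imp_nondecreasing[OF assms(3)])
 show "EX y. ((%t. fv p t) has_real_derivative y) (at x) & 0 <= y" for x
  using fv_deriv0[OF assms(1,2), of x] c_pos[of "ft p x"] by (intro exI[of _ "(1/2) * (fw p x)^2 * c (ft p x)"]) simp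
qed

lemma fv_strict_mono0: assumes "p \<in> P1" "rr p = 0" "s < t" "!!x. s < x ==> x < t ==> fw p x ~= 0" shows "fv p s < fv p t"
proof (rule DERIV_pos_imp_increasing_open[OF assms(3)])
 show "EX y. ((%t. fv p t) has_real_derivative y) (at x) & 0 < y" if "s < x" "x < t" for x
  using fv_deriv0[OF assms(1,2), of x] c_pos[of "ft p x"] assms(4)[OF that]
  by (intro exI[of _ "(1/2) * (fw p x)^2 * c (ft p x)"]) simp
qed (rule cont_f[OF assms(1)])

text \<open>For r = 0 the quotient of v' = (1/2) w^2 c by \<theta>' = w c is w / 2, and w is a
  function of \<theta> and v. So the orbit becomes a solution of a scalar equation.\<close>

lemma graph:
 assumes p: "p \<in> P1" "rr p = 0" and ab: "a < b" and w: "!!s. a <= s ==> s <= b ==> 0 < fw p s"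
 obtains y where "continuous_on {ft p a..ft p b} y"
  "!!s. a <= s ==> s <= b ==> y (ft p s) = fv p s"
  "!!x. ft p a < x ==> x < ft p b ==> (y has_real_derivative (1/2) * qf x (y x)) (at x)"
  "!!x. ft p a <= x ==> x <= ft p b ==> EX s. a <= s & s <= b & ft p s = x"
proof -
 have mono: "ft p s < ft p t" if "a <= s" "s < t" "t <= b" for s t
  by (rule ft_strict_mono[OF p(1) _ that(2)]) (use w that in auto)
 have inj: "inj_on (ft p) {a..b}"
 proof (rule inj_onI)
  fix s t assume st: "s \<in> {a..b}" "t \<in> {a..b}" "ft p s = ft p t"
  then show "s = t" using mono[of s t] mono[of t s] by (cases s t rule: linorder_cases) auto
 qed
 have ex: "EX s. a <= s & s <= b & ft p s = x" if "ft p a <= x" "x <= ft p b" for x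
  using IVT'[of "%s. ft p s" a x b] that ab cont_f(3)[OF p(1)] by auto
 define \<tau> where "\<tau> = the_inv_into {a..b} (ft p)"
 have \<tau>: "\<tau> (ft p s) = s" if "a <= s" "s <= b" for s
  unfolding \<tau>_def using the_inv_into_f_f[OF inj] that by simp
 have \<tau>': "a <= \<tau> x & \<tau> x <= b & ft p (\<tau> x) = x" if "ft p a <= x" "x <= ft p b" for x
  using ex[OF that] \<tau> by force
 define y where "y x = fv p (\<tau> x)" for x
 have img: "ft p ` {a..b} = {ft p a..ft p b}"
 proof (intro equalityI subsetI)
  fix x assume "x \<in> ft p ` {a..b}"
  then obtain s where s: "a <= s" "s <= b" "x = ft p s" by auto
  have "ft p a <= ft p s" "ft p s <= ft p b"
   using mono[of a s] mono[of s b] s by (cases "a = s"; cases "s = b"; simp)+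
  then show "x \<in> {ft p a..ft p b}" using s by simp
 next
  fix x assume "x \<in> {ft p a..ft p b}"
  then obtain s where "a <= s" "s <= b" "ft p s = x" using ex[of x] by auto
  then show "x \<in> ft p ` {a..b}" by auto
 qed
 have c\<tau>: "continuous_on {ft p a..ft p b} \<tau>"
  using continuous_on_inv_into[of "{a..b}" "ft p"] inj cont_f(3)[OF p(1)] img unfolding \<tau>_def
  by (metis (no_types, lifting) compact_Icc continuous_on_cong continuous_on_inv the_inv_into_f_f)
 show thesis
 proof (rule that[of y])
  show "continuous_on {ft p a..ft p b} y"
   unfolding y_def by (rule continuous_on_compose2[OF cont_f(2)[OF p(1), of UNIV] c\<tau>]) simp
  show "y (ft p s) = fv p s" if "a <= s" "s <= b" for s using \<tau>[OF that] by (simp add: y_def)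
  show "(y has_real_derivative (1/2) * qf x (y x)) (at x)" if x: "ft p a < x" "x < ft p b" for x
  proof -
   have t: "a <= \<tau> x" "\<tau> x <= b" "ft p (\<tau> x) = x" using \<tau>'[of x] x by auto
   have wp: "0 < fw p (\<tau> x)" using w t by auto
   have "isCont \<tau> x" using c\<tau> x by (metis continuous_on_interior interior_atLeastAtMost_real greaterThanLessThan_iff)
   then have "(\<tau> has_real_derivative inverse (fw p (\<tau> x) * c (ft p (\<tau> x)))) (at x)"
   proof (rule DERIV_inverse_function[OF ft_deriv[OF p(1)] _ x, rotated -1])
    show "fw p (\<tau> x) * c (ft p (\<tau> x)) ~= 0" using wp c_pos[of "ft p (\<tau> x)"] by simp
    show "ft p (\<tau> y) = y" if "ft p a < y" "y < ft p b" for y using \<tau>'[of y] that by simp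
   qed
   from DERIV_chain2[OF fv_deriv0[OF p] this]
   have "(y has_real_derivative (1/2) * (fw p (\<tau> x))^2 * c (ft p (\<tau> x)) * inverse (fw p (\<tau> x) * c (ft p (\<tau> x)))) (at x)"
    by (simp add: y_def[abs_def])
   moreover have "(1/2) * (fw p (\<tau> x))^2 * c (ft p (\<tau> x)) * inverse (fw p (\<tau> x) * c (ft p (\<tau> x))) = (1/2) * fw p (\<tau> x)"
    using wp c_pos[of "ft p (\<tau> x)"] by (simp add: field_simps power2_eq_square)
   moreover have "fw p (\<tau> x) = qf x (y x)" using qf_eq[OF p, of "\<tau> x"] wp t by (simp add: y_def)
   ultimately show ?thesis by simp
  qed
 qed (use ex in auto)
qed

subsection \<open>Uniqueness of the unstable branch\<close>

definition Lm :: "real => state" where "Lm x = (0, - vs, x, 0)"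

text \<open>The points of the unstable branch with w > 0 during their whole past; the restriction is
  what makes the branch a graph over \<theta>.\<close>

definition UB :: "real => state => bool" where
 "UB tL z \<longleftrightarrow> z \<in> P1 & rr z = 0 & (flow z \<longlongrightarrow> Lm tL) at_bot & (ALL s<=0. 0 < fw z s)"

lemma Lm_simps [simp]: "rr (Lm x) = 0" "vv (Lm x) = - vs" "th (Lm x) = x" "ww (Lm x) = 0"
 by (auto simp: Lm_def)

lemma UB_shift: assumes "UB tL z" "s <= 0" shows "UB tL (flow z s)"
proof -
 have z: "z \<in> P1" using assms unfolding UB_def by simp
 have "filterlim (%t. s + t) at_bot at_bot"
  unfolding filterlim_at_bot eventually_at_bot_linorder by (metis add.commute le_diff_eq)
 then have "((%t. flow z (s + t)) \<longlongrightarrow> Lm tL) at_bot"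
  using assms unfolding UB_def by (auto intro: filterlim_compose)
 moreover have "flow (flow z s) = (%t. flow z (s + t))" using flow_flow[OF z] by (intro ext)
 ultimately show ?thesis using assms z unfolding UB_def by (auto simp: flow_flow fr_zero)
qed

lemma tendsto_at_bot_le:
 assumes "(f \<longlongrightarrow> (l::real)) at_bot" "!!s. s <= (S::real) ==> f s <= K" shows "l <= K"
proof (rule tendsto_upperbound[OF assms(1)])
 show "\<forall>\<^sub>F i in at_bot. f i <= K" unfolding eventually_at_bot_linorder using assms(2) by blast
qed simp

lemma tendsto_at_bot_ge:
 assumes "(f \<longlongrightarrow> (l::real)) at_bot" "!!s. s <= (S::real) ==> K <= f s" shows "K <= l"
proof (rule tendsto_lowerbound[OF assms(1)])
 show "\<forall>\<^sub>F i in at_bot. K <= f i" unfolding eventually_at_bot_linorder using assms(2) by blast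
qed simp

lemma UB_basic:
 assumes U: "UB tL z"
 shows "s < s' ==> s' <= 0 ==> ft z s < ft z s'" "s <= 0 ==> tL < ft z s" "s <= 0 ==> - vs < fv z s"
proof -
 have z: "z \<in> P1" "rr z = 0" "(flow z \<longlongrightarrow> Lm tL) at_bot" "!!s. s <= 0 ==> 0 < fw z s" using U unfolding UB_def by auto
 show m: "ft z s < ft z s'" if "s < s'" "s' <= 0" for s s'
  by (rule ft_strict_mono[OF z(1) _ that(1)]) (use z(4) that in auto)
 have m2: "fv z s < fv z s'" if "s < s'" "s' <= 0" for s s'
 proof (rule fv_strict_mono0[OF z(1,2) that(1)])
  show "fw z x ~= 0" if "x < s'" for x using z(4)[of x] that \<open>s' <= 0\<close> by auto
 qed
 have l: "((%t. ft z t) \<longlongrightarrow> tL) at_bot" "((%t. fv z t) \<longlongrightarrow> - vs) at_bot"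
  using tendsto_intros(1) comp_tendsto(3)[OF z(3)] comp_tendsto(2)[OF z(3)] by auto
 show "tL < ft z s" if s: "s <= 0"
 proof -
  have "tL <= ft z (s - 1)"
  proof (rule tendsto_at_bot_le[OF l(1), of "s - 1"])
   show "ft z x <= ft z (s - 1)" if "x <= s - 1" for x using m[of x "s - 1"] that s by (cases "x = s - 1") auto
  qed
  then show ?thesis using m[of "s - 1" s] s by simp
 qed
 show "- vs < fv z s" if s: "s <= 0"
 proof -
  have "- vs <= fv z (s - 1)"
  proof (rule tendsto_at_bot_le[OF l(2), of "s - 1"])
   show "fv z x <= fv z (s - 1)" if "x <= s - 1" for x using m2[of x "s - 1"] that s by (cases "x = s - 1") auto
  qed
  then show ?thesis using m2[of "s - 1" s] s by simp
 qed
qed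

definition crit :: "real => bool" where "crit tL \<longleftrightarrow> tL = ts | tL = - ts"

lemma critD: assumes "crit tL" shows "- (pi/2) < tL" "tL < pi/2" "G tL = 0" "V tL = Vs" "0 < cos tL"
 and "\<exists>b>tL. b < pi/2 & (ALL x. tL < x --> x < b --> 0 < G x)"
proof -
 show 1: "- (pi/2) < tL" "tL < pi/2" "G tL = 0" "V tL = Vs"
  using assms ts_range V_at_crit unfolding crit_def Vs_def by auto
 then show "0 < cos tL" using cos_pos by simp
 show "\<exists>b>tL. b < pi/2 & (ALL x. tL < x --> x < b --> 0 < G x)"
 proof (cases "tL = ts")
  case True
  show ?thesis by (rule exI[of _ "(ts + pi/2) / 2"]) (use True ts_range G_outer in auto)
 next
  case False
  then have "tL = - ts" using assms unfolding crit_def by simp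
  then show ?thesis by (intro exI[of _ 0]) (use ts_range G_neg_inner in auto)
 qed
qed

text \<open>The constant \<open>3/4\<close> leaves a margin: the unstable slope \<open>dw/d\<theta>\<close> at the equilibrium exceeds
 \<open>(1/2) vs cos^2(tL) / c(tL)\<close>.\<close>
definition kap :: "real => real" where "kap tL = (3/4) * ((1/2) * vs * (cos tL)^2 / c tL)"

text \<open>Comparison functions that vanish at - infinity: w - \<kappa> (\<theta> - tL) is
  nondecreasing, hence nonnegative, and w - K (\<theta> - tL) decreases wherever it is positive,
  hence is never positive. Integrating dv/d\<theta> = w / 2 then bounds v + vs
  quadratically.\<close>

lemma UB_near:
 assumes cr: "crit tL"
 shows "\<exists>K>0. ALL z. UB tL z --> (EX S<=0. ALL s<=S. kap tL * (ft z s - tL) <= fw z s & fv z s + vs <= K * (ft z s - tL)^2 &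
   fv z s < 0 & (cos (ft z s))^2 / c (ft z s) <= (9/8) * ((cos tL)^2 / c tL) & ft z s < pi/2)"
proof -
 note cd = critD[OF cr]
 obtain b where b: "tL < b" "b < pi/2" "!!x. tL < x ==> x < b ==> 0 < G x" using cd(6) by blast
 obtain c0 where c0: "0 < c0" "!!x. tL <= x ==> x <= b ==> c0 <= cos x" using cos_lower[OF cd(1) b(2)] by blast
 obtain A where A: "0 < A" "\<forall>x\<in>{-10..10}. \<forall>y\<in>{-10..10}. \<bar>G x - G y\<bar> <= A * \<bar>x - y\<bar>" using G_lip by blast
 define B where "B = sqrt (2 * WM) / c0"
 define K0 where "K0 = (A + 3 * wM + B) / c0"
 \<comment> \<open>\<open>K0\<close> bounds w' / w as long as \<theta> - tL <= w. Since c >= 1/4, K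
   / 4 > \<open>K0\<close> makes w - K (\<theta> - tL) decrease where it is positive.\<close>
 define K where "K = 4 * K0 + 1"
 have B: "0 <= B" unfolding B_def using c0 WM(1) by simp
 have "0 <= K0" unfolding K0_def using A c0 wM_nonneg B by simp
 then have K1: "1 <= K" "(A + 3 * wM + B) / c0 < K / 4" unfolding K_def K0_def[symmetric] by auto
 define \<kappa> where "\<kappa> = kap tL"
 have k0: "0 < (cos tL)^2 / c tL" by (intro divide_pos_pos zero_less_power cd(5) c_pos)
 \<comment> \<open>cos times the derivative of w - \<kappa> (\<theta> - tL) is G + w \<Phi>. At the
   equilibrium \<Phi> is a quarter of (1/2) vs cos^3 tL, the margin left by the factor 3/4 in
   \<open>kap\<close>.\<close>
 define \<Phi> where "\<Phi> x = - (1/2) * vv x * (cos (th x))^3 - ww x * c (th x) * sin (th x) - (1/2) * ww x * deriv c (th x) * cos (th x) - \<kappa> * c (th x) * cos (th x)" for x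
 have \<Phi>0: "0 < \<Phi> (Lm tL)"
 proof -
  have "\<Phi> (Lm tL) = (1/2) * vs * (cos tL)^3 - (3/4) * ((1/2) * vs * (cos tL)^3)"
   using c_pos[of tL] unfolding \<Phi>_def \<kappa>_def kap_def by (simp add: power2_eq_square power3_eq_cube)
  moreover have "0 < (1/2) * vs * (cos tL)^3" using cd(5) vs_pos by simp
  ultimately show ?thesis by linarith
 qed
 have main: "EX S<=0. ALL s<=S. kap tL * (ft z s - tL) <= fw z s & fv z s + vs <= (K/4) * (ft z s - tL)^2 &
   fv z s < 0 & (cos (ft z s))^2 / c (ft z s) <= (9/8) * ((cos tL)^2 / c tL) & ft z s < pi/2" if U: "UB tL z" for z
 proof -
  have z: "z \<in> P1" "rr z = 0" "(flow z \<longlongrightarrow> Lm tL) at_bot" "!!s. s <= 0 ==> 0 < fw z s" using U unfolding UB_def by auto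
  note ub = UB_basic[OF U]
  have lth: "((%t. ft z t) \<longlongrightarrow> tL) at_bot" and lv: "((%t. fv z t) \<longlongrightarrow> - vs) at_bot" and lw: "((%t. fw z t) \<longlongrightarrow> 0) at_bot"
   using comp_tendsto(3)[OF z(3)] comp_tendsto(2)[OF z(3)] comp_tendsto(4)[OF z(3)] by auto
  have dcl: "isCont (deriv c) x" for x using cont_dc by (simp add: continuous_on_eq_continuous_at)
  have "((%t. \<Phi> (flow z t)) \<longlongrightarrow> - (1/2) * (- vs) * (cos tL)^3 - 0 * c tL * sin tL - (1/2) * 0 * deriv c tL * cos tL - \<kappa> * c tL * cos tL) at_bot"
   unfolding \<Phi>_def
   by (intro tendsto_intros lth lv lw isCont_tendsto_compose[OF isCont_c lth] isCont_tendsto_compose[OF dcl lth])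
  then have l\<Phi>: "((%t. \<Phi> (flow z t)) \<longlongrightarrow> \<Phi> (Lm tL)) at_bot" by (simp add: \<Phi>_def)
  have e1: "eventually (%s. 0 < \<Phi> (flow z s)) at_bot" by (rule order_tendstoD(1)[OF l\<Phi> \<Phi>0])
  have e2: "eventually (%s. fv z s < 0) at_bot" by (rule order_tendstoD(2)[OF lv]) (use vs_pos in simp)
  have e3: "eventually (%s. ft z s < b) at_bot" by (rule order_tendstoD(2)[OF lth b(1)])
  have "((%t. (cos (ft z t))^2 / c (ft z t)) \<longlongrightarrow> (cos tL)^2 / c tL) at_bot"
   by (intro tendsto_intros lth isCont_tendsto_compose[OF isCont_c lth]) (use c_pos[of tL] in simp)
  then have e4: "eventually (%s. (cos (ft z s))^2 / c (ft z s) < (9/8) * ((cos tL)^2 / c tL)) at_bot"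
   by (rule order_tendstoD(2)) (use k0 in simp)
  have "eventually (%s. 0 < \<Phi> (flow z s) & fv z s < 0 & ft z s < b & (cos (ft z s))^2 / c (ft z s) < (9/8) * ((cos tL)^2 / c tL)) at_bot"
   using e1 e2 e3 e4 by eventually_elim simp
  then have "EX S0. ALL s<=S0. 0 < \<Phi> (flow z s) & fv z s < 0 & ft z s < b & (cos (ft z s))^2 / c (ft z s) < (9/8) * ((cos tL)^2 / c tL)"
   unfolding eventually_at_bot_linorder .
  then obtain S0 where S0: "ALL s<=S0. 0 < \<Phi> (flow z s) & fv z s < 0 & ft z s < b & (cos (ft z s))^2 / c (ft z s) < (9/8) * ((cos tL)^2 / c tL)" ..
  define S where "S = min S0 0"
  have S: "0 < \<Phi> (flow z s)" "fv z s < 0" "ft z s < b" "(cos (ft z s))^2 / c (ft z s) < (9/8) * ((cos tL)^2 / c tL)"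
   "s <= 0" "0 < fw z s" "tL < ft z s" "c0 <= cos (ft z s)" "0 < cos (ft z s)" if "s <= S" for s
  proof -
   have s: "s <= S0" "s <= 0" using that by (auto simp: S_def)
   then show "0 < \<Phi> (flow z s)" "fv z s < 0" "(cos (ft z s))^2 / c (ft z s) < (9/8) * ((cos tL)^2 / c tL)"
    "s <= 0" "0 < fw z s" "ft z s < b" "tL < ft z s" using S0 z(4) ub(2) by auto
   then show "c0 <= cos (ft z s)" using c0(2)[of "ft z s"] by auto
   then show "0 < cos (ft z s)" using c0(1) by linarith
  qed
  have low: "\<kappa> * (ft z s - tL) <= fw z s" if s: "s <= S" for s
  proof -
   define \<phi> where "\<phi> t = fw z t - \<kappa> * (ft z t - tL)" for t
   have d: "(\<phi> has_real_derivative dw (flow z t) - \<kappa> * (fw z t * c (ft z t))) (at t)" for t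
    unfolding \<phi>_def by (rule derivative_eq_intros fw_deriv[OF z(1)] ft_deriv[OF z(1)] refl | simp)+
   have pos: "0 <= dw (flow z t) - \<kappa> * (fw z t * c (ft z t))" if t: "t <= S" for t
   proof -
    have "cos (ft z t) * (dw (flow z t) - \<kappa> * (fw z t * c (ft z t))) = G (ft z t) + fw z t * \<Phi> (flow z t)"
     using dw_cos[OF flow_in[OF z(1), of t]] unfolding \<Phi>_def by (simp add: algebra_simps power2_eq_square)
    moreover have "0 <= G (ft z t)" using b(3)[of "ft z t"] S(3,7)[OF t] by simp
    moreover have "0 <= fw z t * \<Phi> (flow z t)" using S(1,6)[OF t] by simp
    ultimately have "0 <= cos (ft z t) * (dw (flow z t) - \<kappa> * (fw z t * c (ft z t)))" by linarith
    then show ?thesis using S(9)[OF t] by (simp add: zero_le_mult_iff)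
   qed
   have "((%t. fw z t - \<kappa> * (ft z t - tL)) \<longlongrightarrow> 0 - \<kappa> * (tL - tL)) at_bot" by (intro tendsto_intros lth lw)
   then have "(\<phi> \<longlongrightarrow> 0) at_bot" by (simp add: \<phi>_def[abs_def])
   then have "0 <= \<phi> s"
   proof (rule tendsto_at_bot_le[of _ _ s])
    show "\<phi> t <= \<phi> s" if "t <= s" for t
     by (rule DERIV_nonneg_imp_nondecreasing[OF that]) (use d pos s in force)
   qed
   then show ?thesis by (simp add: \<phi>_def)
  qed
  have upp: "fw z s <= K * (ft z s - tL)" if s: "s <= S" for s
  proof (rule ccontr)
   assume n: "~ fw z s <= K * (ft z s - tL)"
   define \<phi> where "\<phi> t = fw z t - K * (ft z t - tL)" for t
   have \<phi>s: "0 < \<phi> s" using n by (simp add: \<phi>_def)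
   have d: "(\<phi> has_real_derivative dw (flow z t) - K * (fw z t * c (ft z t))) (at t)" for t
    unfolding \<phi>_def by (rule derivative_eq_intros fw_deriv[OF z(1)] ft_deriv[OF z(1)] refl | simp)+
   have neg: "dw (flow z t) - K * (fw z t * c (ft z t)) < 0" if t: "t <= S" and p: "0 < \<phi> t" for t
   proof -
    have xi: "ft z t - tL <= fw z t"
    proof -
     have "1 * (ft z t - tL) <= K * (ft z t - tL)" using K1 S(7)[OF t] by (intro mult_right_mono) auto
     then show ?thesis using p by (simp add: \<phi>_def)
    qed
    have in10: "ft z t \<in> {-10..10}" "tL \<in> {-10..10}" using S(3,7)[OF t] b cd pi_less_4 by auto
    have "\<bar>G (ft z t)\<bar> <= A * \<bar>ft z t - tL\<bar>" using A(2)[rule_format, OF in10] cd(3) by simp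
    also have "\<dots> <= A * fw z t" using A(1) xi S(7)[OF t] by (intro mult_left_mono) auto
    finally have g: "\<bar>G (ft z t)\<bar> <= A * fw z t" .
    have v: "\<bar>fv z t\<bar> <= B" unfolding B_def by (rule P1_v_bound(1)[OF flow_in[OF z(1)] c0(1) S(8)[OF t]])
    have "dw (flow z t) <= (\<bar>G (ft z t)\<bar> + (3 * wM + B) * \<bar>fw z t\<bar>) / c0"
     using dw_bound[OF flow_in[OF z(1)] c0(1) S(8)[OF t] v] by simp
    also have "\<dots> <= (A * fw z t + (3 * wM + B) * fw z t) / c0" using g S(6)[OF t] c0 by (intro divide_right_mono add_mono) auto
    also have "\<dots> = ((A + 3 * wM + B) / c0) * fw z t" by (simp add: algebra_simps)
    also have "\<dots> < (K / 4) * fw z t" using K1 S(6)[OF t] by (intro mult_strict_right_mono) auto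
    also have "\<dots> <= K * (fw z t * c (ft z t))"
    proof -
     have "(1/4) * (K * fw z t) <= c (ft z t) * (K * fw z t)" using c_bounds K1 S(6)[OF t] by (intro mult_right_mono) auto
     then show ?thesis by (simp add: mult_ac)
    qed
    finally show ?thesis by simp
   qed
   have "((%t. fw z t - K * (ft z t - tL)) \<longlongrightarrow> 0 - K * (tL - tL)) at_bot" by (intro tendsto_intros lth lw)
   then have "(\<phi> \<longlongrightarrow> 0) at_bot" by (simp add: \<phi>_def[abs_def])
   then have "eventually (%t. \<phi> t < \<phi> s / 2) at_bot" by (rule order_tendstoD(2)) (use \<phi>s in simp)
   then have "EX N. ALL t<=N. \<phi> t < \<phi> s / 2" unfolding eventually_at_bot_linorder .
   then obtain N where N: "ALL t<=N. \<phi> t < \<phi> s / 2" ..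
   define s0 where "s0 = min N (s - 1)"
   have s0: "\<phi> s0 <= \<phi> s / 2" "s0 < s" using N by (auto simp: s0_def less_imp_le)
   have "\<phi> s < \<phi> s / 2"
    by (rule stays_below[OF s0(1) d _ s0(2) order_refl]) (use neg s \<phi>s in auto)
   then show False using \<phi>s by simp
  qed
  have quad: "fv z s + vs <= (K/4) * (ft z s - tL)^2" if s: "s <= S" for s
  proof -
   define \<phi> where "\<phi> t = (K/4) * (ft z t - tL)^2 - (fv z t + vs)" for t
   have d: "(\<phi> has_real_derivative (1/2) * fw z t * c (ft z t) * (K * (ft z t - tL) - fw z t)) (at t)" for t
    unfolding \<phi>_def
    by (rule derivative_eq_intros fv_deriv0[OF z(1,2)] ft_deriv[OF z(1)] refl | simp add: algebra_simps power2_eq_square)+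
   have pos: "0 <= (1/2) * fw z t * c (ft z t) * (K * (ft z t - tL) - fw z t)" if t: "t <= S" for t
    using upp[OF t] S(6)[OF t] c_pos[of "ft z t"] by simp
   have "((%t. (K/4) * (ft z t - tL)^2 - (fv z t + vs)) \<longlongrightarrow> (K/4) * (tL - tL)^2 - (- vs + vs)) at_bot" by (intro tendsto_intros lth lv)
   then have "(\<phi> \<longlongrightarrow> 0) at_bot" by (simp add: \<phi>_def[abs_def])
   then have "0 <= \<phi> s"
   proof (rule tendsto_at_bot_le[of _ _ s])
    show "\<phi> t <= \<phi> s" if "t <= s" for t
     by (rule DERIV_nonneg_imp_nondecreasing[OF that]) (use d pos s in force)
   qed
   then show ?thesis by (simp add: \<phi>_def)
  qed
  show ?thesis
  proof (rule exI[of _ S], intro conjI allI impI)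
   show "S <= 0" by (simp add: S_def)
   fix s assume s: "s <= S"
   show "kap tL * (ft z s - tL) <= fw z s" using low[OF s] by (simp add: \<kappa>_def)
   show "fv z s + vs <= (K/4) * (ft z s - tL)^2" by (rule quad[OF s])
   show "fv z s < 0" by (rule S(2)[OF s])
   show "(cos (ft z s))^2 / c (ft z s) <= (9/8) * ((cos tL)^2 / c tL)" using S(4)[OF s] by simp
   show "ft z s < pi/2" using S(3)[OF s] b(2) by simp
  qed
 qed
 show ?thesis using main K1 by (intro exI[of _ "K/4"]) auto
qed

lemma UB_reach:
 assumes U: "UB tL z" and x: "tL < x" "x <= ft z S" "S <= 0"
 obtains s where "s <= S" "ft z s = x"
proof -
 have z: "z \<in> P1" "(flow z \<longlongrightarrow> Lm tL) at_bot" using U unfolding UB_def by auto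
 have "((%t. ft z t) \<longlongrightarrow> tL) at_bot" using comp_tendsto(3)[OF z(2)] by simp
 then have "eventually (%s. ft z s < x) at_bot" by (rule order_tendstoD(2)) (rule x)
 then have "EX N. ALL s<=N. ft z s < x" unfolding eventually_at_bot_linorder .
 then obtain N where N: "ALL s<=N. ft z s < x" ..
 have "ft z (min N S) < x" using N by simp
 then have "\<exists>s\<ge>min N S. s <= S & ft z s = x"
  using x cont_f(3)[OF z(1)] by (intro IVT') auto
 then obtain s where "s <= S" "ft z s = x" by blast
 then show thesis by (rule that)
qed

lemma UB_same_orbit:
 assumes U: "UB tL z1" "UB tL z2" and s: "s1 <= 0" "s2 <= 0" "flow z1 s1 = flow z2 s2" and th: "th z1 = th z2"
 shows "z1 = z2"
proof -
 have z: "z1 \<in> P1" "z2 \<in> P1" using U unfolding UB_def by auto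
 have 1: "z1 = flow z2 (s2 - s1)" using flow_flow[OF z(1), of s1 "-s1"] flow_flow[OF z(2), of s2 "-s1"] s z by simp
 have 2: "z2 = flow z1 (s1 - s2)" using flow_flow[OF z(2), of s2 "-s2"] flow_flow[OF z(1), of s1 "-s2"] s z by simp
 consider "s1 = s2" | "s1 < s2" | "s2 < s1" by linarith
 then show ?thesis
 proof cases
  case 1 then show ?thesis using \<open>z1 = flow z2 (s2 - s1)\<close> z by simp
 next
  case 2 then show ?thesis using UB_basic(1)[OF U(1), of "s1 - s2" 0] \<open>z2 = flow z1 (s1 - s2)\<close> th z by auto
 next
  case 3 then show ?thesis using UB_basic(1)[OF U(2), of "s2 - s1" 0] \<open>z1 = flow z2 (s2 - s1)\<close> th z by auto
 qed
qed

lemma collision_state_eq: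
 assumes "p \<in> P1" "q \<in> P1" "rr p = 0" "rr q = 0" "ft p s = ft q t" "fv p s = fv q t" "0 <= fw p s" "0 <= fw q t"
 shows "flow p s = flow q t"
 by (rule state_eqI) (use assms fr_zero qf_eq[of p s] qf_eq[of q t] in auto)

text \<open>If two unstable branches differ, the difference \<open>D\<close> of their \<open>v\<close>-graphs satisfies
 \<open>D' <= (3/2) D / (\<theta> - tL)\<close>, so \<open>D \<ge> const (\<theta> - tL) powr (3/2)\<close>, against \<open>D = O((\<theta> - tL)^2)\<close>.\<close>
lemma UB_unique_aux:
 assumes cr: "crit tL" and U: "UB tL p1" "UB tL p2" and th: "th p1 = th p2" and K: "0 < K"
  and near1: "!!s. s <= 0 ==> kap tL * (ft p1 s - tL) <= fw p1 s"
  and near2: "!!s. s <= 0 ==> kap tL * (ft p2 s - tL) <= fw p2 s & fv p2 s + vs <= K * (ft p2 s - tL)^2 &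
    (cos (ft p2 s))^2 / c (ft p2 s) <= (9/8) * ((cos tL)^2 / c tL)"
 shows "~ vv p1 < vv p2"
proof
 assume lt: "vv p1 < vv p2"
 have p: "p1 \<in> P1" "p2 \<in> P1" "rr p1 = 0" "rr p2 = 0"
  and w: "!!s. s <= 0 ==> 0 < fw p1 s" "!!s. s <= 0 ==> 0 < fw p2 s" using U unfolding UB_def by auto
 define k where "k = (cos tL)^2 / c tL"
 have k: "0 < k" unfolding k_def by (intro divide_pos_pos zero_less_power critD(5)[OF cr] c_pos)
 have kap: "kap tL = (3/8) * vs * k" unfolding kap_def k_def by simp
 have kp: "0 < kap tL" unfolding kap using k vs_pos by simp
 define x1 where "x1 = th p1 - tL"
 have x1: "0 < x1" using UB_basic(2)[OF U(1), of 0] p by (simp add: x1_def)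
 \<comment> \<open>C is the value of H below at the common starting angle. At distance x the
   quadratic bound on D gives H <= K^2 x, and x is chosen with K^2 x < C.\<close>
 define C where "C = (vv p2 - vv p1)^2 / x1^3"
 have C: "0 < C" using lt x1 by (simp add: C_def)
 define x where "x = min (x1 / 2) (C / (2 * K^2))"
 have x: "0 < x" "x < x1" using x1 C K by (auto simp: x_def)
 have "x <= C / (2 * K^2)" by (simp add: x_def)
 then have "x * (2 * K^2) <= C" using K by (simp add: pos_le_divide_eq)
 moreover have "0 < x * K^2" using x K by simp
 ultimately have xK: "K^2 * x < C" by (simp add: mult_ac)
 have th1: "ft p1 0 = tL + x1" "ft p2 0 = tL + x1" using p th by (auto simp: x1_def)
 obtain a1 where a1: "a1 <= 0" "ft p1 a1 = tL + x" using UB_reach[OF U(1), of "tL + x" 0] x th1 by auto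
 obtain a2 where a2: "a2 <= 0" "ft p2 a2 = tL + x" using UB_reach[OF U(2), of "tL + x" 0] x th1 by auto
 have a0: "a1 < 0" "a2 < 0" using a1 a2 x th1 by (auto simp: less_le)
 obtain y1 where y1: "continuous_on {ft p1 a1..ft p1 0} y1" "!!s. a1 <= s ==> s <= 0 ==> y1 (ft p1 s) = fv p1 s"
  "!!x. ft p1 a1 < x ==> x < ft p1 0 ==> (y1 has_real_derivative (1/2) * qf x (y1 x)) (at x)"
  "!!x. ft p1 a1 <= x ==> x <= ft p1 0 ==> EX s. a1 <= s & s <= 0 & ft p1 s = x"
  by (rule graph[OF p(1,3) a0(1) w(1)]) (auto intro: that)
 obtain y2 where y2: "continuous_on {ft p2 a2..ft p2 0} y2" "!!s. a2 <= s ==> s <= 0 ==> y2 (ft p2 s) = fv p2 s"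
  "!!x. ft p2 a2 < x ==> x < ft p2 0 ==> (y2 has_real_derivative (1/2) * qf x (y2 x)) (at x)"
  "!!x. ft p2 a2 <= x ==> x <= ft p2 0 ==> EX s. a2 <= s & s <= 0 & ft p2 s = x"
  by (rule graph[OF p(2,4) a0(2) w(2)]) (auto intro: that)
 define D where "D t = y2 t - y1 t" for t
 have Dc: "continuous_on {tL + x..tL + x1} D" unfolding D_def using y1(1) y2(1) a1 a2 th1 by (intro continuous_intros) auto
 have pt: "EX s1 s2. s1 <= 0 & s2 <= 0 & a2 <= s2 & ft p1 s1 = t & ft p2 s2 = t & y1 t = fv p1 s1 & y2 t = fv p2 s2"
  if t: "tL + x <= t" "t <= tL + x1" for t
 proof -
  obtain s1 where s1: "a1 <= s1" "s1 <= 0" "ft p1 s1 = t" using y1(4)[of t] t a1 th1 by auto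
  obtain s2 where s2: "a2 <= s2" "s2 <= 0" "ft p2 s2 = t" using y2(4)[of t] t a2 th1 by auto
  have "y1 t = fv p1 s1" "y2 t = fv p2 s2" using y1(2)[of s1] y2(2)[of s2] s1 s2 by simp_all
  then show ?thesis using s1 s2 by (intro exI[of _ s1] exI[of _ s2]) simp
 qed
 have D1: "D (tL + x1) = vv p2 - vv p1" using y1(2)[of 0] y2(2)[of 0] a0 th1 p by (simp add: D_def)
 have Dne: "D t ~= 0" if t: "tL + x <= t" "t <= tL + x1" for t
 proof
  assume z: "D t = 0"
  obtain s1 s2 where s: "s1 <= 0" "s2 <= 0" "ft p1 s1 = t" "ft p2 s2 = t" "y1 t = fv p1 s1" "y2 t = fv p2 s2" using pt[OF t] by blast
  have "flow p1 s1 = flow p2 s2"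
   by (rule collision_state_eq) (use p s z w[of s1] w[of s2] in \<open>auto simp: D_def less_imp_le\<close>)
  then have "p1 = p2" using UB_same_orbit[OF U s(1,2) _ th] by simp
  then show False using lt by simp
 qed
 have Dpos: "0 < D t" if t: "tL + x <= t" "t <= tL + x1" for t
 proof (rule ccontr)
  assume n: "~ 0 < D t"
  obtain u where "t <= u" "u <= tL + x1" "D u = 0"
   using IVT'[of D t 0 "tL + x1"] n t D1 lt continuous_on_subset[OF Dc, of "{t..tL + x1}"] by auto
  then show False using Dne[of u] t by auto
 qed
 \<comment> \<open>The square of D / (\<theta> - tL) powr (3/2), which avoids real exponents; the
   differential inequality makes it nonincreasing.\<close>
 define H where "H t = (D t)^2 / (t - tL)^3" for t
 have "H (tL + x1) <= H (tL + x)"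
 proof (rule DERIV_nonpos_imp_decreasing_open[of "tL + x" "tL + x1"])
  show "tL + x <= tL + x1" using x by simp
  show "continuous_on {tL + x..tL + x1} H" unfolding H_def using x by (intro continuous_intros Dc) auto
  fix t assume t: "tL + x < t" "t < tL + x1"
  define \<xi> where "\<xi> = t - tL"
  have xi: "0 < \<xi>" using t x by (simp add: \<xi>_def)
  define q1 where "q1 = qf t (y1 t)"
  define q2 where "q2 = qf t (y2 t)"
  have dD: "(D has_real_derivative (1/2) * q2 - (1/2) * q1) (at t)"
   unfolding D_def q1_def q2_def by (intro DERIV_diff y1(3) y2(3)) (use t a1 a2 th1 in auto)
  define d where "d = (1/2) * q2 - (1/2) * q1"
  have n: "((%t. (D t)^2) has_real_derivative 2 * D t * d) (at t)"
   using DERIV_power[OF dD, of 2] by (simp add: d_def mult_ac)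
  have "((%t. t - tL) has_real_derivative 1 - 0) (at t)" by (intro DERIV_diff DERIV_ident DERIV_const)
  from DERIV_power[OF this, of 3] have m: "((%t. (t - tL)^3) has_real_derivative 3 * \<xi>^2) (at t)"
   by (simp add: \<xi>_def)
  have "(H has_real_derivative (2 * D t * d * \<xi>^3 - (D t)^2 * (3 * \<xi>^2)) / (\<xi>^3 * \<xi>^3)) (at t)"
   unfolding H_def using DERIV_divide[OF n m] xi by (simp add: \<xi>_def)
  moreover have "(2 * D t * d * \<xi>^3 - (D t)^2 * (3 * \<xi>^2)) / (\<xi>^3 * \<xi>^3) = (2 * D t / \<xi>^4) * (\<xi> * d - (3/2) * D t)"
   using xi by (simp add: field_simps eval_nat_numeral)
  ultimately have dH: "(H has_real_derivative (2 * D t / \<xi>^4) * (\<xi> * ((1/2) * q2 - (1/2) * q1) - (3/2) * D t)) (at t)"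
   by (simp add: d_def)
  obtain s1 s2 where s: "s1 <= 0" "s2 <= 0" "ft p1 s1 = t" "ft p2 s2 = t" "y1 t = fv p1 s1" "y2 t = fv p2 s2" using pt[of t] t by auto
  have q1w: "q1 = fw p1 s1" using qf_eq[OF p(1,3), of s1] w(1)[OF s(1)] s by (simp add: q1_def)
  have q2w: "q2 = fw p2 s2" using qf_eq[OF p(2,4), of s2] w(2)[OF s(2)] s by (simp add: q2_def)
  have ql: "kap tL * \<xi> <= q1" "kap tL * \<xi> <= q2" using near1[OF s(1)] near2[OF s(2)] s q1w q2w by (auto simp: \<xi>_def)
  have e: "q1^2 = (2 * W t - (y1 t)^2 * (cos t)^2) / c t" "q2^2 = (2 * W t - (y2 t)^2 * (cos t)^2) / c t"
   using energy[OF p(1), of s1] energy[OF p(2), of s2] fr_zero p s q1w q2w c_pos[of t] by (auto simp: field_simps)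
  have kc: "(cos t)^2 / c t <= (9/8) * k" using near2[OF s(2)] s by (simp add: k_def)
  have "\<xi> * (q2 - q1) <= 3 * D t"
  proof (cases "q2 <= q1")
   case True
   then have "\<xi> * (q2 - q1) <= 0" using xi by (simp add: mult_nonneg_nonpos)
   then show ?thesis using Dpos[of t] t by simp
  next
   case False
   have vb: "- y1 t - y2 t <= 2 * vs" using UB_basic(3)[OF U(1) s(1)] UB_basic(3)[OF U(2) s(2)] s by simp
   have "(q2 - q1) * (2 * (kap tL * \<xi>)) <= (q2 - q1) * (q1 + q2)"
    using False ql by (intro mult_left_mono) auto
   also have "\<dots> = q2^2 - q1^2" by (simp add: power2_eq_square algebra_simps)
   also have "\<dots> = D t * (- y1 t - y2 t) * ((cos t)^2 / c t)" unfolding e D_def using c_pos[of t] by (simp add: field_simps power2_eq_square)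
   also have "\<dots> <= D t * (2 * vs) * ((9/8) * k)"
   proof (cases "0 <= - y1 t - y2 t")
    case True
    show ?thesis using vb kc Dpos[of t] t True c_pos[of t] vs_pos by (intro mult_mono) auto
   next
    case F: False
    have "D t * (- y1 t - y2 t) <= 0" using Dpos[of t] t F by (simp add: mult_le_0_iff)
    then have "D t * (- y1 t - y2 t) * ((cos t)^2 / c t) <= 0" by (rule mult_nonpos_nonneg[OF _ divide_nonneg_pos[OF zero_le_power2 c_pos]])
    also have "0 <= D t * (2 * vs) * ((9/8) * k)" using Dpos[of t] t vs_pos k by simp
    finally show ?thesis .
   qed
   \<comment> \<open>The factors 9/8 here and 3/4 in \<open>kap\<close> are matched so that the
     quotient is 3; halved, this is the exponent 3/2, below the exponent 2 of the upper
     bound.\<close>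
   also have "\<dots> = 2 * kap tL * (3 * D t)" unfolding kap by simp
   finally have "2 * kap tL * (\<xi> * (q2 - q1)) <= 2 * kap tL * (3 * D t)" by (simp add: mult_ac)
   then show ?thesis using kp by simp
  qed
  then have "\<xi> * ((1/2) * q2 - (1/2) * q1) - (3/2) * D t <= 0" by (simp add: algebra_simps)
  then have "(2 * D t / \<xi>^4) * (\<xi> * ((1/2) * q2 - (1/2) * q1) - (3/2) * D t) <= 0"
   using Dpos[of t] t xi by (intro mult_nonneg_nonpos) auto
  then show "EX y. (H has_real_derivative y) (at t) & y <= 0" using dH by blast
 qed
 then have "C <= (D (tL + x))^2 / x^3" using D1 by (simp add: H_def C_def)
 then have 1: "C * x^3 <= (D (tL + x))^2" using x by (simp add: pos_le_divide_eq)
 have "D (tL + x) <= K * x^2"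
 proof -
  obtain s1 s2 where s: "s1 <= 0" "s2 <= 0" "ft p1 s1 = tL + x" "ft p2 s2 = tL + x" "y1 (tL + x) = fv p1 s1" "y2 (tL + x) = fv p2 s2"
   using pt[of "tL + x"] x by auto
  have "fv p2 s2 + vs <= K * x^2" using near2[OF s(2)] s by simp
  then show ?thesis using UB_basic(3)[OF U(1) s(1)] s by (simp add: D_def)
 qed
 then have "(D (tL + x))^2 <= (K * x^2)^2" using Dpos[of "tL + x"] x by (intro power_mono) auto
 also have "\<dots> = (K^2 * x) * x^3" by (simp add: power2_eq_square power3_eq_cube)
 also have "\<dots> < C * x^3" using xK x by (intro mult_strict_right_mono) auto
 finally show False using 1 by simp
qed

text \<open>Both points are moved back to a common angle so small that the estimates of
  \<open>UB_near\<close> hold in the whole past; equality there propagates along the orbits.\<close>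

lemma UB_unique:
 assumes cr: "crit tL" and U: "UB tL z1" "UB tL z2" and th: "th z1 = th z2"
 shows "z1 = z2"
proof -
 have z: "z1 \<in> P1" "z2 \<in> P1" "rr z1 = 0" "rr z2 = 0" using U unfolding UB_def by auto
 obtain K where K: "0 < K" "ALL z. UB tL z --> (EX S<=0. ALL s<=S. kap tL * (ft z s - tL) <= fw z s & fv z s + vs <= K * (ft z s - tL)^2 &
   fv z s < 0 & (cos (ft z s))^2 / c (ft z s) <= (9/8) * ((cos tL)^2 / c tL) & ft z s < pi/2)" using UB_near[OF cr] by blast
 obtain S1 where S1: "S1 <= 0" "ALL s<=S1. kap tL * (ft z1 s - tL) <= fw z1 s & fv z1 s + vs <= K * (ft z1 s - tL)^2 &
   fv z1 s < 0 & (cos (ft z1 s))^2 / c (ft z1 s) <= (9/8) * ((cos tL)^2 / c tL) & ft z1 s < pi/2" using K(2) U(1) by blast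
 obtain S2 where S2: "S2 <= 0" "ALL s<=S2. kap tL * (ft z2 s - tL) <= fw z2 s & fv z2 s + vs <= K * (ft z2 s - tL)^2 &
   fv z2 s < 0 & (cos (ft z2 s))^2 / c (ft z2 s) <= (9/8) * ((cos tL)^2 / c tL) & ft z2 s < pi/2" using K(2) U(2) by blast
 define x where "x = min (ft z1 S1) (ft z2 S2)"
 have x: "tL < x" "x <= ft z1 S1" "x <= ft z2 S2" using UB_basic(2)[OF U(1) S1(1)] UB_basic(2)[OF U(2) S2(1)] by (auto simp: x_def)
 obtain s1 where s1: "s1 <= S1" "ft z1 s1 = x" by (rule UB_reach[OF U(1) x(1,2) S1(1)]) (auto intro: that)
 obtain s2 where s2: "s2 <= S2" "ft z2 s2 = x" by (rule UB_reach[OF U(2) x(1,3) S2(1)]) (auto intro: that)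
 have s0: "s1 <= 0" "s2 <= 0" using s1 s2 S1 S2 by auto
 note U1 = UB_shift[OF U(1) s0(1)] and U2 = UB_shift[OF U(2) s0(2)]
 have n1: "kap tL * (ft (flow z1 s1) s - tL) <= fw (flow z1 s1) s & fv (flow z1 s1) s + vs <= K * (ft (flow z1 s1) s - tL)^2 &
   (cos (ft (flow z1 s1) s))^2 / c (ft (flow z1 s1) s) <= (9/8) * ((cos tL)^2 / c tL)" if "s <= 0" for s
  using S1(2)[rule_format, of "s1 + s"] that s1 flow_flow[OF z(1), of s1 s] by simp
 have n2: "kap tL * (ft (flow z2 s2) s - tL) <= fw (flow z2 s2) s & fv (flow z2 s2) s + vs <= K * (ft (flow z2 s2) s - tL)^2 &
   (cos (ft (flow z2 s2) s))^2 / c (ft (flow z2 s2) s) <= (9/8) * ((cos tL)^2 / c tL)" if "s <= 0" for s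
  using S2(2)[rule_format, of "s2 + s"] that s2 flow_flow[OF z(2), of s2 s] by simp
 have "~ vv (flow z1 s1) < vv (flow z2 s2)"
  by (rule UB_unique_aux[OF cr U1 U2 _ K(1)]) (use n1 n2 s1 s2 in auto)
 moreover have "~ vv (flow z2 s2) < vv (flow z1 s1)"
  by (rule UB_unique_aux[OF cr U2 U1 _ K(1)]) (use n1 n2 s1 s2 in auto)
 ultimately have "fv z1 s1 = fv z2 s2" by simp
 then have "flow z1 s1 = flow z2 s2"
  using U s0 s1 s2 z unfolding UB_def by (intro collision_state_eq) (auto simp: less_imp_le)
 then show ?thesis by (rule UB_same_orbit[OF U s0 _ th])
qed

end

subsection \<open>Backward limits and shadowing of the unstable branches\<close>

lemma Rv_tendsto: "(f \<longlongrightarrow> l) F ==> ((%x. Rv (f x)) \<longlongrightarrow> Rv l) F"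
 by (rule state_tendstoI) (simp_all add: comp_tendsto tendsto_minus)

lemma Mi_tendsto: "(f \<longlongrightarrow> l) F ==> ((%x. Mi (f x)) \<longlongrightarrow> Mi l) F"
 by (rule state_tendstoI) (simp_all add: comp_tendsto tendsto_minus)

context shape
begin

lemma W_ge: "Vs * (cos x)^2 <= W x"
proof -
 define f where "f x = W x - Vs * (cos x)^2" for x
 have per: "f (y + pi) = f y" for y unfolding f_def by (simp add: W_sym(2))
 have base: "0 <= f y" if "- (pi/2) <= y" "y <= pi/2" for y
 proof (cases "\<bar>y\<bar> = pi/2")
  case True
  then have "y = pi/2 | y = - (pi/2)" by linarith
  then have "cos y = 0" by (elim disjE) (simp_all only: cos_minus cos_pi_half)
  then show ?thesis using W_pos by (simp add: f_def less_imp_le)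
 next
  case False
  then have y: "- (pi/2) < y" "y < pi/2" using that by auto
  have "Vs * (cos y)^2 <= V y * (cos y)^2" using V_min'[OF y] by (intro mult_right_mono) auto
  then show ?thesis using W_V[OF y] by (simp add: f_def mult.commute)
 qed
 define k where "k = \<lfloor>x / pi + 1/2\<rfloor>"
 have "of_int k <= x / pi + 1/2" "x / pi + 1/2 < of_int k + 1" unfolding k_def by linarith+
 then have "of_int k * pi <= x + pi/2" "x + pi/2 < (of_int k + 1) * pi" using pi_gt_zero by (auto simp: field_simps)
 then have "0 <= f (x - of_int k * pi)" by (intro base) (auto simp: algebra_simps)
 then have "0 <= f x" using periodic_int[of f "x - of_int k * pi" k] per by simp
 then show ?thesis by (simp add: f_def)
qed

lemma limit_at_zero_of_G:
 assumes l: "((%t. G (f t)) \<longlongrightarrow> 0) at_top" and f: "!!t::real. 0 <= t ==> x1 <= f t & f t <= x2"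
  and z: "!!x. x1 <= x ==> x <= x2 ==> x ~= tL ==> G x ~= 0"
 shows "(f \<longlongrightarrow> tL) at_top"
proof (rule tendstoI)
 fix e :: real assume e: "0 < e"
 define S where "S = {x1..x2} \<inter> {x. e <= \<bar>x - tL\<bar>}"
 have S: "compact S" unfolding S_def
  by (intro compact_Int_closed closed_Collect_le continuous_intros) auto
 have "\<exists>m>0. \<forall>x\<in>S. m <= \<bar>G x\<bar>"
 proof (cases "S = {}")
  case True then show ?thesis by (intro exI[of _ 1]) auto
 next
  case False
  have "continuous_on S (%x. \<bar>G x\<bar>)" by (intro continuous_intros continuous_on_subset[OF cont_G]) auto
  then have "\<exists>x\<in>S. \<forall>y\<in>S. \<bar>G x\<bar> <= \<bar>G y\<bar>" by (rule continuous_attains_inf[OF S False])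
  then obtain x where x: "x \<in> S" "\<forall>y\<in>S. \<bar>G x\<bar> <= \<bar>G y\<bar>" by blast
  have "G x ~= 0" by (rule z) (use x e in \<open>auto simp: S_def\<close>)
  then show ?thesis using x(2) by (intro exI[of _ "\<bar>G x\<bar>"]) auto
 qed
 then obtain m where m: "0 < m" "\<forall>x\<in>S. m <= \<bar>G x\<bar>" by blast
 from tendstoD[OF l m(1)] eventually_ge_at_top[of 0] show "eventually (%t. dist (f t) tL < e) at_top"
 proof eventually_elim
  case (elim t)
  have "f t \<notin> S" using m(2) elim(1) by (auto simp: dist_real_def)
  then show ?case using f[OF elim(2)] by (auto simp: S_def dist_real_def)
 qed
qed

text \<open>For the reversed orbit v is monotone and bounded, so \<open>barbalat_flow\<close> gives
  w and G(\<theta>) tending to 0, and tL is the only zero of G in the window. Energy then gives v^2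
  tending to vs^2, and the sign of v selects - vs.\<close>

lemma backward_limit:
 assumes cr: "crit tL" and z: "z \<in> P1" "rr z = 0" and x: "- (pi/2) < x1" "x2 < pi/2"
  and G: "!!x. x1 <= x ==> x <= x2 ==> x ~= tL ==> G x ~= 0"
  and win: "!!s. s <= 0 ==> x1 <= ft z s & ft z s <= x2" and v: "!!s. s <= 0 ==> fv z s <= - (vs/2)"
 shows "(flow z \<longlongrightarrow> Lm tL) at_bot"
proof -
 define y where "y = Rv z"
 have y: "y \<in> P1" "rr y = 0" using z by (auto simp: y_def)
 have fl: "flow y t = Rv (flow z (- t))" for t using flow_Rv[OF z(1)] by (simp add: y_def)
 obtain c0 where c0: "0 < c0" "!!x. x1 <= x ==> x <= x2 ==> c0 <= cos x" using cos_lower[OF x] by blast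
 have wy: "x1 <= ft y t & ft y t <= x2" if "0 <= t" for t using win[of "-t"] that fl by simp
 have N: "norm (flow y t) <= WM / c0^2 + sqrt (2 * WM) / c0 + pi/2 + wM" if "0 <= t" for t
  by (rule P1_norm_bound[OF flow_in[OF y(1)] x c0(1) c0(2)]) (use wy[OF that] in auto)
 obtain l where l: "((%t. fv y t) \<longlongrightarrow> l) at_top"
 proof (rule mono_bounded_limit[of 0 "%t. fv y t"])
  show "fv y s <= fv y t" if "0 <= s" "s <= t" for s t by (rule fv_mono0[OF y that(2)])
  show "fv y t <= WM / c0^2 + sqrt (2 * WM) / c0 + pi/2 + wM" if "0 <= t" for t
   using N[OF that] comp_le_norm(2)[of "flow y t"] by linarith
 qed (rule that)
 have lw: "((%t. fw y t) \<longlongrightarrow> 0) at_top" by (rule barbalat_flow(2)[OF y(1) N l y(2)])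
 have "((%t. G (ft y t)) \<longlongrightarrow> 0) at_top" by (rule barbalat_flow(3)[OF y(1) N lw])
 then have lth: "((%t. ft y t) \<longlongrightarrow> tL) at_top" by (rule limit_at_zero_of_G[OF _ wy G])
 have "((%t. (fv y t)^2 + 2 * fr y t) \<longlongrightarrow> 2 * V tL) at_top"
  by (rule sum_limit[OF y(1) lth lw]) (use critD[OF cr] in auto)
 then have "((%t. (fv y t)^2) \<longlongrightarrow> vs^2) at_top" using fr_zero[OF y] critD(4)[OF cr] vs_sq by simp
 then have "((%t. sqrt ((fv y t)^2)) \<longlongrightarrow> sqrt (vs^2)) at_top" by (rule tendsto_real_sqrt)
 moreover have "eventually (%t. sqrt ((fv y t)^2) = fv y t) at_top"
  unfolding eventually_at_top_linorder
 proof (intro exI[of _ 0] allI impI)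
  fix t :: real assume "0 <= t"
  then have "fv y t \<ge> vs/2" using v[of "-t"] fl by simp
  then show "sqrt ((fv y t)^2) = fv y t" using vs_pos by simp
 qed
 ultimately have lv: "((%t. fv y t) \<longlongrightarrow> vs) at_top" using vs_pos by (simp add: Lim_transform_eventually)
 have "((%t. flow y t) \<longlongrightarrow> Rv (Lm tL)) at_top"
  by (rule state_tendstoI) (use lv lw lth fr_zero[OF y] in simp_all)
 then have "((%t. Rv (flow y t)) \<longlongrightarrow> Rv (Rv (Lm tL))) at_top"
  by (rule Rv_tendsto)
 then have "((%t. flow z (- t)) \<longlongrightarrow> Lm tL) at_top" by (simp add: fl)
 then show ?thesis unfolding filterlim_at_bot_mirror .
qed

lemma limit_v_lower:
 assumes z: "z \<in> P1" "rr z = 0" "(flow z \<longlongrightarrow> Lm tL) at_bot" shows "- vs <= fv z s"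
proof -
 have "((%t. fv z t) \<longlongrightarrow> - vs) at_bot" using comp_tendsto(2)[OF z(3)] by simp
 then show ?thesis by (rule tendsto_at_bot_le[of _ _ s]) (rule fv_mono0[OF z(1,2)])
qed

text \<open>For r = 0 a zero of w forces |v| >= vs. As v is negative and has increased from - vs, it
  equals - vs and was constant in the past; then the past is at rest at the equilibrium, and by
  uniqueness the whole orbit is.\<close>

lemma branch_nonzero:
 assumes cr: "crit tL" and z: "z \<in> P1" "rr z = 0" "(flow z \<longlongrightarrow> Lm tL) at_bot" and n: "flow z s0 ~= Lm tL" and v: "fv z s < 0"
 shows "fw z s ~= 0"
proof
 assume w: "fw z s = 0"
 have c0: "cos (ft z s) ~= 0" using w_at_collision[OF flow_in[OF z(1)], of s] w by blast
 have "(fv z s)^2 * (cos (ft z s))^2 = 2 * W (ft z s)" using energy[OF z(1), of s] fr_zero[OF z(1,2)] w by simp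
 also have "\<dots> \<ge> vs^2 * (cos (ft z s))^2" using W_ge[of "ft z s"] vs_sq by simp
 finally have "vs^2 <= (fv z s)^2" using c0 by simp
 then have "vs <= \<bar>fv z s\<bar>" using vs_pos by (simp add: abs_le_square_iff[symmetric])
 then have vle: "fv z s <= - vs" using v by simp
 have vc: "fv z x = - vs" if "x <= s" for x
  using limit_v_lower[OF z, of x] fv_mono0[OF z(1,2) that] vle by simp
 have wx: "fw z x = 0" if "x < s" for x
 proof -
  have "((%t. - vs) has_real_derivative (1/2) * (fw z x)^2 * c (ft z x)) (at x)"
  proof (rule has_field_derivative_transform_within_open[OF fv_deriv0[OF z(1,2)]])
   show "open {..<s}" "x \<in> {..<s}" using that by auto
   show "fv z y = - vs" if "y \<in> {..<s}" for y using vc[of y] that by simp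
  qed
  then have "(1/2) * (fw z x)^2 * c (ft z x) = 0" by (rule DERIV_unique[OF _ DERIV_const])
  then show ?thesis using c_pos[of "ft z x"] by simp
 qed
 have tc: "ft z x = ft z s" if "x <= s" for x
 proof -
  have d: "fw z y = 0" if "y <= s" for y
  proof (cases "y = s")
   case False
   then show ?thesis using wx[of y] that by simp
  qed (use w in simp)
  have "ft z s <= ft z x + 0 * (s - x)"
  proof (rule deriv_upper[OF that ft_deriv[OF z(1)]])
   show "fw z y * c (ft z y) <= 0" if "y <= s" for y by (simp add: d[OF that])
  qed
  moreover have "ft z x + 0 * (s - x) <= ft z s"
  proof (rule deriv_lower[OF that ft_deriv[OF z(1)]])
   show "0 <= fw z y * c (ft z y)" if "y <= s" for y by (simp add: d[OF that])
  qed
  ultimately show ?thesis by simp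
 qed
 have lt: "((%t. ft z t) \<longlongrightarrow> tL) at_bot" using comp_tendsto(3)[OF z(3)] by simp
 have "tL <= ft z s"
 proof (rule tendsto_at_bot_le[OF lt, of s])
  show "ft z x <= ft z s" if "x <= s" for x using tc[OF that] by (rule eq_refl)
 qed
 moreover have "ft z s <= tL"
 proof (rule tendsto_at_bot_ge[OF lt, of s])
  show "ft z s <= ft z x" if "x <= s" for x using tc[OF that, symmetric] by (rule eq_refl)
 qed
 ultimately have eq: "flow z s = Lm tL" by (intro state_eqI) (use fr_zero[OF z(1,2)] vc[of s] w in auto)
 have LP: "Lm tL \<in> P1" using flow_in[OF z(1), of s] eq by simp
 have F0: "Fld (Lm tL) = 0"
 proof -
  have "dw (Lm tL) = 0" using dw_cos[OF LP] critD[OF cr] by simp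
  moreover have "W tL = (cos tL)^2 * Vs" using W_V[of tL] critD[OF cr] by simp
  ultimately show ?thesis unfolding Fld_eq using vs_sq by (simp add: zero_prod_def)
 qed
 have "Lm tL = flow (Lm tL) (s0 - s)"
 proof -
  have "(%t. Lm tL) (s0 - s) = flow ((%t. Lm tL) 0) (s0 - s - 0)"
   by (rule flow_unique[of "min 0 (s0 - s)" "max 0 (s0 - s)"]) (use LP F0 in auto)
  then show ?thesis by simp
 qed
 then show False using n flow_flow[OF z(1), of s "s0 - s"] eq by simp
qed

lemma branch_positive:
 assumes cr: "crit tL" and z: "z \<in> P1" "rr z = 0" "(flow z \<longlongrightarrow> Lm tL) at_bot" and n: "flow z s0 ~= Lm tL"
  and w: "EX s'<=s. 0 <= fw z s'" and v: "fv z s < 0"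
 shows "0 < fw z s"
proof (rule ccontr)
 assume neg: "~ 0 < fw z s"
 obtain s' where s': "s' <= s" "0 <= fw z s'" using w by blast
 have "\<exists>x\<ge>s'. x <= s & fw z x = 0"
  by (rule IVT2') (use s' neg cont_f(4)[OF z(1)] in auto)
 then obtain x where x: "x <= s" "fw z x = 0" by blast
 have "fv z x < 0" using fv_mono0[OF z(1,2) x(1)] v by simp
 then show False using branch_nonzero[OF cr z n] x by blast
qed

lemma tendsto_via_subsequences:
 fixes X :: "nat => 'a::heine_borel"
 assumes b: "bounded (range X)" and u: "!!r l. strict_mono r ==> (X \<circ> r) \<longlonglongrightarrow> l ==> l = a"
 shows "X \<longlonglongrightarrow> a"
proof (rule ccontr)
 assume "~ X \<longlonglongrightarrow> a"
 then obtain e where e: "0 < e" "!!N. \<exists>n\<ge>N. e <= dist (X n) a" unfolding lim_sequentially by (meson not_less)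
 have inf: "infinite {n. e <= dist (X n) a}" unfolding infinite_nat_iff_unbounded_le using e(2) by blast
 define r where "r = enumerate {n. e <= dist (X n) a}"
 have r: "strict_mono r" unfolding r_def using strict_mono_enumerate[OF inf] .
 have re: "e <= dist (X (r n)) a" for n unfolding r_def using enumerate_in_set[OF inf, of n] by simp
 have "range (X \<circ> r) \<subseteq> range X" by auto
 then have bs: "bounded (range (X \<circ> r))" by (rule bounded_subset[OF b])
 obtain l r' where r': "strict_mono r'" "((X \<circ> r) \<circ> r') \<longlonglongrightarrow> l"
  using bounded_imp_convergent_subsequence[OF bs] by auto
 have "(X \<circ> (r \<circ> r')) \<longlonglongrightarrow> l" using r'(2) by (simp add: o_assoc)
 from u[OF strict_mono_o[OF r r'(1)] this] have "l = a" .
 then have "(%n. dist (X (r (r' n))) a) \<longlonglongrightarrow> 0" using tendsto_dist[OF r'(2) tendsto_const[of a]] by (simp add: o_def)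
 then have "e <= 0" by (rule tendsto_lowerbound) (use re in auto)
 then show False using e by simp
qed

text \<open>After T0 the orbit of p keeps away from the angle xe, so the exit times tn tend to
  infinity and the limit z has spent its whole past in the window with v <= - vs/2.\<close>

lemma shadow_core:
 assumes cr: "crit tL" and p: "p \<in> P1" and pn: "pn \<longlonglongrightarrow> p" "!!n. pn n \<in> P1"
  and x: "- (pi/2) < x1" "x2 < pi/2" and G: "!!x. x1 <= x ==> x <= x2 ==> x ~= tL ==> G x ~= 0"
  and T0: "0 <= T0" and tn: "!!n. T0 <= tn n"
  and win: "!!n s. T0 <= s ==> s <= tn n ==> x1 <= ft (pn n) s & ft (pn n) s <= x2 & fv (pn n) s <= - (vs/2)"
  and xe: "!!n. ft (pn n) (tn n) = xe" and \<eta>: "0 < \<eta>" "!!s. T0 <= s ==> \<eta> <= \<bar>ft p s - xe\<bar>"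
  and lim: "(%n. flow (pn n) (tn n)) \<longlonglongrightarrow> z"
 shows "z \<in> P1" "rr z = 0" "th z = xe" "(flow z \<longlongrightarrow> Lm tL) at_bot" "!!s. s <= 0 ==> fv z s < 0"
proof -
 show z: "z \<in> P1" by (rule Lim_in_closed_set[OF closed_P1 _ _ lim]) (use pn in auto)
 have "(%n. ft (pn n) (tn n)) \<longlonglongrightarrow> th z" by (rule comp_tendsto(3)[OF lim])
 then show "th z = xe" unfolding xe by (simp add: LIMSEQ_const_iff)
 have evP: "\<forall>\<^sub>F n in sequentially. pn n \<in> P1" using pn by simp
 have tinf: "\<forall>\<^sub>F n in sequentially. S < tn n" for S
  using flow_uniform[OF pn(1) evP p \<eta>(1), of "\<bar>S\<bar>"]
 proof eventually_elim
  case (elim n)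
  show ?case
  proof (rule ccontr)
   assume "~ S < tn n"
   then have "\<bar>tn n\<bar> <= \<bar>S\<bar>" using tn[of n] T0 by simp
   then have "\<bar>ft (pn n) (tn n) - ft p (tn n)\<bar> < \<eta>" using elim by (intro comp_close(3)) simp
   then show False using \<eta>(2)[OF tn[of n]] xe[of n] by simp
  qed
 qed
 have bk: "x1 <= ft z s & ft z s <= x2 & fv z s <= - (vs/2)" if s: "s <= 0" for s
 proof -
  have "(%n. flow (flow (pn n) (tn n)) s) \<longlonglongrightarrow> flow z s"
  proof (rule flow_tendsto[where q = "%n. flow (pn n) (tn n)" and t = "%n. s", OF lim _ z tendsto_const])
   show "\<forall>\<^sub>F n in sequentially. flow (pn n) (tn n) \<in> P1" by (rule always_eventually) (simp add: pn(2))
  qed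
  then have l: "(%n. flow (pn n) (tn n + s)) \<longlonglongrightarrow> flow z s" by (simp only: flow_flow[OF pn(2)])
  have ev: "\<forall>\<^sub>F n in sequentially. x1 <= ft (pn n) (tn n + s) & ft (pn n) (tn n + s) <= x2 & fv (pn n) (tn n + s) <= - (vs/2)"
   using tinf[of "T0 - s"]
  proof eventually_elim
   case (elim n)
   show ?case by (rule win) (use elim s in auto)
  qed
  have "x1 <= ft z s" by (rule tendsto_lowerbound[OF comp_tendsto(3)[OF l]]) (rule eventually_mono[OF ev], simp, simp)
  moreover have "ft z s <= x2" by (rule tendsto_upperbound[OF comp_tendsto(3)[OF l]]) (rule eventually_mono[OF ev], simp, simp)
  moreover have "fv z s <= - (vs/2)" by (rule tendsto_upperbound[OF comp_tendsto(2)[OF l]]) (rule eventually_mono[OF ev], simp, simp)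
  ultimately show ?thesis by simp
 qed
 show "fv z s < 0" if "s <= 0" for s using bk[OF that] vs_pos by auto
 obtain c0 where c0: "0 < c0" "!!x. x1 <= x ==> x <= x2 ==> c0 <= cos x" using cos_lower[OF x] by blast
 show r0: "rr z = 0"
 proof (rule ccontr)
  assume "rr z ~= 0"
  then have rz: "0 < rr z" using P1_bounds(1)[OF z] by simp
  define \<kappa> where "\<kappa> = vs/2 * c0^2 * rr z"
  have \<kappa>: "0 < \<kappa>" using rz c0 vs_pos by (simp add: \<kappa>_def)
  have vc: "fv z s * (cos (ft z s))^2 <= - (vs/2 * c0^2)" if s: "s <= 0" for s
  proof -
   have "c0 <= cos (ft z s)" using c0(2) bk[OF s] by simp
   then have "vs/2 * c0^2 <= (- fv z s) * (cos (ft z s))^2"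
    using bk[OF s] c0 vs_pos by (intro mult_mono power_mono) auto
   then show ?thesis by simp
  qed
  have d: "fr z s * fv z s * (cos (ft z s))^2 <= - (vs/2 * c0^2) * fr z s" if s: "s <= 0" for s
   using mult_left_mono[OF vc[OF s] fr_nonneg[OF z, of s]] by (simp add: mult_ac)
  have ge: "rr z <= fr z s" if s: "s <= 0" for s
  proof -
   have "fr z 0 <= fr z s + 0 * (0 - s)"
   proof (rule deriv_upper[OF s fr_deriv[OF z]])
    show "fr z x * fv z x * (cos (ft z x))^2 <= 0" if "x <= 0" for x
    proof -
     have "- (vs/2 * c0^2) * fr z x <= 0" using fr_nonneg[OF z, of x] vs_pos by (intro mult_nonpos_nonneg) auto
     with d[OF that] show ?thesis by (rule order_trans)
    qed
   qed
   then show ?thesis using z by simp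
  qed
  \<comment> \<open>With v negative, r grows backwards at a rate of at least \<kappa>. Over this
    time span it would exceed the energy bound \<open>WM / c0^2\<close>, so r = 0.\<close>
  define s where "s = - (WM / c0^2 / \<kappa>)"
  have s: "s <= 0" using WM(1) \<kappa> by (simp add: s_def)
  have "fr z 0 <= fr z s + (- \<kappa>) * (0 - s)"
  proof (rule deriv_upper[OF s fr_deriv[OF z]])
   show "fr z x * fv z x * (cos (ft z x))^2 <= - \<kappa>" if "x <= 0" for x
   proof -
    have "vs/2 * c0^2 * rr z <= vs/2 * c0^2 * fr z x" using ge[OF that] vs_pos by (intro mult_left_mono) auto
    then show ?thesis using d[OF that] by (simp add: \<kappa>_def)
   qed
  qed
  moreover have "fr z s <= WM / c0^2"
   by (rule P1_v_bound(2)[OF flow_in[OF z] c0(1)]) (use c0(2) bk[OF s] in auto)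
  moreover have "\<kappa> * (0 - s) = WM / c0^2" using \<kappa> by (simp add: s_def)
  ultimately show False using rz z by simp
 qed
 show "(flow z \<longlongrightarrow> Lm tL) at_bot"
  by (rule backward_limit[OF cr z r0 x G]) (use bk in auto)
qed

text \<open>The half-width of the windows around the critical points. The first two terms keep them
  inside (- \<pi>/2, \<pi>/2) and free of further critical points; the third limits the rise of v
  across a window to vs / 5.\<close>

definition \<delta>w :: real where "\<delta>w = min (min ((pi/2 - ts) / 2) (ts / 2)) (vs / (5 * (wM + 1)))"

lemma \<delta>w: "0 < \<delta>w" "\<delta>w < pi/2 - ts" "\<delta>w < ts" "wM * \<delta>w <= vs / 5"
proof -
 have w1: "0 < wM + 1" using wM_nonneg by simp
 then have a: "0 < vs / (5 * (wM + 1))" using vs_pos by simp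
 show p: "0 < \<delta>w" using ts_range a by (simp add: \<delta>w_def)
 have "\<delta>w <= (pi/2 - ts) / 2" "\<delta>w <= ts / 2" unfolding \<delta>w_def by linarith+
 then show "\<delta>w < pi/2 - ts" "\<delta>w < ts" using ts_range by auto
 have "\<delta>w <= vs / (5 * (wM + 1))" unfolding \<delta>w_def by linarith
 then have "\<delta>w * (5 * (wM + 1)) <= vs" using w1 by (simp add: pos_le_divide_eq)
 then have "5 * (wM * \<delta>w) + 5 * \<delta>w <= vs" by (simp add: algebra_simps)
 then show "wM * \<delta>w <= vs / 5" using p by simp
qed

lemma window:
 assumes "crit tL"
 shows "- (pi/2) < tL - \<delta>w" "tL + \<delta>w < pi/2" "!!x. tL - \<delta>w <= x ==> x <= tL + \<delta>w ==> x ~= tL ==> G x ~= 0"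
proof -
 show a: "- (pi/2) < tL - \<delta>w" "tL + \<delta>w < pi/2" using assms \<delta>w ts_range unfolding crit_def by auto
 fix x assume x: "tL - \<delta>w <= x" "x <= tL + \<delta>w" "x ~= tL"
 show "G x ~= 0" using G_nonzero[of x] x a assms \<delta>w ts_range unfolding crit_def by auto
qed

text \<open>Along the orbit dv is at most (w / 2) d\<theta>, as the term with r only lowers
  v.\<close>

lemma v_growth_up:
 assumes p: "p \<in> P1" and s: "a <= b" and w: "!!s. a <= s ==> s <= b ==> 0 <= fw p s"
 shows "fv p b - fv p a <= (1/2) * wM * (ft p b - ft p a)"
proof -
 have "fv p b - (1/2) * wM * ft p b <= fv p a - (1/2) * wM * ft p a + 0 * (b - a)"
 proof (rule deriv_upper[OF s, of "%s. fv p s - (1/2) * wM * ft p s"])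
  fix t assume t: "a <= t" "t <= b"
  show "((%s. fv p s - (1/2) * wM * ft p s) has_real_derivative
    ((1/2) * (fw p t)^2 * c (ft p t) - fr p t * (cos (ft p t))^2) - (1/2) * wM * (fw p t * c (ft p t))) (at t)"
   by (intro DERIV_diff fv_deriv[OF p] DERIV_cmult ft_deriv[OF p])
  have "fw p t * (fw p t * c (ft p t)) <= wM * (fw p t * c (ft p t))"
   using P1_bounds(6)[OF flow_in[OF p], of t] w[OF t] c_pos[of "ft p t"] by (intro mult_right_mono) auto
  moreover have "0 <= fr p t * (cos (ft p t))^2" using fr_nonneg[OF p] by simp
  ultimately show "((1/2) * (fw p t)^2 * c (ft p t) - fr p t * (cos (ft p t))^2) - (1/2) * wM * (fw p t * c (ft p t)) <= 0"
   by (simp add: power2_eq_square)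
 qed
 then show ?thesis by (simp add: algebra_simps)
qed

lemma v_growth_down:
 assumes p: "p \<in> P1" and s: "a <= b" and w: "!!s. a <= s ==> s <= b ==> fw p s <= 0"
 shows "fv p b - fv p a <= (1/2) * wM * (ft p a - ft p b)"
 using v_growth_up[OF sym_P1(2)[OF p] s] w by (simp add: flow_Mi[OF p])

lemma conv_time:
 assumes p: "p \<in> P1" "(flow p \<longlongrightarrow> Lm tL) at_top"
 obtains T0 where "0 <= T0" "!!s. T0 <= s ==> \<bar>ft p s - tL\<bar> < \<delta>w / 2" "!!s. T0 <= s ==> fv p s < - (9/10) * vs"
proof -
 have lt: "((%t. ft p t) \<longlongrightarrow> tL) at_top" and lv: "((%t. fv p t) \<longlongrightarrow> - vs) at_top"
  using comp_tendsto(3)[OF p(2)] comp_tendsto(2)[OF p(2)] by auto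
 have "eventually (%s. dist (ft p s) tL < \<delta>w / 2) at_top" by (rule tendstoD[OF lt]) (use \<delta>w in simp)
 moreover have "eventually (%s. fv p s < - (9/10) * vs) at_top" by (rule order_tendstoD(2)[OF lv]) (use vs_pos in simp)
 ultimately have "eventually (%s. dist (ft p s) tL < \<delta>w / 2 & fv p s < - (9/10) * vs) at_top" by (rule eventually_conj)
 then have "EX N. \<forall>s\<ge>N. dist (ft p s) tL < \<delta>w / 2 & fv p s < - (9/10) * vs" unfolding eventually_at_top_linorder .
 then obtain N where N: "\<forall>s\<ge>N. dist (ft p s) tL < \<delta>w / 2 & fv p s < - (9/10) * vs" ..
 show thesis by (rule that[of "max N 0"]) (use N in \<open>auto simp: dist_real_def\<close>)
qed

text \<open>At T0 the nearby orbits have v <= - (8/10) vs; crossing the window raises v by at most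
  vs / 5, so it stays below - vs/2 as \<open>shadow_core\<close> requires. Every limit point then
  lies on the unstable branch at the angle tL + \<delta>w, where the branch has one point
  only.\<close>

lemma shadow_up:
 assumes cr: "crit tL" and p: "p \<in> P1" "Conv tL p" "(flow p \<longlongrightarrow> Lm tL) at_top"
  and pn: "pn \<longlonglongrightarrow> p" "!!n. pn n \<in> P1" and tn: "!!n. Up (tL + \<delta>w) (pn n) (tn n)"
  and z0: "UB tL z0" "th z0 = tL + \<delta>w"
 shows "(%n. flow (pn n) (tn n)) \<longlonglongrightarrow> z0"
proof (rule tendsto_via_subsequences)
 note wi = window[OF cr]
 obtain c0 where c0: "0 < c0" "!!x. tL - \<delta>w <= x ==> x <= tL + \<delta>w ==> c0 <= cos x" using cos_lower[OF wi(1,2)] by blast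
 have thn: "ft (pn n) (tn n) = tL + \<delta>w" for n using tn unfolding Up_def by blast
 have "norm (flow (pn n) (tn n)) <= WM / c0^2 + sqrt (2 * WM) / c0 + pi/2 + wM" for n
  by (rule P1_norm_bound[OF flow_in[OF pn(2)] wi(1,2) c0(1)]) (use thn c0(2) \<delta>w in auto)
 then show "bounded (range (%n. flow (pn n) (tn n)))" unfolding bounded_iff by blast
 fix r l assume r: "strict_mono (r :: nat => nat)" and l: "((%n. flow (pn n) (tn n)) \<circ> r) \<longlonglongrightarrow> l"
 obtain T0 where T0: "0 <= T0" "!!s. T0 <= s ==> \<bar>ft p s - tL\<bar> < \<delta>w / 2" "!!s. T0 <= s ==> fv p s < - (9/10) * vs"
  by (rule conv_time[OF p(1,3)]) (rule that)
 have ltp: "ft p s < tL" if "0 <= s" for s using p(2) that unfolding Conv_def by blast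
 \<comment> \<open>The second term is the loss from - (9/10) vs for p to - (8/10) vs for its
   neighbours.\<close>
 define \<epsilon> where "\<epsilon> = min (\<delta>w / 2) (vs / 10)"
 have \<epsilon>: "0 < \<epsilon>" "\<epsilon> <= \<delta>w / 2" "\<epsilon> <= vs / 10" using \<delta>w vs_pos by (auto simp: \<epsilon>_def)
 have "\<forall>\<^sub>F n in sequentially. ALL t. \<bar>t\<bar> <= T0 --> norm (flow (pn n) t - flow p t) < \<epsilon>"
  by (rule flow_uniform[OF pn(1) _ p(1) \<epsilon>(1)]) (use pn in simp)
 then obtain N where N: "!!n t. N <= n ==> \<bar>t\<bar> <= T0 ==> norm (flow (pn n) t - flow p t) < \<epsilon>"
  unfolding eventually_sequentially by blast
 define r' where "r' n = r (n + N)" for n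
 have r'N: "N <= r' n" for n using seq_suble[OF r, of "n + N"] by (simp add: r'_def)
 have sub: "strict_mono r'" using r unfolding r'_def strict_mono_def by simp
 have l': "(%n. flow (pn (r' n)) (tn (r' n))) \<longlonglongrightarrow> l"
  using LIMSEQ_ignore_initial_segment[OF l, of N] by (simp add: r'_def o_def)
 have pn': "(%n. pn (r' n)) \<longlonglongrightarrow> p" using LIMSEQ_subseq_LIMSEQ[OF pn(1) sub] by (simp add: o_def)
 have T0tn: "T0 <= tn (r' n)" for n
 proof (rule ccontr)
  assume "~ T0 <= tn (r' n)"
  moreover have "0 < tn (r' n)" using tn unfolding Up_def by blast
  ultimately have "\<bar>ft (pn (r' n)) (tn (r' n)) - ft p (tn (r' n))\<bar> < \<epsilon>" by (intro comp_close(3) N r'N) auto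
  then show False using thn[of "r' n"] ltp[of "tn (r' n)"] \<open>0 < tn (r' n)\<close> \<epsilon> \<delta>w by auto
 qed
 have win: "tL - \<delta>w <= ft (pn (r' n)) s & ft (pn (r' n)) s <= tL + \<delta>w & fv (pn (r' n)) s <= - (vs/2)"
  if s: "T0 <= s" "s <= tn (r' n)" for n s
 proof -
  let ?q = "pn (r' n)"
  have "norm (flow ?q T0 - flow p T0) < \<epsilon>" by (rule N[OF r'N]) (use T0 in simp)
  note cl = comp_close[OF this]
  have a: "tL - \<delta>w <= ft ?q T0" using cl(3) T0(2)[OF order_refl] \<epsilon> by linarith
  have b: "fv ?q T0 <= - (8/10) * vs" using cl(2) T0(3)[OF order_refl] \<epsilon> by linarith
  have m1: "ft ?q T0 <= ft ?q s" using Up_mono[OF pn(2)[of "r' n"] tn[of "r' n"] T0(1), of s] s by (cases "T0 = s") auto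
  have m2: "ft ?q s <= tL + \<delta>w" using Up_mono[OF pn(2)[of "r' n"] tn[of "r' n"], of s "tn (r' n)"] s T0(1) thn by (cases "s = tn (r' n)") auto
  have "fv ?q s - fv ?q T0 <= (1/2) * wM * (ft ?q s - ft ?q T0)"
   by (rule v_growth_up[OF pn(2) s(1)]) (use tn[of "r' n"] s T0(1) in \<open>auto simp: Up_def less_imp_le\<close>)
  also have "\<dots> <= (1/2) * wM * (2 * \<delta>w)" using a m2 wM_nonneg by (intro mult_left_mono) auto
  also have "\<dots> <= vs / 5" using \<delta>w(4) by simp
  finally show ?thesis using a b m1 m2 vs_pos by auto
 qed
 have \<eta>: "\<delta>w <= \<bar>ft p s - (tL + \<delta>w)\<bar>" if "T0 <= s" for s using ltp[of s] that T0(1) \<delta>w by auto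
 note core = shadow_core[OF cr p(1) pn' pn(2) wi T0(1) T0tn win thn \<delta>w(1) \<eta> l']
 have c5: "fv l s < 0" if "s <= 0" for s by (rule core(5)) (use that in auto)
 have nl: "flow l 0 ~= Lm tL" using core(1,3) \<delta>w(1) by auto
 have "0 <= ww l"
 proof (rule tendsto_lowerbound[OF comp_tendsto(4)[OF l']])
  show "\<forall>\<^sub>F n in sequentially. 0 <= fw (pn (r' n)) (tn (r' n))" using tn unfolding Up_def by (auto simp: less_imp_le)
 qed simp
 moreover have nz: "fw l s ~= 0" if "s <= 0" for s
  by (rule branch_nonzero[OF cr core(1,2,4) nl c5[OF that]])
 ultimately have w0: "0 < fw l 0" using nz[of 0] core(1) by simp
 have "0 < fw l s" if s: "s <= 0" for s
 proof (rule ccontr)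
  assume n: "~ 0 < fw l s"
  have "\<exists>x\<ge>s. x <= 0 & fw l x = 0" by (rule IVT') (use n w0 s cont_f(4)[OF core(1)] in auto)
  then show False using nz by blast
 qed
 then have "UB tL l" unfolding UB_def using core by blast
 then show "l = z0" using UB_unique[OF cr _ z0(1)] z0(2) core(3) by simp
qed

text \<open>Orbits that turn just before - ts rise and fall within the window; each leg covers less
  than \<delta>w, so the total rise of v is again at most vs / 5. They leave along the branch with w
  < 0, the \<open>Mi\<close>-image of the branch at ts.\<close>

lemma shadow_ret:
 assumes p: "p \<in> Sec (- (pi/2))" "Conv (- ts) p" "(flow p \<longlongrightarrow> Lm (- ts)) at_top"
  and pn: "pn \<longlonglongrightarrow> p" "!!n. pn n \<in> Sec (- (pi/2))" and tn: "!!n. Ret (pn n) (tn n)"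
  and z0: "UB ts z0" "th z0 = ts + \<delta>w"
 shows "EX N un. (\<forall>n\<ge>N. 0 < un n & un n < tn n & ft (pn n) (un n) = - ts - \<delta>w & (ALL s. un n <= s & s <= tn n --> fw (pn n) s < 0)) &
   (%n. flow (pn n) (un n)) \<longlonglongrightarrow> Mi z0"
proof -
 have cr: "crit (- ts)" by (simp add: crit_def)
 have cr': "crit ts" by (simp add: crit_def)
 note wi = window[OF cr]
 have pP: "p \<in> P1" and p0: "th p = - (pi/2)" using p by (auto simp: Sec_def)
 have pnP: "pn n \<in> P1" and pn0: "th (pn n) = - (pi/2)" for n using pn(2)[of n] by (auto simp: Sec_def)
 obtain T0 where T0: "0 <= T0" "!!s. T0 <= s ==> \<bar>ft p s - (- ts)\<bar> < \<delta>w / 2" "!!s. T0 <= s ==> fv p s < - (9/10) * vs"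
  by (rule conv_time[OF pP p(3)]) (rule that)
 have T0p: "0 < T0" using T0(1) T0(2)[of T0] p0 pP wi(1) \<delta>w by (cases "T0 = 0") auto
 have wp: "0 < fw p s" "ft p s < - ts" if "0 <= s" for s using p(2) that unfolding Conv_def by auto
 have "\<exists>x\<in>{0..T0}. \<forall>y\<in>{0..T0}. fw p x <= fw p y"
  by (rule continuous_attains_inf) (use T0 cont_f(4)[OF pP] in auto)
 then obtain s0 where s0: "s0 \<in> {0..T0}" "\<forall>y\<in>{0..T0}. fw p s0 <= fw p y" by blast
 \<comment> \<open>The third term keeps w positive up to T0, so the turn takes place after T0 and
   inside the window.\<close>
 define \<epsilon> where "\<epsilon> = min (min (\<delta>w / 2) (vs / 10)) (fw p s0)"
 have \<epsilon>: "0 < \<epsilon>" "\<epsilon> <= \<delta>w / 2" "\<epsilon> <= vs / 10" "\<epsilon> <= fw p s0" using \<delta>w vs_pos wp(1)[of s0] s0(1) unfolding \<epsilon>_def by auto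
 have "\<forall>\<^sub>F n in sequentially. ALL t. \<bar>t\<bar> <= T0 --> norm (flow (pn n) t - flow p t) < \<epsilon>"
  by (rule flow_uniform[OF pn(1) _ pP \<epsilon>(1)]) (use pnP in simp)
 then obtain N where N: "!!n t. N <= n ==> \<bar>t\<bar> <= T0 ==> norm (flow (pn n) t - flow p t) < \<epsilon>"
  unfolding eventually_sequentially by blast
 have wpos: "0 < fw (pn n) s" if "N <= n" "0 <= s" "s <= T0" for n s
 proof -
  have "\<bar>fw (pn n) s - fw p s\<bar> < \<epsilon>" by (rule comp_close(4)[OF N]) (use that in auto)
  moreover have "fw p s0 <= fw p s" using s0 that by simp
  ultimately show ?thesis using \<epsilon>(4) by linarith
 qed
 have ex: "EX a u. T0 < a & a < u & u < tn n & ft (pn n) u = - ts - \<delta>w & (ALL s. 0 <= s & s <= a --> 0 <= fw (pn n) s) &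
   (ALL s. a < s & s <= tn n --> fw (pn n) s < 0) & ft (pn n) a < - ts & - ts - \<delta>w < ft (pn n) T0 & fv (pn n) T0 <= - (8/10) * vs & fw (pn n) a = 0" if n: "N <= n" for n
 proof -
  obtain a where a: "0 < a" "a < tn n" "fw (pn n) a = 0" "!!s. 0 <= s ==> s < a ==> 0 < fw (pn n) s"
    "!!s. a < s ==> s <= tn n ==> fw (pn n) s < 0" "- (pi/2) < ft (pn n) a" "ft (pn n) a < - ts"
   by (rule Ret_structure[OF pn(2) tn, of n]) (rule that)
  have aT: "T0 < a"
  proof (rule ccontr)
   assume "~ T0 < a"
   then show False using wpos[OF n, of a] a by simp
  qed
  have "norm (flow (pn n) T0 - flow p T0) < \<epsilon>" by (rule N[OF n]) (use T0 in simp)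
  note cl = comp_close[OF this]
  have b1: "- ts - \<delta>w < ft (pn n) T0" using cl(3) T0(2)[OF order_refl] \<epsilon> by linarith
  have b2: "fv (pn n) T0 <= - (8/10) * vs" using cl(2) T0(3)[OF order_refl] \<epsilon> by linarith
  have m: "ft (pn n) T0 < ft (pn n) a" by (rule ft_strict_mono[OF pnP _ aT]) (use a T0 in auto)
  have e: "ft (pn n) (tn n) = - (pi/2)" using tn unfolding Ret_def by blast
  have "\<exists>u\<ge>a. u <= tn n & ft (pn n) u = - ts - \<delta>w"
   by (rule IVT2') (use e m b1 a wi(1) cont_f(3)[OF pnP] in auto)
  then obtain u where u: "a <= u" "u <= tn n" "ft (pn n) u = - ts - \<delta>w" by blast
  have "a ~= u" "u ~= tn n" using u m b1 e wi(1) by auto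
  moreover have "0 <= fw (pn n) s" if "0 <= s" "s <= a" for s using a(3) a(4)[of s] that by (cases "s = a") auto
  ultimately show ?thesis using aT u a b1 b2 by (intro exI[of _ a] exI[of _ u]) auto
 qed
 have "ALL n. EX a u. N <= n --> T0 < a & a < u & u < tn n & ft (pn n) u = - ts - \<delta>w & (ALL s. 0 <= s & s <= a --> 0 <= fw (pn n) s) &
   (ALL s. a < s & s <= tn n --> fw (pn n) s < 0) & ft (pn n) a < - ts & - ts - \<delta>w < ft (pn n) T0 & fv (pn n) T0 <= - (8/10) * vs & fw (pn n) a = 0"
  using ex by blast
 then obtain an un where au: "!!n. N <= n ==> T0 < an n & an n < un n & un n < tn n & ft (pn n) (un n) = - ts - \<delta>w &
  (ALL s. 0 <= s & s <= an n --> 0 <= fw (pn n) s) &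
   (ALL s. an n < s & s <= tn n --> fw (pn n) s < 0) & ft (pn n) (an n) < - ts & - ts - \<delta>w < ft (pn n) T0 & fv (pn n) T0 <= - (8/10) * vs & fw (pn n) (an n) = 0"
  by (metis (no_types, lifting))
 define X where "X n = flow (pn (n + N)) (un (n + N))" for n
 have XL: "X \<longlonglongrightarrow> Mi z0"
 proof (rule tendsto_via_subsequences)
  obtain c0 where c0: "0 < c0" "!!x. - ts - \<delta>w <= x ==> x <= - ts + \<delta>w ==> c0 <= cos x" using cos_lower[OF wi(1,2)] by blast
  have "norm (X n) <= WM / c0^2 + sqrt (2 * WM) / c0 + pi/2 + wM" for n
   unfolding X_def
   by (rule P1_norm_bound[OF flow_in[OF pnP] wi(1,2) c0(1)]) (use au[of "n + N"] c0(2) \<delta>w in auto)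
  then show "bounded (range X)" unfolding bounded_iff by blast
  fix r l assume r: "strict_mono (r :: nat => nat)" and l: "(X \<circ> r) \<longlonglongrightarrow> l"
  define r' where "r' n = r n + N" for n
  have sub: "strict_mono r'" using r unfolding r'_def strict_mono_def by simp
  have l': "(%n. flow (pn (r' n)) (un (r' n))) \<longlonglongrightarrow> l" using l by (simp add: r'_def X_def o_def)
  have pn': "(%n. pn (r' n)) \<longlonglongrightarrow> p" using LIMSEQ_subseq_LIMSEQ[OF pn(1) sub] by (simp add: o_def)
  have au': "T0 < an (r' n)" "an (r' n) < un (r' n)" "un (r' n) < tn (r' n)" "ft (pn (r' n)) (un (r' n)) = - ts - \<delta>w"
   "!!s. 0 <= s ==> s <= an (r' n) ==> 0 <= fw (pn (r' n)) s" "!!s. an (r' n) < s ==> s <= tn (r' n) ==> fw (pn (r' n)) s < 0"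
   "ft (pn (r' n)) (an (r' n)) < - ts" "- ts - \<delta>w < ft (pn (r' n)) T0" "fv (pn (r' n)) T0 <= - (8/10) * vs" "fw (pn (r' n)) (an (r' n)) = 0" for n
   using au[of "r' n"] by (auto simp: r'_def)
  have le1: "0 <= (1/2) * wM * y \<longleftrightarrow> 0 <= y | wM = 0" for y using wM_nonneg by (auto simp: zero_le_mult_iff)
  have win: "- ts - \<delta>w <= ft (pn (r' n)) s & ft (pn (r' n)) s <= - ts + \<delta>w & fv (pn (r' n)) s <= - (vs/2)"
   if s: "T0 <= s" "s <= un (r' n)" for n s
  proof -
   let ?q = "pn (r' n)"
   have up: "ft ?q x <= ft ?q y" if "T0 <= x" "x <= y" "y <= an (r' n)" for x y
    using deriv_lower[OF that(2) ft_deriv[OF pnP], where K = 0] au'(5) that T0(1) c_pos by (auto simp: less_imp_le)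
   have dn: "ft ?q y <= ft ?q x" if "an (r' n) <= x" "x <= y" "y <= tn (r' n)" for x y
   proof (cases "x = y")
    case False
    then show ?thesis using ft_strict_antimono[OF pnP[of "r' n"], of x y] au'(6)[of n] that by auto
   qed simp
   have va: "fv ?q x <= - (8/10) * vs + (1/2) * wM * \<delta>w" if x: "T0 <= x" "x <= an (r' n)" for x
   proof -
    have "fv ?q x - fv ?q T0 <= (1/2) * wM * (ft ?q x - ft ?q T0)"
     by (rule v_growth_up[OF pnP x(1)]) (use au'(5) x T0(1) in auto)
    also have "\<dots> <= (1/2) * wM * \<delta>w" using up[OF x(1,2)] x au'(7,8)[of n] wM_nonneg by (intro mult_left_mono) auto
    finally show ?thesis using au'(9)[of n] by simp
   qed
   show ?thesis
   proof (cases "s <= an (r' n)")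
    case True
    then show ?thesis using va[OF s(1) True] up[of T0 s] up[of s "an (r' n)"] au'(1,7,8)[of n] s \<delta>w vs_pos by auto
   next
    case False
    have "fv ?q s - fv ?q (an (r' n)) <= (1/2) * wM * (ft ?q (an (r' n)) - ft ?q s)"
    proof (rule v_growth_down[OF pnP])
     show "fw ?q x <= 0" if "an (r' n) <= x" "x <= s" for x
      using au'(6)[of n x] au'(10)[of n] au'(3)[of n] that s by (cases "x = an (r' n)") auto
    qed (use False in simp)
    also have "\<dots> <= (1/2) * wM * \<delta>w" using dn[of s "un (r' n)"] False s au'(3,4,7)[of n] wM_nonneg by (intro mult_left_mono) auto
    finally have "fv ?q s <= - (8/10) * vs + wM * \<delta>w" using va[of "an (r' n)"] au'(1)[of n] by auto
    then have "fv ?q s <= - (vs/2)" using \<delta>w(4) vs_pos by linarith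
    moreover have "- ts - \<delta>w <= ft ?q s" using dn[of s "un (r' n)"] False s au'(3,4)[of n] by auto
    moreover have "ft ?q s <= - ts + \<delta>w" using dn[of "an (r' n)" s] False s au'(3,7)[of n] \<delta>w by auto
    ultimately show ?thesis by simp
   qed
  qed
  have \<eta>: "\<delta>w / 2 <= \<bar>ft p s - (- ts - \<delta>w)\<bar>" if "T0 <= s" for s using T0(2)[OF that] \<delta>w by (auto simp: abs_if split: if_splits)
  have tT: "T0 <= un (r' n)" for n using au'(1,2)[of n] by simp
  have d2: "0 < \<delta>w / 2" using \<delta>w by simp
  note core = shadow_core[OF cr pP pn' pnP wi T0(1) tT win au'(4) d2 \<eta> l']
  have c5: "fv l s < 0" if "s <= 0" for s by (rule core(5)) (use that in auto)
  have nl: "flow l 0 ~= Lm (- ts)" using core(1,3) \<delta>w(1) by auto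
  have "ww l <= 0"
  proof (rule tendsto_upperbound[OF comp_tendsto(4)[OF l']])
   show "\<forall>\<^sub>F n in sequentially. fw (pn (r' n)) (un (r' n)) <= 0" using au'(2,3,6) by (auto simp: less_imp_le)
  qed simp
  moreover have nz: "fw l s ~= 0" if "s <= 0" for s
   by (rule branch_nonzero[OF cr core(1,2,4) nl c5[OF that]])
  ultimately have w0: "fw l 0 < 0" using nz[of 0] core(1) by simp
  have neg: "fw l s < 0" if s: "s <= 0" for s
  proof (rule ccontr)
   assume n: "~ fw l s < 0"
   have "\<exists>x\<ge>s. x <= 0 & fw l x = 0" by (rule IVT2') (use n w0 s cont_f(4)[OF core(1)] in auto)
   then show False using nz by blast
  qed
  have "((%t. Mi (flow l t)) \<longlongrightarrow> Lm ts) at_bot"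
   using Mi_tendsto[OF core(4)] by (simp add: Mi_def Lm_def)
  moreover have "flow (Mi l) = (%t. Mi (flow l t))" using flow_Mi[OF core(1)] by (intro ext)
  ultimately have "UB ts (Mi l)" unfolding UB_def using core(1,2) neg by simp
  then have "Mi l = z0" using UB_unique[OF cr' _ z0(1)] z0(2) core(3) by simp
  then show "l = Mi z0" by (metis Mi_Mi)
 qed
 then have "(%n. flow (pn n) (un n)) \<longlonglongrightarrow> Mi z0" unfolding X_def by (rule LIMSEQ_offset)
 moreover have "0 < un n & un n < tn n & ft (pn n) (un n) = - ts - \<delta>w & (ALL s. un n <= s & s <= tn n --> fw (pn n) s < 0)" if "N <= n" for n
  using au[OF that] T0(1) by auto
 ultimately show ?thesis by blast
qed

subsection \<open>Collision orbits and barriers\<close>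

text \<open>Graphs of collision orbits over \<theta> cannot meet: at a common angle and v the states
  coincide, so the two orbits are one, and monotonicity of \<theta> leaves no time shift between the
  initial points.\<close>

lemma collision_order:
 assumes p: "p \<in> P1" "rr p = 0" and g: "g \<in> P1" "rr g = 0" and th: "th p = th g" and v: "vv p < vv g"
  and s: "0 <= s" "!!x. 0 <= x ==> x <= s ==> 0 < fw p x" and t: "0 <= t" "!!x. 0 <= x ==> x <= t ==> 0 < fw g x"
  and eq: "ft p s = ft g t"
 shows "fv p s < fv g t"
proof (cases "s = 0 | t = 0")
 case True
 have "s = 0 & t = 0"
 proof (rule ccontr)
  assume n: "~ (s = 0 & t = 0)"
  have "ft p 0 < ft p s" if "s ~= 0" by (rule ft_strict_mono[OF p(1)]) (use s that in auto)
  moreover have "ft g 0 < ft g t" if "t ~= 0" by (rule ft_strict_mono[OF g(1)]) (use t that in auto)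
  ultimately show False using n True eq th p(1) g(1) by auto
 qed
 then show ?thesis using v p g by simp
next
 case False
 then have st: "0 < s" "0 < t" using s t by auto
 obtain y1 where y1: "continuous_on {ft p 0..ft p s} y1" "!!x. 0 <= x ==> x <= s ==> y1 (ft p x) = fv p x"
  "!!x. ft p 0 < x ==> x < ft p s ==> (y1 has_real_derivative (1/2) * qf x (y1 x)) (at x)"
  "!!x. ft p 0 <= x ==> x <= ft p s ==> EX u. 0 <= u & u <= s & ft p u = x"
  by (rule graph[OF p st(1) s(2)]) (auto intro: that)
 obtain y2 where y2: "continuous_on {ft g 0..ft g t} y2" "!!x. 0 <= x ==> x <= t ==> y2 (ft g x) = fv g x"
  "!!x. ft g 0 < x ==> x < ft g t ==> (y2 has_real_derivative (1/2) * qf x (y2 x)) (at x)"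
  "!!x. ft g 0 <= x ==> x <= ft g t ==> EX u. 0 <= u & u <= t & ft g u = x"
  by (rule graph[OF g st(2) t(2)]) (auto intro: that)
 have th0: "ft g 0 = ft p 0" using th p g by simp
 have lt: "ft p 0 < ft p s" by (rule ft_strict_mono[OF p(1)]) (use s st in auto)
 show ?thesis
 proof (rule ccontr)
  assume n: "~ fv p s < fv g t"
  have "\<exists>x\<ge>ft p 0. x <= ft p s & y2 x - y1 x = 0"
  proof (rule IVT2')
   show "y2 (ft p s) - y1 (ft p s) <= 0" using y1(2)[of s] y2(2)[of t] n s(1) t(1) by (simp add: eq)
   show "0 <= y2 (ft p 0) - y1 (ft p 0)" using y1(2)[of 0] y2(2)[of 0] v s(1) t(1) p g by (simp add: th)
   show "continuous_on {ft p 0..ft p s} (%x. y2 x - y1 x)" using y1(1) y2(1) by (intro continuous_intros) (simp_all add: th0 eq)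
  qed (use lt in simp)
  then obtain x where x: "ft p 0 <= x" "x <= ft p s" "y2 x = y1 x" by auto
  obtain u where u: "0 <= u" "u <= s" "ft p u = x" using y1(4)[OF x(1,2)] by blast
  obtain u' where u': "0 <= u'" "u' <= t" "ft g u' = x" using y2(4)[of x] x th0 eq by auto
  have fe: "flow p u = flow g u'"
   by (rule collision_state_eq[OF p(1) g(1) p(2) g(2)]) (use u u' x y1(2)[OF u(1,2)] y2(2)[OF u'(1,2)] s(2)[OF u(1,2)] t(2)[OF u'(1,2)] in \<open>auto simp: less_imp_le\<close>)
  have pg: "p = flow g (u' - u)"
   using flow_inverse[OF p(1) fe] flow_flow[OF g(1), of u' "- u"] by simp
  have gp: "g = flow p (u - u')"
   using flow_inverse[OF g(1) fe[symmetric]] flow_flow[OF p(1), of u "- u'"] by simp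
  have "ft g 0 < ft g (u' - u)" if "u < u'" by (rule ft_strict_mono[OF g(1)]) (use t(2) that u u' in auto)
  moreover have "ft p 0 < ft p (u - u')" if "u' < u" by (rule ft_strict_mono[OF p(1)]) (use s(2) that u u' in auto)
  ultimately have "u = u'" using pg gp th p(1) g(1) by (metis flow_0 less_irrefl linorder_neqE_linordered_idom)
  then show False using pg v g(1) by simp
 qed
qed

lemma Conv_limit_pos:
 assumes cr: "crit tL" and p: "p \<in> P1" "0 < rr p" and C: "Conv tL p"
 shows "(flow p \<longlongrightarrow> Lm tL) at_top"
proof -
 have l: "((%t. ft p t) \<longlongrightarrow> tL) at_top" "((%t. fw p t) \<longlongrightarrow> 0) at_top" using C unfolding Conv_def by blast+
 have v: "sqrt (2 * V tL) = vs" using critD(4)[OF cr] by (simp add: vs_def)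
 show ?thesis using collapse[OF p l critD(1,2)[OF cr]] l v by (intro state_tendstoI) simp_all
qed

text \<open>For r = 0 the limit of v is vs or - vs, and v, being nondecreasing, starts above -
  vs.\<close>

lemma Conv_limit_zero:
 assumes cr: "crit tL" and p: "p \<in> P1" "rr p = 0" and v: "- vs < vv p" and C: "Conv tL p"
 shows "(flow p \<longlongrightarrow> (0, vs, tL, 0)) at_top"
proof -
 have l: "((%t. ft p t) \<longlongrightarrow> tL) at_top" "((%t. fw p t) \<longlongrightarrow> 0) at_top" using C unfolding Conv_def by blast+
 have sq: "((%t. (fv p t)^2) \<longlongrightarrow> vs^2) at_top"
  using sum_limit[OF p(1) l critD(1,2)[OF cr]] critD(4)[OF cr] by (simp add: fr_zero[OF p] vs_sq)
 have "\<forall>\<^sub>F t in at_top. (fv p t)^2 < (vs + 1)^2"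
  by (rule order_tendstoD(2)[OF sq]) (use vs_pos in \<open>simp add: power2_eq_square algebra_simps\<close>)
 then have "EX N. \<forall>t\<ge>N. (fv p t)^2 < (vs + 1)^2" unfolding eventually_at_top_linorder .
 then obtain N where N: "\<forall>t\<ge>N. (fv p t)^2 < (vs + 1)^2" ..
 have b: "fv p t <= vs + 1" if "N <= t" for t
 proof (rule power2_le_imp_le)
  show "(fv p t)^2 <= (vs + 1)^2" using N[rule_format, OF that] by simp
 qed (use vs_pos in simp)
 obtain k where k: "((%t. fv p t) \<longlongrightarrow> k) at_top"
  by (rule mono_bounded_limit[where T = N and f = "%t. fv p t" and B = "vs + 1"]) (auto intro: fv_mono0[OF p] b that)
 have "k^2 = vs^2" by (rule tendsto_unique[OF _ tendsto_power[OF k] sq]) simp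
 moreover have "vv p <= k"
 proof (rule tendsto_lowerbound[OF k])
  show "\<forall>\<^sub>F t in at_top. vv p <= fv p t"
   unfolding eventually_at_top_linorder by (rule exI[of _ 0]) (use fv_mono0[OF p, of 0] p in auto)
 qed simp
 ultimately have "k = vs" using v by (auto simp: power2_eq_iff)
 then show ?thesis using l k by (intro state_tendstoI) (simp_all add: fr_zero[OF p])
qed

lemma flow_MiRv: "p \<in> P1 ==> flow (Mi (Rv p)) t = Mi (Rv (flow p (- t)))"
 by (simp add: flow_Mi flow_Rv)

text \<open>\<open>Mi\<close> after \<open>Rv\<close> reverses time but keeps the sign of w; it
  exchanges the stable branch at (0, vs, tL, 0) with the unstable branch of
  \<open>Lm (- tL)\<close>.\<close>

lemma Conv_reverse:
 assumes q: "q \<in> P1" "rr q = 0" and C: "Conv tL q" and l: "(flow q \<longlongrightarrow> (0, vs, tL, 0)) at_top"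
 shows "UB (- tL) (Mi (Rv q))"
 unfolding UB_def
proof (intro conjI allI impI)
 have "((%t. Mi (Rv (flow q (- t)))) \<longlongrightarrow> Mi (Rv (0, vs, tL, 0))) at_bot"
  by (intro Mi_tendsto Rv_tendsto filterlim_compose[OF l filterlim_uminus_at_top_at_bot])
 moreover have "Mi (Rv (0, vs, tL, 0)) = Lm (- tL)" by (rule state_eqI) auto
 moreover have "flow (Mi (Rv q)) = (%t. Mi (Rv (flow q (- t))))" using flow_MiRv[OF q(1)] by (intro ext)
 ultimately show "(flow (Mi (Rv q)) \<longlongrightarrow> Lm (- tL)) at_bot" by simp
 show "0 < fw (Mi (Rv q)) s" if "s <= 0" for s using C that flow_MiRv[OF q(1), of s] unfolding Conv_def by simp
qed (use q in auto)

lemma UB_reverse: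
 assumes U: "UB tL z"
 shows "Conv (- tL) (Mi (Rv z))" "((%t. fv (Mi (Rv z)) t) \<longlongrightarrow> vs) at_top" "0 <= s ==> fv (Mi (Rv z)) s < vs"
proof -
 have z: "z \<in> P1" and l: "(flow z \<longlongrightarrow> Lm tL) at_bot" and w: "!!s. s <= 0 ==> 0 < fw z s" using U unfolding UB_def by blast+
 note f = flow_MiRv[OF z]
 have l': "((%t. flow z (- t)) \<longlongrightarrow> Lm tL) at_top" by (rule filterlim_compose[OF l filterlim_uminus_at_bot_at_top])
 show "Conv (- tL) (Mi (Rv z))"
  unfolding Conv_def f
  using w UB_basic(2)[OF U] tendsto_minus[OF comp_tendsto(3)[OF l']] comp_tendsto(4)[OF l'] by simp
 show "((%t. fv (Mi (Rv z)) t) \<longlongrightarrow> vs) at_top" using tendsto_minus[OF comp_tendsto(2)[OF l']] by (simp add: f)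
 show "fv (Mi (Rv z)) s < vs" if "0 <= s" for s using UB_basic(3)[OF U, of "- s"] that by (simp add: f)
qed

lemma good_crit: "good a tL ==> crit tL" by (auto simp: good_def crit_def)
lemma crit_minus: "crit tL ==> crit (- tL)" by (auto simp: crit_def)

lemma ft_IVT:
 assumes "p \<in> P1" "0 <= t" "th p <= x" "x <= ft p t"
 obtains s where "0 <= s" "s <= t" "ft p s = x"
proof -
 have "\<exists>s\<ge>0. s <= t & ft p s = x" by (rule IVT') (use assms cont_f(3)[OF assms(1)] in auto)
 then show ?thesis using that by blast
qed

text \<open>The reversed branch h = \<open>Mi (Rv z)\<close> starts on the section with v = - vv z
  and converges to the equilibrium with v = vs over tL. By \<open>UB_unique\<close> it is the only
  such orbit starting above - vs, so it separates the collision points that turn from those that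
  pass.\<close>

lemma barrier:
 assumes g: "good a tL" and z: "UB (- tL) z" "th z = - a" "vv z < 0" and q: "q \<in> Sec a" "rr q = 0"
 shows "- vv z < vv q ==> Turn tL q" and "- vs < vv q ==> vv q < - vv z ==> EX t. Up tL q t"
proof -
 define h where "h = Mi (Rv z)"
 have cr: "crit tL" by (rule good_crit[OF g])
 have zP: "z \<in> P1" "rr z = 0" using z unfolding UB_def by blast+
 have h: "h \<in> P1" "rr h = 0" "th h = a" "vv h = - vv z" using z(2) zP by (auto simp: h_def)
 note hC = UB_reverse[OF z(1), folded h_def, simplified]
 have qP: "q \<in> P1" "th q = a" "0 < ww q" using SecD[OF q(1)] by auto
 have hw: "0 < fw h s" "ft h s < tL" if "0 <= s" for s using hC(1) that unfolding Conv_def by blast+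
 have nC: "~ Conv tL q" if v: "- vs < vv q" "vv q ~= - vv z"
 proof
  assume C: "Conv tL q"
  have "UB (- tL) (Mi (Rv q))" by (rule Conv_reverse[OF qP(1) q(2) C Conv_limit_zero[OF cr qP(1) q(2) v(1) C]])
  then have "Mi (Rv q) = z" using UB_unique[OF crit_minus[OF cr] _ z(1)] z(2) qP(2) by simp
  then have "vv (Mi (Rv q)) = vv z" by simp
  then show False using v by simp
 qed
 have tri: "(EX t. Up tL q t) | Turn tL q | Conv tL q"
  by (rule section_trichotomy[OF g qP(1)]) (use qP goodD(2)[OF g] in auto)
 show "Turn tL q" if v: "- vv z < vv q"
 proof -
  have "~ Up tL q t" for t
  proof
   assume U: "Up tL q t"
   have ge: "fv h T <= fv q t" if T: "0 <= T" for T
   proof -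
    have "th h <= ft h T" using ft_strict_mono[OF h(1), of 0 T] hw T h(1) by (cases "T = 0") auto
    then obtain s where s: "0 <= s" "s <= t" "ft q s = ft h T"
     using ft_IVT[OF qP(1), of t "ft h T"] U hw(2)[OF T] qP(2) h(3) unfolding Up_def by (auto simp: less_imp_le)
    have "fv h T < fv q s"
     by (rule collision_order[OF h(1,2) qP(1) q(2) _ _ T _ s(1)]) (use h qP v hw U s in \<open>auto simp: Up_def\<close>)
    then show ?thesis using fv_mono0[OF qP(1) q(2) s(2)] by simp
   qed
   \<comment> \<open>The barrier runs below q and tends to v = vs. With v >= vs at tL energy leaves
     no room for w > 0.\<close>
   have "vs <= fv q t"
   proof (rule tendsto_upperbound[OF hC(2)])
    show "\<forall>\<^sub>F T in at_top. fv h T <= fv q t" unfolding eventually_at_top_linorder using ge by blast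
   qed simp
   then have "vs^2 <= (fv q t)^2" using vs_pos by (intro power_mono) auto
   then have "vs^2 * (cos tL)^2 <= (fv q t)^2 * (cos tL)^2" by (intro mult_right_mono) auto
   moreover have "2 * W tL = vs^2 * (cos tL)^2" using W_V[OF critD(1,2)[OF cr]] critD(4)[OF cr] vs_sq by simp
   moreover have "0 < (fw q t)^2 * c (ft q t)" using U c_pos[of "ft q t"] unfolding Up_def by (intro mult_pos_pos zero_less_power) auto
   ultimately show False using energy[OF qP(1), of t] fr_zero[OF qP(1) q(2), of t] U unfolding Up_def by simp
  qed
  moreover have "- vs < vv q" using v z(3) vs_pos by simp
  ultimately show ?thesis using tri nC v by auto
 qed
 show "EX t. Up tL q t" if v: "- vs < vv q" "vv q < - vv z"
 proof -
  have "~ Turn tL q"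
  proof
   assume "Turn tL q"
   then obtain u0 where u0: "0 < u0" "fw q u0 < 0" "!!s. 0 <= s ==> s <= u0 ==> ft q s < tL" unfolding Turn_def by blast
   obtain u where u: "0 < u" "u <= u0" "fw q u = 0" "!!s. 0 <= s ==> s < u ==> 0 < fw q s"
    using first_time[of 0 u0 "%s. fw q s" 0] cont_f(4)[OF qP(1)] u0 qP by auto
   have mono: "ft q s < ft q u" if "0 <= s" "s < u" for s
    by (rule ft_strict_mono[OF qP(1)]) (use u(4) that in auto)
   have lu: "ft q u < tL" using u0(3) u by simp
   have "\<exists>T\<ge>0. ft q u <= ft h T"
   proof -
    have "((%t. ft h t) \<longlongrightarrow> tL) at_top" using hC(1) unfolding Conv_def by blast
    from order_tendstoD(1)[OF this lu] have "EX N. \<forall>t\<ge>N. ft q u < ft h t" unfolding eventually_at_top_linorder .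
    then obtain N where "\<forall>t\<ge>N. ft q u < ft h t" ..
    then show ?thesis by (intro exI[of _ "max N 0"]) (auto simp: less_imp_le)
   qed
   then obtain T where T: "0 <= T" "ft q u <= ft h T" by blast
   have hT: "fv q s <= fv h T" if s: "0 <= s" "s < u" for s
   proof -
    have "th q <= ft q s" using ft_strict_mono[OF qP(1), of 0 s] u(4) s qP(1) by (cases "s = 0") auto
    then obtain t where t: "0 <= t" "t <= T" "ft h t = ft q s"
     using ft_IVT[OF h(1) T(1), of "ft q s"] T(2) mono[OF s] qP(2) h(3) by auto
    have "fv q s < fv h t"
     by (rule collision_order[OF qP(1) q(2) h(1,2) _ _ s(1) _ t(1)]) (use h qP v hw u s t in auto)
    then show ?thesis using fv_mono0[OF h(1,2) t(2)] by simp
   qed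
   \<comment> \<open>The order is known only while w > 0, hence the limit from the left. It gives
     |v| < vs at the turn, whereas w = r = 0 requires v^2 cos^2 = 2 W >= vs^2 cos^2.\<close>
   have "fv q u <= fv h T"
   proof (rule tendsto_upperbound)
    show "((%s. fv q s) \<longlongrightarrow> fv q u) (at_left u)"
     using DERIV_isCont[OF fv_deriv[OF qP(1)], of u] unfolding isCont_def by (rule filterlim_at_split[THEN iffD1, THEN conjunct1])
    show "\<forall>\<^sub>F s in at_left u. fv q s <= fv h T"
     using eventually_at_left_real[OF u(1)] by eventually_elim (use hT in auto)
   qed simp
   then have "fv q u < vs" using hC(3)[OF T(1)] by simp
   moreover have "- vs < fv q u" using fv_mono0[OF qP(1) q(2), of 0 u] u(1) v(1) qP(1) by simp
   ultimately have "(fv q u)^2 < vs^2" using power_strict_mono[of "\<bar>fv q u\<bar>" vs 2] by (simp add: abs_less_iff)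
   moreover have c0: "0 < (cos (ft q u))^2"
    using cos_pos[of "ft q u"] mono[of 0] u(1) lu goodD(1,3)[OF g] qP by (simp add: zero_less_power2)
   ultimately have "(fv q u)^2 * (cos (ft q u))^2 < vs^2 * (cos (ft q u))^2" by (intro mult_strict_right_mono)
   then show False using energy[OF qP(1), of u] fr_zero[OF qP(1) q(2), of u] u(3) W_ge[of "ft q u"] vs_sq by simp
  qed
  then show ?thesis using tri nC v by auto
 qed
qed

subsection \<open>The two section maps\<close>

text \<open>An orbit that passes - ts is carried on to \<theta> = 0 by \<open>exit_left\<close>;
  this step is why r > 0 is assumed.\<close>

lemma sec_left:
 assumes p: "p \<in> Sec (- (pi/2))" "0 < rr p"
 shows "(EX t. Ret p t) | (EX t. Up 0 p t) | Conv (- ts) p"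
proof -
 have pP: "p \<in> P1" "th p = - (pi/2)" "0 < ww p" using SecD[OF p(1)] by auto
 have g: "good (- (pi/2)) (- ts)" by (simp add: good_def)
 have "EX t. Up 0 p t" if U: "Up (- ts) p t" for t
 proof -
  have *: "0 < rr (flow p t)" using fr_pos_iff[OF pP(1), of t] fr_nonneg[OF pP(1), of t] p(2) by linarith
  obtain t' where t': "0 < t'" "ft (flow p t) t' = 0" "\<forall>s\<in>{0..t'}. 0 < fw (flow p t) s"
   using exit_left[OF flow_in[OF pP(1)] *] U ts_range pP(1) unfolding Up_def by auto
  then have "Up 0 (flow p t) t'" unfolding Up_def by auto
  then show ?thesis using Up_trans[OF pP(1) U] by blast
 qed
 then show ?thesis using section_trichotomy[OF g pP(1)] pP goodD(2)[OF g] Turn_imp_Ret[OF p(1)] by auto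
qed

lemma Up0_not:
 assumes p: "p \<in> Sec (- (pi/2))" and U: "Up 0 p t"
 shows "~ Ret p t'" "~ Conv (- ts) p" "EX s. Up (- ts) p s"
proof -
 obtain s where s: "Up (- ts) p s" using Up_between[OF SecD(1)[OF p] U, of "- ts"] SecD(2)[OF p] ts_range by auto
 then show "EX s. Up (- ts) p s" by blast
 show "~ Ret p t'" using Ret_imp_Turn[OF SecD(1,2)[OF p]] Up_not_Turn[OF s] by blast
 show "~ Conv (- ts) p" using Conv_not_Up s by blast
qed

lemma Up_pass_right:
 assumes p: "p \<in> P1" and U: "Up ts p t" shows "EX t. Up (pi/2) p t"
proof -
 obtain t' where t': "0 < t'" "ft (flow p t) t' = pi/2" "\<forall>s\<in>{0..t'}. 0 < fw (flow p t) s"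
  using pass_right[OF flow_in[OF p], of t] U ts_range p unfolding Up_def by auto
 then have "Up (pi/2) (flow p t) t'" unfolding Up_def by auto
 then show ?thesis using Up_trans[OF p U] by blast
qed

lemma sec_mid:
 assumes p: "p \<in> Sec 0"
 shows "(EX t. Up (pi/2) p t) | Turn ts p | Conv ts p"
proof -
 have g: "good 0 ts" by (simp add: good_def)
 show ?thesis using section_trichotomy[OF g SecD(1)[OF p]] SecD[OF p] goodD(2)[OF g] Up_pass_right[OF SecD(1)[OF p]] by auto
qed

lemma UpR_not:
 assumes p: "p \<in> Sec 0" and U: "Up (pi/2) p t" shows "~ Turn ts p" "~ Conv ts p"
proof -
 obtain s where s: "Up ts p s" using Up_between[OF SecD(1)[OF p] U, of "ts"] SecD(2)[OF p] ts_range by auto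
 show "~ Turn ts p" using Up_not_Turn[OF s] by blast
 show "~ Conv ts p" using Conv_not_Up s by blast
qed

lemma UB_window:
 assumes U: "UB tL z" and b: "tL + \<delta>w < th z"
 obtains z0 t where "UB tL z0" "th z0 = tL + \<delta>w" "Up (th z) z0 t" "up (th z) z0 = z" "z0 \<in> P1"
proof -
 have z: "z \<in> P1" "!!s. s <= 0 ==> 0 < fw z s" using U unfolding UB_def by blast+
 obtain s where s: "s <= 0" "ft z s = tL + \<delta>w" using UB_reach[OF U, of "tL + \<delta>w" 0] b \<delta>w(1) z by auto
 define z0 where "z0 = flow z s"
 have P: "z0 \<in> P1" using z by (simp add: z0_def)
 have ne: "s ~= 0" using s b z by auto
 have f: "flow z0 x = flow z (s + x)" for x using flow_flow[OF z(1)] by (simp add: z0_def)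
 have Up: "Up (th z) z0 (- s)" unfolding Up_def f using s ne z by auto
 show ?thesis
  by (rule that[of z0 "- s"]) (use Up UB_shift[OF U s(1)] s P up_eq[OF P Up] z f in \<open>auto simp: z0_def\<close>)
qed

text \<open>\<open>shadow_up\<close> gives convergence at the edge of the window; from there to the
  next section the branch is followed for a finite time, where passing is stable.\<close>

lemma shadow_Up:
 assumes cr: "crit tL" and p: "p \<in> P1" "0 < rr p" "Conv tL p"
  and pn: "pn \<longlonglongrightarrow> p" "!!n. pn n \<in> P1" "!!n. th (pn n) < tL" and tn: "!!n. Up b (pn n) (tn n)"
  and z: "UB tL z" "th z = b" "tL + \<delta>w < b"
 shows "(%n. up b (pn n)) \<longlonglongrightarrow> z"
proof -
 obtain z0 t where z0: "UB tL z0" "th z0 = tL + \<delta>w" "Up b z0 t" "up b z0 = z" "z0 \<in> P1"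
  using UB_window[OF z(1), unfolded z(2), OF z(3)] by blast
 have "EX t'. Up (tL + \<delta>w) (pn n) t' & Up b (flow (pn n) t') (tn n - t')" for n
 proof -
  have "th (pn n) < tL + \<delta>w" using pn(3)[of n] \<delta>w(1) by simp
  from Up_between[OF pn(2)[of n] tn[of n] this z(3)] show ?thesis by blast
 qed
 then have "EX un. ALL n. Up (tL + \<delta>w) (pn n) (un n) & Up b (flow (pn n) (un n)) (tn n - un n)" by (rule choice[OF allI])
 then obtain un where un: "!!n. Up (tL + \<delta>w) (pn n) (un n)" "!!n. Up b (flow (pn n) (un n)) (tn n - un n)" by blast
 have l: "(%n. flow (pn n) (un n)) \<longlonglongrightarrow> z0"
  by (rule shadow_up[OF cr p(1,3) Conv_limit_pos[OF cr p] pn(1,2) un(1) z0(1,2)])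
 have ev: "\<forall>\<^sub>F n in sequentially. flow (pn n) (un n) \<in> P1" using pn(2) by simp
 have "(%n. up b (flow (pn n) (un n))) \<longlonglongrightarrow> up b z0" by (rule Up_stable(2)[OF l ev z0(5,3)])
 moreover have "up b (flow (pn n) (un n)) = up b (pn n)" for n
  using up_eq[OF flow_in[OF pn(2)[of n]] un(2)[of n]] up_eq[OF pn(2)[of n] tn[of n]] flow_flow[OF pn(2)[of n], of "un n" "tn n - un n"] by simp
 ultimately show ?thesis using z0(4) by simp
qed

lemma Sh_tendsto: "(f \<longlongrightarrow> l) F ==> ((%x. Sh a (f x)) \<longlongrightarrow> Sh a l) F"
 by (rule state_tendstoI) (auto intro!: tendsto_intros)

text \<open>The downward leg is reflected by \<open>Mi\<close>, after which it passes from the edge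
  of the window at ts to \<pi>/2; undoing the reflection inside \<open>Qm\<close> leaves a
  translation by - \<pi>.\<close>

lemma shadow_Ret:
 assumes p: "p \<in> Sec (- (pi/2))" "0 < rr p" "Conv (- ts) p"
  and pn: "pn \<longlonglongrightarrow> p" "!!n. pn n \<in> Sec (- (pi/2))" and tn: "!!n. Ret (pn n) (tn n)"
  and z: "UB ts z" "th z = pi/2"
 shows "(%n. Qm (pn n)) \<longlonglongrightarrow> Sh (- pi) z"
proof -
 have cr: "crit (- ts)" by (simp add: crit_def)
 have b: "ts + \<delta>w < pi/2" using \<delta>w by simp
 obtain z0 t where z0: "UB ts z0" "th z0 = ts + \<delta>w" "Up (pi/2) z0 t" "up (pi/2) z0 = z" "z0 \<in> P1"
  using UB_window[OF z(1), unfolded z(2), OF b] by blast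
 have pnP: "pn n \<in> P1" for n using SecD(1)[OF pn(2)] .
 obtain N un where un: "\<forall>n\<ge>N. 0 < un n & un n < tn n & ft (pn n) (un n) = - ts - \<delta>w & (ALL s. un n <= s & s <= tn n --> fw (pn n) s < 0)"
   and l: "(%n. flow (pn n) (un n)) \<longlonglongrightarrow> Mi z0"
  using shadow_ret[OF p(1,3) Conv_limit_pos[OF cr SecD(1)[OF p(1)] p(2,3)] pn tn z0(1,2)] by blast
 define y where "y n = Mi (flow (pn n) (un n))" for n
 have yP: "y n \<in> P1" for n using pnP by (simp add: y_def)
 have ly: "y \<longlonglongrightarrow> z0" using Mi_tendsto[OF l] unfolding y_def by simp
 have fy: "flow (y n) s = Mi (flow (pn n) (un n + s))" for n s
  using flow_Mi[OF flow_in[OF pnP]] flow_flow[OF pnP] by (simp add: y_def)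
 have Uy: "Up (pi/2) (y n) (tn n - un n)" if "N <= n" for n
  unfolding Up_def fy using un[rule_format, OF that] tn[of n] unfolding Ret_def by auto
 have Q: "Qm (pn n) = Sh (- pi) (up (pi/2) (y n))" if "N <= n" for n
  using Qm_eq[OF tn[of n]] up_eq[OF yP Uy[OF that]] fy[of n "tn n - un n"] by (simp add: Sr_def)
 have "(%n. Sh (- pi) (up (pi/2) (y n))) \<longlonglongrightarrow> Sh (- pi) z"
  using Sh_tendsto[OF Up_stable(2)[OF ly _ z0(5,3)], of "- pi"] yP z0(4) by simp
 moreover have "\<forall>\<^sub>F n in sequentially. Sh (- pi) (up (pi/2) (y n)) = Qm (pn n)"
  using eventually_ge_at_top[of N] by eventually_elim (use Q in simp)
 ultimately show ?thesis by (rule Lim_transform_eventually)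
qed

end

text \<open>\<open>Sh (- pi) zA\<close> is the point of \<open>\<gamma>\<close> on \<open>\<theta> = - \<pi>/2\<close>, so \<open>v1 = vv zA\<close>; \<open>zB\<close> is the point of \<open>\<gamma>'\<close> on \<open>\<theta> = 0\<close>, so \<open>v3 = vv zB\<close>.\<close>

locale branches = shape +
 fixes zA zB :: state
 assumes zA: "UB ts zA" "th zA = pi/2" "vv zA < 0"
  and EA: "EX t. Up 0 (Sh (- pi) zA) t" "0 < vv (up 0 (Sh (- pi) zA))"
  and zB: "UB (- ts) zB" "th zB = 0" "vv zB < 0"
begin

subsection \<open>Shooting\<close>

definition Good :: "real => state => bool" where
 "Good b p \<longleftrightarrow> (EX t. Up b p t) & 0 < vv (up b p)"

text \<open>A section a, the next section b, the critical point between them, and the point z at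
  which its unstable branch meets b. In both cases v is negative at z.\<close>

definition stage :: "real => real => real => state => bool" where
 "stage a b tL z \<longleftrightarrow> a = - (pi/2) & b = 0 & tL = - ts & z = zB | a = 0 & b = pi/2 & tL = ts & z = zA"

lemma stageD:
 assumes "stage a b tL z"
 shows "crit tL" "a < tL" "UB tL z" "th z = b" "vv z < 0" "tL + \<delta>w < b"
  "!!p. p \<in> Sec a ==> 0 < rr p ==> (EX t. Up b p t) | Turn tL p | Conv tL p"
  "!!p t. p \<in> Sec a ==> Up b p t ==> ~ Turn tL p"
proof -
 have "crit tL & a < tL & UB tL z & th z = b & vv z < 0 & tL + \<delta>w < b"
  using assms zA zB ts_range \<delta>w by (auto simp: stage_def crit_def)
 then show "crit tL" "a < tL" "UB tL z" "th z = b" "vv z < 0" "tL + \<delta>w < b" by blast+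
 show "(EX t. Up b p t) | Turn tL p | Conv tL p" if "p \<in> Sec a" "0 < rr p" for p
  using assms sec_left[of p] sec_mid[of p] Ret_imp_Turn[of p] SecD[of p] that unfolding stage_def by blast
 show "~ Turn tL p" if "p \<in> Sec a" "Up b p t" for p t
  using assms UpR_not[of p t] Up0_not(3)[of p t] Up_not_Turn that unfolding stage_def by blast
qed

lemma Good_stable:
 assumes q: "(q \<longlongrightarrow> p) F" "\<forall>\<^sub>F x in F. q x \<in> P1" and p: "p \<in> P1" and U: "Good b p"
 shows "\<forall>\<^sub>F x in F. Good b (q x)"
proof -
 obtain t where t: "Up b p t" "0 < vv (up b p)" using U unfolding Good_def by blast
 have "\<forall>\<^sub>F x in F. 0 < vv (up b (q x))"
  by (rule order_tendstoD(1)[OF comp_tendsto(2)[OF Up_stable(2)[OF q p t(1)]] t(2)])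
 with Up_stable(1)[OF q p t(1)] show ?thesis by eventually_elim (auto simp: Good_def)
qed

text \<open>Take e as the infimum of the parameters that are not good. Goodness is open, so e itself
  is not good, but it is a limit of good parameters. A turn at e would be inherited by them, and
  convergence at e would make them arrive close to z with v < 0; so the orbit of e passes, with v >=
  0 as a limit and hence v = 0.\<close>

lemma shoot:
 fixes X :: "real => state"
 assumes st: "stage a b tL z" and AB: "A <= B" and X: "continuous_on {A..B} X"
  and XS: "!!r. A <= r ==> r <= B ==> X r \<in> Sec a & 0 < rr (X r)" and G: "Good b (X A)" "~ Good b (X B)"
 shows "\<exists>e>A. e <= B & (EX t. Up b (X e) t) & vv (up b (X e)) = 0 & (ALL r. A <= r --> r < e --> Good b (X r))"
proof -
 define S where "S = {r \<in> {A..B}. ~ Good b (X r)}"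
 define e where "e = Inf S"
 have S: "B \<in> S" "bdd_below S" "!!r. r \<in> S ==> A <= r" using AB G unfolding S_def by (auto intro!: bdd_belowI[of _ A])
 have eA: "A <= e" unfolding e_def by (rule cInf_greatest) (use S in auto)
 have eB: "e <= B" unfolding e_def by (rule cInf_lower) (use S in auto)
 have ge: "Good b (X r)" if "A <= r" "r < e" for r
 proof (rule ccontr)
  assume "~ Good b (X r)"
  then have "r \<in> S" using that eB unfolding S_def by auto
  then have "e <= r" unfolding e_def by (rule cInf_lower[OF _ S(2)])
  then show False using that by simp
 qed
 have XP: "X r \<in> P1" if "A <= r" "r <= B" for r using XS[OF that] SecD(1) by blast
 have bad: "~ Good b (X e)"
 proof
  assume g: "Good b (X e)"
  have l: "(X \<longlongrightarrow> X e) (at e within {A..B})" using X eA eB unfolding continuous_on_def by auto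
  have "\<forall>\<^sub>F r in at e within {A..B}. X r \<in> P1" unfolding eventually_at_filter using XP by (intro always_eventually) auto
  from Good_stable[OF l this XP[OF eA eB] g] obtain d where d: "0 < d" "\<forall>r\<in>{A..B}. r ~= e & dist r e < d --> Good b (X r)"
   unfolding eventually_at by blast
  obtain r where r: "r \<in> S" "r < e + d" using cInf_lessD[of S "e + d"] S(1) d(1) unfolding e_def by auto
  then have "e <= r" unfolding e_def by (intro cInf_lower[OF _ S(2)])
  then show False using r d g unfolding S_def by (cases "r = e") (auto simp: dist_real_def)
 qed
 have Ae: "A < e" using bad G(1) eA by (cases "A = e") auto
 define rn where "rn n = e - (e - A) / real (Suc n)" for n
 have rn: "A <= rn n" "rn n < e" for n
 proof -
  have "(e - A) / real (Suc n) <= (e - A) / 1" using Ae by (intro divide_left_mono) auto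
  then show "A <= rn n" by (simp add: rn_def)
  show "rn n < e" using Ae by (simp add: rn_def)
 qed
 have "rn \<longlonglongrightarrow> e - 0" unfolding rn_def
  by (intro tendsto_diff tendsto_const) (rule filterlim_compose[OF lim_const_over_n[of "e - A"] filterlim_Suc])
 then have lrn: "rn \<longlonglongrightarrow> e" by simp
 define pn where "pn n = X (rn n)" for n
 have rnB: "rn n <= B" for n using rn(2)[of n] eB by simp
 have pl: "pn \<longlonglongrightarrow> X e" unfolding pn_def
  by (rule continuous_on_tendsto_compose[OF X lrn]) (use eA eB rn(1) rnB in auto)
 have pnS: "pn n \<in> Sec a" for n using XS[OF rn(1) rnB] unfolding pn_def by blast
 have pnP: "pn n \<in> P1" for n using SecD(1)[OF pnS] .
 have ev: "\<forall>\<^sub>F n in sequentially. pn n \<in> P1" using pnP by simp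
 have gn: "Good b (pn n)" for n using ge[OF rn] unfolding pn_def .
 then have "EX tn. ALL n. Up b (pn n) (tn n)" unfolding Good_def by (intro choice) blast
 then obtain tn where tn: "!!n. Up b (pn n) (tn n)" by blast
 have Xe: "X e \<in> Sec a" "0 < rr (X e)" "X e \<in> P1" using XS[OF eA eB] XP[OF eA eB] by blast+
 have lim0: "0 <= vv l" if "(%n. up b (pn n)) \<longlonglongrightarrow> l" for l
  by (rule tendsto_lowerbound[OF comp_tendsto(2)[OF that]]) (use gn in \<open>auto simp: Good_def less_imp_le\<close>)
 have "~ Turn tL (X e)"
 proof
  assume "Turn tL (X e)"
  from eventually_happens[OF Turn_stable[OF pl ev Xe(3) this]] obtain n where "Turn tL (pn n)" by auto
  then show False using stageD(8)[OF st pnS tn] by blast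
 qed
 moreover have "~ Conv tL (X e)"
 proof
  assume C: "Conv tL (X e)"
  have "th (pn n) < tL" for n using SecD(2)[OF pnS] stageD(2)[OF st] by simp
  from lim0[OF shadow_Up[OF stageD(1)[OF st] Xe(3,2) C pl pnP this tn stageD(3,4,6)[OF st]]] show False
   using stageD(5)[OF st] by simp
 qed
 ultimately obtain t where t: "Up b (X e) t" using stageD(7)[OF st Xe(1,2)] by blast
 have "0 <= vv (up b (X e))" by (rule lim0[OF Up_stable(2)[OF pl ev Xe(3) t]])
 then have "vv (up b (X e)) = 0" using bad t unfolding Good_def by force
 then show ?thesis using Ae eB t ge by blast
qed

lemma shoot_rev:
 fixes X :: "real => state"
 assumes st: "stage a b tL z" and AB: "A <= B" and X: "continuous_on {A..B} X"
  and XS: "!!r. A <= r ==> r <= B ==> X r \<in> Sec a & 0 < rr (X r)" and G: "Good b (X B)" "~ Good b (X A)"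
 shows "\<exists>e\<ge>A. e < B & (EX t. Up b (X e) t) & vv (up b (X e)) = 0 & (ALL r. e < r --> r <= B --> Good b (X r))"
proof -
 define Y where "Y r = X (A + B - r)" for r
 have "continuous_on {A..B} Y" unfolding Y_def
  by (rule continuous_on_compose2[OF X]) (auto intro!: continuous_intros)
 moreover have "Y r \<in> Sec a & 0 < rr (Y r)" if "A <= r" "r <= B" for r using XS[of "A + B - r"] that by (simp add: Y_def)
 ultimately obtain e where e: "A < e" "e <= B" "EX t. Up b (Y e) t" "vv (up b (Y e)) = 0" "ALL r. A <= r --> r < e --> Good b (Y r)"
  using shoot[OF st AB, of Y] G by (auto simp: Y_def)
 have "Good b (X r)" if "A + B - e < r" "r <= B" for r using e(5)[rule_format, of "A + B - r"] that by (simp add: Y_def)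
 then show ?thesis using e by (intro exI[of _ "A + B - e"]) (auto simp: Y_def)
qed

text \<open>On a collision line energy fixes w independently of r and v.\<close>

definition Zq :: "real => real => state" where "Zq r v = (r, v, - (pi/2), sqrt (2 * W (- (pi/2)) / c (- (pi/2))))"

lemma Zq_simps [simp]: "rr (Zq r v) = r" "vv (Zq r v) = v" "th (Zq r v) = - (pi/2)"
 by (auto simp: Zq_def)

lemma Zq_Sec: "0 <= r ==> Zq r v \<in> Sec (- (pi/2))"
proof -
 assume r: "0 <= r"
 have w: "0 < 2 * W (- (pi/2)) / c (- (pi/2))" using W_pos c_pos[of "- (pi/2)"] by simp
 then have "ww (Zq r v) > 0" "(ww (Zq r v))^2 * c (- (pi/2)) = 2 * W (- (pi/2))" using c_pos[of "- (pi/2)"] by (auto simp: Zq_def)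
 then show ?thesis using r by (auto simp: Sec_def P1_iff En_def)
qed

lemma Zq_tendsto: "(f \<longlongrightarrow> r) F ==> ((%x. Zq (f x) v) \<longlongrightarrow> Zq r v) F"
 unfolding Zq_def by (intro tendsto_intros)

definition DQ :: "nat => state => bool" where "DQ k p \<longleftrightarrow> (\<forall>j<k. EX t. Ret ((Qm ^^ j) p) t)"

lemma rr_Qm: "p \<in> P1 ==> Ret p t ==> 0 < rr p ==> 0 < rr (Qm p)"
 using fr_pos_iff[of p t] fr_nonneg[of p t] by (auto simp: Qm_eq)

lemma DQ_in:
 assumes "p \<in> Sec (- (pi/2))" "0 < rr p" "DQ k p" "j <= k"
 shows "(Qm ^^ j) p \<in> Sec (- (pi/2)) & 0 < rr ((Qm ^^ j) p)"
 using assms(4)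
proof (induction j)
 case (Suc j)
 then obtain t where t: "Ret ((Qm ^^ j) p) t" using assms(3)[unfolded DQ_def, rule_format, of j] by (auto simp: Suc_le_eq)
 have h: "(Qm ^^ j) p \<in> Sec (- (pi/2))" "0 < rr ((Qm ^^ j) p)" using Suc by auto
 show ?case using Qm_Sec[OF SecD(1)[OF h(1)] t] rr_Qm[OF SecD(1)[OF h(1)] t h(2)] by simp
qed (use assms in auto)

lemma DQ_Suc: "DQ (Suc k) p \<longleftrightarrow> DQ k p & (EX t. Ret ((Qm ^^ k) p) t)"
 unfolding DQ_def by (auto simp: less_Suc_eq)

lemma DQ_stable:
 assumes q: "(q \<longlongrightarrow> p) F" and qS: "\<forall>\<^sub>F x in F. q x \<in> Sec (- (pi/2)) & 0 < rr (q x)" and p: "p \<in> Sec (- (pi/2))" "0 < rr p"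
 shows "DQ k p ==> (\<forall>\<^sub>F x in F. DQ k (q x)) & ((%x. (Qm ^^ k) (q x)) \<longlongrightarrow> (Qm ^^ k) p) F"
proof (induction k)
 case 0
 then show ?case using q by (simp add: DQ_def)
next
 case (Suc k)
 have D: "DQ k p" and t: "EX t. Ret ((Qm ^^ k) p) t" using Suc.prems by (auto simp: DQ_Suc)
 obtain t where t: "Ret ((Qm ^^ k) p) t" using t by blast
 note IH = Suc.IH[OF D]
 have ev: "\<forall>\<^sub>F x in F. (Qm ^^ k) (q x) \<in> Sec (- (pi/2))"
  using IH[THEN conjunct1] qS by eventually_elim (use DQ_in in blast)
 note R = Ret_stable[OF IH[THEN conjunct2] ev DQ_in[OF p D order_refl, THEN conjunct1] t]
 have "\<forall>\<^sub>F x in F. DQ (Suc k) (q x)" using IH[THEN conjunct1] R(1) by eventually_elim (auto simp: DQ_Suc)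
 then show ?case using R(2) by simp
qed

text \<open>r cos^2 is bounded, so a large r confines \<theta> to the neighbourhood of - \<pi>/2,
  where \<open>far_turn\<close> and \<open>return_time\<close> apply. Their times are uniform, and
  during T1 + T2 r loses at most the factor E.\<close>

lemma far_return:
 "\<exists>R>0. \<forall>p\<in>Sec (- (pi/2)). R <= rr p --> (EX t. Ret p t) & M <= rr (Qm p)"
proof -
 define \<theta>1 where "\<theta>1 = (- (pi/2) - ts) / 2"
 have \<theta>1: "- (pi/2) < \<theta>1" "\<theta>1 < - ts" using ts_range by (auto simp: \<theta>1_def)
 obtain T1 where T1: "0 < T1" "\<forall>p\<in>P1. th p = - (pi/2) --> 0 < ww p --> (ALL s. 0 <= s --> s <= T1 --> ft p s <= \<theta>1) -->
  (\<exists>u>0. u <= T1 & fw p u = 0 & (ALL s. 0 <= s --> s < u --> 0 < fw p s))" using far_turn[OF \<theta>1(2)] by blast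
 obtain T2 where T2: "0 < T2" "\<forall>p\<in>P1. - (pi/2) < th p --> th p <= \<theta>1 --> ww p <= 0 -->
  (\<exists>t>0. t <= T2 & ft p t = - (pi/2) & fw p t < 0 & (ALL s. 0 < s --> s <= t --> fw p s < 0) &
   (ALL s. 0 <= s --> s < t --> - (pi/2) < ft p s & ft p s <= th p))" using return_time[OF \<theta>1(2)] by blast
 define K where "K = sqrt (2 * WM)"
 define E where "E = exp (K * (T1 + T2))"
 have c1: "0 < cos \<theta>1" using cos_pos[of \<theta>1] \<theta>1 ts_range by simp
 \<comment> \<open>With r >= R' the angle \<theta>1 would violate r cos^2 <= \<open>WM\<close>; R'
   also dominates the demanded M.\<close>
 define R' where "R' = max (max M 1) (WM / (cos \<theta>1)^2 + 1)"
 have R'1: "1 <= R'" "M <= R'" by (auto simp: R'_def)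
 have E: "0 < E" by (simp add: E_def)
 show ?thesis
 proof (rule exI[of _ "R' * E"], intro conjI ballI impI)
  show "0 < R' * E" using R'1 E by simp
  fix p assume p: "p \<in> Sec (- (pi/2))" and rp: "R' * E <= rr p"
  note pS = SecD[OF p]
  have Kb: "- K <= fv p s * (cos (ft p s))^2" for s
  proof -
   have "(fv p s * (cos (ft p s))^2)^2 = ((fv p s)^2 * (cos (ft p s))^2) * (cos (ft p s))^2" by (simp add: power2_eq_square)
   also have "\<dots> <= (2 * WM) * 1"
    using P1_bounds(7)[OF flow_in[OF pS(1)], of s] WM(1) by (intro mult_mono[where b = "2 * WM"]) (auto simp: abs_square_le_1)
   finally have "\<bar>fv p s * (cos (ft p s))^2\<bar> <= K" unfolding K_def using real_le_rsqrt[of "\<bar>fv p s * (cos (ft p s))^2\<bar>" "2 * WM"] by simp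
   then show ?thesis by linarith
  qed
  have rlow: "R' <= fr p s" if s: "0 <= s" "s <= T1 + T2" for s
  proof -
   have "fr p 0 * exp (K * 0) + 0 * (s - 0) <= fr p s * exp (K * s)"
   proof (rule deriv_lower[OF s(1)])
    fix x
    show "((%s. fr p s * exp (K * s)) has_real_derivative (fr p x * (fv p x * (cos (ft p x))^2 + K) * exp (K * x))) (at x)"
     by (auto intro!: derivative_eq_intros fr_deriv[OF pS(1)] simp: algebra_simps)
    show "0 <= fr p x * (fv p x * (cos (ft p x))^2 + K) * exp (K * x)"
     using Kb[of x] fr_nonneg[OF pS(1), of x] by (intro mult_nonneg_nonneg) auto
   qed
   then have 1: "R' * E <= fr p s * exp (K * s)" using rp pS(1) by simp
   have "exp (K * s) <= E" unfolding E_def K_def using s WM(1) by (simp add: mult_left_mono)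
   then have "fr p s * exp (K * s) <= fr p s * E" using fr_nonneg[OF pS(1)] by (intro mult_left_mono)
   with 1 show ?thesis using E by (meson mult_right_le_imp_le order_trans)
  qed
  have away: "ft p s ~= \<theta>1" if s: "0 <= s" "s <= T1" for s
  proof
   assume e: "ft p s = \<theta>1"
   have "R' * (cos \<theta>1)^2 <= fr p s * (cos \<theta>1)^2" using rlow[of s] s T2(1) by (intro mult_right_mono) auto
   also have "\<dots> <= WM" using P1_bounds(3)[OF flow_in[OF pS(1)], of s] e by simp
   finally have "R' <= WM / (cos \<theta>1)^2" using c1 by (simp add: field_simps)
   then show False unfolding R'_def by simp
  qed
  have below: "ft p s <= \<theta>1" if s: "0 <= s" "s <= T1" for s
  proof (rule ccontr)
   assume "~ ft p s <= \<theta>1"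
   then obtain s' where "0 <= s'" "s' <= s" "ft p s' = \<theta>1" using ft_IVT[OF pS(1) s(1), of \<theta>1] \<theta>1 pS(2) by auto
   then show False using away s by auto
  qed
  obtain u where u: "0 < u" "u <= T1" "fw p u = 0" "!!s. 0 <= s ==> s < u ==> 0 < fw p s"
   using T1(2)[rule_format, OF pS below] by blast
  have inc: "- (pi/2) < ft p s" if "0 < s" "s <= u" for s
   using ft_strict_mono[OF pS(1), of 0 s] u(4) that pS by auto
  obtain t where t: "0 < t" "t <= T2" "ft (flow p u) t = - (pi/2)" "fw (flow p u) t < 0"
   "!!s. 0 <= s ==> s < t ==> - (pi/2) < ft (flow p u) s & ft (flow p u) s <= ft p u"
   using T2(2)[rule_format, OF flow_in[OF pS(1)] inc[OF u(1) order_refl] below] u by (metis less_imp_le order_refl)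
  have Rt: "Ret p (u + t)"
   unfolding Ret_def
  proof (intro conjI allI impI)
   show "0 < u + t" using u t by simp
   show "ft p (u + t) = - (pi/2)" "fw p (u + t) < 0" using t flow_flow[OF pS(1), of u] by auto
   fix s assume s: "0 < s & s < u + t"
   show "- (pi/2) < ft p s" "ft p s < - ts"
    using inc[of s] below[of s] below[of u] t(5)[of "s - u"] flow_flow[OF pS(1), of u "s - u"] s u(1,2) \<theta>1(2)
    by (cases "s <= u"; auto)+
  qed
  then show "EX t. Ret p t" by blast
  show "M <= rr (Qm p)" using Qm_eq[OF Rt] rlow[of "u + t"] R'1(2) u t by simp
 qed
qed

lemma far_DQ: "\<exists>R>0. \<forall>p\<in>Sec (- (pi/2)). R <= rr p --> DQ k p"
proof (induction k)
 case 0
 show ?case by (intro exI[of _ 1]) (simp add: DQ_def)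
next
 case (Suc k)
 then obtain R where R: "0 < R" "\<forall>p\<in>Sec (- (pi/2)). R <= rr p --> DQ k p" by blast
 obtain R' where R': "0 < R'" "\<forall>p\<in>Sec (- (pi/2)). R' <= rr p --> (EX t. Ret p t) & R <= rr (Qm p)" using far_return[of R] by blast
 show ?case
 proof (intro exI[of _ R'] conjI ballI impI)
  fix p assume p: "p \<in> Sec (- (pi/2))" "R' <= rr p"
  then obtain t where t: "Ret p t" "R <= rr (Qm p)" using R' by blast
  have D: "DQ k (Qm p)" using R(2) Qm_Sec[OF SecD(1)[OF p(1)] t(1)] t(2) by blast
  show "DQ (Suc k) p" unfolding DQ_def
  proof (intro allI impI)
   fix j assume j: "j < Suc k"
   show "EX t. Ret ((Qm ^^ j) p) t"
   proof (cases j)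
    case (Suc i)
    then show ?thesis using D j unfolding DQ_def by (simp add: funpow_swap1)
   qed (use t in auto)
  qed
 qed (rule R'(1))
qed

lemma A_facts: "Sh (- pi) zA \<in> Sec (- (pi/2))" "Good 0 (Sh (- pi) zA)" "Sh (- pi) zA \<in> P1"
proof -
 have z: "zA \<in> P1" "0 < ww zA" using zA(1) unfolding UB_def by (force, metis flow_0 order_refl)
 then show "Sh (- pi) zA \<in> Sec (- (pi/2))" using zA(2) by (simp add: Sec_def)
 show "Sh (- pi) zA \<in> P1" using z by simp
 show "Good 0 (Sh (- pi) zA)" using EA unfolding Good_def by blast
qed

text \<open>Small r prevents the first return, since the collision orbit with v = 0 lies below the
  barrier and passes; large r permits all returns. Let e be the supremum of the r without k returns.
  At e some iterate fails to return, although it is a limit of returning points; hence it converges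
  to the equilibrium, and the next iterates for r slightly above e are close to the point of
  \<gamma>, where v2 > 0 makes them good.\<close>

lemma periodic_hit_pos:
 assumes k: "0 < k"
 shows "\<exists>p\<in>Sec (- (pi/2)). 0 < rr p & vv p = 0 & DQ k p & (EX t. Up 0 ((Qm ^^ k) p) t) & vv (up 0 ((Qm ^^ k) p)) = 0"
proof -
 define Z where "Z \<rho> = Zq \<rho> 0" for \<rho>
 have ZS: "Z \<rho> \<in> Sec (- (pi/2))" if "0 <= \<rho>" for \<rho> using Zq_Sec[OF that] by (simp add: Z_def)
 have Zr: "rr (Z \<rho>) = \<rho>" "vv (Z \<rho>) = 0" for \<rho> by (auto simp: Z_def)
 have Zl: "((%x. Z (f x)) \<longlongrightarrow> Z \<rho>) F" if "(f \<longlongrightarrow> \<rho>) F" for f \<rho> and F :: "'b filter" unfolding Z_def by (rule Zq_tendsto[OF that])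
 have g: "good (- (pi/2)) (- ts)" by (simp add: good_def)
 obtain t0 where t0: "Up (- ts) (Z 0) t0"
  using barrier(2)[OF g, of zA "Z 0"] zA ZS[of 0] vs_pos by (auto simp: Zr)
 have "\<forall>\<^sub>F \<rho> in at_right 0. Up (- ts) (Z \<rho>) (upT (- ts) (Z \<rho>))"
 proof (rule Up_stable(1)[OF Zl[OF tendsto_ident_at] _ SecD(1)[OF ZS] t0])
  show "\<forall>\<^sub>F \<rho> in at_right 0. Z \<rho> \<in> P1" using eventually_at_right_less[of 0] by eventually_elim (use SecD(1)[OF ZS] in auto)
 qed simp
 then obtain d where d: "0 < d" "!!\<rho>. 0 < \<rho> ==> \<rho> < d ==> Up (- ts) (Z \<rho>) (upT (- ts) (Z \<rho>))"
  unfolding eventually_at_right_field by auto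
 have nD: "~ DQ k (Z \<rho>)" if "0 < \<rho>" "\<rho> < d" for \<rho>
 proof
  assume "DQ k (Z \<rho>)"
  then obtain t where "Ret (Z \<rho>) t" using k unfolding DQ_def by auto
  then show False using Ret_imp_Turn[OF SecD(1,2)[OF ZS]] Up_not_Turn[OF d(2)[OF that]] that by auto
 qed
 \<comment> \<open>One return more than k: beyond R the k-th iterate returns again instead of
   reaching \<theta> = 0, which supplies the other end for \<open>shoot\<close>.\<close>
 obtain R where R: "0 < R" "\<forall>p\<in>Sec (- (pi/2)). R <= rr p --> DQ (Suc k) p" using far_DQ[of "Suc k"] by blast
 define S where "S = {\<rho>. 0 < \<rho> & ~ DQ k (Z \<rho>)}"
 have SR: "\<rho> < R" if "\<rho> \<in> S" for \<rho>
 proof (rule ccontr)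
  assume "~ \<rho> < R"
  then have "DQ (Suc k) (Z \<rho>)" using R(1) R(2)[rule_format, OF ZS[of \<rho>]] Zr by auto
  then show False using that unfolding S_def by (simp add: DQ_Suc)
 qed
 have Sd: "d/2 \<in> S" using nD[of "d/2"] d(1) unfolding S_def by simp
 have Sb: "bdd_above S" by (rule bdd_aboveI[of _ R]) (use SR in \<open>auto simp: less_imp_le\<close>)
 define e where "e = Sup S"
 have e0: "0 < e" using cSup_upper[OF Sd Sb] d(1) unfolding e_def by simp
 have De: "DQ k (Z \<rho>)" if "e < \<rho>" for \<rho>
 proof (rule ccontr)
  assume "~ DQ k (Z \<rho>)"
  then have "\<rho> \<in> S" using that e0 unfolding S_def by simp
  then have "\<rho> <= e" unfolding e_def by (rule cSup_upper[OF _ Sb])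
  then show False using that by simp
 qed
 have Ze: "Z e \<in> Sec (- (pi/2))" "0 < rr (Z e)" using ZS[of e] e0 by (auto simp: Zr)
 have nDe: "~ DQ k (Z e)"
 proof
  assume D: "DQ k (Z e)"
  have "\<forall>\<^sub>F \<rho> in at_left e. Z \<rho> \<in> Sec (- (pi/2)) & 0 < rr (Z \<rho>)"
   using eventually_at_left_real[OF e0] by eventually_elim (use ZS in \<open>auto simp: Zr\<close>)
  from DQ_stable[OF Zl[OF tendsto_ident_at] this Ze D] obtain b where b: "b < e" "!!y. b < y ==> y < e ==> DQ k (Z y)"
   unfolding eventually_at_left_field by blast
  obtain \<rho> where r: "\<rho> \<in> S" "b < \<rho>" using less_cSupD[of S b] Sd b(1) unfolding e_def by auto
  then have "\<rho> <= e" unfolding e_def by (intro cSup_upper[OF _ Sb])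
  then show False using r b(2)[of \<rho>] D unfolding S_def by (cases "\<rho> = e") auto
 qed
 then obtain j0 where j0: "j0 < k" "~ (EX t. Ret ((Qm ^^ j0) (Z e)) t)" unfolding DQ_def by auto
 define j where "j = (LEAST j. ~ (EX t. Ret ((Qm ^^ j) (Z e)) t))"
 have j: "j < k" "~ (EX t. Ret ((Qm ^^ j) (Z e)) t)" "!!i. i < j ==> EX t. Ret ((Qm ^^ i) (Z e)) t"
 proof -
  show "j < k" using Least_le[of "%j. ~ (EX t. Ret ((Qm ^^ j) (Z e)) t)", OF j0(2)] j0(1) unfolding j_def by simp
  show "~ (EX t. Ret ((Qm ^^ j) (Z e)) t)" unfolding j_def by (rule LeastI[of "%j. ~ (EX t. Ret ((Qm ^^ j) (Z e)) t)", OF j0(2)])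
  show "EX t. Ret ((Qm ^^ i) (Z e)) t" if "i < j" for i
   using not_less_Least[OF that[unfolded j_def]] by simp
 qed
 have Dj: "DQ j (Z e)" using j(3) unfolding DQ_def by blast
 define rn where "rn n = e + 1 / real (Suc n)" for n
 have rn: "e < rn n" for n by (simp add: rn_def)
 have "rn \<longlonglongrightarrow> e + 0" unfolding rn_def by (intro tendsto_add tendsto_const) (rule filterlim_compose[OF lim_const_over_n[of 1] filterlim_Suc])
 then have lrn: "rn \<longlonglongrightarrow> e" by simp
 have rnS: "Z (rn n) \<in> Sec (- (pi/2))" "0 < rr (Z (rn n))" "DQ k (Z (rn n))" for n using ZS[of "rn n"] rn[of n] e0 De by (auto simp: Zr)
 define pn where "pn n = (Qm ^^ j) (Z (rn n))" for n
 have pl: "pn \<longlonglongrightarrow> (Qm ^^ j) (Z e)" unfolding pn_def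
  by (rule DQ_stable[OF Zl[OF lrn] _ Ze Dj, THEN conjunct2]) (use rnS in simp)
 have pn: "pn n \<in> Sec (- (pi/2))" for n using DQ_in[OF rnS, of j] j(1) unfolding pn_def by simp
 have "ALL n. EX t. Ret (pn n) t" using rnS(3) j(1) unfolding DQ_def pn_def by blast
 then have "EX tn. ALL n. Ret (pn n) (tn n)" by (rule choice)
 then obtain tn where tn: "!!n. Ret (pn n) (tn n)" by blast
 have q: "(Qm ^^ j) (Z e) \<in> Sec (- (pi/2))" "0 < rr ((Qm ^^ j) (Z e))" using DQ_in[OF Ze Dj order_refl] by auto
 \<comment> \<open>Reaching \<theta> = 0 is open and excludes a return, so no limit of returning
   points does it.\<close>
 have noUp: "~ Up 0 p t" if l: "sq \<longlonglongrightarrow> p" and sq: "!!n. sq n \<in> Sec (- (pi/2))" "!!n. EX t. Ret (sq n) t" and p: "p \<in> P1" for sq p t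
 proof
  assume U: "Up 0 p t"
  have "\<forall>\<^sub>F n in sequentially. sq n \<in> P1" using SecD(1)[OF sq(1)] by simp
  from eventually_happens[OF Up_stable(1)[OF l this p U]] obtain n where "Up 0 (sq n) (upT 0 (sq n))" by auto
  then show False using Up0_not(1)[OF sq(1)] sq(2)[of n] by blast
 qed
 have C: "Conv (- ts) ((Qm ^^ j) (Z e))"
  using sec_left[OF q] j(2) noUp[OF pl pn _ SecD(1)[OF q(1)]] tn by blast
 have lQ: "(%n. Qm (pn n)) \<longlonglongrightarrow> Sh (- pi) zA" by (rule shadow_Ret[OF q C pl pn tn zA(1,2)])
 have QS: "Qm (pn n) \<in> Sec (- (pi/2))" for n by (rule Qm_Sec[OF SecD(1)[OF pn] tn])
 \<comment> \<open>\<gamma> reaches \<theta> = 0, so iterates close to it cannot return; hence none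
   of the k returns comes after the critical one.\<close>
 have jk: "Suc j = k"
 proof (rule ccontr)
  assume "Suc j ~= k"
  then have "EX t. Ret ((Qm ^^ Suc j) (Z (rn n))) t" for n using rnS(3)[of n, unfolded DQ_def, rule_format, of "Suc j"] j(1) by auto
  then have "EX t. Ret (Qm (pn n)) t" for n unfolding pn_def by simp
  then show False using noUp[OF lQ QS _ A_facts(3)] EA(1) by blast
 qed
 have "\<forall>\<^sub>F n in sequentially. Good 0 (Qm (pn n))"
  by (rule Good_stable[OF lQ _ A_facts(3,2)]) (use SecD(1)[OF QS] in simp)
 from eventually_happens[OF this] obtain n where n: "Good 0 (Qm (pn n))" by auto
 define X where "X \<rho> = (Qm ^^ k) (Z \<rho>)" for \<rho>
 have XS: "X \<rho> \<in> Sec (- (pi/2)) & 0 < rr (X \<rho>)" if "e < \<rho>" for \<rho>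
  unfolding X_def using DQ_in[OF ZS _ De[OF that] order_refl] that e0 by (simp add: Zr)
 define B where "B = max R (rn n)"
 have Xc: "continuous_on {rn n..B} X"
  unfolding continuous_on_def
 proof
  fix \<rho> assume r: "\<rho> \<in> {rn n..B}"
  then have er: "e < \<rho>" using rn[of n] by simp
  have "\<forall>\<^sub>F x in at \<rho> within {rn n..B}. x \<in> {rn n..B}" by (simp add: eventually_at_filter)
  then have "\<forall>\<^sub>F x in at \<rho> within {rn n..B}. Z x \<in> Sec (- (pi/2)) & 0 < rr (Z x)"
   by eventually_elim (use ZS rn[of n] e0 in \<open>auto simp: Zr\<close>)
  then show "(X \<longlongrightarrow> X \<rho>) (at \<rho> within {rn n..B})" unfolding X_def
   by (intro DQ_stable[THEN conjunct2] Zl tendsto_ident_at De[OF er]) (use ZS er e0 in \<open>auto simp: Zr\<close>)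
 qed
 have GA: "Good 0 (X (rn n))" using n jk unfolding X_def pn_def by auto
 have nG: "~ Good 0 (X B)"
 proof
  assume "Good 0 (X B)"
  then obtain t where "Up 0 (X B) t" unfolding Good_def by blast
  moreover have "EX t. Ret (X B) t"
   using R(2)[rule_format, OF ZS[of B]] R(1) by (simp add: Zr B_def DQ_Suc X_def)
  moreover have "X B \<in> Sec (- (pi/2))" using XS[of B] rn[of n] by (simp add: B_def)
  ultimately show False using Up0_not(1) by blast
 qed
 have stg: "stage (- (pi/2)) 0 (- ts) zB" by (simp add: stage_def)
 have XS': "X r \<in> Sec (- (pi/2)) & 0 < rr (X r)" if "rn n <= r" "r <= B" for r using XS[of r] rn[of n] that by simp
 have rB: "rn n <= B" by (simp add: B_def)
 from shoot[OF stg rB Xc XS' GA nG] obtain r where r: "rn n < r" "EX t. Up 0 (X r) t" "vv (up 0 (X r)) = 0" by blast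
 have er: "e < r" using r(1) rn[of n] by simp
 show ?thesis
  by (rule bexI[of _ "Z r"]) (use r er e0 De[OF er] ZS[of r] in \<open>auto simp: Zr X_def\<close>)
qed

subsection \<open>Angular estimates\<close>

text \<open>If V were constant with 2 V = K^2, a collision orbit v = - K cos x would satisfy
  dx/d\<theta> = cos / (2 sqrt c) exactly. Only increments of this primitive are used.\<close>

definition \<beta>w :: "real => real" where "\<beta>w = (SOME f. ALL x. (f has_real_derivative (1/2) * cos x / sqrt (c x)) (at x))"

lemma \<beta>w_deriv: "(\<beta>w has_real_derivative (1/2) * cos x / sqrt (c x)) (at x)"
proof -
 have "continuous_on UNIV (%x. (1/2) * cos x / sqrt (c x))"
  by (intro continuous_intros cont_c) (use c_pos in \<open>auto simp: less_imp_neq[symmetric]\<close>)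
 from continuous_antiderivative[OF this] have "EX f. ALL x. (f has_real_derivative (1/2) * cos x / sqrt (c x)) (at x)"
  unfolding has_real_derivative_iff_has_vector_derivative by blast
 then have "ALL x. (\<beta>w has_real_derivative (1/2) * cos x / sqrt (c x)) (at x)" unfolding \<beta>w_def by (rule someI_ex)
 then show ?thesis ..
qed

definition b1 :: real where "b1 = \<beta>w ts - \<beta>w 0"

lemma \<beta>w_odd: "\<beta>w 0 - \<beta>w (- ts) = b1"
proof -
 have "(%x. \<beta>w x + \<beta>w (- x)) ts = (%x. \<beta>w x + \<beta>w (- x)) 0"
 proof (rule DERIV_isconst2[of 0 ts])
  have D: "((%x. \<beta>w x + \<beta>w (- x)) has_real_derivative 0) (at x)" for x
  proof -
   have "((%x. \<beta>w (- x)) has_real_derivative ((1/2) * cos (- x) / sqrt (c (- x))) * (- 1)) (at x)"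
    by (rule DERIV_chain2[OF \<beta>w_deriv]) (auto intro!: derivative_eq_intros)
   from DERIV_add[OF \<beta>w_deriv this] show ?thesis by (simp add: c_sym)
  qed
  show "continuous_on {0..ts} (%x. \<beta>w x + \<beta>w (- x))"
   by (rule continuous_at_imp_continuous_on) (use D DERIV_isCont in blast)
  show "!!x. 0 < x ==> x < ts ==> ((%x. \<beta>w x + \<beta>w (- x)) has_real_derivative 0) (at x)" by (rule D)
 qed (use ts_range in auto)
 then show ?thesis by (simp add: b1_def)
qed

lemma \<beta>w_mono: "- (pi/2) <= x ==> x <= y ==> y <= pi/2 ==> \<beta>w x <= \<beta>w y"
 using deriv_lower[of x y \<beta>w "%x. (1/2) * cos x / sqrt (c x)" 0] \<beta>w_deriv cos_ge_zero c_pos by (auto simp: less_imp_le)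

text \<open>c >= 1/4 makes the integrand at most 1, so \<open>b1\<close> is at most ts.\<close>

lemma b1_bounds: "0 <= b1" "b1 < pi/2"
proof -
 show "0 <= b1" using \<beta>w_mono[of 0 ts] ts_range by (simp add: b1_def)
 have "\<beta>w ts <= \<beta>w 0 + 1 * (ts - 0)"
 proof (rule deriv_upper[OF _ \<beta>w_deriv])
  fix x
  have "sqrt (1/4) <= sqrt (c x)" using c_bounds(1)[of x] by (rule real_sqrt_le_mono)
  then have "1/2 <= sqrt (c x)" by (simp add: real_sqrt_divide)
  moreover have "cos x <= 1" by simp
  ultimately have "(1/2) * cos x <= sqrt (c x)" "0 < sqrt (c x)" by linarith+
  then show "(1/2) * cos x / sqrt (c x) <= 1" by (simp add: pos_divide_le_eq)
 qed (use ts_range in simp)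
 then show "b1 < pi/2" using ts_range by (simp add: b1_def)
qed

lemma arccos_deriv:
 assumes f: "(f has_real_derivative f') (at s)" and K: "0 < K" "\<bar>f s\<bar> < K"
 shows "((%s. arccos (- f s / K)) has_real_derivative f' / sqrt (K^2 - (f s)^2)) (at s)"
proof -
 have b: "- 1 < - f s / K" "- f s / K < 1" using K by (auto simp: field_simps abs_less_iff)
 have "((%s. - f s / K) has_real_derivative - f' / K) (at s)" using f K by (auto intro!: derivative_eq_intros)
 from DERIV_chain2[OF DERIV_arccos[OF b] this]
 have D: "((%s. arccos (- f s / K)) has_real_derivative inverse (- sqrt (1 - (- f s / K)^2)) * (- f' / K)) (at s)" .
 have "K^2 - (f s)^2 = K^2 * (1 - (- f s / K)^2)" using K by (simp add: field_simps)
 then have "sqrt (K^2 - (f s)^2) = K * sqrt (1 - (- f s / K)^2)" using K by (simp add: real_sqrt_mult)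
 then have "inverse (- sqrt (1 - (- f s / K)^2)) * (- f' / K) = f' / sqrt (K^2 - (f s)^2)" by (simp add: field_simps)
 with D show ?thesis by simp
qed

text \<open>V >= \<open>Vs\<close> makes w, and with it the growth of the angle arccos (- v / vs),
  at least that of the constant potential \<open>Vs\<close>.\<close>

lemma ang_lower:
 assumes p: "p \<in> P1" "rr p = 0" and ab: "a <= b" and h: "!!s. a <= s ==> s <= b ==> 0 < fw p s & \<bar>fv p s\<bar> < vs & \<bar>ft p s\<bar> <= pi/2"
 shows "arccos (- fv p a / vs) - \<beta>w (ft p a) <= arccos (- fv p b / vs) - \<beta>w (ft p b)"
proof -
 have "(arccos (- fv p a / vs) - \<beta>w (ft p a)) + 0 * (b - a) <= arccos (- fv p b / vs) - \<beta>w (ft p b)"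
 proof (rule deriv_lower[OF ab])
  fix s assume s: "a <= s" "s <= b"
  define S N where "S = sqrt (vs^2 - (fv p s)^2)" and "N = fw p s * sqrt (c (ft p s))"
  show "((%s. arccos (- fv p s / vs) - \<beta>w (ft p s)) has_real_derivative
    ((1/2) * (fw p s)^2 * c (ft p s)) / S - (1/2) * cos (ft p s) / sqrt (c (ft p s)) * (fw p s * c (ft p s))) (at s)"
   unfolding S_def using h[OF s] vs_pos
   by (intro DERIV_diff arccos_deriv fv_deriv0[OF p] DERIV_chain2[OF \<beta>w_deriv] ft_deriv[OF p(1)]) auto
  have c0: "0 < c (ft p s)" by (rule c_pos)
  have N: "0 < N" "(fw p s)^2 * c (ft p s) = N^2" "cos (ft p s) / sqrt (c (ft p s)) * (fw p s * c (ft p s)) = cos (ft p s) * N"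
   using h[OF s] c0 by (auto simp: N_def power_mult_distrib real_div_sqrt field_simps)
  have "\<bar>fv p s\<bar>^2 < vs^2" using h[OF s] by (intro power_strict_mono) auto
  then have S: "0 < S" "S^2 = vs^2 - (fv p s)^2" by (auto simp: S_def)
  have cg: "0 <= cos (ft p s)" using h[OF s] by (intro cos_ge_zero) auto
  have "(cos (ft p s) * S)^2 <= N^2"
   using energy[OF p(1), of s] fr_zero[OF p, of s] W_ge[of "ft p s"] vs_sq N(2) by (simp add: power_mult_distrib S(2) algebra_simps)
  then have "cos (ft p s) * S <= N" by (rule power2_le_imp_le) (use N(1) in simp)
  then have "cos (ft p s) * S * N <= N * N" using N(1) by (intro mult_right_mono) auto
  then have "cos (ft p s) * N <= N^2 / S" using S(1) by (simp add: field_simps power2_eq_square)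
  then show "0 <= ((1/2) * (fw p s)^2 * c (ft p s)) / S - (1/2) * cos (ft p s) / sqrt (c (ft p s)) * (fw p s * c (ft p s))"
   using N(2,3) by simp
 qed
 then show ?thesis by simp
qed

definition vE :: real where "vE = sqrt (2 * V 0)"

lemma vE: "vs < vE" "vE^2 = 2 * V 0" "0 < vE"
proof -
 have "Vs < V 0" by (rule V_min) (use ts_range in auto)
 then show "vs < vE" "vE^2 = 2 * V 0" using Vs_pos by (auto simp: vs_def vE_def)
 then show "0 < vE" using vs_pos by simp
qed

lemma W_le: "\<bar>x\<bar> <= ts ==> 2 * W x <= vE^2 * (cos x)^2"
proof -
 assume x: "\<bar>x\<bar> <= ts"
 have "V \<bar>x\<bar> <= V 0" using V_dec_inner[of 0 "\<bar>x\<bar>"] x by (cases "x = 0") (auto simp: less_imp_le)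
 moreover have "V \<bar>x\<bar> = V x" using V_even'[of x] x ts_range by (auto simp: abs_if)
 ultimately have "V x <= V 0" by simp
 then show "2 * W x <= vE^2 * (cos x)^2" using W_V[of x] x ts_range vE(2) mult_right_mono[of "V x" "V 0" "(cos x)^2"] by (simp add: abs_le_iff mult.commute)
qed

lemma v_less_vE:
 assumes p: "p \<in> P1" and w: "fw p s ~= 0" and x: "\<bar>ft p s\<bar> <= ts" shows "\<bar>fv p s\<bar> < vE"
proof -
 have c0: "0 < (cos (ft p s))^2" using cos_pos[of "ft p s"] x ts_range by (simp add: abs_le_iff zero_less_power2)
 have "0 < (fw p s)^2 * c (ft p s)" using w c_pos by simp
 moreover have "0 <= fr p s * (cos (ft p s))^2" using P1_bounds(2)[OF flow_in[OF p]] .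
 ultimately have "(fv p s)^2 * (cos (ft p s))^2 < vE^2 * (cos (ft p s))^2" using energy[OF p, of s] W_le[OF x] by linarith
 then have "(fv p s)^2 < vE^2" using c0 by simp
 then show ?thesis using vE(3) abs_le_square_iff[of vE "fv p s"] by (simp add: not_le[symmetric])
qed

text \<open>Between the critical points V <= V(0), so the constant potential V(0) bounds the growth
  of the angle from above; a positive r only slows it down.\<close>

lemma ang_upper:
 assumes p: "p \<in> P1" and ab: "a <= b" and h: "!!s. a <= s ==> s <= b ==> 0 < fw p s & \<bar>ft p s\<bar> <= ts"
 shows "arccos (- fv p b / vE) - \<beta>w (ft p b) <= arccos (- fv p a / vE) - \<beta>w (ft p a)"
proof -
 have "arccos (- fv p b / vE) - \<beta>w (ft p b) <= (arccos (- fv p a / vE) - \<beta>w (ft p a)) + 0 * (b - a)"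
 proof (rule deriv_upper[OF ab])
  fix s assume s: "a <= s" "s <= b"
  define S N where "S = sqrt (vE^2 - (fv p s)^2)" and "N = fw p s * sqrt (c (ft p s))"
  have lt: "\<bar>fv p s\<bar> < vE" by (rule v_less_vE[OF p]) (use h[OF s] in auto)
  show "((%s. arccos (- fv p s / vE) - \<beta>w (ft p s)) has_real_derivative
    ((1/2) * (fw p s)^2 * c (ft p s) - fr p s * (cos (ft p s))^2) / S - (1/2) * cos (ft p s) / sqrt (c (ft p s)) * (fw p s * c (ft p s))) (at s)"
   unfolding S_def using lt vE(3)
   by (intro DERIV_diff arccos_deriv fv_deriv[OF p] DERIV_chain2[OF \<beta>w_deriv] ft_deriv[OF p(1)]) auto
  have c0: "0 < c (ft p s)" by (rule c_pos)
  have N: "0 < N" "(fw p s)^2 * c (ft p s) = N^2" "cos (ft p s) / sqrt (c (ft p s)) * (fw p s * c (ft p s)) = cos (ft p s) * N"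
   using h[OF s] c0 by (auto simp: N_def power_mult_distrib real_div_sqrt field_simps)
  have "\<bar>fv p s\<bar>^2 < vE^2" using lt by (intro power_strict_mono) auto
  then have S: "0 < S" "S^2 = vE^2 - (fv p s)^2" by (auto simp: S_def)
  have cg: "0 <= cos (ft p s)" using h[OF s] ts_range by (intro cos_ge_zero) auto
  have rn: "0 <= fr p s * (cos (ft p s))^2" using P1_bounds(2)[OF flow_in[OF p]] .
  have e1: "(cos (ft p s) * S)^2 = vE^2 * (cos (ft p s))^2 - (fv p s)^2 * (cos (ft p s))^2"
   by (simp add: power_mult_distrib S(2) algebra_simps)
  have "2 * W (ft p s) <= vE^2 * (cos (ft p s))^2" using W_le h[OF s] by blast
  then have "N^2 <= (cos (ft p s) * S)^2" unfolding e1 N(2)[symmetric] energy[OF p] using rn by linarith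
  then have "N <= cos (ft p s) * S" by (rule power2_le_imp_le) (use S(1) cg in simp)
  then have "N * N <= cos (ft p s) * S * N" using N(1) by (intro mult_right_mono) auto
  then have "N^2 / S <= cos (ft p s) * N" using S(1) by (simp add: field_simps power2_eq_square)
  moreover have "0 <= fr p s * (cos (ft p s))^2 / S" using rn S by simp
  ultimately show "((1/2) * (fw p s)^2 * c (ft p s) - fr p s * (cos (ft p s))^2) / S - (1/2) * cos (ft p s) / sqrt (c (ft p s)) * (fw p s * c (ft p s)) <= 0"
   using N(2,3) by (simp add: diff_divide_distrib)
 qed
 then show ?thesis by simp
qed

text \<open>In the coordinate \<open>v = - vs cos x\<close> a collision orbit satisfies \<open>dx/d\<theta> = sqrt (a + u / sin x ^ 2) / 2\<close>
 with \<open>a, u \<ge> 0\<close>, whose right-hand side is convex in \<open>x\<close>.\<close>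

lemma qf_sin:
 assumes "0 < x" "x < pi"
 shows "qf \<theta> (- vs * cos x) / sin x = sqrt (vs^2 * (cos \<theta>)^2 / c \<theta> + ((2 * W \<theta> - vs^2 * (cos \<theta>)^2) / c \<theta>) / (sin x)^2)"
proof -
 have s: "0 < sin x" using assms by (rule sin_gt_zero)
 have cs: "(cos x)^2 = 1 - (sin x)^2" by (rule cos_squared_eq)
 have "(2 * W \<theta> - (- vs * cos x)^2 * (cos \<theta>)^2) / c \<theta> = (sin x)^2 * (vs^2 * (cos \<theta>)^2 / c \<theta> + ((2 * W \<theta> - vs^2 * (cos \<theta>)^2) / c \<theta>) / (sin x)^2)"
  using s c_pos[of \<theta>] by (simp add: power_mult_distrib cs field_simps)
 then show ?thesis unfolding qf_def using s by (simp add: real_sqrt_mult)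
qed

text \<open>Midpoint convexity: 1 / sin is convex on (0, \<pi>), and y |-> sqrt (a^2 + y^2) is
  increasing for y >= 0 and convex by the triangle inequality in the plane.\<close>

lemma qf_convex:
 assumes x: "0 < x1" "x1 < pi" "0 < x2" "x2 < pi"
 shows "qf \<theta> (- vs * cos ((x1 + x2) / 2)) / sin ((x1 + x2) / 2) <= (qf \<theta> (- vs * cos x1) / sin x1 + qf \<theta> (- vs * cos x2) / sin x2) / 2"
proof -
 define m where "m = (x1 + x2) / 2"
 have m: "0 < m" "m < pi" using x by (auto simp: m_def)
 define a where "a = sqrt (vs^2 * (cos \<theta>)^2 / c \<theta>)"
 define u where "u = sqrt ((2 * W \<theta> - vs^2 * (cos \<theta>)^2) / c \<theta>)"
 have c0: "0 < c \<theta>" by (rule c_pos)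
 have a2: "vs^2 * (cos \<theta>)^2 / c \<theta> = a^2" using c0 by (simp add: a_def)
 have u2: "(2 * W \<theta> - vs^2 * (cos \<theta>)^2) / c \<theta> = u^2" using c0 W_ge[of \<theta>] vs_sq by (simp add: u_def)
 have u0: "0 <= u" using c0 W_ge[of \<theta>] vs_sq by (simp add: u_def)
 have f: "qf \<theta> (- vs * cos y) / sin y = sqrt (a^2 + (u * (1 / sin y))^2)" if "0 < y" "y < pi" for y
  using qf_sin[OF that, of \<theta>] unfolding a2 u2 by (simp add: power_divide)
 have s: "0 < sin x1" "0 < sin x2" "0 < sin m" using x m by (auto intro: sin_gt_zero)
 \<comment> \<open>With the inequality between arithmetic and geometric mean this yields the
   convexity of 1 / sin.\<close>
 have "sin x1 * sin x2 <= (sin m)^2"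
 proof -
  have e: "2 * m = x1 + x2" by (simp add: m_def)
  have "cos (x1 + x2) = 1 - 2 * (sin m)^2" using cos_double_sin[of m] unfolding e .
  moreover have "2 * (sin x1 * sin x2) = cos (x1 - x2) - cos (x1 + x2)" by (simp add: cos_diff cos_add)
  moreover have "cos (x1 - x2) <= 1" by simp
  ultimately show ?thesis by linarith
 qed
 then have "4 * (sin x1 * sin x2)^2 <= (sin m)^2 * (4 * (sin x1 * sin x2))"
  using s by (simp add: power2_eq_square mult_right_mono)
 also have "\<dots> <= (sin m)^2 * (sin x1 + sin x2)^2"
  using sum_squares_ge_zero[of "sin x1 - sin x2" 0] by (intro mult_left_mono) (auto simp: power2_eq_square algebra_simps)
 finally have "(2 * (sin x1 * sin x2))^2 <= (sin m * (sin x1 + sin x2))^2" by (simp add: power_mult_distrib)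
 then have "2 * (sin x1 * sin x2) <= sin m * (sin x1 + sin x2)" by (rule power2_le_imp_le) (use s in simp)
 then have k: "1 / sin m <= (1 / sin x1 + 1 / sin x2) / 2" using s by (simp add: field_simps)
 have "sqrt (a^2 + (u * (1 / sin m))^2) <= sqrt (a^2 + (u * ((1 / sin x1 + 1 / sin x2) / 2))^2)"
  using k u0 s by (intro real_sqrt_le_mono add_left_mono power_mono mult_left_mono) auto
 also have "\<dots> = sqrt ((a + a)^2 + (u * (1 / sin x1) + u * (1 / sin x2))^2) / 2"
 proof -
  have e: "(a + a)^2 + (u * (1 / sin x1) + u * (1 / sin x2))^2 = 4 * (a^2 + (u * ((1 / sin x1 + 1 / sin x2) / 2))^2)"
   by (simp add: power2_eq_square algebra_simps)
  show ?thesis unfolding e real_sqrt_mult by simp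
 qed
 also have "\<dots> <= (sqrt (a^2 + (u * (1 / sin x1))^2) + sqrt (a^2 + (u * (1 / sin x2))^2)) / 2"
  using real_sqrt_sum_squares_triangle_ineq[of a a "u * (1 / sin x1)" "u * (1 / sin x2)"] by (intro divide_right_mono) auto
 finally show ?thesis using f[OF x(1,2)] f[OF x(3,4)] f[OF m] by (simp add: m_def)
qed

text \<open>Along an orbit with \<open>r > 0\<close> the slope \<open>dv/d\<theta>\<close> is strictly smaller than on the collision manifold.\<close>

lemma slope_strict:
 assumes p: "p \<in> P1" "0 < rr p" and w: "0 < fw p s" and th: "- (pi/2) < ft p s" "ft p s < pi/2"
 shows "(1/2) * (fw p s)^2 * c (ft p s) - fr p s * (cos (ft p s))^2 < (1/2) * qf (ft p s) (fv p s) * (fw p s * c (ft p s))"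
proof -
 have c0: "0 < c (ft p s)" by (rule c_pos)
 have r: "0 < fr p s * (cos (ft p s))^2"
  using fr_pos_iff[OF p(1), of s] fr_nonneg[OF p(1), of s] p(2) cos_pos[OF th] by (intro mult_pos_pos) auto
 have "fw p s = sqrt ((fw p s)^2)" using w by simp
 also have "(fw p s)^2 <= (2 * W (ft p s) - (fv p s)^2 * (cos (ft p s))^2) / c (ft p s)"
  using energy[OF p(1), of s] r c0 by (simp add: field_simps)
 finally have "fw p s <= qf (ft p s) (fv p s)" unfolding qf_def by simp
 then have "fw p s * (fw p s * c (ft p s)) <= qf (ft p s) (fv p s) * (fw p s * c (ft p s))" using w c0 by (intro mult_right_mono) auto
 then show ?thesis using r by (simp add: power2_eq_square)
qed

text \<open>At a first contact with the collision graph the slope of the orbit with r > 0 would be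
  strictly smaller, so there is none. The graph is differentiable in the interior only, hence the
  weak inequality at the end.\<close>

lemma stays_under:
 assumes p: "p \<in> P1" "0 < rr p" and g: "g \<in> P1" "rr g = 0"
  and ab: "a < b" "!!s. a <= s ==> s <= b ==> 0 < fw p s" and gt: "a' < b'" "!!s. a' <= s ==> s <= b' ==> 0 < fw g s"
  and eq: "ft g a' < ft p a" "ft p b = ft g b'" and th: "- (pi/2) <= ft g a'" "ft g b' <= pi/2"
  and init: "!!u. a' <= u ==> u <= b' ==> ft g u = ft p a ==> fv p a < fv g u"
 shows "fv p b <= fv g b'"
proof -
 obtain y where y: "continuous_on {ft g a'..ft g b'} y" "!!s. a' <= s ==> s <= b' ==> y (ft g s) = fv g s"
  "!!x. ft g a' < x ==> x < ft g b' ==> (y has_real_derivative (1/2) * qf x (y x)) (at x)"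
  "!!x. ft g a' <= x ==> x <= ft g b' ==> EX s. a' <= s & s <= b' & ft g s = x"
  by (rule graph[OF g gt(1) gt(2)]) (auto intro: that)
 have mono: "ft p s < ft p s'" if "a <= s" "s < s'" "s' <= b" for s s'
  by (rule ft_strict_mono[OF p(1)]) (use ab that in auto)
 have rng: "ft g a' < ft p s & ft p s <= ft g b'" if "a <= s" "s <= b" for s
  using mono[of a s] mono[of s b] eq that by (cases "s = a"; cases "s = b") auto
 define d where "d s = y (ft p s) - fv p s" for s
 have dc: "continuous_on {a..b} d" unfolding d_def
  by (intro continuous_on_diff continuous_on_compose2[OF y(1)] cont_f[OF p(1)]) (use rng in \<open>auto simp: less_imp_le\<close>)
 obtain ua where ua: "a' <= ua" "ua <= b'" "ft g ua = ft p a" using y(4)[of "ft p a"] rng[of a] ab(1) by auto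
 have d0: "0 < d a" using init[OF ua] y(2)[OF ua(1,2)] ua(3) by (simp add: d_def)
 have pos: "0 < d s" if s: "a <= s" "s < b" for s
 proof (rule ccontr)
  assume n: "~ 0 < d s"
  have dcs: "continuous_on {a..s} d" using dc s by (auto intro: continuous_on_subset)
  obtain u where u: "a < u" "u <= s" "d u = 0" "!!x. a <= x ==> x < u ==> 0 < d x"
   by (rule first_time[OF s(1) dcs _ d0]) (use n in \<open>auto intro: that\<close>)
  have ub: "a <= u" "u < b" "ft g a' < ft p u" "ft p u < ft g b'" using u s rng[of u] mono[of u b] eq by auto
  have D: "(d has_real_derivative (1/2) * qf (ft p u) (y (ft p u)) * (fw p u * c (ft p u)) - ((1/2) * (fw p u)^2 * c (ft p u) - fr p u * (cos (ft p u))^2)) (at u)"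
   unfolding d_def by (rule DERIV_diff[OF DERIV_chain2[OF y(3)[OF ub(3,4)] ft_deriv[OF p(1)]] fv_deriv[OF p(1)]])
  have "y (ft p u) = fv p u" using u(3) by (simp add: d_def)
  then have "0 < (1/2) * qf (ft p u) (y (ft p u)) * (fw p u * c (ft p u)) - ((1/2) * (fw p u)^2 * c (ft p u) - fr p u * (cos (ft p u))^2)"
   using slope_strict[OF p ab(2)[of u]] ub th by auto
  from DERIV_pos_inc_left[OF D this] obtain e where e: "0 < e" "\<forall>h>0. h < e --> d (u - h) < d u" by blast
  define h where "h = min (e / 2) (u - a)"
  have h: "0 < h" "h < e" "a <= u - h" "u - h < u" using e(1) u(1) by (auto simp: h_def min_def)
  show False using e(2)[rule_format, OF h(1,2)] u(4)[OF h(3,4)] u(3) by simp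
 qed
 have "0 <= d b"
 proof (rule tendsto_lowerbound)
  have "(d \<longlongrightarrow> d b) (at b within {a..b})" using dc ab(1) unfolding continuous_on_def by auto
  then show "(d \<longlongrightarrow> d b) (at_left b)"
   by (simp add: at_within_Icc_at_left[OF ab(1)])
  show "\<forall>\<^sub>F s in at_left b. 0 <= d s" using eventually_at_left_real[OF ab(1)] by eventually_elim (use pos in \<open>auto intro: less_imp_le\<close>)
 qed simp
 then show ?thesis using y(2)[of b'] gt(1) eq(2) by (simp add: d_def)
qed

lemma abs_v_less:
 assumes g: "g \<in> P1" "rr g = 0" "fw g \<tau> ~= 0" "- (pi/2) < ft g \<tau>" "ft g \<tau> < pi/2" and W: "2 * W (ft g \<tau>) <= K^2 * (cos (ft g \<tau>))^2" "0 < K"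
 shows "\<bar>fv g \<tau>\<bar> < K"
proof -
 have "0 < (fw g \<tau>)^2 * c (ft g \<tau>)" using g(3) c_pos by simp
 then have "(fv g \<tau>)^2 * (cos (ft g \<tau>))^2 < K^2 * (cos (ft g \<tau>))^2" using energy[OF g(1), of \<tau>] fr_zero[OF g(1,2), of \<tau>] W by simp
 then have "(fv g \<tau>)^2 < K^2" using cos_pos[OF g(4,5)] by simp
 then show ?thesis using W(2) abs_le_square_iff[of K "fv g \<tau>"] by (simp add: not_le[symmetric])
qed

subsection \<open>The convexity comparison\<close>

lemma zA_facts: "zA \<in> P1" "rr zA = 0" "!!s. s <= 0 ==> 0 < fw zA s" "- vs < vv zA"
proof -
 show z: "zA \<in> P1" "rr zA = 0" "!!s. s <= 0 ==> 0 < fw zA s" using zA(1) unfolding UB_def by blast+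
 show "- vs < vv zA" using UB_basic(3)[OF zA(1), of 0] z by simp
qed

text \<open>The mean of the angles of two collision orbits, one leaving \<open>ts\<close> at \<open>v = - vs\<close> and one which is symmetric
 to it at \<open>\<pi>/2\<close>, is a supersolution, and orbits with \<open>r > 0\<close> are strict subsolutions.\<close>

lemma convex_bound:
 assumes p: "p \<in> P1" "0 < rr p" "Up (pi/2) p t" "0 < fv p t" and u: "0 <= u" "u < t" "ts < ft p u"
  and h: "h \<in> P1" "rr h = 0" "Up (pi/2) h t'" "fv h t' = - vv zA" and \<tau>: "0 <= \<tau>" "\<tau> <= t'" "ft h \<tau> = ts"
 shows "- vs * cos (arccos (- fv h \<tau> / vs) / 2) < fv p u"
proof -
 note zf = zA_facts
 have pw: "0 < fw p s" if "0 <= s" "s <= t" for s using p(3) that unfolding Up_def by blast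
 have hw: "0 < fw h s" if "0 <= s" "s <= t'" for s using h(3) that unfolding Up_def by blast
 have pt: "ft p t = pi/2" "ft h t' = pi/2" "0 < t" "0 < t'" using p(3) h(3) unfolding Up_def by blast+
 have pmono: "ft p s < ft p s'" if "0 <= s" "s < s'" "s' <= t" for s s'
  by (rule ft_strict_mono[OF p(1)]) (use pw that in auto)
 have hmono: "ft h s < ft h s'" if "0 <= s" "s < s'" "s' <= t'" for s s'
  by (rule ft_strict_mono[OF h(1)]) (use hw that in auto)
 \<comment> \<open>The branch through \<open>zA\<close> exists only for \<theta> > ts; a start
   strictly between ts and the angle at u makes both graphs available on the whole range.\<close>
 define \<theta>0 where "\<theta>0 = (ts + ft p u) / 2"
 have u2: "ft p u < pi/2" using pmono[OF u(1,2)] pt by simp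
 have \<theta>0: "ts < \<theta>0" "\<theta>0 < ft p u" "\<theta>0 < pi/2" using u(3) u2 by (auto simp: \<theta>0_def)
 obtain sa where sa: "sa <= 0" "ft zA sa = \<theta>0" using UB_reach[OF zA(1), of \<theta>0 0] \<theta>0 zA(2) zf(1) by auto
 have sa0: "sa < 0" using sa \<theta>0 zA(2) zf(1) by (cases "sa = 0") auto
 obtain \<tau>0 where t0: "0 <= \<tau>0" "\<tau>0 <= t' - \<tau>" "ft (flow h \<tau>) \<tau>0 = \<theta>0"
  using ft_IVT[OF flow_in[OF h(1)], of "t' - \<tau>" \<tau> \<theta>0] \<tau> \<theta>0 pt flow_flow[OF h(1), of \<tau> "t' - \<tau>"] by auto
 define \<tau>1 where "\<tau>1 = \<tau> + \<tau>0"
 have \<tau>1: "\<tau> <= \<tau>1" "\<tau>1 <= t'" "ft h \<tau>1 = \<theta>0" using t0 flow_flow[OF h(1), of \<tau> \<tau>0] by (auto simp: \<tau>1_def)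
 have \<tau>1': "\<tau>1 < t'" using \<tau>1 pt \<theta>0 by (cases "\<tau>1 = t'") auto
 have zw: "0 < fw zA s" if "sa <= s" "s <= 0" for s using zf(3)[OF that(2)] .
 have hw1: "0 < fw h s" if "\<tau>1 <= s" "s <= t'" for s using hw[of s] that \<tau>1 \<tau> by simp
 obtain y1 where y1: "continuous_on {ft zA sa..ft zA 0} y1" "!!s. sa <= s ==> s <= 0 ==> y1 (ft zA s) = fv zA s"
  "!!x. ft zA sa < x ==> x < ft zA 0 ==> (y1 has_real_derivative (1/2) * qf x (y1 x)) (at x)"
  "!!x. ft zA sa <= x ==> x <= ft zA 0 ==> EX s. sa <= s & s <= 0 & ft zA s = x"
  by (rule graph[OF zf(1,2) sa0 zw]) (auto intro: that)
 obtain y2 where y2: "continuous_on {ft h \<tau>1..ft h t'} y2" "!!s. \<tau>1 <= s ==> s <= t' ==> y2 (ft h s) = fv h s"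
  "!!x. ft h \<tau>1 < x ==> x < ft h t' ==> (y2 has_real_derivative (1/2) * qf x (y2 x)) (at x)"
  "!!x. ft h \<tau>1 <= x ==> x <= ft h t' ==> EX s. \<tau>1 <= s & s <= t' & ft h s = x"
  by (rule graph[OF h(1,2) \<tau>1' hw1]) (auto intro: that)
 note y1 = y1[unfolded sa(2) flow_0[OF zf(1)] zA(2)]
 note y2 = y2[unfolded \<tau>1(3) pt(2)]
 have hv: "\<bar>fv h \<tau>\<bar> < vs"
 proof (rule abs_v_less[OF h(1,2)])
  show "fw h \<tau> ~= 0" using hw[OF \<tau>(1,2)] by simp
  show "2 * W (ft h \<tau>) <= vs^2 * (cos (ft h \<tau>))^2" using W_V[of ts] ts_range vs_sq by (simp add: \<tau>(3) Vs_def)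
 qed (use ts_range \<tau>(3) vs_pos in auto)
 have y1b: "- vs < y1 x" "y1 x < vs" if x: "\<theta>0 <= x" "x <= pi/2" for x
 proof -
  obtain s where s: "sa <= s" "s <= 0" "ft zA s = x" using y1(4)[OF x] by blast
  have "y1 x = fv zA s" using y1(2)[OF s(1,2)] s(3) by simp
  then show "- vs < y1 x" "y1 x < vs" using UB_basic(3)[OF zA(1) s(2)] fv_mono0[OF zf(1,2) s(2)] zf(1) zA(3) vs_pos by auto
 qed
 have y2b: "fv h \<tau> <= y2 x" "y2 x < vs" if x: "\<theta>0 <= x" "x <= pi/2" for x
 proof -
  obtain s where s: "\<tau>1 <= s" "s <= t'" "ft h s = x" using y2(4)[OF x] by blast
  have "y2 x = fv h s" using y2(2)[OF s(1,2)] s(3) by simp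
  then show "fv h \<tau> <= y2 x" "y2 x < vs" using fv_mono0[OF h(1,2), of \<tau> s] fv_mono0[OF h(1,2) s(2)] h(4) zf(4) s \<tau>1 by auto
 qed
 define X1 X2 where "X1 x = arccos (- y1 x / vs)" and "X2 x = arccos (- y2 x / vs)" for x
 have q: "- 1 < - y / vs" "- y / vs < 1" if "- vs < y" "y < vs" for y using that vs_pos by (auto simp: field_simps)
 have y2b': "- vs < y2 x" if "\<theta>0 <= x" "x <= pi/2" for x using y2b(1)[OF that] hv by (simp add: abs_less_iff)
 have X1: "0 < X1 x" "X1 x < pi" "cos (X1 x) = - y1 x / vs" if "\<theta>0 <= x" "x <= pi/2" for x
  using arccos_lt_bounded[OF q[OF y1b[OF that]]] q[OF y1b[OF that]] by (auto simp: X1_def)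
 have X2: "0 < X2 x" "X2 x < pi" "cos (X2 x) = - y2 x / vs" if "\<theta>0 <= x" "x <= pi/2" for x
  using arccos_lt_bounded[OF q[OF y2b'[OF that] y2b(2)[OF that]]] q[OF y2b'[OF that] y2b(2)[OF that]] by (auto simp: X2_def)
 \<comment> \<open>The curve whose angle is the mean of the two angles; by \<open>qf_convex\<close>
   its slope is at least qf / 2.\<close>
 define ym where "ym x = - vs * cos ((X1 x + X2 x) / 2)" for x
 have ymc: "continuous_on {\<theta>0..pi/2} ym"
  unfolding ym_def X1_def X2_def using vs_pos q y1b y2b' y2b(2)
  by (intro continuous_intros y1(1) y2(1) ballI conjI less_imp_le) auto
 have ymD: "EX D. (ym has_real_derivative D) (at x) & (1/2) * qf x (ym x) <= D" if x: "\<theta>0 < x" "x < pi/2" for x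
 proof -
  have x': "\<theta>0 <= x" "x <= pi/2" using x by auto
  have sq: "sqrt (vs^2 - y^2) = vs * sin X" if "0 < X" "X < pi" "cos X = - y / vs" for X y
  proof -
   have "y = - vs * cos X" using that(3) vs_pos by (simp add: field_simps)
   then have "vs^2 - y^2 = (vs * sin X)^2" by (simp add: power_mult_distrib sin_squared_eq algebra_simps)
   then show ?thesis using vs_pos sin_gt_zero[OF that(1,2)] by simp
  qed
  have a1: "\<bar>y1 x\<bar> < vs" "\<bar>y2 x\<bar> < vs" using y1b[OF x'] y2b'[OF x'] y2b(2)[OF x'] by auto
  have D1: "(X1 has_real_derivative (1/2) * qf x (y1 x) / (vs * sin (X1 x))) (at x)"
   unfolding X1_def using arccos_deriv[OF y1(3)[OF x] vs_pos a1(1)] sq[OF X1[OF x']] by (simp add: X1_def)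
  have D2: "(X2 has_real_derivative (1/2) * qf x (y2 x) / (vs * sin (X2 x))) (at x)"
   unfolding X2_def using arccos_deriv[OF y2(3)[OF x] vs_pos a1(2)] sq[OF X2[OF x']] by (simp add: X2_def)
  let ?m = "(X1 x + X2 x) / 2"
  let ?D = "vs * sin ?m * (((1/2) * qf x (y1 x) / (vs * sin (X1 x)) + (1/2) * qf x (y2 x) / (vs * sin (X2 x))) / 2)"
  have "(ym has_real_derivative ?D) (at x)" unfolding ym_def
   using DERIV_cmult[OF DERIV_chain2[OF DERIV_cos DERIV_cdivide[OF DERIV_add[OF D1 D2], of 2]], of "- vs"]
   by (rule DERIV_cong) simp
  moreover have "(1/2) * qf x (ym x) <= ?D"
  proof -
   have m: "0 < sin ?m" by (rule sin_gt_zero) (use X1[OF x'] X2[OF x'] in auto)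
   have yy: "- vs * cos (X1 x) = y1 x" "- vs * cos (X2 x) = y2 x" using X1(3)[OF x'] X2(3)[OF x'] vs_pos by auto
   have "qf x (ym x) / sin ?m <= (qf x (y1 x) / sin (X1 x) + qf x (y2 x) / sin (X2 x)) / 2"
    using qf_convex[OF X1(1,2)[OF x'] X2(1,2)[OF x'], of x] unfolding yy ym_def by simp
   then have "qf x (ym x) <= sin ?m * ((qf x (y1 x) / sin (X1 x) + qf x (y2 x) / sin (X2 x)) / 2)"
    using m by (simp add: pos_divide_le_eq mult.commute)
   moreover have "?D = (1/2) * (sin ?m * ((qf x (y1 x) / sin (X1 x) + qf x (y2 x) / sin (X2 x)) / 2))"
   proof -
    have g1: "(1/2) * a / (vs * s) = (1/2) * (a / s) / vs" for a s by simp
    have g2: "vs * m * (((1/2) * a / vs + (1/2) * b / vs) / 2) = (1/2) * (m * ((a + b) / 2))" for m a b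
     using vs_pos by (simp add: field_simps)
    show ?thesis unfolding g1 g2 ..
   qed
   ultimately show ?thesis by linarith
  qed
  ultimately show ?thesis by blast
 qed
 define d where "d s = ym (ft p s) - fv p s" for s
 have rng: "\<theta>0 < ft p s & ft p s <= pi/2" if "u <= s" "s <= t" for s
  using pmono[of u s] pmono[of s t] \<theta>0(2) pt that u by (cases "s = u"; cases "s = t") auto
 have dc: "continuous_on {u..t} d" unfolding d_def
  by (intro continuous_on_diff continuous_on_compose2[OF ymc] cont_f[OF p(1)]) (use rng in \<open>auto simp: less_imp_le\<close>)
 have dt: "d t < 0"
 proof -
  have e: "y1 (pi/2) = vv zA" "y2 (pi/2) = - vv zA" using y1(2)[of 0] y2(2)[of t'] sa zA(2) zf(1) pt(2) \<tau>1 h(4) by auto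
  \<comment> \<open>The two orbits have opposite v at \<pi>/2, so their angles add up to \<pi> and
    the mean curve has v = 0 there, below p.\<close>
  have x12: "X2 (pi/2) = pi - X1 (pi/2)" unfolding X1_def X2_def e
   using arccos_minus[of "- vv zA / vs"] q[OF zf(4)] zA(3) vs_pos by simp
  have "ym (pi/2) = 0" unfolding ym_def x12 by simp
  then show ?thesis unfolding d_def pt(1) using p(4) by simp
 qed
 \<comment> \<open>Going back from t, a first contact would come with a positive derivative of d,
   which contradicts d < 0 just after it.\<close>
 have "d u < 0"
 proof (rule ccontr)
  assume n: "~ d u < 0"
  have hc: "continuous_on {0..t - u} (%s. - d (t - s))"
   by (intro continuous_intros continuous_on_compose2[OF dc]) auto
  obtain r where r: "0 < r" "r <= t - u" "- d (t - r) = 0" "!!x. 0 <= x ==> x < r ==> 0 < - d (t - x)"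
   by (rule first_time[OF _ hc, of 0]) (use n dt u in \<open>auto intro: that\<close>)
  define s where "s = t - r"
  have s: "u <= s" "s < t" "d s = 0" "!!x. s < x ==> x <= t ==> d x < 0"
   using r(1,2,3) r(4)[of "t - x" for x] by (auto simp: s_def)
  have x: "\<theta>0 < ft p s" "ft p s < pi/2" using rng[of s] s pmono[of s t] pt u by auto
  obtain D where D: "(ym has_real_derivative D) (at (ft p s))" "(1/2) * qf (ft p s) (ym (ft p s)) <= D" using ymD[OF x] by blast
  have Dd: "(d has_real_derivative D * (fw p s * c (ft p s)) - ((1/2) * (fw p s)^2 * c (ft p s) - fr p s * (cos (ft p s))^2)) (at s)"
   unfolding d_def by (rule DERIV_diff[OF DERIV_chain2[OF D(1) ft_deriv[OF p(1)]] fv_deriv[OF p(1)]])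
  have w: "0 < fw p s" using pw[of s] s u by simp
  have "ym (ft p s) = fv p s" using s(3) by (simp add: d_def)
  then have "(1/2) * qf (ft p s) (fv p s) * (fw p s * c (ft p s)) <= D * (fw p s * c (ft p s))"
   using D(2) w c_pos[of "ft p s"] by (intro mult_right_mono) auto
  then have "0 < D * (fw p s * c (ft p s)) - ((1/2) * (fw p s)^2 * c (ft p s) - fr p s * (cos (ft p s))^2)"
   using slope_strict[OF p(1,2) w] x \<theta>0 ts_range by simp
  from DERIV_pos_inc_right[OF Dd this] obtain e where e: "0 < e" "\<forall>h>0. h < e --> d s < d (s + h)" by blast
  define k where "k = min (e / 2) (t - s)"
  have k: "0 < k" "k < e" "s < s + k" "s + k <= t" using e(1) s(2) by (auto simp: k_def min_def)
  show False using e(2)[rule_format, OF k(1,2)] s(4)[OF k(3,4)] s(3) by simp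
 qed
 moreover have "- vs * cos (arccos (- fv h \<tau> / vs) / 2) <= ym (ft p u)"
 proof -
  have xx: "\<theta>0 <= ft p u" "ft p u <= pi/2" using \<theta>0 u2 by auto
  have hq: "- 1 < - fv h \<tau> / vs" "- fv h \<tau> / vs < 1" using q[of "fv h \<tau>"] hv by (auto simp: abs_less_iff)
  have "arccos (- fv h \<tau> / vs) <= X2 (ft p u)" unfolding X2_def
   using y2b(1)[OF xx] q[OF y2b'[OF xx] y2b(2)[OF xx]] hq vs_pos by (intro arccos_le_arccos) (auto simp: divide_right_mono)
  \<comment> \<open>Of the first orbit only X1 > 0 is kept; the angle of the second has not
    decreased since ts.\<close>
  then have "arccos (- fv h \<tau> / vs) / 2 <= (X1 (ft p u) + X2 (ft p u)) / 2" using X1[OF xx] by simp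
  then have "cos ((X1 (ft p u) + X2 (ft p u)) / 2) <= cos (arccos (- fv h \<tau> / vs) / 2)"
   using arccos_lt_bounded[OF hq] X1[OF xx] X2[OF xx] by (intro cos_monotone_0_pi_le) auto
  then show ?thesis unfolding ym_def using vs_pos by simp
 qed
 ultimately show ?thesis by (simp add: d_def)
qed

text \<open>The time reversal of the orbit of \<open>Sh (- pi) zA\<close>, which connects \<open>(0, - v2)\<close> on \<open>\<theta> = 0\<close> to \<open>(0, - v1)\<close> on \<open>\<theta> = \<pi>/2\<close>.\<close>

definition v2 :: real where "v2 = vv (up 0 (Sh (- pi) zA))"
definition hA :: state where "hA = Mi (Rv (up 0 (Sh (- pi) zA)))"

lemma hA_facts: "hA \<in> Sec 0" "rr hA = 0" "vv hA = - v2" "EX t. Up (pi/2) hA t & fv hA t = - vv zA"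
proof -
 let ?A = "Sh (- pi) zA"
 obtain t where t: "Up 0 ?A t" using EA(1) by blast
 have A: "?A \<in> P1" "rr ?A = 0" by (rule A_facts(3)) (simp add: zA_facts)
 have u: "up 0 ?A = flow ?A t" by (rule up_eq[OF A(1) t])
 have uS: "flow ?A t \<in> Sec 0" by (rule Up_Sec[OF A(1) t])
 show "hA \<in> Sec 0" using SecD[OF uS] unfolding hA_def u Sec_def by simp
 show "rr hA = 0" unfolding hA_def u using fr_zero[OF A] by simp
 show "vv hA = - v2" by (simp add: hA_def v2_def)
 have f: "flow hA s = Mi (Rv (flow ?A (t - s)))" for s
  unfolding hA_def u using flow_MiRv[OF flow_in[OF A(1)]] flow_flow[OF A(1), of t "- s"] by simp
 have "Up (pi/2) hA t" unfolding Up_def f using t A(1) zA(2) unfolding Up_def by auto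
 moreover have "fv hA t = - vv zA" unfolding f using A(1) by simp
 ultimately show "EX t. Up (pi/2) hA t & fv hA t = - vv zA" by blast
qed

lemma v2_pos: "0 < v2" using EA(2) by (simp add: v2_def)

definition \<tau>A :: real where "\<tau>A = upT ts hA"
definition tA :: real where "tA = upT (pi/2) hA"

lemma tA: "Up (pi/2) hA tA" "fv hA tA = - vv zA" "Up ts hA \<tau>A" "\<tau>A < tA" "0 < \<tau>A" "ft hA \<tau>A = ts" "\<bar>fv hA \<tau>A\<bar> < vs" "hA \<in> P1"
proof -
 show h: "hA \<in> P1" by (rule SecD(1)[OF hA_facts(1)])
 obtain t where t: "Up (pi/2) hA t" "fv hA t = - vv zA" using hA_facts(4) by blast
 have e: "tA = t" unfolding tA_def by (rule upT_eq[OF h t(1)])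
 show "Up (pi/2) hA tA" "fv hA tA = - vv zA" using t by (simp_all add: e)
 obtain t' where t': "Up ts hA t'" "0 < t'" "t' < t"
  using Up_between[OF h t(1), of ts] SecD(2)[OF hA_facts(1)] ts_range by auto
 have e': "\<tau>A = t'" unfolding \<tau>A_def by (rule upT_eq[OF h t'(1)])
 show "Up ts hA \<tau>A" "\<tau>A < tA" "0 < \<tau>A" using t' by (simp_all add: e e')
 then show f: "ft hA \<tau>A = ts" unfolding Up_def by blast
 show "\<bar>fv hA \<tau>A\<bar> < vs"
 proof (rule abs_v_less[OF h hA_facts(2)])
  have "0 < fw hA \<tau>A" using t'(1) unfolding e' Up_def by auto
  then show "fw hA \<tau>A ~= 0" by simp
  show "2 * W (ft hA \<tau>A) <= vs^2 * (cos (ft hA \<tau>A))^2" using W_V[of ts] ts_range vs_sq by (simp add: f Vs_def)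
 qed (use f ts_range vs_pos in auto)
qed

text \<open>The angle of the orbit of \<open>hA\<close> at the critical angle, in the coordinate v =
  - vs cos x.\<close>

definition xr :: real where "xr = arccos (- fv hA \<tau>A / vs)"

lemma xr: "0 < xr" "xr < pi"
proof -
 have "- 1 < - fv hA \<tau>A / vs" "- fv hA \<tau>A / vs < 1" using tA(7) vs_pos by (auto simp: field_simps abs_less_iff)
 then show "0 < xr" "xr < pi" using arccos_lt_bounded unfolding xr_def by blast+
qed

text \<open>Along the orbit of \<open>zB\<close> the angle \<open>arccos (- v / vs)\<close> grows from \<open>0\<close> at \<open>- ts\<close> at least as fast as \<open>\<beta>w\<close>.\<close>

lemma zB_angle:
 assumes v: "v2 <= - vv zB" shows "2 * b1 <= xr"
proof -
 have z: "zB \<in> P1" "rr zB = 0" "!!s. s <= 0 ==> 0 < fw zB s" "(flow zB \<longlongrightarrow> Lm (- ts)) at_bot" using zB(1) unfolding UB_def by blast+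
 have zS: "zB \<in> Sec 0" using z(1) z(3)[of 0] zB(2) by (simp add: Sec_def)
 have zl: "- vs < vv zB" using UB_basic(3)[OF zB(1), of 0] z(1) by simp
 have g: "good 0 ts" by (simp add: good_def)
 obtain t where t: "Up ts zB t" using barrier(2)[OF g zB(1) _ zB(3) zS z(2) zl] zB(2,3) by auto
 have tw: "0 < fw zB s" if "s <= t" for s using t z(3)[of s] that unfolding Up_def by (cases "s <= 0") auto
 have tt: "ft zB t = ts" "0 < t" using t unfolding Up_def by blast+
 have vt: "\<bar>fv zB t\<bar> < vs"
 proof (rule abs_v_less[OF z(1,2)])
  show "fw zB t ~= 0" using tw[of t] by simp
  show "2 * W (ft zB t) <= vs^2 * (cos (ft zB t))^2" using W_V[of ts] ts_range vs_sq by (simp add: tt(1) Vs_def)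
 qed (use tt ts_range vs_pos in auto)
 have vb: "\<bar>fv zB s\<bar> < vs" if "s <= t" for s
 proof -
  have "fv zB s <= fv zB t" by (rule fv_mono0[OF z(1,2) that])
  moreover have "- vs < fv zB s"
   using UB_basic(3)[OF zB(1), of s] fv_mono0[OF z(1,2), of 0 s] zl z(1) by (cases "s <= 0") auto
  ultimately show ?thesis using vt by (simp add: abs_less_iff)
 qed
 have fb: "- ts < ft zB s" "ft zB s <= ts" if "s <= t" for s
 proof -
  have "ft zB s < ft zB t" if "s < t" by (rule ft_strict_mono[OF z(1)]) (use tw that in auto)
  then show "ft zB s <= ts" using tt \<open>s <= t\<close> by (cases "s = t") auto
  have "ft zB 0 < ft zB s" if "0 < s" by (rule ft_strict_mono[OF z(1)]) (use tw that \<open>s <= t\<close> in auto)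
  then show "- ts < ft zB s" using UB_basic(2)[OF zB(1), of s] z(1) zB(2) ts_range by (cases "s <= 0") auto
 qed
 have "2 * b1 <= arccos (- fv zB t / vs)"
 proof -
  have "arccos (- fv zB s / vs) - \<beta>w (ft zB s) <= arccos (- fv zB t / vs) - \<beta>w (ft zB t)" if s: "s <= 0" for s
  proof (rule ang_lower[OF z(1,2)])
   show "0 < fw zB x & \<bar>fv zB x\<bar> < vs & \<bar>ft zB x\<bar> <= pi/2" if "s <= x" "x <= t" for x
    using tw[OF that(2)] vb[OF that(2)] fb[OF that(2)] ts_range by (simp add: abs_le_iff)
  qed (use s tt in simp)
  moreover have "0 <= arccos (- fv zB s / vs)" if s: "s <= 0" for s
   using vb[of s] s tt vs_pos by (intro arccos_lbound) (auto simp: field_simps abs_less_iff)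
  \<comment> \<open>At time s the angle is only known to be nonnegative; for s tending to - infinity
    \<theta> tends to - ts, so the total growth up to ts is at least 2 b1.\<close>
  ultimately have K: "\<beta>w (ft zB t) - arccos (- fv zB t / vs) <= \<beta>w (ft zB s)" if "s <= 0" for s using that by force
  have "((%s. \<beta>w (ft zB s)) \<longlongrightarrow> \<beta>w (- ts)) at_bot"
   using isCont_tendsto_compose[OF DERIV_isCont[OF \<beta>w_deriv] comp_tendsto(3)[OF z(4)]] by simp
  from tendsto_at_bot_ge[OF this K] have "\<beta>w (ft zB t) - arccos (- fv zB t / vs) <= \<beta>w (- ts)" .
  then show ?thesis using \<beta>w_odd b1_def tt(1) by simp
 qed
 moreover have "fv zB t <= fv hA \<tau>A"
 proof (cases "v2 = - vv zB")
  case True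
  have "flow zB 0 = flow hA 0"
   by (rule collision_state_eq) (use z zS hA_facts(1-3) tA(8) True SecD[OF zS] SecD[OF hA_facts(1)] in \<open>auto simp: less_imp_le\<close>)
  then have e: "zB = hA" using z(1) tA(8) by simp
  have "t = \<tau>A" using Up_unique[OF tA(8) t[unfolded e] tA(3)] .
  then show ?thesis by (simp add: e)
 next
  case False
  have "fv zB t < fv hA \<tau>A"
  proof (rule collision_order[OF z(1,2) tA(8) hA_facts(2)])
   show "th zB = th hA" using zB(2) SecD(2)[OF hA_facts(1)] by simp
   show "vv zB < vv hA" using v False hA_facts(3) by simp
   show "0 < fw hA x" if "0 <= x" "x <= \<tau>A" for x using tA(3) that unfolding Up_def by blast
  qed (use tt tA tw in auto)
  then show ?thesis by simp
 qed
 ultimately show ?thesis unfolding xr_def using vt tA(7) vs_pos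
  arccos_le_arccos[of "- fv hA \<tau>A / vs" "- fv zB t / vs"] by (auto simp: field_simps abs_less_iff)
qed

subsection \<open>Orbits through the Eulerian line with vanishing radial velocity\<close>

definition Pq :: "real => real => state" where "Pq r v = (r, v, 0, sqrt ((2 * V 0 - v^2 - 2 * r) / c 0))"

lemma Pq_simps [simp]: "rr (Pq r v) = r" "vv (Pq r v) = v" "th (Pq r v) = 0" by (auto simp: Pq_def)

lemma W0: "W 0 = V 0" using W_V[of 0] by simp

lemma Pq_P1: assumes "0 <= r" "v^2 + 2 * r <= 2 * V 0" shows "Pq r v \<in> P1"
proof -
 have "(ww (Pq r v))^2 * c 0 = 2 * V 0 - v^2 - 2 * r" using assms c_pos[of 0] by (simp add: Pq_def)
 then show ?thesis using assms by (simp add: P1_iff En_def W0 field_simps)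
qed

lemma Pq_Sec: assumes "0 <= r" "v^2 + 2 * r < 2 * V 0" shows "Pq r v \<in> Sec 0"
 using Pq_P1[of r v] assms c_pos[of 0] by (auto simp: Sec_def Pq_def)

lemma Sec0_eq: assumes p: "p \<in> Sec 0" shows "p = Pq (rr p) (vv p)" "(vv p)^2 + 2 * rr p < 2 * V 0"
proof -
 have w: "(ww p)^2 * c 0 = 2 * V 0 - (vv p)^2 - 2 * rr p" using SecD[OF p] by (auto simp: P1_iff En_def W0)
 then have "(ww p)^2 = (2 * V 0 - (vv p)^2 - 2 * rr p) / c 0" using c_pos[of 0] by (simp add: field_simps)
 then have "ww p = sqrt ((2 * V 0 - (vv p)^2 - 2 * rr p) / c 0)" using SecD(3)[OF p] by (metis real_sqrt_unique less_imp_le)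
 then show "p = Pq (rr p) (vv p)" using SecD(2)[OF p] by (intro state_eqI) (auto simp: Pq_def)
 have "0 < (ww p)^2 * c 0" using SecD(3)[OF p] c_pos[of 0] by simp
 then show "(vv p)^2 + 2 * rr p < 2 * V 0" using w by simp
qed

lemma Pq_tendsto: "(f \<longlongrightarrow> r) F ==> (g \<longlongrightarrow> v) F ==> ((%x. Pq (f x) (g x)) \<longlongrightarrow> Pq r v) F"
 unfolding Pq_def using c_pos[of 0] by (intro tendsto_intros) auto

lemma V0_pos: "0 < V 0" using vE(2,3) by (metis zero_less_power2 less_irrefl zero_less_mult_pos zero_less_numeral)

abbreviation "P0 r \<equiv> Pq r 0"

lemma P0_Sec: "0 <= r ==> r < V 0 ==> P0 r \<in> Sec 0" by (rule Pq_Sec) auto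

text \<open>At r = V(0), v = 0 energy leaves w = 0, so the point is fixed by \<open>Mi\<close> and
  its orbit never leaves \<theta> = 0.\<close>

lemma homothetic_orbit:
 shows "ft (P0 (V 0)) s = 0" "((%s. fr (P0 (V 0)) s) \<longlongrightarrow> 0) at_top" "((%s. fv (P0 (V 0)) s) \<longlongrightarrow> - vE) at_top"
proof -
 let ?e = "P0 (V 0)"
 have e: "?e \<in> P1" by (rule Pq_P1) (use V0_pos in auto)
 have "ww ?e = 0" by (simp add: Pq_def)
 then have "Mi ?e = ?e" by (intro state_eqI) auto
 then have "flow ?e s = Mi (flow ?e s)" for s using flow_Mi[OF e] by metis
 then have "ft ?e s = - ft ?e s" "fw ?e s = - fw ?e s" for s by (metis comp_simps(11), metis comp_simps(12))
 then have z: "ft ?e s = 0" "fw ?e s = 0" for s by (auto simp: eq_neg_iff_add_eq_0)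
 show "ft ?e s = 0" by (rule z)
 have l: "((%t. ft ?e t) \<longlongrightarrow> 0) at_top" "((%t. fw ?e t) \<longlongrightarrow> 0) at_top" by (simp_all add: z)
 show "((%s. fr ?e s) \<longlongrightarrow> 0) at_top" "((%s. fv ?e s) \<longlongrightarrow> - vE) at_top"
  using collapse[OF e _ l] V0_pos by (simp_all add: vE_def)
qed

text \<open>The case in which the direct shooting along \<open>P0\<close> meets no sign change: then
  information must come from the end r = V(0).\<close>

definition AllUp :: bool where "AllUp \<longleftrightarrow> (ALL r. 0 < r --> r < V 0 --> Good (pi/2) (P0 r))"

lemma AllUp_times:
 assumes "AllUp" "0 < r" "r < V 0"
 obtains t t' where "Up (pi/2) (P0 r) t" "Up ts (P0 r) t'" "0 < t'" "t' < t" "Up (pi/2) (flow (P0 r) t') (t - t')" "0 < fv (P0 r) t"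
  "up (pi/2) (P0 r) = flow (P0 r) t" "up ts (P0 r) = flow (P0 r) t'" "P0 r \<in> P1"
proof -
 have S: "P0 r \<in> Sec 0" by (rule P0_Sec) (use assms in auto)
 have g: "Good (pi/2) (P0 r)" using assms unfolding AllUp_def by blast
 then obtain t where t: "Up (pi/2) (P0 r) t" unfolding Good_def by blast
 obtain t' where t': "Up ts (P0 r) t'" "0 < t'" "t' < t" "Up (pi/2) (flow (P0 r) t') (t - t')"
  using Up_between[OF SecD(1)[OF S] t, of ts] ts_range by auto
 have u: "up (pi/2) (P0 r) = flow (P0 r) t" by (rule up_eq[OF SecD(1)[OF S] t])
 then have "0 < fv (P0 r) t" using g unfolding Good_def by simp
 then show ?thesis using that[OF t t'] u up_eq[OF SecD(1)[OF S] t'(1)] SecD(1)[OF S] by blast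
qed

lemma near_homothetic:
 assumes T: "0 < \<epsilon>" "\<epsilon> < pi" "0 < \<eta>"
 obtains T where "0 < T" "\<forall>\<^sub>F r in at_left (V 0). 0 < r & r < V 0 & fv (P0 r) T < - vE * cos \<epsilon> & fr (P0 r) T < \<eta> &
  (ALL s. 0 <= s --> s <= T --> ft (P0 r) s < ts)"
proof -
 let ?e = "P0 (V 0)"
 have e: "?e \<in> P1" by (rule Pq_P1) (use V0_pos in auto)
 have "cos \<epsilon> < 1" using cos_monotone_0_pi[of 0 \<epsilon>] T by simp
 then have lt: "- vE < - vE * cos \<epsilon>" using vE(3) by simp
 have "\<forall>\<^sub>F s in at_top. fv ?e s < - vE * cos \<epsilon> & fr ?e s < \<eta>"
  using order_tendstoD(2)[OF homothetic_orbit(3) lt] order_tendstoD(2)[OF homothetic_orbit(2) T(3)] by eventually_elim simp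
 then have "EX N. \<forall>s\<ge>N. fv ?e s < - vE * cos \<epsilon> & fr ?e s < \<eta>" unfolding eventually_at_top_linorder .
 then obtain N where N: "\<forall>s\<ge>N. fv ?e s < - vE * cos \<epsilon> & fr ?e s < \<eta>" ..
 define S where "S = max N 1"
 have S: "0 < S" "fv ?e S < - vE * cos \<epsilon>" "fr ?e S < \<eta>" using N by (auto simp: S_def)
 define e' where "e' = min ts (min (- vE * cos \<epsilon> - fv ?e S) (\<eta> - fr ?e S))"
 have e': "0 < e'" "e' <= ts" "e' <= - vE * cos \<epsilon> - fv ?e S" "e' <= \<eta> - fr ?e S" using S ts_range by (auto simp: e'_def)
 have rg: "\<forall>\<^sub>F r in at_left (V 0). 0 < r & r < V 0" using eventually_at_left_real[OF V0_pos] by eventually_elim auto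
 have ev: "\<forall>\<^sub>F r in at_left (V 0). P0 r \<in> P1" using rg by eventually_elim (use SecD(1)[OF P0_Sec] in auto)
 have l: "((%r. P0 r) \<longlongrightarrow> ?e) (at_left (V 0))" by (intro Pq_tendsto tendsto_ident_at tendsto_const)
 show ?thesis
 proof (rule that[OF S(1)])
  show "\<forall>\<^sub>F r in at_left (V 0). 0 < r & r < V 0 & fv (P0 r) S < - vE * cos \<epsilon> & fr (P0 r) S < \<eta> &
   (ALL s. 0 <= s --> s <= S --> ft (P0 r) s < ts)"
   using rg flow_uniform[OF l ev e e'(1), of S]
  proof eventually_elim
   case (elim r)
   have c: "norm (flow (P0 r) s - flow ?e s) < e'" if "0 <= s" "s <= S" for s using elim(2)[rule_format, of s] that by simp
   have "ft (P0 r) s < ts" if "0 <= s" "s <= S" for s using comp_close(3)[OF c[OF that]] homothetic_orbit(1)[of s] e'(2) by linarith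
   moreover have "fv (P0 r) S < - vE * cos \<epsilon>" "fr (P0 r) S < \<eta>"
    using comp_close(1,2)[OF c[of S]] S(1) e'(3,4) by linarith+
   ultimately show ?case using elim(1) by blast
  qed
 qed
qed

text \<open>For r close to V(0) the orbit first follows the homothetic orbit until v is close to -
  vE; from there to ts \<open>ang_upper\<close> lets the angle grow by at most b1. As v stays
  negative meanwhile, r remains small.\<close>

lemma at_theta_s:
 assumes A: "AllUp" and e: "0 < \<epsilon>" "b1 + \<epsilon> < pi/2" "0 < \<eta>"
 shows "\<forall>\<^sub>F r in at_left (V 0). 0 < r & r < V 0 & vv (up ts (P0 r)) <= - vE * cos (b1 + \<epsilon>) & rr (up ts (P0 r)) < \<eta>"
proof -
 have ep: "\<epsilon> < pi" using e b1_bounds by simp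
 obtain T where T: "0 < T" "\<forall>\<^sub>F r in at_left (V 0). 0 < r & r < V 0 & fv (P0 r) T < - vE * cos \<epsilon> & fr (P0 r) T < \<eta> &
  (ALL s. 0 <= s --> s <= T --> ft (P0 r) s < ts)" using near_homothetic[OF e(1) ep e(3)] by blast
 show ?thesis using T(2)
 proof eventually_elim
  case (elim r)
  obtain t t' where t: "Up (pi/2) (P0 r) t" "Up ts (P0 r) t'" "0 < t'" "t' < t" "up ts (P0 r) = flow (P0 r) t'" "P0 r \<in> P1"
   using AllUp_times[OF A] elim by metis
  let ?p = "P0 r"
  have w: "0 < fw ?p s" if "0 <= s" "s <= t'" for s using t(2) that unfolding Up_def by blast
  have Tt: "T < t'" using elim t(2,3) unfolding Up_def by (metis less_imp_le less_irrefl not_le)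
  have fth: "0 <= ft ?p s & ft ?p s <= ts" if "0 <= s" "s <= t'" for s
   using Up_mono[OF t(6,2), of 0 s] Up_mono[OF t(6,2), of s t'] that t(2,6) unfolding Up_def by (cases "s = 0"; cases "s = t'") auto
  have vl: "\<bar>fv ?p s\<bar> < vE" if "0 <= s" "s <= t'" for s
   by (rule v_less_vE[OF t(6)]) (use w[OF that] fth[OF that] in auto)
  have vle: "fv ?p s <= - vE * cos (b1 + \<epsilon>)" if s: "T <= s" "s <= t'" for s
  proof -
   have s0: "0 <= s" using T(1) s by simp
   have "arccos (- fv ?p s / vE) - \<beta>w (ft ?p s) <= arccos (- fv ?p T / vE) - \<beta>w (ft ?p T)"
    by (rule ang_upper[OF t(6) s(1)]) (use w fth T(1) s in \<open>auto simp: abs_le_iff\<close>)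
   moreover have "\<beta>w (ft ?p s) - \<beta>w (ft ?p T) <= b1"
    using \<beta>w_mono[of "ft ?p s" ts] \<beta>w_mono[of 0 "ft ?p T"] fth[OF s0 s(2)] fth[of T] T(1) Tt ts_range unfolding b1_def by auto
   moreover have "arccos (- fv ?p T / vE) <= \<epsilon>"
   proof -
    have "cos \<epsilon> <= - fv ?p T / vE" using elim vE(3) by (simp add: field_simps)
    then have "arccos (- fv ?p T / vE) <= arccos (cos \<epsilon>)"
     using vl[of T] T(1) Tt vE(3) by (intro arccos_le_arccos) (auto simp: field_simps abs_less_iff)
    then show ?thesis using e(1) ep by (simp add: arccos_cos)
   qed
   ultimately have "arccos (- fv ?p s / vE) <= b1 + \<epsilon>" by linarith
   moreover have q: "- 1 <= - fv ?p s / vE" "- fv ?p s / vE <= 1" using vl[OF s0 s(2)] vE(3) by (auto simp: field_simps abs_less_iff)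
   ultimately have "cos (b1 + \<epsilon>) <= cos (arccos (- fv ?p s / vE))" using e b1_bounds arccos_lbound[OF q] by (intro cos_monotone_0_pi_le) auto
   then show ?thesis using q vE(3) by (simp add: field_simps)
  qed
  have "0 < cos (b1 + \<epsilon>)" using e b1_bounds by (intro cos_gt_zero_pi) auto
  then have "0 < vE * cos (b1 + \<epsilon>)" using vE(3) by simp
  then have vneg: "fv ?p s <= 0" if s: "T <= s" "s <= t'" for s using vle[OF s] by linarith
  have "fr ?p t' <= fr ?p T + 0 * (t' - T)"
  proof (rule deriv_upper[OF _ fr_deriv[OF t(6)]])
   show "fr ?p s * fv ?p s * (cos (ft ?p s))^2 <= 0" if "T <= s" "s <= t'" for s
    using fr_nonneg[OF t(6), of s] vneg[OF that] by (intro mult_nonpos_nonneg mult_nonneg_nonpos) auto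
  qed (use Tt in simp)
  then show ?case using elim vle[of t'] Tt t(5) by simp
 qed
qed

lemma theta_s_lower:
 assumes A: "AllUp" and r: "0 < r" "r < V 0" shows "- vs * cos (xr / 2) <= vv (up ts (P0 r))"
proof -
 obtain t t' where t: "Up (pi/2) (P0 r) t" "Up ts (P0 r) t'" "0 < t'" "t' < t" "0 < fv (P0 r) t" "up ts (P0 r) = flow (P0 r) t'" "P0 r \<in> P1"
  using AllUp_times[OF A r] by metis
 have ev: "- vs * cos (xr / 2) <= fv (P0 r) u" if u: "t' < u" "u < t" for u
 proof -
  have "ft (P0 r) t' < ft (P0 r) u" by (rule Up_mono[OF t(7,1)]) (use u t(3) in auto)
  then have "ts < ft (P0 r) u" using t(2) unfolding Up_def by simp
  from convex_bound[OF t(7) _ t(1,5) _ u(2) this tA(8) hA_facts(2) tA(1,2) _ _ tA(6)] show ?thesis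
   unfolding xr_def using r u t(3) tA(4,5) by simp
 qed
 have "- vs * cos (xr / 2) <= fv (P0 r) t'"
 proof (rule tendsto_lowerbound)
  show "((%s. fv (P0 r) s) \<longlongrightarrow> fv (P0 r) t') (at_right t')"
   using DERIV_isCont[OF fv_deriv[OF t(7)], of t'] unfolding isCont_def by (rule filterlim_at_split[THEN iffD1, THEN conjunct2])
  show "\<forall>\<^sub>F s in at_right t'. - vs * cos (xr / 2) <= fv (P0 r) s"
   using eventually_at_right_real[OF t(4)] by eventually_elim (use ev in auto)
 qed simp
 then show ?thesis using t(6) by simp
qed

text \<open>If v2 <= - v3, \<open>zB_angle\<close> gives xr >= 2 b1, and all direct orbits have v >=
  - vs cos b1 at ts. Close to r = V(0) they have v at most about - vE cos b1, a contradiction since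
  vs < vE.\<close>

lemma v2_v3: assumes A: "AllUp" shows "- vv zB < v2"
proof (rule ccontr)
 assume "~ - vv zB < v2"
 then have b: "2 * b1 <= xr" by (intro zB_angle) simp
 have cb: "0 < cos b1" by (rule cos_gt_zero_pi) (use b1_bounds in auto)
 have "((%e. vE * cos (b1 + e)) \<longlongrightarrow> vE * cos (b1 + 0)) (at_right 0)" by (intro tendsto_intros)
 moreover have "vs * cos b1 < vE * cos (b1 + 0)" using vE(1) cb by simp
 ultimately have "\<forall>\<^sub>F e in at_right 0. vs * cos b1 < vE * cos (b1 + e)" by (rule order_tendstoD(1))
 then have "\<forall>\<^sub>F e in at_right 0. vs * cos b1 < vE * cos (b1 + e) & 0 < e & e < pi/2 - b1"
  using eventually_at_right_real[of 0 "pi/2 - b1"] b1_bounds by (simp add: eventually_conj_iff greaterThanLessThan_iff)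
 from eventually_happens[OF this] obtain e where e: "vs * cos b1 < vE * cos (b1 + e)" "0 < e" "b1 + e < pi/2" by auto
 from eventually_happens[OF at_theta_s[OF A e(2,3) zero_less_one]] obtain r where r: "0 < r" "r < V 0" "vv (up ts (P0 r)) <= - vE * cos (b1 + e)"
  by (auto simp: trivial_limit_at_left_real)
 have "cos (xr / 2) <= cos b1" using b b1_bounds xr by (intro cos_monotone_0_pi_le) auto
 then have "vs * cos (xr / 2) <= vs * cos b1" using vs_pos by simp
 then show False using theta_s_lower[OF A r(1,2)] r(3) e(1) by simp
qed

text \<open>\<open>hA\<close> arrives at \<pi>/2 exactly on the barrier v = - v1. Starting slightly
  lower still passes, by stability, and arrives strictly below it.\<close>

lemma barrier_orbit: "\<exists>g\<in>Sec 0. rr g = 0 & - vE < vv g & (EX t. Up (pi/2) g t & fv g t < - vv zA)"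
proof -
 have v2E: "v2^2 < vE^2" using Sec0_eq(2)[OF hA_facts(1)] hA_facts vE(2) by simp
 then have v2l: "v2 < vE" using v2_pos vE(3) by (simp add: power_less_imp_less_base)
 have hE: "hA = Pq 0 (- v2)" using Sec0_eq(1)[OF hA_facts(1)] hA_facts by simp
 have l: "((%v. Pq 0 v) \<longlongrightarrow> hA) (at_left (- v2))" unfolding hE by (intro Pq_tendsto tendsto_ident_at tendsto_const)
 have rg: "\<forall>\<^sub>F v in at_left (- v2). - vE < v & v < - v2" using eventually_at_left_real[of "- vE" "- v2"] v2l by simp
 have S: "Pq 0 v \<in> Sec 0" if "- vE < v" "v < - v2" for v
 proof (rule Pq_Sec)
  have "\<bar>v\<bar> < vE" using that v2_pos by simp
  then show "v^2 + 2 * 0 < 2 * V 0" using vE(2,3) power_strict_mono[of "\<bar>v\<bar>" vE 2] by simp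
 qed simp
 have ev: "\<forall>\<^sub>F v in at_left (- v2). Pq 0 v \<in> P1" using rg by eventually_elim (use SecD(1)[OF S] in auto)
 have "\<forall>\<^sub>F v in at_left (- v2). - vE < v & v < - v2 & Up (pi/2) (Pq 0 v) (upT (pi/2) (Pq 0 v))"
  using rg Up_stable(1)[OF l ev tA(8,1)] by eventually_elim simp
 from eventually_happens[OF this] obtain v t where v: "- vE < v" "v < - v2" "Up (pi/2) (Pq 0 v) t"
  by (auto simp: trivial_limit_at_left_real)
 note gS = S[OF v(1,2)]
 have "fv (Pq 0 v) t < fv hA tA"
  by (rule collision_order[OF SecD(1)[OF gS] _ tA(8) hA_facts(2)])
   (use v hA_facts(3) SecD(2)[OF hA_facts(1)] tA(1) in \<open>auto simp: Up_def\<close>)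
 then show ?thesis using gS v tA(2) by (intro bexI[of _ "Pq 0 v"]) auto
qed

text \<open>The orbit near the homothetic one falls below the initial v of g while \<theta> is still
  before ts, and \<open>stays_under\<close> keeps it there.\<close>

lemma above_bound:
 assumes A: "AllUp" and g: "g \<in> Sec 0" "rr g = 0" "- vE < vv g" "Up (pi/2) g t"
 shows "\<forall>\<^sub>F r in at_left (V 0). vv (up (pi/2) (P0 r)) <= fv g t"
proof -
 have gP: "g \<in> P1" by (rule SecD(1)[OF g(1)])
 have "\<bar>fv g 0\<bar> < vE" by (rule v_less_vE[OF gP]) (use SecD[OF g(1)] gP ts_range in auto)
 then have gv: "- 1 < - vv g / vE" "- vv g / vE < 1" using gP vE(3) by (auto simp: field_simps abs_less_iff)
 define \<epsilon> where "\<epsilon> = arccos (- vv g / vE)"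
 have e: "0 < \<epsilon>" "\<epsilon> < pi" "vv g = - vE * cos \<epsilon>" using arccos_lt_bounded[OF gv] gv vE(3) by (auto simp: \<epsilon>_def)
 obtain T where T: "0 < T" "\<forall>\<^sub>F r in at_left (V 0). 0 < r & r < V 0 & fv (P0 r) T < - vE * cos \<epsilon> & fr (P0 r) T < 1 &
  (ALL s. 0 <= s --> s <= T --> ft (P0 r) s < ts)" using near_homothetic[OF e(1,2) zero_less_one] by blast
 show ?thesis using T(2)
 proof eventually_elim
  case (elim r)
  obtain tp t' where t: "Up (pi/2) (P0 r) tp" "Up ts (P0 r) t'" "0 < t'" "t' < tp" "up (pi/2) (P0 r) = flow (P0 r) tp" "P0 r \<in> P1"
   using AllUp_times[OF A] elim by metis
  have Tt: "T < t'" using elim t(2,3) unfolding Up_def by (metis less_imp_le less_irrefl not_le)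
  have "fv (P0 r) tp <= fv g t"
  proof (rule stays_under[OF t(6) _ gP g(2), where a = T and a' = 0])
   show "0 < rr (P0 r)" "T < tp" "0 < t" using elim Tt t(4) g(4) by (auto simp: Up_def)
   show "0 < fw (P0 r) s" if "T <= s" "s <= tp" for s using t(1) T(1) that unfolding Up_def by auto
   show "0 < fw g s" if "0 <= s" "s <= t" for s using g(4) that unfolding Up_def by auto
   show "ft g 0 < ft (P0 r) T" using Up_mono[OF t(6,1), of 0 T] T(1) Tt t(4,6) SecD(2)[OF g(1)] gP by auto
   show "ft (P0 r) tp = ft g t" "ft g t <= pi/2" using t(1) g(4) unfolding Up_def by auto
   show "- (pi/2) <= ft g 0" using SecD(2)[OF g(1)] gP by simp
   show "fv (P0 r) T < fv g u" if "0 <= u" for u using elim fv_mono0[OF gP g(2) that] e(3) gP by simp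
  qed
  then show ?case using t(5) by simp
 qed
qed

text \<open>The hit of \<theta> = \<pi>/2, translated to the section - \<pi>/2.\<close>

definition q1 :: "real => state" where "q1 r = Sh (- pi) (up (pi/2) (P0 r))"

lemma Sh_Sec: "p \<in> Sec (pi/2) ==> Sh (- pi) p \<in> Sec (- (pi/2))" by (auto simp: Sec_def)

text \<open>For r tending to V(0) a subsequence of the points at ts converges to a collision point
  with - vs < v < 0. It continues to \<pi>/2 and arrives with 0 <= v < - v1, below the barrier, so
  it passes the next critical angle; nearby orbits pass as well and cannot return.\<close>

lemma q1_pass: assumes A: "AllUp" shows "\<exists>r>0. r < V 0 & ~ (EX t. Ret (q1 r) t)"
proof -
 obtain g t where g: "g \<in> Sec 0" "rr g = 0" "- vE < vv g" "Up (pi/2) g t" "fv g t < - vv zA" using barrier_orbit by blast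
 define rn where "rn n = V 0 - V 0 / real (Suc (Suc n))" for n
 have rn: "0 < rn n" "rn n < V 0" for n
 proof -
  have "V 0 / real (Suc (Suc n)) < V 0 / 1" by (rule divide_strict_left_mono) (use V0_pos in auto)
  then show "0 < rn n" by (simp add: rn_def)
  show "rn n < V 0" using V0_pos by (simp add: rn_def)
 qed
 have "rn \<longlonglongrightarrow> V 0 - 0" unfolding rn_def
  by (intro tendsto_diff tendsto_const) (rule filterlim_compose[OF lim_const_over_n[of "V 0"]], intro filterlim_compose[OF filterlim_Suc] filterlim_Suc)
 then have fl: "filterlim rn (at_left (V 0)) sequentially" using rn by (auto simp: filterlim_at eventually_sequentially less_imp_neq)
 define y where "y n = up ts (P0 (rn n))" for n
 have U: "(EX t. Up (pi/2) (y n) t) & y n \<in> P1 & th (y n) = ts & 0 < ww (y n) & up (pi/2) (y n) = up (pi/2) (P0 (rn n)) & 0 < vv (up (pi/2) (P0 (rn n)))" for n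
 proof -
  obtain t t' where t: "Up (pi/2) (P0 (rn n)) t" "Up ts (P0 (rn n)) t'" "0 < t'" "t' < t" "Up (pi/2) (flow (P0 (rn n)) t') (t - t')" "0 < fv (P0 (rn n)) t"
  "up (pi/2) (P0 (rn n)) = flow (P0 (rn n)) t" "up ts (P0 (rn n)) = flow (P0 (rn n)) t'" "P0 (rn n) \<in> P1" using AllUp_times[OF A rn] by blast
  note S = SecD[OF Up_Sec[OF t(9,2)]]
  have "up (pi/2) (y n) = flow (P0 (rn n)) t" using up_eq[OF S(1) t(5)] flow_flow[OF t(9), of t' "t - t'"] by (simp add: y_def t(8))
  then show ?thesis using t S by (auto simp: y_def)
 qed
 have yP: "y n \<in> P1" "th (y n) = ts" "0 < ww (y n)" for n using U[of n] by simp_all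
 obtain c0 where c0: "0 < c0" "!!x. ts <= x ==> x <= ts ==> c0 <= cos x" using cos_lower[of ts ts] ts_range by auto
 have "norm (y n) <= WM / c0^2 + sqrt (2 * WM) / c0 + pi/2 + wM" for n
  by (rule P1_norm_bound[OF yP(1) _ _ c0(1), of ts ts]) (use yP(2) c0(2) ts_range in auto)
 then have "bounded (range y)" unfolding bounded_iff by blast
 then have "seq_compact (closure (range y))" by (simp add: compact_imp_seq_compact)
 then obtain l r where lr: "strict_mono (r :: nat => nat)" "(y \<circ> r) \<longlonglongrightarrow> l"
  unfolding seq_compact_def using closure_subset[of "range y"] by (metis rangeI subsetD)
 have fr': "filterlim (%n. rn (r n)) (at_left (V 0)) sequentially" by (rule filterlim_compose[OF fl filterlim_subseq[OF lr(1)]])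
 have yl: "(%n. y (r n)) \<longlonglongrightarrow> l" using lr(2) by (simp add: o_def)
 have lP: "l \<in> P1" by (rule Lim_in_closed_set[OF closed_P1 _ _ yl]) (use yP in auto)
 have "(%n. th (y (r n))) \<longlonglongrightarrow> th l" by (rule comp_tendsto(3)[OF yl])
 then have lth: "th l = ts" by (simp add: yP(2) LIMSEQ_const_iff)
 define \<epsilon> where "\<epsilon> = (pi/2 - b1) / 2"
 have e: "0 < \<epsilon>" "b1 + \<epsilon> < pi/2" using b1_bounds by (auto simp: \<epsilon>_def field_simps)
 have rl: "rr l <= \<eta>" if "0 < \<eta>" for \<eta>
 proof (rule tendsto_upperbound[OF comp_tendsto(1)[OF yl]])
  show "\<forall>\<^sub>F n in sequentially. rr (y (r n)) <= \<eta>"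
   using eventually_compose_filterlim[OF at_theta_s[OF A e that] fr'] by eventually_elim (simp add: y_def)
 qed simp
 have lr0: "rr l = 0" using rl P1_bounds(1)[OF lP] by (metis field_le_epsilon add.left_neutral antisym)
 have vu: "vv l <= - vE * cos (b1 + \<epsilon>)"
 proof (rule tendsto_upperbound[OF comp_tendsto(2)[OF yl]])
  show "\<forall>\<^sub>F n in sequentially. vv (y (r n)) <= - vE * cos (b1 + \<epsilon>)"
   using eventually_compose_filterlim[OF at_theta_s[OF A e zero_less_one] fr'] by eventually_elim (simp add: y_def)
 qed simp
 have "0 < cos (b1 + \<epsilon>)" using e b1_bounds by (intro cos_gt_zero_pi) auto
 then have "0 < vE * cos (b1 + \<epsilon>)" using vE(3) by simp
 then have vneg: "vv l < 0" using vu by simp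
 have "- vs * cos (xr / 2) <= vv l"
  by (rule tendsto_lowerbound[OF comp_tendsto(2)[OF yl]]) (use theta_s_lower[OF A rn] in \<open>auto simp: y_def\<close>)
 moreover have "cos (xr / 2) < 1" using cos_monotone_0_pi[of 0 "xr / 2"] xr by simp
 then have "vs * cos (xr / 2) < vs" using vs_pos by simp
 ultimately have vl: "- vs < vv l" by simp
 have "0 <= ww l" by (rule tendsto_lowerbound[OF comp_tendsto(4)[OF yl]]) (use yP(3) in \<open>auto simp: less_imp_le\<close>)
 \<comment> \<open>At ts with r = w = 0 energy would require |v| = vs, but v lies strictly between -
   vs and 0.\<close>
 moreover have "ww l ~= 0"
 proof
  assume "ww l = 0"
  then have "(vv l)^2 * (cos ts)^2 = 2 * W ts" using energy[OF lP, of 0] lP lth lr0 by simp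
  also have "\<dots> = vs^2 * (cos ts)^2" using W_V[of ts] ts_range vs_sq by (simp add: Vs_def)
  finally have "(vv l)^2 = vs^2" using cos_pos[of ts] ts_range by simp
  then show False using vl vneg vs_pos by (auto simp: power2_eq_iff)
 qed
 ultimately have lw: "0 < ww l" by simp
 obtain tl where tl: "0 < tl" "ft l tl = pi/2" "\<forall>s\<in>{0..tl}. 0 < fw l s" using pass_right[OF lP, unfolded lth, OF order_refl ts_range(2) lw] by blast
 then have Ul: "Up (pi/2) l tl" unfolding Up_def by auto
 have ev: "\<forall>\<^sub>F n in sequentially. y (r n) \<in> P1" using yP by simp
 have ul: "(%n. up (pi/2) (y (r n))) \<longlonglongrightarrow> up (pi/2) l" by (rule Up_stable(2)[OF yl ev lP Ul])
 have ue: "up (pi/2) (y n) = up (pi/2) (P0 (rn n))" "0 < vv (up (pi/2) (P0 (rn n)))" for n using U[of n] by simp_all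
 define a where "a = Sh (- pi) (up (pi/2) l)"
 have qa: "(%n. q1 (rn (r n))) \<longlonglongrightarrow> a" using Sh_tendsto[OF ul, of "- pi"] unfolding q1_def a_def ue(1) .
 have aS: "a \<in> Sec (- (pi/2))" unfolding a_def up_eq[OF lP Ul] by (rule Sh_Sec[OF Up_Sec[OF lP Ul]])
 have ar: "rr a = 0" unfolding a_def up_eq[OF lP Ul] using fr_zero[OF lP lr0] by simp
 have "vv a <= fv g t"
 proof (rule tendsto_upperbound[OF comp_tendsto(2)[OF qa]])
  show "\<forall>\<^sub>F n in sequentially. vv (q1 (rn (r n))) <= fv g t"
   using eventually_compose_filterlim[OF above_bound[OF A g(1-4)] fr'] by eventually_elim (simp add: q1_def)
 qed simp
 moreover have "0 <= vv a"
  by (rule tendsto_lowerbound[OF comp_tendsto(2)[OF qa]]) (use ue in \<open>auto simp: q1_def less_imp_le\<close>)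
 moreover have gd: "good (- (pi/2)) (- ts)" by (simp add: good_def)
 ultimately obtain ta where ta: "Up (- ts) a ta" using barrier(2)[OF gd _ _ zA(3) aS ar] zA(1,2) g(5) vs_pos by auto
 have evq: "\<forall>\<^sub>F n in sequentially. q1 (rn (r n)) \<in> P1"
 proof (rule always_eventually, rule allI)
  fix n
  obtain t' where t': "Up (pi/2) (y (r n)) t'" using U by blast
  show "q1 (rn (r n)) \<in> P1" unfolding q1_def ue(1)[symmetric] up_eq[OF yP(1) t'] using yP(1) by simp
 qed
 from eventually_happens[OF Up_stable(1)[OF qa evq SecD(1)[OF aS] ta]] obtain n t' where n: "Up (- ts) (q1 (rn (r n))) t'" by auto
 obtain t'' where t'': "Up (pi/2) (y (r n)) t''" using U by blast
 have qS: "q1 (rn (r n)) \<in> Sec (- (pi/2))" unfolding q1_def ue(1)[symmetric] up_eq[OF yP(1) t''] by (rule Sh_Sec[OF Up_Sec[OF yP(1) t'']])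
 have "~ Ret (q1 (rn (r n))) s" for s using Ret_imp_Turn[OF SecD(1,2)[OF qS]] Up_not_Turn[OF n] by blast
 then show ?thesis using rn by blast
qed

lemma rr_up: "p \<in> P1 ==> 0 < rr p ==> Up b p t ==> 0 < rr (up b p)"
 using fr_pos_iff[of p t] fr_nonneg[of p t] by (auto simp: up_eq)

lemma continuous_on_up:
 assumes X: "continuous_on S X" and XP: "!!r. r \<in> S ==> X r \<in> P1 & (EX t. Up b (X r) t)"
 shows "continuous_on S (%r. up b (X r))"
 unfolding continuous_on_def
proof
 fix r assume r: "r \<in> S"
 obtain t where t: "Up b (X r) t" using XP[OF r] by blast
 have ev: "\<forall>\<^sub>F x in at r within S. X x \<in> P1" unfolding eventually_at_filter using XP by (intro always_eventually) auto
 show "((%r. up b (X r)) \<longlongrightarrow> up b (X r)) (at r within S)"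
  by (rule Up_stable(2)[OF _ ev _ t]) (use X r XP in \<open>auto simp: continuous_on_def\<close>)
qed

lemma continuous_on_Qm:
 assumes X: "continuous_on S X" and XP: "!!r. r \<in> S ==> X r \<in> Sec (- (pi/2)) & (EX t. Ret (X r) t)"
 shows "continuous_on S (%r. Qm (X r))"
 unfolding continuous_on_def
proof
 fix r assume r: "r \<in> S"
 obtain t where t: "Ret (X r) t" using XP[OF r] by blast
 have ev: "\<forall>\<^sub>F x in at r within S. X x \<in> Sec (- (pi/2))" unfolding eventually_at_filter using XP by (intro always_eventually) auto
 show "((%r. Qm (X r)) \<longlongrightarrow> Qm (X r)) (at r within S)"
  by (rule Ret_stable(2)[OF _ ev _ t]) (use X r XP in \<open>auto simp: continuous_on_def\<close>)
qed

lemma continuous_on_Sh: "continuous_on S X ==> continuous_on S (%r. Sh a (X r))"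
 unfolding continuous_on_def by (auto intro: Sh_tendsto)

lemma v_gain:
 assumes p: "p \<in> P1" "rr p = 0" and U: "Up b p t" shows "vv p < fv p t"
proof -
 have "fw p x ~= 0" if "0 < x" "x < t" for x using U that unfolding Up_def by (metis less_imp_le less_irrefl)
 from fv_strict_mono0[OF p _ this, of 0 t] show ?thesis using U p unfolding Up_def by simp
qed

lemma P0_cont: "continuous_on S (%r. P0 r)"
 unfolding continuous_on_def by (intro ballI Pq_tendsto tendsto_ident_at tendsto_const)

lemma P0_zero: "Good (pi/2) (P0 0)" "EX t. Up (pi/2) (P0 0) t & - vv zA < fv (P0 0) t"
proof -
 have S: "P0 0 \<in> Sec 0" by (rule P0_Sec) (use V0_pos in auto)
 have g: "good 0 ts" by (simp add: good_def)
 obtain t0 where "Up ts (P0 0) t0" using barrier(2)[OF g zB(1) _ zB(3) S] zB(2,3) vs_pos by auto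
 then obtain t where t: "Up (pi/2) (P0 0) t" using Up_pass_right[OF SecD(1)[OF S]] by blast
 have "0 < fv (P0 0) t" using v_gain[OF SecD(1)[OF S] _ t] by simp
 then show "Good (pi/2) (P0 0)" using t up_eq[OF SecD(1)[OF S] t] unfolding Good_def by auto
 have "fv hA tA < fv (P0 0) t"
  by (rule collision_order[OF tA(8) hA_facts(2) SecD(1)[OF S]])
   (use hA_facts(3) v2_pos SecD(2)[OF hA_facts(1)] tA(1) t in \<open>auto simp: Up_def\<close>)
 then show "EX t. Up (pi/2) (P0 0) t & - vv zA < fv (P0 0) t" using t tA(2) by auto
qed

lemma ev_right: "\<forall>\<^sub>F r in at_right (0::real). P r ==> \<exists>d>0. ALL r. 0 < r --> r < d --> P r"
 unfolding eventually_at_right_field by auto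

lemma P0_right: "((%r. P0 r) \<longlongrightarrow> P0 0) (at_right 0)" "\<forall>\<^sub>F r in at_right 0. P0 r \<in> P1"
proof -
 show "((%r. P0 r) \<longlongrightarrow> P0 0) (at_right 0)" by (intro Pq_tendsto tendsto_ident_at tendsto_const)
 show "\<forall>\<^sub>F r in at_right 0. P0 r \<in> P1" using eventually_at_right_real[OF V0_pos]
  by eventually_elim (use SecD(1)[OF P0_Sec] in auto)
qed

text \<open>At r = 0 the orbit passes, and v, increasing from 0, is positive at \<pi>/2. This end of
  the curve is good and the negated hypothesis provides the other.\<close>

lemma direct_hit:
 assumes n: "~ AllUp"
 shows "\<exists>p\<in>Sec 0. 0 < rr p & vv p = 0 & (EX t. Up (pi/2) p t) & vv (up (pi/2) p) = 0"
proof -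
 obtain r1 where r1: "0 < r1" "r1 < V 0" "~ Good (pi/2) (P0 r1)" using n unfolding AllUp_def by blast
 have S0: "P0 0 \<in> P1" using SecD(1)[OF P0_Sec[of 0]] V0_pos by simp
 obtain d where d: "0 < d" "ALL r. 0 < r --> r < d --> Good (pi/2) (P0 r)"
  using ev_right[OF Good_stable[OF P0_right S0 P0_zero(1)]] by blast
 define A where "A = min (d/2) (r1/2)"
 have A: "0 < A" "A < d" "A <= r1" using d(1) r1(1) by (auto simp: A_def)
 have st: "stage 0 (pi/2) ts zA" by (simp add: stage_def)
 have XS: "P0 r \<in> Sec 0 & 0 < rr (P0 r)" if "A <= r" "r <= r1" for r using P0_Sec[of r] that A r1 by simp
 have GA: "Good (pi/2) (P0 A)" using d A by blast
 obtain e where "A < e" "e <= r1" "EX t. Up (pi/2) (P0 e) t" "vv (up (pi/2) (P0 e)) = 0"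
  using shoot[OF st A(3) P0_cont XS GA r1(3)] by blast
 then show ?thesis using XS[of e] by (intro bexI[of _ "P0 e"]) auto
qed

text \<open>For small r the point \<open>q1 r\<close> lies above the barrier, so it returns and its
  image turns again. Let ra be the first r without this return. Just below ra the images follow
  \<gamma> to \<theta> = 0 with v close to v2 > - v3, and there they turn before ts. The required
  hit lies between such an r and one at which the image meets \<theta> = 0 with v = 0.\<close>

lemma indirect_hit:
 assumes A: "AllUp"
 shows "\<exists>p\<in>Sec 0. EX q. 0 < rr p & vv p = 0 & (EX t. Up (pi/2) p t) & q = Sh (- pi) (up (pi/2) p) & (EX t. Ret q t) &
  (EX t. Up 0 (Qm q) t) & (EX t. Up (pi/2) (up 0 (Qm q)) t) & vv (up (pi/2) (up 0 (Qm q))) = 0"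
proof -
 define q2 where "q2 r = Qm (q1 r)" for r
 define x where "x r = up 0 (q2 r)" for r
 have g: "good (- (pi/2)) (- ts)" by (simp add: good_def)
 have P0U: "P0 r \<in> P1 & (EX t. Up (pi/2) (P0 r) t)" if "r \<in> {0..<V 0}" for r
 proof (cases "r = 0")
  case True
  then show ?thesis using P0_zero(2) P0_Sec[of 0] V0_pos SecD(1) by auto
 next
  case False
  then show ?thesis using A P0_Sec[of r] SecD(1) that unfolding AllUp_def Good_def by auto
 qed
 have q1c: "continuous_on {0..<V 0} q1"
  unfolding q1_def by (intro continuous_on_Sh continuous_on_up P0_cont P0U)
 have q1S: "q1 r \<in> Sec (- (pi/2))" if r: "r \<in> {0..<V 0}" for r
 proof -
  obtain t where t: "Up (pi/2) (P0 r) t" using P0U[OF r] by blast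
  have P: "P0 r \<in> P1" using P0U[OF r] by blast
  show ?thesis unfolding q1_def up_eq[OF P t] by (rule Sh_Sec[OF Up_Sec[OF P t]])
 qed
 have q1r: "0 < rr (q1 r)" if r: "0 < r" "r < V 0" for r
 proof -
  have "r \<in> {0..<V 0}" using r by simp
  then obtain t where t: "Up (pi/2) (P0 r) t" and P: "P0 r \<in> P1" using P0U by blast
  show ?thesis using rr_up[OF P _ t] r by (simp add: q1_def)
 qed
 have z0: "0 \<in> {0..<V 0}" using V0_pos by simp
 obtain t0 where t0: "Up (pi/2) (P0 0) t0" "- vv zA < fv (P0 0) t0" using P0_zero(2) by blast
 have P00: "P0 0 \<in> P1" using P0U[OF z0] by blast
 have q10: "rr (q1 0) = 0" "- vv zA < vv (q1 0)"
  unfolding q1_def up_eq[OF P00 t0(1)] using fr_zero[OF P00, of t0] t0(2) by simp_all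
 have TR: "EX t. Ret q t" if "q \<in> Sec (- (pi/2))" "rr q = 0" "- vv zA < vv q" for q
  using barrier(1)[OF g _ _ zA(3) that(1,2)] zA(1,2) that(3) Turn_imp_Ret[OF that(1)] by simp
 obtain tq where tq: "Ret (q1 0) tq" using TR[OF q1S[OF z0] q10] by blast
 note q1P = SecD(1)[OF q1S]
 have q20: "q2 0 \<in> Sec (- (pi/2))" "rr (q2 0) = 0" "- vv zA < vv (q2 0)"
 proof -
  show "q2 0 \<in> Sec (- (pi/2))" unfolding q2_def by (rule Qm_Sec[OF q1P[OF z0] tq])
  show "rr (q2 0) = 0" unfolding q2_def Qm_eq[OF tq] using fr_zero[OF q1P[OF z0] q10(1)] by simp
  have "vv (q1 0) <= fv (q1 0) tq" using fv_mono0[OF q1P[OF z0] q10(1), of 0 tq] tq q1P[OF z0] unfolding Ret_def by simp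
  then show "- vv zA < vv (q2 0)" unfolding q2_def Qm_eq[OF tq] using q10(2) by simp
 qed
 have T20: "Turn (- ts) (q2 0)" using barrier(1)[OF g _ _ zA(3) q20(1,2)] zA(1,2) q20(3) by simp
 have q1l: "(q1 \<longlongrightarrow> q1 0) (at_right 0)"
 proof -
  have "(q1 \<longlongrightarrow> q1 0) (at 0 within {0..<V 0})" using q1c z0 unfolding continuous_on_def by blast
  then have "(q1 \<longlongrightarrow> q1 0) (at 0 within {0..V 0 / 2})" by (rule tendsto_within_subset) (use V0_pos in auto)
  then show ?thesis using V0_pos at_within_Icc_at_right[of 0 "V 0 / 2"] by simp
 qed
 have rg: "\<forall>\<^sub>F r in at_right 0. 0 < r & r < V 0" using eventually_at_right_real[OF V0_pos] by eventually_elim simp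
 have evS: "\<forall>\<^sub>F r in at_right 0. q1 r \<in> Sec (- (pi/2))" using rg by eventually_elim (use q1S in auto)
 note R0 = Ret_stable[OF q1l evS q1S[OF z0] tq]
 have ev2: "\<forall>\<^sub>F r in at_right 0. q2 r \<in> P1"
  using R0(1) evS
 proof eventually_elim
  case (elim r)
  show ?case unfolding q2_def by (rule SecD(1)[OF Qm_Sec[OF SecD(1)[OF elim(2)] elim(1)]])
 qed
 have "\<forall>\<^sub>F r in at_right 0. Turn (- ts) (q2 r)"
  by (rule Turn_stable[OF _ ev2 SecD(1)[OF q20(1)] T20]) (use R0(2) in \<open>simp add: q2_def\<close>)
 then have "\<forall>\<^sub>F r in at_right 0. Turn (- ts) (q2 r) & Ret (q1 r) (retT (q1 r)) & r < V 0"
  using R0(1) rg by eventually_elim simp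
 from ev_right[OF this] obtain d where d: "0 < d" "!!r. 0 < r ==> r < d ==> Turn (- ts) (q2 r) & Ret (q1 r) (retT (q1 r)) & r < V 0" by blast
 define S where "S = {r. 0 < r & r < V 0 & ~ (EX t. Ret (q1 r) t)}"
 obtain s0 where s0: "s0 \<in> S" using q1_pass[OF A] unfolding S_def by blast
 have Sb: "bdd_below S" by (rule bdd_belowI[of _ 0]) (auto simp: S_def)
 define ra where "ra = Inf S"
 have "d <= ra" unfolding ra_def
 proof (rule cInf_greatest)
  show "d <= r" if "r \<in> S" for r
   using that d(2)[of r] unfolding S_def by (cases "r < d") auto
 qed (use s0 in blast)
 then have ra0: "0 < ra" using d(1) by simp
 have "ra <= s0" unfolding ra_def by (rule cInf_lower[OF s0 Sb])
 then have raV: "ra < V 0" using s0 unfolding S_def by simp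
 have Rt: "EX t. Ret (q1 r) t" if r: "0 < r" "r < ra" for r
 proof (rule ccontr)
  assume "~ (EX t. Ret (q1 r) t)"
  then have "r \<in> S" using r raV unfolding S_def by simp
  then have "ra <= r" unfolding ra_def by (rule cInf_lower[OF _ Sb])
  then show False using r by simp
 qed
 have raI: "ra \<in> {0..<V 0}" using ra0 raV by simp
 have q1lim: "(q1 \<longlongrightarrow> q1 ra) (at ra)"
 proof -
  have "continuous_on {0<..<V 0} q1" using q1c by (rule continuous_on_subset) auto
  then have "isCont q1 ra" using ra0 raV continuous_on_eq_continuous_at[of "{0<..<V 0}" q1] by auto
  then show ?thesis unfolding isCont_def .
 qed
 have raS: "~ (EX t. Ret (q1 ra) t)"
 proof
  assume "EX t. Ret (q1 ra) t"
  then obtain t where t: "Ret (q1 ra) t" by blast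
  have l: "(q1 \<longlongrightarrow> q1 ra) (at_right ra)" using q1lim by (rule filterlim_at_split[THEN iffD1, THEN conjunct2])
  have "\<forall>\<^sub>F r in at_right ra. q1 r \<in> Sec (- (pi/2))" using eventually_at_right_real[OF raV] by eventually_elim (use q1S ra0 in auto)
  from Ret_stable(1)[OF l this q1S[OF raI] t] obtain b where b: "ra < b" "!!y. ra < y ==> y < b ==> Ret (q1 y) (retT (q1 y))"
   unfolding eventually_at_right_field by blast
  obtain r where r: "r \<in> S" "r < b" using cInf_lessD[of S b] s0 b(1) unfolding ra_def by auto
  then have "ra <= r" unfolding ra_def by (intro cInf_lower[OF _ Sb])
  then show False using r b(2)[of r] t unfolding S_def by (cases "r = ra") auto
 qed
 define rn where "rn n = ra - ra / real (Suc (Suc n))" for n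
 have rn: "0 < rn n" "rn n < ra" for n
 proof -
  have "ra / real (Suc (Suc n)) < ra / 1" by (rule divide_strict_left_mono) (use ra0 in auto)
  then show "0 < rn n" by (simp add: rn_def)
  show "rn n < ra" using ra0 by (simp add: rn_def)
 qed
 have "rn \<longlonglongrightarrow> ra - 0" unfolding rn_def
  by (intro tendsto_diff tendsto_const) (rule filterlim_compose[OF lim_const_over_n[of ra]], intro filterlim_compose[OF filterlim_Suc] filterlim_Suc)
 then have lrn: "rn \<longlonglongrightarrow> ra" by simp
 have ql: "(%n. q1 (rn n)) \<longlonglongrightarrow> q1 ra"
  by (rule isCont_tendsto_compose[OF _ lrn]) (use q1lim in \<open>simp add: isCont_def\<close>)
 have rnI: "rn n \<in> {0..<V 0}" for n using rn[of n] raV by simp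
 have "EX tn. ALL n. Ret (q1 (rn n)) (tn n)" by (intro choice allI Rt rn)
 then obtain tn where tn: "!!n. Ret (q1 (rn n)) (tn n)" by blast
 have "~ Up 0 (q1 ra) t" for t
 proof
  assume U: "Up 0 (q1 ra) t"
  have "\<forall>\<^sub>F n in sequentially. q1 (rn n) \<in> P1" using q1P[OF rnI] by simp
  from eventually_happens[OF Up_stable(1)[OF ql this q1P[OF raI] U]] obtain n where "Up 0 (q1 (rn n)) (upT 0 (q1 (rn n)))" by auto
  then show False using Up0_not(1)[OF q1S[OF rnI]] tn by blast
 qed
 then have C: "Conv (- ts) (q1 ra)" using sec_left[OF q1S[OF raI] q1r[OF ra0 raV]] raS by blast
 have q2A: "(%n. q2 (rn n)) \<longlonglongrightarrow> Sh (- pi) zA" unfolding q2_def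
  by (rule shadow_Ret[OF q1S[OF raI] q1r[OF ra0 raV] C ql q1S[OF rnI] tn zA(1,2)])
 have q2S: "q2 r \<in> Sec (- (pi/2)) & 0 < rr (q2 r)" if r: "0 < r" "r < ra" for r
 proof -
  have rI: "r \<in> {0..<V 0}" using r raV by simp
  obtain t where t: "Ret (q1 r) t" using Rt[OF r] by blast
  show ?thesis using Qm_Sec[OF q1P[OF rI] t] rr_Qm[OF q1P[OF rI] t] q1r[of r] r raV by (simp add: q2_def)
 qed
 have evP: "\<forall>\<^sub>F n in sequentially. q2 (rn n) \<in> P1" using q2S[OF rn] SecD(1) by (intro always_eventually) blast
 obtain tA' where tA': "Up 0 (Sh (- pi) zA) tA'" using EA(1) by blast
 note xl = Up_stable[OF q2A evP A_facts(3) tA']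
 have uA: "up 0 (Sh (- pi) zA) \<in> Sec 0" "rr (up 0 (Sh (- pi) zA)) = 0"
  unfolding up_eq[OF A_facts(3) tA'] using Up_Sec[OF A_facts(3) tA'] fr_zero[OF A_facts(3)] zA_facts(2) by simp_all
 have gB: "good 0 ts" by (simp add: good_def)
 \<comment> \<open>Here v2 > - v3 is used: the point of \<gamma> on \<theta> = 0 lies above the
   barrier given by \<open>zB\<close>.\<close>
 have TA: "Turn ts (up 0 (Sh (- pi) zA))"
  using barrier(1)[OF gB zB(1) _ zB(3) uA] zB(2) v2_v3[OF A] by (simp add: v2_def)
 have evx: "\<forall>\<^sub>F n in sequentially. x (rn n) \<in> P1"
  using xl(1) evP by eventually_elim (use Up_Sec SecD(1) up_eq in \<open>metis x_def\<close>)
 have "\<forall>\<^sub>F n in sequentially. Turn ts (x (rn n))"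
  by (rule Turn_stable[OF _ evx SecD(1)[OF uA(1)] TA]) (use xl(2) in \<open>simp add: x_def\<close>)
 then have "\<forall>\<^sub>F n in sequentially. Turn ts (x (rn n)) & Good 0 (q2 (rn n)) & d/2 < rn n"
  using Good_stable[OF q2A evP A_facts(3,2)] order_tendstoD(1)[OF lrn, of "d/2"] \<open>d <= ra\<close> d(1) by (simp add: eventually_conj_iff)
 from eventually_happens[OF this] obtain n where n: "Turn ts (x (rn n))" "Good 0 (q2 (rn n))" "d/2 < rn n" by auto
 have st: "stage (- (pi/2)) 0 (- ts) zB" and st': "stage 0 (pi/2) ts zA" by (simp_all add: stage_def)
 have sub: "0 < r & r < ra" if "d/2 <= r" "r <= rn n" for r using that d(1) rn(2)[of n] by auto
 have q2c: "continuous_on {d/2..rn n} q2" unfolding q2_def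
 proof (rule continuous_on_Qm)
  show "continuous_on {d/2..rn n} q1" by (rule continuous_on_subset[OF q1c]) (use sub raV in force)
  show "q1 r \<in> Sec (- (pi/2)) & (EX t. Ret (q1 r) t)" if "r \<in> {d/2..rn n}" for r
   using q1S[of r] Rt[of r] sub[of r] that raV by simp
 qed
 have q2S': "q2 r \<in> Sec (- (pi/2)) & 0 < rr (q2 r)" if "d/2 <= r" "r <= rn n" for r using q2S sub[OF that] by blast
 have nG: "~ Good 0 (q2 (d/2))"
 proof
  assume "Good 0 (q2 (d/2))"
  then obtain t where "Up 0 (q2 (d/2)) t" unfolding Good_def by blast
  from stageD(8)[OF st _ this] show False using q2S'[of "d/2"] d(2)[of "d/2"] d(1) n(3) by simp
 qed
 obtain rd where rd: "d/2 <= rd" "rd < rn n" "EX t. Up 0 (q2 rd) t" "vv (up 0 (q2 rd)) = 0" "!!r. rd < r ==> r <= rn n ==> Good 0 (q2 r)"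
  using shoot_rev[OF st less_imp_le[OF n(3)] q2c q2S' n(2) nG] by blast
 have U2: "q2 r \<in> P1 & (EX t. Up 0 (q2 r) t)" if r: "r \<in> {rd..rn n}" for r
 proof
  show "q2 r \<in> P1" by (rule SecD(1)[of _ "- (pi/2)"]) (use q2S'[of r] r rd(1) in simp)
  show "EX t. Up 0 (q2 r) t" using rd(3) rd(5)[of r] r unfolding Good_def by (cases "r = rd") simp_all
 qed
 have xc: "continuous_on {rd..rn n} x" unfolding x_def
  by (rule continuous_on_up[OF continuous_on_subset[OF q2c] U2]) (use rd in auto)
 have xS: "x r \<in> Sec 0 & 0 < rr (x r)" if r: "rd <= r" "r <= rn n" for r
 proof -
  obtain t where t: "Up 0 (q2 r) t" using U2[of r] r by auto
  have P: "q2 r \<in> P1" using U2[of r] r by auto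
  show ?thesis using Up_Sec[OF P t] rr_up[OF P _ t] q2S'[of r] r rd(1) up_eq[OF P t] by (simp add: x_def)
 qed
 \<comment> \<open>At rd the second passage of \<theta> = 0 has v = 0, so it is itself a point
   \<open>P0\<close> and good by assumption.\<close>
 have Gd: "Good (pi/2) (x rd)"
 proof -
  have s: "x rd \<in> Sec 0" "0 < rr (x rd)" "vv (x rd) = 0" using xS[of rd] rd by (auto simp: x_def)
  then have "x rd = P0 (rr (x rd))" "rr (x rd) < V 0" using Sec0_eq[OF s(1)] by auto
  then show ?thesis using A s(2) unfolding AllUp_def by metis
 qed
 have nGx: "~ Good (pi/2) (x (rn n))"
  using stageD(8)[OF st' xS[of "rn n", THEN conjunct1]] n(1) rd(2) unfolding Good_def by auto
 obtain e where e: "rd < e" "e <= rn n" "EX t. Up (pi/2) (x e) t" "vv (up (pi/2) (x e)) = 0"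
  using shoot[OF st' less_imp_le[OF rd(2)] xc xS Gd nGx] by blast
 have eI: "0 < e" "e < ra" using sub[of e] e rd(1) by auto
 then have "P0 e \<in> Sec 0" "P0 e \<in> P1 & (EX t. Up (pi/2) (P0 e) t)" using P0_Sec[of e] P0U[of e] raV by auto
 then show ?thesis using eI Rt[OF eI] U2[of e] e
  by (intro bexI[of _ "P0 e"] exI[of _ "q1 e"]) (auto simp: q1_def x_def q2_def)
qed

end

subsection \<open>Counting crossings\<close>

lemma crosses_at_reflect:
 assumes "!!t. g t = 2 * a - f (t + k)" "crosses_at f a (s + k)"
 shows "crosses_at g a s"
proof -
 from assms(2) obtain e where fs: "f (s + k) = a" and e: "0 < e" and
  d: "((ALL t. s + k - e < t & t < s + k --> f t < a) & (ALL t. s + k < t & t < s + k + e --> f t > a)) |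
    ((ALL t. s + k - e < t & t < s + k --> f t > a) & (ALL t. s + k < t & t < s + k + e --> f t < a))"
  unfolding crosses_at_def by blast
 show ?thesis unfolding crosses_at_def
 proof (intro conjI exI[of _ e] e)
  show "g s = a" using assms(1)[of s] fs by simp
  show "((ALL t. s - e < t & t < s --> g t < a) & (ALL t. s < t & t < s + e --> g t > a)) |
    ((ALL t. s - e < t & t < s --> g t > a) & (ALL t. s < t & t < s + e --> g t < a))"
   using d
  proof
   assume L: "(ALL t. s + k - e < t & t < s + k --> f t < a) & (ALL t. s + k < t & t < s + k + e --> f t > a)"
   have "g t > a" if "s - e < t" "t < s" for t using L[THEN conjunct1, rule_format, of "t + k"] that assms(1)[of t] by simp
   moreover have "g t < a" if "s < t" "t < s + e" for t using L[THEN conjunct2, rule_format, of "t + k"] that assms(1)[of t] by simp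
   ultimately show ?thesis by blast
  next
   assume L: "(ALL t. s + k - e < t & t < s + k --> f t > a) & (ALL t. s + k < t & t < s + k + e --> f t < a)"
   have "g t < a" if "s - e < t" "t < s" for t using L[THEN conjunct1, rule_format, of "t + k"] that assms(1)[of t] by simp
   moreover have "g t > a" if "s < t" "t < s + e" for t using L[THEN conjunct2, rule_format, of "t + k"] that assms(1)[of t] by simp
   ultimately show ?thesis by blast
  qed
 qed
qed

lemma no_crossings: "(!!s. 0 < s ==> s < t ==> f s ~= a) ==> crossing_times f a {0<..<t} = {}"
 unfolding crossing_times_def crosses_at_def by auto

context branches begin

text \<open>Each application of \<open>Qm\<close> contributes exactly one crossing, at the return
  time; what follows is the reflection of the orbit of the image in \<theta> = - \<pi>/2, which
  preserves crossings of that line.\<close>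

lemma count_returns:
 assumes "p \<in> Sec (- (pi/2))" "DQ k p" "Up 0 ((Qm ^^ k) p) t"
 shows "\<exists>s>0. flow p s = (Sr ^^ k) (up 0 ((Qm ^^ k) p)) & finite (crossing_times (%s. ft p s) (- (pi/2)) {0<..<s}) &
   card (crossing_times (%s. ft p s) (- (pi/2)) {0<..<s}) = k"
 using assms
proof (induction k arbitrary: p)
 case 0
 then have U: "Up 0 p t" and P: "p \<in> P1" "th p = - (pi/2)" using SecD by auto
 have "ft p s ~= - (pi/2)" if "0 < s" "s < t" for s using Up_mono[OF P(1) U, of 0 s] that P by simp
 then have "crossing_times (%s. ft p s) (- (pi/2)) {0<..<t} = {}" by (rule no_crossings)
 then show ?case using U up_eq[OF P(1) U] unfolding Up_def by (intro exI[of _ t]) simp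
next
 case (Suc k)
 have P: "p \<in> P1" "th p = - (pi/2)" using SecD Suc.prems(1) by auto
 obtain t1 where t1: "Ret p t1" using Suc.prems(2)[unfolded DQ_def, rule_format, of 0] by auto
 define p' where "p' = Qm p"
 have p'S: "p' \<in> Sec (- (pi/2))" unfolding p'_def by (rule Qm_Sec[OF P(1) t1])
 have D': "DQ k p'" unfolding DQ_def
 proof (intro allI impI)
  fix j assume "j < k"
  then show "EX t. Ret ((Qm ^^ j) p') t" using Suc.prems(2)[unfolded DQ_def, rule_format, of "Suc j"] by (simp add: p'_def funpow_swap1)
 qed
 have Qe: "(Qm ^^ Suc k) p = (Qm ^^ k) p'" by (simp add: p'_def funpow_swap1)
 obtain s where s: "0 < s" "flow p' s = (Sr ^^ k) (up 0 ((Qm ^^ k) p'))" "finite (crossing_times (%s. ft p' s) (- (pi/2)) {0<..<s})"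
  "card (crossing_times (%s. ft p' s) (- (pi/2)) {0<..<s}) = k"
  using Suc.IH[OF p'S D'] Suc.prems(3) unfolding Qe by blast
 have p'P: "p' \<in> P1" "th p' = - (pi/2)" "0 < ww p'" using SecD[OF p'S] by auto
 have f: "flow p (t1 + x) = Sr (flow p' x)" for x
 proof -
  have "flow p t1 = Sr p'" unfolding p'_def Qm_eq[OF t1] by simp
  then show ?thesis using flow_flow[OF P(1), of t1 x] flow_Sr[OF p'P(1), of x] by simp
 qed
 have r1: "ft p' x = 2 * (- (pi/2)) - ft p (x + t1)" for x using f[of x] by (simp add: add.commute)
 have r2: "ft p x = 2 * (- (pi/2)) - ft p' (x + (- t1))" for x using f[of "x - t1"] by simp
 have t10: "0 < t1" "ft p t1 = - (pi/2)" "!!x. 0 < x ==> x < t1 ==> - (pi/2) < ft p x" using t1 unfolding Ret_def by blast+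
 have iff: "crosses_at (%s. ft p s) (- (pi/2)) (x + t1) \<longleftrightarrow> crosses_at (%s. ft p' s) (- (pi/2)) x" for x
  using crosses_at_reflect[of "%s. ft p' s" "- (pi/2)" "%s. ft p s" t1 x, OF r1]
   crosses_at_reflect[of "%s. ft p s" "- (pi/2)" "%s. ft p' s" "- t1" "x + t1", OF r2] by auto
 have c1: "crosses_at (%s. ft p s) (- (pi/2)) t1"
 proof -
  have "\<forall>\<^sub>F x in at_right 0. 0 < fw p' x"
  proof (rule order_tendstoD(1)[OF _ p'P(3)])
   show "((%x. fw p' x) \<longlongrightarrow> ww p') (at_right 0)"
    using DERIV_isCont[OF fw_deriv[OF p'P(1)], of 0] p'P(1) unfolding isCont_def by (simp add: filterlim_at_split)
  qed
  then obtain e where e: "0 < e" "!!x. 0 < x ==> x < e ==> 0 < fw p' x" unfolding eventually_at_right_field by auto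
  have inc: "- (pi/2) < ft p' x" if "0 < x" "x < e" for x
   using ft_strict_mono[OF p'P(1), of 0 x] e(2) that p'P by auto
  define d where "d = min e t1"
  have d: "0 < d" "d <= e" "d <= t1" using e(1) t10(1) by (auto simp: d_def)
  have "ft p x < - (pi/2)" if "t1 < x" "x < t1 + d" for x using inc[of "x - t1"] r2[of x] that d by simp
  moreover have "- (pi/2) < ft p x" if "t1 - d < x" "x < t1" for x using t10(3)[of x] that d by simp
  ultimately show ?thesis unfolding crosses_at_def using t10(2) d(1) by blast
 qed
 have set: "crossing_times (%s. ft p s) (- (pi/2)) {0<..<t1 + s} = insert t1 ((%x. x + t1) ` crossing_times (%s. ft p' s) (- (pi/2)) {0<..<s})"
  (is "?A = insert t1 (_ ` ?B)")
 proof (rule set_eqI)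
  fix x
  consider "x <= 0" | "0 < x" "x < t1" | "x = t1" | "t1 < x" by linarith
  then show "x \<in> ?A \<longleftrightarrow> x \<in> insert t1 ((%x. x + t1) ` ?B)"
  proof cases
   case 2
   then have "~ crosses_at (%s. ft p s) (- (pi/2)) x" using t10(3)[OF 2] unfolding crosses_at_def by auto
   then show ?thesis using 2 by (auto simp: crossing_times_def)
  next
   case 4
   have "x \<in> ?A \<longleftrightarrow> x - t1 \<in> ?B" using iff[of "x - t1"] 4 t10(1) by (auto simp: crossing_times_def)
   also have "\<dots> \<longleftrightarrow> x \<in> (%x. x + t1) ` ?B" by (auto intro: image_eqI[of _ _ "x - t1"])
   finally show ?thesis using 4 by auto
  qed (use t10(1) s(1) c1 in \<open>auto simp: crossing_times_def\<close>)
 qed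
 have "t1 \<notin> (%x. x + t1) ` crossing_times (%s. ft p' s) (- (pi/2)) {0<..<s}" by (auto simp: crossing_times_def)
 then have "card (crossing_times (%s. ft p s) (- (pi/2)) {0<..<t1 + s}) = Suc k"
  unfolding set using s(3,4) by (simp add: card_image inj_on_def)
 moreover have "finite (crossing_times (%s. ft p s) (- (pi/2)) {0<..<t1 + s})" unfolding set using s(3) by simp
 moreover have "flow p (t1 + s) = (Sr ^^ Suc k) (up 0 ((Qm ^^ Suc k) p))" unfolding Qe using f[of s] s(2) by simp
 ultimately show ?case using t10(1) s(1) by (intro exI[of _ "t1 + s"]) simp
qed

text \<open>The orbit is symmetric about both perpendicular hits, and the composition of the two symmetries is a shift.\<close>

lemma periodic_from_hits:
 assumes p: "p \<in> P1" "0 < rr p" "th p = - (pi/2)" "vv p = 0" and s: "0 < s" "vv (flow p s) = 0" "ft p s = e" and e: "e = 0 | e = - pi"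
 shows "periodic_orbit c W (flow p) (4 * s)"
proof -
 define R2 where "R2 x = (if e = 0 then Mi x else Sh (- pi) (Sh (- pi) (Mi x)))" for x
 have R2: "rr (R2 x) = rr x" "vv (R2 x) = vv x" "th (R2 x) = 2 * e - th x" "ww (R2 x) = - ww x" for x
  using e by (auto simp: R2_def)
 have fR2: "flow (R2 x) t = R2 (flow x t)" if "x \<in> P1" for x t
  using that by (simp add: R2_def flow_Mi flow_Sh)
 have R2P: "R2 x \<in> P1" if "x \<in> P1" for x using that by (simp add: R2_def)
 have "Rv (Sr p) = p" by (rule state_eqI) (use p in auto)
 then have a: "flow p t = Rv (Sr (flow p (- t)))" for t
  using flow_Rv[of "Sr p" t] flow_Sr[OF p(1), of "- t"] p(1) by simp
 have "Rv (R2 (flow p s)) = flow p s" by (rule state_eqI) (use s in \<open>auto simp: R2\<close>)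
 then have b: "flow p (s + t) = Rv (R2 (flow p (s - t)))" for t
  using flow_Rv[of "R2 (flow p s)" t] fR2[of "flow p s" "- t"] R2P[of "flow p s"] p(1) flow_flow[OF p(1), of s t] flow_flow[OF p(1), of s "- t"] by simp
 \<comment> \<open>2 e + \<pi> is \<pi> or - \<pi>. As \<theta> is identified modulo 2 \<pi>, the
   period is four times s.\<close>
 have per: "flow p (t + 2 * s) = Sh (2 * e + pi) (flow p t)" for t
 proof -
  have "flow p (t + 2 * s) = Rv (R2 (flow p (- t)))" using b[of "s + t"] by (simp add: algebra_simps)
  also have "\<dots> = Sh (2 * e + pi) (flow p t)" unfolding a[of t] by (rule state_eqI) (auto simp: R2)
  finally show ?thesis .
 qed
 have per4: "flow p (t + 4 * s) = Sh (2 * e + pi) (Sh (2 * e + pi) (flow p t))" for t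
  using per[of "t + 2 * s"] per[of t] by (simp add: algebra_simps)
 show ?thesis unfolding periodic_orbit_def
 proof (intro conjI allI)
  show "0 < 4 * s" using s by simp
  show "is_solution_on c W (flow p) UNIV" unfolding is_solution_on_def using flow_sol[OF p(1)] by blast
  show "flow p t \<in> P1" for t using p by simp
  show "0 < fr p t" for t using fr_pos_iff[OF p(1), of t] fr_nonneg[OF p(1), of t] p(2) by linarith
  show "\<exists>m::int. ALL t. fr p (t + 4 * s) = fr p t & fv p (t + 4 * s) = fv p t & fw p (t + 4 * s) = fw p t & ft p (t + 4 * s) = ft p t + 2 * pi * m"
   by (rule exI[of _ "if e = 0 then 1 else - 1"]) (use e in \<open>auto simp: per4\<close>)
 qed
qed

section \<open>Existence for every number of crossings\<close>

definition Sol :: "nat => bool" where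
 "Sol k \<longleftrightarrow> (\<exists>p\<in>P1. \<exists>s>0. 0 < rr p & th p = - (pi/2) & vv p = 0 & fv p s = 0 & ft p s = (if even k then 0 else - pi) &
   finite (crossing_times (%s. ft p s) (- (pi/2)) {0<..<s}) & card (crossing_times (%s. ft p s) (- (pi/2)) {0<..<s}) = k)"

lemma Sol_pos: assumes k: "0 < k" shows "Sol k"
proof -
 obtain p t where p: "p \<in> Sec (- (pi/2))" "0 < rr p" "vv p = 0" "DQ k p" "Up 0 ((Qm ^^ k) p) t" "vv (up 0 ((Qm ^^ k) p)) = 0"
  using periodic_hit_pos[OF k] by blast
 obtain s where s: "0 < s" "flow p s = (Sr ^^ k) (up 0 ((Qm ^^ k) p))" "finite (crossing_times (%s. ft p s) (- (pi/2)) {0<..<s})"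
   "card (crossing_times (%s. ft p s) (- (pi/2)) {0<..<s}) = k" using count_returns[OF p(1,4,5)] by blast
 have q: "(Qm ^^ k) p \<in> P1" using DQ_in[OF p(1,2,4) order_refl] SecD(1) by blast
 have th0: "th (up 0 ((Qm ^^ k) p)) = 0" using p(5) up_eq[OF q p(5)] unfolding Up_def by simp
 have "vv ((Sr ^^ j) x) = vv x & th ((Sr ^^ j) x) = (if even j then th x else - th x - pi)" for j x by (induction j) auto
 then have "fv p s = 0" "ft p s = (if even k then 0 else - pi)" using s(2) th0 p(6) by auto
 then show ?thesis unfolding Sol_def using p s SecD[OF p(1)] by blast
qed

lemma Sol_zero_intro:
 assumes "p \<in> P1" "0 < rr p" "th p = - (pi/2)" "vv p = 0" "0 < s" "fv p s = 0" "ft p s = 0" "!!x. 0 < x ==> x < s ==> - (pi/2) < ft p x"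
 shows "Sol 0"
proof -
 have "crossing_times (%s. ft p s) (- (pi/2)) {0<..<s} = {}" by (rule no_crossings) (use assms(8) in force)
 then show ?thesis unfolding Sol_def using assms(1-7) by (intro bexI[of _ p] exI[of _ s]) auto
qed

lemma Sol_zero: "Sol 0"
proof (cases AllUp)
 case False
 obtain p t where p: "p \<in> Sec 0" "0 < rr p" "vv p = 0" "Up (pi/2) p t" "vv (up (pi/2) p) = 0" using direct_hit[OF False] by blast
 note S = SecD[OF p(1)]
 have f: "flow (Mi (Rv (flow p t))) s = Mi (Rv (flow p (t - s)))" for s
  using flow_MiRv[OF flow_in[OF S(1)], of t s] flow_flow[OF S(1), of t "- s"] by simp
 show ?thesis
 proof (rule Sol_zero_intro)
  show "Mi (Rv (flow p t)) \<in> P1" using S(1) by simp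
  show "0 < rr (Mi (Rv (flow p t)))" using rr_up[OF S(1) p(2,4)] up_eq[OF S(1) p(4)] by simp
  show "th (Mi (Rv (flow p t))) = - (pi/2)" "0 < t" using p(4) unfolding Up_def by auto
  show "vv (Mi (Rv (flow p t))) = 0" using p(5) up_eq[OF S(1) p(4)] by simp
  show "fv (Mi (Rv (flow p t))) t = 0" "ft (Mi (Rv (flow p t))) t = 0" unfolding f using p(3) S by simp_all
  show "- (pi/2) < ft (Mi (Rv (flow p t))) x" if "0 < x" "x < t" for x
   unfolding f using Up_mono[OF S(1) p(4), of "t - x" t] that p(4) unfolding Up_def by simp
 qed
next
 case True
 obtain p t1 q t2 t3 t4 where p: "p \<in> Sec 0" "0 < rr p" "vv p = 0" "Up (pi/2) p t1" and q: "q = Sh (- pi) (up (pi/2) p)" "Ret q t2"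
  "Up 0 (Qm q) t3" "Up (pi/2) (up 0 (Qm q)) t4" "vv (up (pi/2) (up 0 (Qm q))) = 0" using indirect_hit[OF True] by blast
 note S = SecD[OF p(1)]
 have up1: "flow p t1 = Sh pi q" unfolding q(1) up_eq[OF S(1) p(4)] by (rule state_eqI) auto
 have qP: "q \<in> P1" unfolding q(1) up_eq[OF S(1) p(4)] using S(1) by simp
 define q' where "q' = Qm q"
 have q'P: "q' \<in> P1" unfolding q'_def Qm_eq[OF q(2)] using qP by simp
 have q2: "flow q t2 = Sr q'" unfolding q'_def Qm_eq[OF q(2)] by simp
 have f1: "flow p (t1 + s) = Sh pi (flow q s)" for s using flow_flow[OF S(1), of t1 s] flow_Sh(1)[OF qP, of s] up1 by simp
 \<comment> \<open>The translation by \<pi> and the reflection in - \<pi>/2 compose to the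
   reflection in 0.\<close>
 have f2: "flow p (t1 + t2 + s) = Mi (flow q' s)" for s
 proof -
  have "flow q (t2 + s) = Sr (flow q' s)" using flow_flow[OF qP, of t2 s] flow_Sr[OF q'P, of s] q2 by simp
  then have "flow p (t1 + t2 + s) = Sh pi (Sr (flow q' s))" using f1[of "t2 + s"] by (simp add: add.assoc)
  also have "\<dots> = Mi (flow q' s)" by (rule state_eqI) auto
  finally show ?thesis .
 qed
 have U3: "Up 0 q' t3" using q(3) unfolding q'_def .
 have U4: "Up (pi/2) (flow q' t3) t4" using q(4) up_eq[OF q'P U3] unfolding q'_def by simp
 have U34: "Up (pi/2) q' (t3 + t4)" by (rule Up_trans[OF q'P U3 U4])
 define t34 where "t34 = t3 + t4"
 note U = U34[folded t34_def]
 have v0: "fv q' t34 = 0"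
  using q(5) up_eq[OF q'P U3] up_eq[OF flow_in[OF q'P] U4] flow_flow[OF q'P, of t3 t4] unfolding q'_def t34_def by simp
 define \<tau> where "\<tau> = t1 + t2 + t34"
 have pos: "0 < t1" "0 < t2" "0 < t34" using p(4) q(2) U unfolding Up_def Ret_def by blast+
 have f: "flow (Rv (flow p \<tau>)) s = Rv (flow p (\<tau> - s))" for s
  using flow_Rv[OF flow_in[OF S(1)], of \<tau> s] flow_flow[OF S(1), of \<tau> "- s"] by simp
 have e: "flow p \<tau> = Mi (flow q' t34)" unfolding \<tau>_def by (rule f2)
 show ?thesis
 proof (rule Sol_zero_intro)
  show "Rv (flow p \<tau>) \<in> P1" "0 < \<tau>" using S(1) pos by (auto simp: \<tau>_def)
  show "0 < rr (Rv (flow p \<tau>))" using fr_pos_iff[OF S(1), of \<tau>] fr_nonneg[OF S(1), of \<tau>] p(2) by simp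
  show "th (Rv (flow p \<tau>)) = - (pi/2)" "vv (Rv (flow p \<tau>)) = 0" unfolding e using U v0 unfolding Up_def by auto
  show "fv (Rv (flow p \<tau>)) \<tau> = 0" "ft (Rv (flow p \<tau>)) \<tau> = 0" unfolding f using p(3) S by simp_all
  \<comment> \<open>The excursion crosses \<theta> = \<pi>/2, but - \<pi>/2 is met only at its end;
    hence no crossing of that line is counted.\<close>
  have main: "- (pi/2) < ft p x" if x: "0 <= x" "x < \<tau>" for x
  proof -
   consider "x <= t1" | "t1 < x" "x <= t1 + t2" | "t1 + t2 < x" by linarith
   then show ?thesis
   proof cases
    case 1
    then have "0 <= ft p x" using Up_mono[OF S(1) p(4), of 0 x] x S by (cases "x = 0") auto
    then show ?thesis using pi_gt_zero by linarith
   next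
    case 2
    have "- (pi/2) <= ft q (x - t1)" using q(2) 2 unfolding Ret_def by (cases "x - t1 = t2") (auto intro: less_imp_le)
    moreover have "ft p x = ft q (x - t1) + pi" using f1[of "x - t1"] by simp
    ultimately show ?thesis using pi_gt_zero by linarith
   next
    case 3
    define y where "y = x - (t1 + t2)"
    have y: "0 <= y" "y < t34" using 3 x by (auto simp: y_def \<tau>_def)
    have "ft q' y < pi/2" using Up_mono[OF q'P U y order_refl] U unfolding Up_def by simp
    then show ?thesis using f2[of y] by (simp add: y_def)
   qed
  qed
  show "- (pi/2) < ft (Rv (flow p \<tau>)) x" if "0 < x" "x < \<tau>" for x unfolding f using main[of "\<tau> - x"] that by simp
 qed
qed

lemma periodic_orbits:
 "EX x T. periodic_orbit c W x T & th (x 0) = - (pi / 2) & vv (x 0) = 0 &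
   finite (crossing_times (%s. th (x s)) (- (pi / 2)) {0<..<T / 4}) &
   card (crossing_times (%s. th (x s)) (- (pi / 2)) {0<..<T / 4}) = k &
   vv (x (T / 4)) = 0 & th (x (T / 4)) = (if even k then 0 else - pi)"
proof -
 have "Sol k" using Sol_zero Sol_pos by (cases k) auto
 then obtain p s where p: "p \<in> P1" "0 < s" "0 < rr p" "th p = - (pi/2)" "vv p = 0" "fv p s = 0" "ft p s = (if even k then 0 else - pi)"
   "finite (crossing_times (%s. ft p s) (- (pi/2)) {0<..<s})" "card (crossing_times (%s. ft p s) (- (pi/2)) {0<..<s}) = k"
  unfolding Sol_def by blast
 have "periodic_orbit c W (flow p) (4 * s)" by (rule periodic_from_hits[OF p(1,3,4,5,2,6,7)]) simp
 then show ?thesis using p by (intro exI[of _ "flow p"] exI[of _ "4 * s"]) auto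
qed

end

subsection \<open>The branches of the unstable manifolds\<close>

context shape begin

text \<open>Identifies the given parametrization with the flow, which continues it beyond b; the
  initial sign condition becomes w >= 0 at arbitrarily early times.\<close>

lemma unstable_branch_flow:
 assumes u: "unstable_branch c W (0, - sqrt (2 * V ts), \<theta>', 0) \<gamma> b" and s1: "s1 < b"
 shows "\<gamma> s1 \<in> P1" "rr (\<gamma> s1) = 0" "(flow (\<gamma> s1) \<longlongrightarrow> Lm \<theta>') at_bot" "t < b ==> flow (\<gamma> s1) (t - s1) = \<gamma> t"
  "EX s. flow (\<gamma> s1) s ~= Lm \<theta>'" "EX s'<=s. 0 <= fw (\<gamma> s1) s'"
proof -
 have L: "(0, - sqrt (2 * V ts), \<theta>', 0) = Lm \<theta>'" by (simp add: Lm_def vs_def Vs_def)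
 note u = u[unfolded L unstable_branch_def is_solution_on_def collision_manifold_def]
 show P: "\<gamma> s1 \<in> P1" "rr (\<gamma> s1) = 0" using u s1 by blast+
 show fl: "flow (\<gamma> s1) (t - s1) = \<gamma> t" if t: "t < b" for t
  by (rule flow_unique[symmetric, of "min s1 t" "max s1 t" \<gamma> s1 t]) (use u s1 t P in auto)
 have ev: "\<forall>\<^sub>F t in at_bot. flow (\<gamma> s1) (t - s1) = \<gamma> t"
  unfolding eventually_at_bot_linorder by (intro exI[of _ "b - 1"]) (use fl in auto)
 have l: "((%t. flow (\<gamma> s1) (t - s1)) \<longlongrightarrow> Lm \<theta>') at_bot"
 proof (rule Lim_transform_eventually[of \<gamma>])
  show "(\<gamma> \<longlongrightarrow> Lm \<theta>') at_bot" using u by blast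
  show "\<forall>\<^sub>F t in at_bot. \<gamma> t = flow (\<gamma> s1) (t - s1)" using ev by eventually_elim simp
 qed
 have sh: "filterlim (%t. t + s1) at_bot at_bot"
  unfolding filterlim_at_bot eventually_at_bot_linorder by (intro allI, rule_tac x = "Z - s1" in exI) auto
 show "(flow (\<gamma> s1) \<longlongrightarrow> Lm \<theta>') at_bot" using filterlim_compose[OF l sh] by simp
 obtain s0 where "s0 < b" "\<gamma> s0 ~= Lm \<theta>'" using u by blast
 then show "EX s. flow (\<gamma> s1) s ~= Lm \<theta>'" using fl[of s0] by metis
 have "EX N. ALL t<=N. 0 <= ww (\<gamma> t)" using u unfolding eventually_at_bot_linorder by blast
 then obtain N where N: "ALL t<=N. 0 <= ww (\<gamma> t)" ..
 define m where "m = min (min N (s + s1)) (b - 1)"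
 have m: "m <= N" "m - s1 <= s" "m < b" by (auto simp: m_def)
 show "EX s'<=s. 0 <= fw (\<gamma> s1) s'" by (rule exI[of _ "m - s1"]) (use m N fl[OF m(3)] in auto)
qed

text \<open>v < 0 at z holds in the whole past as v is nondecreasing, so w has no zero there and
  keeps its initial sign.\<close>

lemma UB_intro:
 assumes cr: "crit tL" and z: "z \<in> P1" "rr z = 0" "(flow z \<longlongrightarrow> Lm tL) at_bot" "EX s. flow z s ~= Lm tL"
  and w: "!!s. EX s'<=s. 0 <= fw z s'" and v: "vv z < 0"
 shows "UB tL z"
proof -
 obtain s0 where s0: "flow z s0 ~= Lm tL" using z(4) by blast
 have "0 < fw z s" if "s <= 0" for s
 proof (rule branch_positive[OF cr z(1-3) s0 w])
  show "fv z s < 0" using fv_mono0[OF z(1,2) that] z(1) v by simp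
 qed
 then show ?thesis unfolding UB_def using z by blast
qed

text \<open>Between \<open>- \<pi>/2\<close> and \<open>0\<close> the branch cannot turn: to the left of \<open>- ts\<close> this would need \<open>v > vs\<close>,
 and then \<open>- ts\<close> could not be passed any more; to the right of it \<open>w\<close> increases at its zeros.\<close>

lemma branch_Up:
 assumes z: "z \<in> P1" "rr z = 0" "th z = - (pi/2)" "0 < ww z" "- vs < vv z" and t: "0 < t" "ft z t = 0" "!!s. 0 <= s ==> s < t ==> ft z s ~= 0"
 shows "Up 0 z t"
proof -
 have neg: "ft z s < 0" if s: "0 <= s" "s < t" for s
 proof (rule ccontr)
  assume "~ ft z s < 0"
  then obtain x where "0 <= x" "x <= s" "ft z x = 0" using ft_IVT[OF z(1) s(1), of 0] z(3) by auto
  then show False using t(3) s by auto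
 qed
 have "0 < fw z x" if x: "0 <= x" "x <= t" for x
 proof (rule ccontr)
  assume n: "~ 0 < fw z x"
  obtain u where u: "0 < u" "u <= x" "fw z u = 0" "!!s. 0 <= s ==> s < u ==> 0 < fw z s"
   using first_time[of 0 x "%s. fw z s" 0] x cont_f(4)[OF z(1)] n z by auto
  have gt: "- (pi/2) < ft z u" using ft_strict_mono[OF z(1), of 0 u] u z by auto
  have le: "ft z u <= 0" using neg[of u] t(2) u x by (cases "u = t") auto
  have lt2: "ft z u < pi/2" using le pi_gt_zero by linarith
  have c0: "0 < (cos (ft z u))^2" using cos_pos[OF gt lt2] by (simp add: zero_less_power2)
  have nG: "G (ft z u) ~= 0"
  proof
   assume "G (ft z u) = 0"
   then obtain d where d: "0 < d" "!!s. \<bar>s - u\<bar> <= d ==> fw z s = 0"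
    by (rule homothetic[OF z(1) u(3) refl _ gt lt2]) (auto intro: that)
   define y where "y = max 0 (u - d)"
   have "0 <= y" "y < u" "\<bar>y - u\<bar> <= d" using d(1) u(1) by (auto simp: y_def)
   then show False using u(4)[of y] d(2)[of y] by simp
  qed
  have dw: "dw (flow z u) <= 0"
  proof (rule ccontr)
   assume "~ dw (flow z u) <= 0"
   then have "0 < dw (flow z u)" by simp
   from DERIV_pos_inc_left[OF fw_deriv[OF z(1)] this] obtain d where d: "0 < d" "\<forall>h>0. h < d --> fw z (u - h) < fw z u" by blast
   define h where "h = min (d/2) u"
   have h: "0 < h" "h < d" "0 <= u - h" "u - h < u" using d(1) u(1) by (auto simp: h_def min_def)
   show False using d(2)[rule_format, OF h(1,2)] u(4)[OF h(3,4)] u(3) by simp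
  qed
  have "G (ft z u) < 0"
   using dw_at_rest[OF flow_in[OF z(1)] u(3) gt lt2] nG dw by (auto simp: sgn_if split: if_splits)
  then have lt: "ft z u < - ts" using G_neg_inner[of "ft z u"] nG le by (cases "ft z u" "- ts" rule: linorder_cases) (auto simp: le_less)
  have "Vs < V (ft z u)" by (rule V_min) (use gt le lt ts_range in auto)
  moreover have "W (ft z u) = (cos (ft z u))^2 * V (ft z u)" by (rule W_V) (use gt le in auto)
  ultimately have "vs^2 * (cos (ft z u))^2 < 2 * W (ft z u)" using c0 vs_sq by (simp add: mult.commute)
  then have "vs^2 * (cos (ft z u))^2 < (fv z u)^2 * (cos (ft z u))^2" using energy[OF z(1), of u] fr_zero[OF z(1,2), of u] u(3) by simp
  then have "vs^2 < (fv z u)^2" using c0 by simp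
  moreover have "- vs < fv z u" using fv_mono0[OF z(1,2), of 0 u] u(1) z by simp
  ultimately have v: "vs < fv z u" using vs_pos by (smt (verit) power2_less_imp_less power2_minus)
  obtain y0 where y0: "0 <= y0" "y0 <= t - u" "ft (flow z u) y0 = - ts"
   using ft_IVT[OF flow_in[OF z(1)], of "t - u" u "- ts"] flow_flow[OF z(1), of u "t - u"] t(2) lt u x ts_range by auto
  define y where "y = u + y0"
  have y: "u <= y" "ft z y = - ts" using y0 flow_flow[OF z(1), of u y0] by (auto simp: y_def)
  have "vs < fv z y" using fv_mono0[OF z(1,2) y(1)] v by simp
  moreover have "(fv z y)^2 * (cos ts)^2 <= vs^2 * (cos ts)^2"
  proof -
   have "0 <= (fw z y)^2 * c (ft z y)" using c_pos[of "ft z y"] by simp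
   then show ?thesis using energy[OF z(1), of y] fr_zero[OF z(1,2), of y] W_V[of ts] W_sym(1)[of ts] ts_range vs_sq by (simp add: y(2) Vs_def mult.commute)
  qed
  then have "(fv z y)^2 <= vs^2" using cos_pos[of ts] ts_range by simp
  ultimately show False using vs_pos power_strict_mono[of vs "fv z y" 2] by simp
 qed
 then show ?thesis unfolding Up_def using t by blast
qed

lemma branches_exist:
 assumes 1: "unstable_branch c W (0, - sqrt (2 * V ts), ts - pi, 0) \<gamma> b" "s1 < b" "s2 < b"
   "first_hit \<gamma> (- (pi / 2)) s1" "vv (\<gamma> s1) < 0" "first_hit \<gamma> 0 s2" "vv (\<gamma> s2) > 0"
  and 2: "unstable_branch c W (0, - sqrt (2 * V ts), - ts, 0) \<gamma>' b'" "s3 < b'" "first_hit \<gamma>' 0 s3" "vv (\<gamma>' s3) < 0"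
 shows "branches c V W ts (Sh pi (\<gamma> s1)) (\<gamma>' s3)"
proof -
 define z where "z = \<gamma> s1"
 note A = unstable_branch_flow[OF 1(1,2), folded z_def]
 note B = unstable_branch_flow[OF 2(1,2)]
 have thz: "th z = - (pi/2)" using 1(4) by (simp add: first_hit_def z_def)
 have vz: "vv z < 0" using 1(5) by (simp add: z_def)
 have fS: "flow (Sh pi z) = (%t. Sh pi (flow z t))" using flow_Sh(1)[OF A(1)] by (intro ext)
 have ShL: "x = Lm (ts - pi)" if "Sh pi x = Lm ts" for x
 proof -
  have "rr (Sh pi x) = 0 & vv (Sh pi x) = - vs & th (Sh pi x) = ts & ww (Sh pi x) = 0" unfolding that by simp
  then show ?thesis by (intro state_eqI) auto
 qed
 have LS: "Sh pi (Lm (ts - pi)) = Lm ts" by (rule state_eqI) auto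
 have UA: "UB ts (Sh pi z)"
 proof (rule UB_intro)
  show "(flow (Sh pi z) \<longlongrightarrow> Lm ts) at_bot" unfolding fS using Sh_tendsto[OF A(3), of pi] LS by simp
  show "EX s. flow (Sh pi z) s ~= Lm ts" unfolding fS using A(5) ShL by blast
  show "EX s'<=s. 0 <= fw (Sh pi z) s'" for s unfolding fS using A(6) by simp
 qed (use A(1,2) vz in \<open>auto simp: crit_def\<close>)
 have UB': "UB (- ts) (\<gamma>' s3)"
  by (rule UB_intro[OF _ B(1,2,3,5) B(6) 2(4)]) (simp add: crit_def)
 have wz: "0 < ww z" "- vs < vv z"
  using UA UB_basic(3)[OF UA, of 0] A(1) unfolding UB_def fS by (auto dest: spec[of _ 0])
 \<comment> \<open>Until s1 the angle increases to - \<pi>/2, so \<theta> = 0 cannot have been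
   reached before.\<close>
 have s12: "s1 < s2"
 proof (rule ccontr)
  assume "~ s1 < s2"
  then have le: "s2 - s1 <= 0" by simp
  have e: "ft z (s2 - s1) = 0" using A(4)[OF 1(3)] 1(6) by (simp add: first_hit_def)
  have "ft (Sh pi z) (s2 - s1) <= ft (Sh pi z) 0" using UB_basic(1)[OF UA, of "s2 - s1" 0] le by (cases "s2 = s1") auto
  then show False unfolding fS using e thz A(1) by simp
 qed
 have U: "Up 0 z (s2 - s1)"
 proof (rule branch_Up[OF A(1,2) thz wz])
  show "ft z (s2 - s1) = 0" using A(4)[OF 1(3)] 1(6) by (simp add: first_hit_def)
  show "ft z s ~= 0" if "0 <= s" "s < s2 - s1" for s
  proof -
   have "s + s1 < s2" using that by simp
   then show ?thesis using A(4)[of "s + s1"] 1(3,6) unfolding first_hit_def by auto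
  qed
 qed (use s12 in simp)
 have Sz: "Sh (- pi) (Sh pi z) = z" by (rule state_eqI) auto
 have "0 < vv (up 0 z)" using up_eq[OF A(1) U] A(4)[OF 1(3)] 1(7) by simp
 then show ?thesis unfolding z_def[symmetric]
  by unfold_locales (use UA UB' U Sz thz vz 2(3,4) in \<open>auto simp: first_hit_def\<close>)
qed

end

theorem theorem3p3:
  fixes c V W :: "real \<Rightarrow> real" and \<theta>s :: real
  assumes c_choice: "c = c_one \<or> c = c_two"
    and V_smooth: "smooth_on {\<theta>. cos \<theta> \<noteq> 0} V"
    and V_pos: "\<forall>\<theta>. cos \<theta> \<noteq> 0 \<longrightarrow> V \<theta> > 0"
    and V_even: "\<forall>\<theta>. cos \<theta> \<noteq> 0 \<longrightarrow> V (- \<theta>) = V \<theta>"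
    and V_periodic: "\<forall>\<theta>. cos \<theta> \<noteq> 0 \<longrightarrow> V (\<theta> + pi) = V \<theta>"
    and W_smooth: "smooth_on UNIV W"
    and W_pos: "\<forall>\<theta>. W \<theta> > 0"
    and W_ext: "\<forall>\<theta>. cos \<theta> \<noteq> 0 \<longrightarrow> W \<theta> = (cos \<theta>)^2 * V \<theta>"
    and \<theta>s_range: "0 < \<theta>s" "\<theta>s < pi / 2"
    and V_crit: "{\<theta> \<in> {- (pi / 2)<..<pi / 2}. deriv V \<theta> = 0} = {- \<theta>s, 0, \<theta>s}"
    and V_nondeg: "\<forall>\<theta>\<in>{- \<theta>s, 0, \<theta>s}. deriv (deriv V) \<theta> \<noteq> 0"
    and v1_neg_v2_pos:
      "\<exists>\<gamma> b s1 s2. unstable_branch c W (0, - sqrt (2 * V \<theta>s), \<theta>s - pi, 0) \<gamma> b \<and>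
          s1 < b \<and> s2 < b \<and>
          first_hit \<gamma> (- (pi / 2)) s1 \<and> vv (\<gamma> s1) < 0 \<and>
          first_hit \<gamma> 0 s2 \<and> vv (\<gamma> s2) > 0"
    and v3_neg:
      "\<exists>\<gamma>' b' s3. unstable_branch c W (0, - sqrt (2 * V \<theta>s), - \<theta>s, 0) \<gamma>' b' \<and>
          s3 < b' \<and> first_hit \<gamma>' 0 s3 \<and> vv (\<gamma>' s3) < 0"
  shows "\<forall>k::nat. \<exists>x T. periodic_orbit c W x T \<and>
           th (x 0) = - (pi / 2) \<and> vv (x 0) = 0 \<and>
           finite (crossing_times (\<lambda>s. th (x s)) (- (pi / 2)) {0<..<T / 4}) \<and>
           card (crossing_times (\<lambda>s. th (x s)) (- (pi / 2)) {0<..<T / 4}) = k \<and>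
           vv (x (T / 4)) = 0 \<and>
           th (x (T / 4)) = (if even k then 0 else - pi)"
proof -
  interpret shape c V W \<theta>s
    by unfold_locales (fact c_choice V_smooth V_pos V_even V_periodic W_smooth W_pos W_ext \<theta>s_range V_crit V_nondeg)+
  obtain \<gamma> b s1 s2 where 1: "unstable_branch c W (0, - sqrt (2 * V \<theta>s), \<theta>s - pi, 0) \<gamma> b" "s1 < b" "s2 < b"
      "first_hit \<gamma> (- (pi / 2)) s1" "vv (\<gamma> s1) < 0" "first_hit \<gamma> 0 s2" "vv (\<gamma> s2) > 0" using v1_neg_v2_pos by blast
  obtain \<gamma>' b' s3 where 2: "unstable_branch c W (0, - sqrt (2 * V \<theta>s), - \<theta>s, 0) \<gamma>' b'" "s3 < b'" 
      "first_hit \<gamma>' 0 s3" "vv (\<gamma>' s3) < 0" using v3_neg by blast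
  interpret B: branches c V W \<theta>s "Sh pi (\<gamma> s1)" "\<gamma>' s3" by (rule branches_exist[OF 1 2])
  show ?thesis using B.periodic_orbits by blast
qed

end
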